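(* Let $1<\alpha<2$ and $d\geq 2$. Let the real parameters $1<p,q<+\infty$, $1<\mathfrak{p},\mathfrak{q}<+\infty$, $1<\mathbf{p},\mathbf{q}<+\infty$ and $\mathfrak{s}\in\mathbb{R}$ satisfy the following conditions (where $r'$ denotes the conjugate exponent of $r$, $\frac1r+\frac1{r'}=1$): 1) $\frac{\alpha}{p}+\frac{d}{q'}=\alpha-1$, with $2<p<+\infty$ and $1<q<2$; 2) $\frac{\alpha}{\mathfrak{p}}+\frac{d}{\mathfrak{q}'}=2\alpha-1$, with $1<p'<\mathfrak{p}<p$ and $q\leq \mathfrak{q}<q'$; 3) $\frac{\alpha}{\mathbf{p}}+\frac{d}{\mathbf{q}'}-\mathfrak{s}=2\alpha-1$, with $1<\mathbf{p}<p$ and $q\leq\mathbf{q}<+\infty$. Let $\vec{u}_0$ be a divergence-free initial velocity with $\vec{u}_0\in\dot{\mathscr{B}}^{-\frac{\alpha}{p},\infty}_{L^{q,\infty}_\xi}(\mathbb{R}^d)$, let $\theta_0\in\dot{\mathscr{B}}^{-\frac{\alpha}{\mathfrak{p}},\infty}_{L^{\mathfrak{q},\infty}_\xi}(\mathbb{R}^d)$ be an initial temperature, and let $\vec{f}\in L^{\mathbf{p},\infty}_t([0,+\infty[,\mathcal{F}^{\mathfrak{s}}_{L^{\mathbf{q},\infty}_\xi}(\mathbb{R}^d))$ be an external force. If the quantity $$\|\vec{u}_0\|_{\dot{\mathscr{B}}^{-\frac{\alpha}{p},\infty}_{L^{q,\infty}_\xi}}+\|\theta_0\|_{\dot{\mathscr{B}}^{-\frac{\alpha}{\mathfrak{p}},\infty}_{L^{\mathfrak{q},\infty}_\xi}}+\|\vec{f}\|_{L^{\mathbf{p},\infty}_t(\mathcal{F}^{\mathfrak{s}}_{L^{\mathbf{q},\infty}_\xi})}$$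 is small enough (i.e. smaller than some constant $\varepsilon>0$ depending only on $\alpha$, $d$ and the indices), then there exists a couple $(\vec{u},\theta)\in L^{p,\infty}_t(L^{q,\infty}_\xi)\times L^{\mathfrak{p},\infty}_t(L^{\mathfrak{q},\infty}_\xi)$ which is a global mild solution of the fractional Navier-Stokes-Boussinesq system with data $(\vec{u}_0,\theta_0,\vec{f})$, that is, for $t>0$, $$\begin{cases}\displaystyle \vec{u}(t)=\mathfrak{p}_t*\vec{u}_0-\int_0^t\mathfrak{p}_{t-s}*\mathbb{P}(\mathrm{div}(\vec{u}\otimes\vec{u}))\,ds+\int_0^t\mathfrak{p}_{t-s}*\mathbb{P}(\theta\vec{e}_d)\,ds+\int_0^t\mathfrak{p}_{t-s}*\mathbb{P}(\vec{f})\,ds,\\[3mm] \displaystyle \theta(t)=\mathfrak{p}_t*\theta_0-\int_0^t\mathfrak{p}_{t-s}*\mathrm{div}(\theta\vec{u})\,ds.\end{cases}$$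
   Context: Fourier transform: $\widehat{\phi}$ always denotes the Fourier transform taken only in the space variable $x\in\mathbb{R}^d$, with frequency variable $\xi\in\mathbb{R}^d$. The system: $\partial_t\vec{u}=-(-\Delta)^{\alpha/2}\vec{u}-\mathbb{P}\mathrm{div}(\vec{u}\otimes\vec{u})+\mathbb{P}(\theta\vec{e}_d)+\mathbb{P}(\vec{f})$, $\partial_t\theta=-(-\Delta)^{\alpha/2}\theta-\mathrm{div}(\theta\vec{u})$, $\vec{u}(0,\cdot)=\vec{u}_0$ with $\mathrm{div}(\vec{u}_0)=0$, $\theta(0,\cdot)=\theta_0$, where $\vec{u}:[0,+\infty[\times\mathbb{R}^d\to\mathbb{R}^d$, $\theta:[0,+\infty[\times\mathbb{R}^d\to\mathbb{R}$, $\vec{f}:[0,+\infty[\times\mathbb{R}^d\to\mathbb{R}^d$, and $\vec{e}_d$ is the $d$-th canonical basis vector. Here $\widehat{(-\Delta)^{\alpha/2}\phi}(\xi)=|\xi|^\alpha\widehat{\phi}(\xi)$; $\mathfrak{p}_t$ is the kernel of the semigroup $e^{-t(-\Delta)^{\alpha/2}}$, i.e. $\widehat{\mathfrak{p}_t*\phi}(\xi)=e^{-t|\xi|^\alpha}\widehat{\phi}(\xi)$; and $\mathbb{P}(\vec{\phi})=\vec{\phi}+\nabla(-\Delta)^{-1}\mathrm{div}(\vec{\phi})$ is the Leray projector, i.e. $\widehat{\mathbb{P}\vec\phi}(\xi)=\widehat{\vec\phi}(\xi)-\frac{\xi\,(\xi\cdot\widehat{\vec\phi}(\xi))}{|\xi|^2}$.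 A global mild solution is a solution of the integral (Duhamel) equations for all $t>0$. Lorentz spaces: for $1\le q<+\infty$, $\|g\|_{L^{q,\infty}}=\sup_{\lambda>0}\lambda\,|\{x:|g(x)|>\lambda\}|^{1/q}$ and $L^{q,\infty}$ is the space of measurable functions for which this is finite; $L^{\infty,\infty}=L^\infty$. Fourier-Besov-Lorentz spaces: for $\mathfrak{s}\in\mathbb{R}$ and $1<q<+\infty$, $\dot{\mathscr{B}}^{\mathfrak{s},\infty}_{L^{q,\infty}_\xi}(\mathbb{R}^d)$ is the space of (vector- or scalar-valued) tempered distributions $\psi$ modulo polynomials such that $$\|\psi\|_{\dot{\mathscr{B}}^{\mathfrak{s},\infty}_{L^{q,\infty}_\xi}}=\sup_{j\in\mathbb{Z}}2^{j\mathfrak{s}}\big\|\mathds{1}_{\{2^j\le|\xi|\le2^{j+1}\}}\widehat{\psi}\big\|_{L^{q,\infty}}<+\infty.$$ Time-space Fourier-Herz-Lorentz spaces: for $1\le p,q<+\infty$ and $\mathfrak{s}\in\mathbb{R}$, $L^{p,\infty}_t([0,+\infty[,\mathcal{F}^{\mathfrak{s}}_{L^{q,\infty}_\xi}(\mathbb{R}^d))$, also written $L^{p,\infty}_t(\mathcal{F}^{\mathfrak{s}}_{L^{q,\infty}_\xi})$, is the space of (vector- or scalar-valued) functions $\phi$ on $[0,+\infty[\times\mathbb{R}^d$ such that $$\|\phi\|_{L^{p,\infty}_t(\mathcal{F}^{\mathfrak{s}}_{L^{q,\infty}_\xi})}=\Big\|\,\big\||\xi|^{\mathfrak{s}}\widehat{\phi}(t,\xi)\big\|_{L^{q,\infty}(d\xi)}\Big\|_{L^{p,\infty}_t([0,+\infty[)}<+\infty.$$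 When $\mathfrak{s}=0$ it is denoted $L^{p,\infty}_t(L^{q,\infty}_\xi)$, with $\|\phi\|_{L^{p,\infty}_t(L^{q,\infty}_\xi)}=\|\,\|\widehat{\phi}(t,\cdot)\|_{L^{q,\infty}}\|_{L^{p,\infty}_t}$. *)

theory Defs
  imports "HOL-Analysis.Analysis"
begin

section \<open>Schwartz functions and tempered distributions\<close>

definition pd :: "'n::finite \<Rightarrow> (real^'n \<Rightarrow> complex) \<Rightarrow> real^'n \<Rightarrow> complex" where
  "pd i \<phi> x = frechet_derivative \<phi> (at x) (axis i 1)"

definition pds :: "'n::finite list \<Rightarrow> (real^'n \<Rightarrow> complex) \<Rightarrow> real^'n \<Rightarrow> complex" where
  "pds is \<phi> = foldr pd is \<phi>"

definition schwartz :: "(real^'n::finite \<Rightarrow> complex) \<Rightarrow> bool" where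
  "schwartz \<phi> \<longleftrightarrow>
     (\<forall>is. pds is \<phi> differentiable_on UNIV) \<and>
     (\<forall>is N. bounded (range (\<lambda>x. (1 + norm x) ^ N *\<^sub>R pds is \<phi> x)))"

definition schwartz_seminorm :: "nat \<Rightarrow> (real^'n::finite \<Rightarrow> complex) \<Rightarrow> real" where
  "schwartz_seminorm N \<phi> =
     (SUP (is, x) \<in> {is. length is \<le> N} \<times> UNIV. (1 + norm x) ^ N * norm (pds is \<phi> x))"

text \<open>A distribution is a functional on test functions; only its values on Schwartz functions
  are meaningful.\<close>

type_synonym 'n tdist = "((real, 'n) vec \<Rightarrow> complex) \<Rightarrow> complex"
type_synonym 'n tdist_vec = "('n tdist, 'n) vec"

definition tempered :: "'n::finite tdist \<Rightarrow> bool" where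
  "tempered T \<longleftrightarrow>
     (\<forall>\<phi> \<psi> a b. schwartz \<phi> \<longrightarrow> schwartz \<psi> \<longrightarrow>
        T (\<lambda>x. a * \<phi> x + b * \<psi> x) = a * T \<phi> + b * T \<psi>) \<and>
     (\<exists>C N. \<forall>\<phi>. schwartz \<phi> \<longrightarrow> norm (T \<phi>) \<le> C * schwartz_seminorm N \<phi>)"

definition real_valued :: "'n::finite tdist \<Rightarrow> bool" where
  "real_valued T \<longleftrightarrow> (\<forall>\<phi>. schwartz \<phi> \<longrightarrow> T (\<lambda>x. cnj (\<phi> x)) = cnj (T \<phi>))"

definition dist_pd :: "'n::finite \<Rightarrow> 'n tdist \<Rightarrow> 'n tdist" where
  "dist_pd i T = (\<lambda>\<phi>. - T (pd i \<phi>))"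

definition dist_div :: "'n::finite tdist_vec \<Rightarrow> 'n tdist" where
  "dist_div V = (\<lambda>\<phi>. \<Sum>j\<in>UNIV. dist_pd j (V $ j) \<phi>)"

definition divergence_free :: "'n::finite tdist_vec \<Rightarrow> bool" where
  "divergence_free V \<longleftrightarrow> (\<forall>\<phi>. schwartz \<phi> \<longrightarrow> dist_div V \<phi> = 0)"


section \<open>Fourier transform in the space variable\<close>

definition fourier :: "(real^'n::finite \<Rightarrow> complex) \<Rightarrow> real^'n \<Rightarrow> complex" where
  "fourier \<phi> \<xi> = (LINT x|lborel. cis (- (x \<bullet> \<xi>)) * \<phi> x)"

definition inv_fourier :: "(real^'n::finite \<Rightarrow> complex) \<Rightarrow> real^'n \<Rightarrow> complex" where
  "inv_fourier \<phi> x = (LINT \<xi>|lborel. cis (x \<bullet> \<xi>) * \<phi> \<xi>) / of_real ((2 * pi) ^ CARD('n))"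

definition dist_fourier :: "'n::finite tdist \<Rightarrow> 'n tdist" where
  "dist_fourier T = (\<lambda>\<phi>. T (fourier \<phi>))"

text \<open>\<open>fourier_off_origin T g\<close>: on the open set of nonzero frequencies the Fourier transform of
  \<open>T\<close> is the locally integrable function \<open>g\<close>. Adding a polynomial to \<open>T\<close> changes its Fourier
  transform at the origin only, so this property, and hence \<open>fhat T\<close> below, depends only on the
  class of \<open>T\<close> modulo polynomials.\<close>

definition fourier_off_origin :: "'n::finite tdist \<Rightarrow> (real^'n \<Rightarrow> complex) \<Rightarrow> bool" where
  "fourier_off_origin T g \<longleftrightarrow>
     g \<in> borel_measurable borel \<and>
     (\<forall>\<phi> r R. schwartz \<phi> \<longrightarrow> 0 < r \<longrightarrow> (\<forall>\<xi>. norm \<xi> < r \<or> R < norm \<xi> \<longrightarrow> \<phi> \<xi> = 0) \<longrightarrow>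
        integrable lborel (\<lambda>\<xi>. g \<xi> * \<phi> \<xi>) \<and>
        dist_fourier T \<phi> = (LINT \<xi>|lborel. g \<xi> * \<phi> \<xi>))"

definition fhat :: "'n::finite tdist \<Rightarrow> real^'n \<Rightarrow> complex" where
  "fhat T = (SOME g. fourier_off_origin T g)"

definition fhat_vec :: "'n::finite tdist_vec \<Rightarrow> real^'n \<Rightarrow> complex^'n" where
  "fhat_vec V \<xi> = (\<chi> i. fhat (V $ i) \<xi>)"

definition tempered_fun :: "(real^'n::finite \<Rightarrow> complex) \<Rightarrow> bool" where
  "tempered_fun g \<longleftrightarrow>
     g \<in> borel_measurable borel \<and> (\<exists>N::nat. integrable lborel (\<lambda>\<xi>. g \<xi> / of_real ((1 + norm \<xi>) ^ N)))"

text \<open>\<open>fourier_regular T\<close>: the Fourier transform of \<open>T\<close> is a function on the whole space,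
  without any part concentrated at the origin.\<close>

definition fourier_regular :: "'n::finite tdist \<Rightarrow> bool" where
  "fourier_regular T \<longleftrightarrow>
     tempered T \<and> (\<exists>g. fourier_off_origin T g) \<and> tempered_fun (fhat T) \<and>
     (\<forall>\<phi>. schwartz \<phi> \<longrightarrow> dist_fourier T \<phi> = (LINT \<xi>|lborel. fhat T \<xi> * \<phi> \<xi>))"

text \<open>The tempered distribution whose Fourier transform is the function \<open>g\<close>.\<close>

definition dist_inv_fourier :: "(real^'n::finite \<Rightarrow> complex) \<Rightarrow> 'n tdist" where
  "dist_inv_fourier g = (\<lambda>\<phi>. LINT \<xi>|lborel. g \<xi> * inv_fourier \<phi> \<xi>)"


section \<open>Function spaces\<close>

definition conj_exp :: "real \<Rightarrow> real" where
  "conj_exp r = r / (r - 1)"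

text \<open>Only used with a positive exponent.\<close>

definition ennreal_powr :: "ennreal \<Rightarrow> real \<Rightarrow> ennreal" where
  "ennreal_powr x a = (if x = top then top else ennreal (enn2real x powr a))"

definition weak_norm :: "'a measure \<Rightarrow> real \<Rightarrow> ('a \<Rightarrow> ennreal) \<Rightarrow> ennreal" where
  "weak_norm M q g =
     (SUP l\<in>{0::real<..}. ennreal l * ennreal_powr (emeasure M {x \<in> space M. ennreal l < g x}) (1 / q))"

definition annulus :: "int \<Rightarrow> (real^'n::finite) set" where
  "annulus j = {\<xi>. 2 powr real_of_int j \<le> norm \<xi> \<and> norm \<xi> \<le> 2 powr (real_of_int j + 1)}"

definition annuli_norm :: "real \<Rightarrow> real \<Rightarrow> (real^'n::finite \<Rightarrow> 'b::real_normed_vector) \<Rightarrow> ennreal" where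
  "annuli_norm \<ss> q g =
     (SUP j::int. ennreal (2 powr (real_of_int j * \<ss>)) *
        weak_norm lborel q (\<lambda>\<xi>. ennreal (norm (indicat_real (annulus j) \<xi> *\<^sub>R g \<xi>))))"

definition besov_norm :: "real \<Rightarrow> real \<Rightarrow> 'n::finite tdist \<Rightarrow> ennreal" where
  "besov_norm \<ss> q T = annuli_norm \<ss> q (fhat T)"

definition besov_norm_vec :: "real \<Rightarrow> real \<Rightarrow> 'n::finite tdist_vec \<Rightarrow> ennreal" where
  "besov_norm_vec \<ss> q V = annuli_norm \<ss> q (fhat_vec V)"

definition besov :: "real \<Rightarrow> real \<Rightarrow> 'n::finite tdist set" where
  "besov \<ss> q = {T. tempered T \<and> (\<exists>g. fourier_off_origin T g) \<and> besov_norm \<ss> q T < top}"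

definition besov_vec :: "real \<Rightarrow> real \<Rightarrow> 'n::finite tdist_vec set" where
  "besov_vec \<ss> q =
     {V. (\<forall>i. tempered (V $ i) \<and> (\<exists>g. fourier_off_origin (V $ i) g)) \<and> besov_norm_vec \<ss> q V < top}"

definition herz_norm :: "real \<Rightarrow> real \<Rightarrow> real \<Rightarrow> (real \<Rightarrow> 'n::finite tdist) \<Rightarrow> ennreal" where
  "herz_norm p \<ss> q \<phi> =
     weak_norm (lebesgue_on {0..}) p
       (\<lambda>t. weak_norm lborel q (\<lambda>\<xi>. ennreal (norm \<xi> powr \<ss> * norm (fhat (\<phi> t) \<xi>))))"

definition herz_norm_vec :: "real \<Rightarrow> real \<Rightarrow> real \<Rightarrow> (real \<Rightarrow> 'n::finite tdist_vec) \<Rightarrow> ennreal" where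
  "herz_norm_vec p \<ss> q \<phi> =
     weak_norm (lebesgue_on {0..}) p
       (\<lambda>t. weak_norm lborel q (\<lambda>\<xi>. ennreal (norm \<xi> powr \<ss> * norm (fhat_vec (\<phi> t) \<xi>))))"

text \<open>For almost every time the spatial Fourier transform is a function, and these functions are
  jointly measurable in time and frequency up to null sets.\<close>

definition time_fourier_measurable :: "(real \<Rightarrow> 'n::finite tdist) \<Rightarrow> bool" where
  "time_fourier_measurable \<phi> \<longleftrightarrow>
     (AE t in lebesgue_on {0..}. fourier_regular (\<phi> t)) \<and>
     (\<exists>G \<in> borel_measurable (borel :: (real \<times> (real^'n)) measure).
        AE t in lebesgue_on {0..}. AE \<xi> in lborel. fhat (\<phi> t) \<xi> = G (t, \<xi>))"

definition herz :: "real \<Rightarrow> real \<Rightarrow> real \<Rightarrow> (real \<Rightarrow> 'n::finite tdist) set" where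
  "herz p \<ss> q = {\<phi>. time_fourier_measurable \<phi> \<and> herz_norm p \<ss> q \<phi> < top}"

definition herz_vec :: "real \<Rightarrow> real \<Rightarrow> real \<Rightarrow> (real \<Rightarrow> 'n::finite tdist_vec) set" where
  "herz_vec p \<ss> q =
     {\<phi>. (\<forall>i. time_fourier_measurable (\<lambda>t. \<phi> t $ i)) \<and> herz_norm_vec p \<ss> q \<phi> < top}"


section \<open>The fractional Navier--Stokes--Boussinesq system\<close>

definition heat_symbol :: "real \<Rightarrow> real \<Rightarrow> real^'n::finite \<Rightarrow> complex" where
  "heat_symbol \<alpha> t \<xi> = of_real (exp (- t * norm \<xi> powr \<alpha>))"

definition heat :: "real \<Rightarrow> real \<Rightarrow> 'n::finite tdist \<Rightarrow> 'n tdist" where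
  "heat \<alpha> t T = dist_inv_fourier (\<lambda>\<xi>. heat_symbol \<alpha> t \<xi> * fhat T \<xi>)"

definition heat_defined :: "real \<Rightarrow> real \<Rightarrow> 'n::finite tdist \<Rightarrow> bool" where
  "heat_defined \<alpha> t T \<longleftrightarrow>
     (\<exists>g. fourier_off_origin T g) \<and> tempered_fun (\<lambda>\<xi>. heat_symbol \<alpha> t \<xi> * fhat T \<xi>)"

definition leray :: "'n::finite tdist_vec \<Rightarrow> 'n tdist_vec" where
  "leray V = (\<chi> i. dist_inv_fourier (\<lambda>\<xi>.
     fhat (V $ i) \<xi> -
     of_real (\<xi> $ i) * (\<Sum>j\<in>UNIV. of_real (\<xi> $ j) * fhat (V $ j) \<xi>) / of_real ((norm \<xi>)\<^sup>2)))"

text \<open>The product of two distributions whose Fourier transforms are functions, given by the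
  convolution theorem. It makes sense also when the factors are not themselves functions. The
  constant is the one belonging to the normalisation of \<open>fourier\<close>.\<close>

definition convolution :: "(real^'n::finite \<Rightarrow> complex) \<Rightarrow> (real^'n \<Rightarrow> complex) \<Rightarrow> real^'n \<Rightarrow> complex" where
  "convolution g h \<xi> = (LINT \<eta>|lborel. g (\<xi> - \<eta>) * h \<eta>)"

definition dist_prod :: "'n::finite tdist \<Rightarrow> 'n tdist \<Rightarrow> 'n tdist" where
  "dist_prod T S =
     dist_inv_fourier (\<lambda>\<xi>. convolution (fhat T) (fhat S) \<xi> / of_real ((2 * pi) ^ CARD('n)))"

definition dist_prod_defined :: "'n::finite tdist \<Rightarrow> 'n tdist \<Rightarrow> bool" where
  "dist_prod_defined T S \<longleftrightarrow>
     fourier_regular T \<and> fourier_regular S \<and>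
     (AE \<xi> in lborel. integrable lborel (\<lambda>\<eta>. fhat T (\<xi> - \<eta>) * fhat S \<eta>)) \<and>
     tempered_fun (convolution (fhat T) (fhat S))"

definition div_tensor :: "'n::finite tdist_vec \<Rightarrow> 'n tdist_vec \<Rightarrow> 'n tdist_vec" where
  "div_tensor U V = (\<chi> i. dist_div (\<chi> j. dist_prod (U $ i) (V $ j)))"

definition div_scaled :: "'n::finite tdist \<Rightarrow> 'n tdist_vec \<Rightarrow> 'n tdist" where
  "div_scaled T V = dist_div (\<chi> j. dist_prod T (V $ j))"

text \<open>The index type is linearly ordered only in order to single out the last basis vector.\<close>

definition along_last :: "'n::{finite,linorder} tdist \<Rightarrow> 'n tdist_vec" where
  "along_last T = (\<chi> i. if i = Max UNIV then T else (\<lambda>_. 0))"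

text \<open>Time integrals of distributions are weak integrals, taken against each Schwartz function.\<close>

definition duhamel :: "real \<Rightarrow> real \<Rightarrow> (real \<Rightarrow> 'n::finite tdist) \<Rightarrow> 'n tdist" where
  "duhamel \<alpha> t F = (\<lambda>\<phi>. LINT s:{0..t}|lebesgue. heat \<alpha> (t - s) (F s) \<phi>)"

definition duhamel_defined :: "real \<Rightarrow> real \<Rightarrow> (real \<Rightarrow> 'n::finite tdist) \<Rightarrow> bool" where
  "duhamel_defined \<alpha> t F \<longleftrightarrow>
     (AE s in lebesgue_on {0..t}. fourier_regular (F s)) \<and>
     (\<forall>\<phi>. schwartz \<phi> \<longrightarrow> set_integrable lebesgue {0..t} (\<lambda>s. heat \<alpha> (t - s) (F s) \<phi>))"

definition global_mild_solution ::
  "real \<Rightarrow> 'n::{finite,linorder} tdist_vec \<Rightarrow> 'n tdist \<Rightarrow> (real \<Rightarrow> 'n tdist_vec) \<Rightarrow>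
   (real \<Rightarrow> 'n tdist_vec) \<Rightarrow> (real \<Rightarrow> 'n tdist) \<Rightarrow> bool" where
  "global_mild_solution \<alpha> u\<^sub>0 \<theta>\<^sub>0 f u \<theta> \<longleftrightarrow>
     (AE s in lebesgue_on {0..}.
        (\<forall>i j. dist_prod_defined (u s $ i) (u s $ j)) \<and>
        (\<forall>j. dist_prod_defined (\<theta> s) (u s $ j)) \<and>
        (\<forall>i. fourier_regular (f s $ i))) \<and>
     (\<forall>t>0.
        (\<forall>i. tempered (u t $ i) \<and>
           heat_defined \<alpha> t (u\<^sub>0 $ i) \<and>
           duhamel_defined \<alpha> t (\<lambda>s. leray (div_tensor (u s) (u s)) $ i) \<and>
           duhamel_defined \<alpha> t (\<lambda>s. leray (along_last (\<theta> s)) $ i) \<and>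
           duhamel_defined \<alpha> t (\<lambda>s. leray (f s) $ i) \<and>
           (\<forall>\<phi>. schwartz \<phi> \<longrightarrow>
              (u t $ i) \<phi> =
                heat \<alpha> t (u\<^sub>0 $ i) \<phi>
                - duhamel \<alpha> t (\<lambda>s. leray (div_tensor (u s) (u s)) $ i) \<phi>
                + duhamel \<alpha> t (\<lambda>s. leray (along_last (\<theta> s)) $ i) \<phi>
                + duhamel \<alpha> t (\<lambda>s. leray (f s) $ i) \<phi>)) \<and>
        tempered (\<theta> t) \<and>
        heat_defined \<alpha> t \<theta>\<^sub>0 \<and>
        duhamel_defined \<alpha> t (\<lambda>s. div_scaled (\<theta> s) (u s)) \<and>
        (\<forall>\<phi>. schwartz \<phi> \<longrightarrow>
           \<theta> t \<phi> = heat \<alpha> t \<theta>\<^sub>0 \<phi> - duhamel \<alpha> t (\<lambda>s. div_scaled (\<theta> s) (u s)) \<phi>))"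

end

theory Submission
  imports Defs "HOL-Probability.Probability"
begin

text \<open>On the Fourier side the system is a quadratic Duhamel equation for functions of time and
  frequency. Replacing every symbol and datum by its modulus gives a monotone iteration of
  \<open>[0, \<infinity>]\<close>-valued majorants, and the Picard iterates converge pointwise, dominatedly, wherever the
  limit of the majorants is finite; no Banach space is needed. For a fixed time the majorants are
  bounded in weak Lebesgue spaces in frequency: convolution, multiplication by powers of the frequency
  and the decay of the heat symbol act there by weak Young and Hoelder inequalities, with a kernel
  \<open>\<bar>t - s\<bar> powr (- b)\<close> in time. What remains is a scalar iteration in weak Lebesgue spaces in
  time, controlled by the fractional integral (Hardy-Littlewood-Sobolev) inequality at the critical
  exponents, and it stays bounded for small data. Undoing the Fourier transform requires Fourier
  inversion on Schwartz functions, and bump functions that identify the transform of a distribution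
  off the origin almost everywhere.\<close>

section \<open>Weak Lebesgue spaces\<close>

text \<open>The weak spaces are described by the dual index \<kappa> = 1 - 1 / q of an exponent q.
  In this index every estimate is linear: convolution in frequency adds indices, multiplication by a
  function of index \<kappa>' adds \<kappa>' - 1, the weight \<open>norm \<xi> powr (- s)\<close>
  subtracts s / d, and convolution with the time kernel \<open>\<bar>t\<bar> powr (- b)\<close> adds
  1 - b. The conditions on the indices say exactly that each Duhamel term returns to the spaces it
  starts from, so no power of time is left over and the bounds are global in time. At this balance
  the time kernels lie in weak spaces only, out of reach of the ordinary Young and Hoelder
  inequalities. The buoyancy term is linear and carries no small factor; it is absorbed by keeping
  the temperature small compared with the velocity. A further obstacle is that \<open>fhat\<close>
  is a mere choice of representative and that the data are measurable only up to null sets. Explicit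
  Borel versions, jointly measurable in time and frequency, replace it throughout, and the mild
  equation is still obtained at every positive time.\<close>

lemma nn_integral_lborel_shift:
  fixes h :: "'a::euclidean_space \<Rightarrow> ennreal"
  assumes [measurable]: "h \<in> borel_measurable borel"
  shows "(\<integral>\<^sup>+x. h (c + x) \<partial>lborel) = (\<integral>\<^sup>+x. h x \<partial>lborel)"
proof -
  have "(\<integral>\<^sup>+x. h x \<partial>lborel) = (\<integral>\<^sup>+x. h x \<partial>(distr lborel borel ((+) c)))"
    by (simp add: lborel_distr_plus)
  also have "\<dots> = (\<integral>\<^sup>+x. h (c + x) \<partial>lborel)"
    by (subst nn_integral_distr) auto
  finally show ?thesis by simp
qed

lemma lborel_distr_uminus_euclidean:
  "distr lborel borel (\<lambda>x. - x) = (lborel :: 'a::euclidean_space measure)"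
proof -
  have "(lborel :: 'a measure) = density (distr lborel borel (\<lambda>x. 0 + (-1) *\<^sub>R x)) (\<lambda>_. ennreal (\<bar>-1\<bar> ^ DIM('a)))"
    by (rule lborel_affine) simp
  then show ?thesis by (simp add: density_1)
qed

lemma nn_integral_lborel_uminus:
  fixes h :: "'a::euclidean_space \<Rightarrow> ennreal"
  assumes [measurable]: "h \<in> borel_measurable borel"
  shows "(\<integral>\<^sup>+x. h (- x) \<partial>lborel) = (\<integral>\<^sup>+x. h x \<partial>lborel)"
proof -
  have "(\<integral>\<^sup>+x. h x \<partial>lborel) = (\<integral>\<^sup>+x. h x \<partial>(distr lborel borel (\<lambda>x. - x)))"
    by (simp add: lborel_distr_uminus_euclidean)
  also have "\<dots> = (\<integral>\<^sup>+x. h (- x) \<partial>lborel)"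
    by (subst nn_integral_distr) auto
  finally show ?thesis by simp
qed

lemma nn_integral_lborel_reflect:
  fixes h :: "'a::euclidean_space \<Rightarrow> ennreal"
  assumes [measurable]: "h \<in> borel_measurable borel"
  shows "(\<integral>\<^sup>+x. h (c - x) \<partial>lborel) = (\<integral>\<^sup>+x. h x \<partial>lborel)"
  using nn_integral_lborel_uminus[of "\<lambda>x. h (c + x)"] nn_integral_lborel_shift[of h c] by simp

lemma emeasure_lborel_reflect:
  fixes A :: "'a::euclidean_space set"
  assumes [measurable]: "A \<in> sets borel"
  shows "emeasure lborel {y. x - y \<in> A} = emeasure lborel A"
proof -
  have [measurable]: "{y. x - y \<in> A} \<in> sets borel"
    using measurable_sets_borel[of "\<lambda>y. x - y" borel A] by (simp add: vimage_def)
  have "emeasure lborel {y. x - y \<in> A} = (\<integral>\<^sup>+y. indicator A (x - y) \<partial>lborel)"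
    using nn_integral_indicator[of "{y. x - y \<in> A}" lborel] by (simp add: indicator_def)
  also have "\<dots> = emeasure lborel A"
    by (subst nn_integral_lborel_reflect) auto
  finally show ?thesis .
qed

text \<open>A convolution integrand contains its first factor at the reflected point \<xi> - \<eta>,
  so an almost everywhere identity for that factor has to survive the reflection. It does because
  Lebesgue measure is reflection invariant.\<close>

lemma AE_lborel_reflect:
  fixes P :: "'a::euclidean_space \<Rightarrow> bool"
  assumes "AE x in lborel. P x"
  shows "AE y in lborel. P (c - y)"
proof -
  from assms obtain N where N: "N \<in> null_sets lborel" "{x. \<not> P x} \<subseteq> N"
    by (auto elim!: AE_E simp: null_sets_def)
  from N have [measurable]: "N \<in> sets borel" by (auto simp: null_sets_def)
  have "emeasure lborel {y. c - y \<in> N} = 0"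
    using N by (subst emeasure_lborel_reflect) auto
  moreover have "{y. c - y \<in> N} \<in> sets lborel"
    using measurable_sets_borel[of "\<lambda>y. c - y" borel N] by (simp add: vimage_def)
  ultimately show ?thesis
    using N by (intro AE_I[of _ _ "{y. c - y \<in> N}"]) auto
qed

text \<open>For \<open>\<kappa> = 1 - 1 / q\<close> and \<open>1 < q\<close> this is, up to a constant factor, the bound \<open>K\<close> on the weak
  \<open>L^q\<close> norm. In this form it is countably subadditive and passes through integrals.\<close>

definition lorentz :: "real \<Rightarrow> ennreal \<Rightarrow> ('a::euclidean_space \<Rightarrow> ennreal) \<Rightarrow> bool" where
  "lorentz \<kappa> K g \<longleftrightarrow> g \<in> borel_measurable borel \<and>
     (\<forall>E\<in>sets borel. emeasure lborel E < \<infinity> \<longrightarrow>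
        (\<integral>\<^sup>+x. g x * indicator E x \<partial>lborel) \<le> K * ennreal (measure lborel E powr \<kappa>))"

lemma lorentz_measurable: "lorentz \<kappa> K g \<Longrightarrow> g \<in> borel_measurable borel"
  by (simp add: lorentz_def)

lemma lorentzD:
  "lorentz \<kappa> K g \<Longrightarrow> E \<in> sets borel \<Longrightarrow> emeasure lborel E < \<infinity> \<Longrightarrow>
    (\<integral>\<^sup>+x. g x * indicator E x \<partial>lborel) \<le> K * ennreal (measure lborel E powr \<kappa>)"
  by (simp add: lorentz_def)

text \<open>On a null set both sides are 0, the right one because \<open>0 powr \<kappa>\<close> is
  0. Later proofs may therefore divide by the measure of the test set.\<close>

lemma lorentzI:
  assumes "g \<in> borel_measurable borel"
    and "\<And>E. E \<in> sets borel \<Longrightarrow> emeasure lborel E < \<infinity> \<Longrightarrow> 0 < measure lborel E \<Longrightarrow>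
      (\<integral>\<^sup>+x. g x * indicator E x \<partial>lborel) \<le> K * ennreal (measure lborel E powr \<kappa>)"
  shows "lorentz \<kappa> K g"
  unfolding lorentz_def
proof (intro conjI ballI impI)
  fix E :: "'a set" assume E: "E \<in> sets borel" "emeasure lborel E < \<infinity>"
  show "(\<integral>\<^sup>+x. g x * indicator E x \<partial>lborel) \<le> K * ennreal (measure lborel E powr \<kappa>)"
  proof (cases "measure lborel E = 0")
    case True
    then have "emeasure lborel E = 0"
      using E(2) by (simp add: emeasure_eq_ennreal_measure)
    then have "E \<in> null_sets lborel" using E by (auto simp: null_sets_def)
    then have "(\<integral>\<^sup>+x. g x * indicator E x \<partial>lborel) = 0"
      by (intro nn_integral_0_iff_AE[THEN iffD2])
        (use assms(1) E AE_not_in[OF \<open>E \<in> null_sets lborel\<close>] in \<open>auto simp: indicator_def\<close>)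
    then show ?thesis by simp
  next
    case False
    then show ?thesis using assms(2)[OF E] by (simp add: zero_less_measure_iff)
  qed
qed (rule assms)

text \<open>For nonnegative \<kappa> the right-hand side grows with the measure. Level sets are
  known only through upper bounds for their measure, which is the form accepted here.\<close>

lemma lorentz_le:
  assumes "lorentz \<kappa> K g" "A \<in> sets borel" "emeasure lborel A \<le> ennreal c" "0 \<le> c" "0 \<le> \<kappa>"
  shows "(\<integral>\<^sup>+x. g x * indicator A x \<partial>lborel) \<le> K * ennreal (c powr \<kappa>)"
proof -
  have fin: "emeasure lborel A < \<infinity>" using assms(3) by (auto intro: le_less_trans)
  have "measure lborel A \<le> c"
    using assms(3,4) fin by (simp add: emeasure_eq_ennreal_measure)
  then have "measure lborel A powr \<kappa> \<le> c powr \<kappa>"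
    using assms(5) by (intro powr_mono2) auto
  then show ?thesis
    using lorentzD[OF assms(1,2) fin] by (meson ennreal_leI mult_left_mono order_trans zero_le)
qed

lemma lorentz_mono:
  assumes "lorentz \<kappa> K f" "g \<in> borel_measurable borel" "AE x in lborel. g x \<le> f x" "K \<le> K'"
  shows "lorentz \<kappa> K' g"
proof (rule lorentzI)
  fix E :: "'a set" assume E: "E \<in> sets borel" "emeasure lborel E < \<infinity>"
  have "(\<integral>\<^sup>+x. g x * indicator E x \<partial>lborel) \<le> (\<integral>\<^sup>+x. f x * indicator E x \<partial>lborel)"
    using assms(3) by (intro nn_integral_mono_AE) (auto elim!: eventually_mono intro!: mult_right_mono)
  also have "\<dots> \<le> K * ennreal (measure lborel E powr \<kappa>)"
    by (rule lorentzD[OF assms(1) E])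
  also have "\<dots> \<le> K' * ennreal (measure lborel E powr \<kappa>)"
    using assms(4) by (intro mult_right_mono) auto
  finally show "(\<integral>\<^sup>+x. g x * indicator E x \<partial>lborel) \<le> K' * ennreal (measure lborel E powr \<kappa>)" .
qed (rule assms)

text \<open>The product \<open>\<infinity> * 0\<close> is 0, so this rests on
  \<open>lorentzI\<close> having removed the null sets.\<close>

lemma lorentz_top: "g \<in> borel_measurable borel \<Longrightarrow> lorentz \<kappa> \<infinity> g"
  by (rule lorentzI) (auto simp: ennreal_top_mult)

lemma lorentz_zero: "lorentz \<kappa> K (\<lambda>_. 0)"
  by (rule lorentzI) auto

text \<open>The endpoint \<kappa> = 1 stands for bounded functions. Multiplying the constant 1 by a
  function with known level sets is how powers and functions of bounded weak norm enter the
  scale.\<close>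

lemma lorentz_one: "lorentz 1 1 (\<lambda>_. 1)"
  by (rule lorentzI) (auto simp: emeasure_eq_ennreal_measure)

lemma lorentz_cmult:
  assumes "lorentz \<kappa> K g"
  shows "lorentz \<kappa> (c * K) (\<lambda>x. c * g x)"
proof (rule lorentzI)
  note [measurable] = lorentz_measurable[OF assms]
  show "(\<lambda>x. c * g x) \<in> borel_measurable borel" by measurable
  fix E :: "'a set" assume E[measurable]: "E \<in> sets borel" and fin: "emeasure lborel E < \<infinity>"
  have "(\<integral>\<^sup>+x. c * g x * indicator E x \<partial>lborel) = c * (\<integral>\<^sup>+x. g x * indicator E x \<partial>lborel)"
    by (subst nn_integral_cmult[symmetric]) (auto simp: mult.assoc)
  also have "\<dots> \<le> c * (K * ennreal (measure lborel E powr \<kappa>))"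
    by (intro mult_left_mono lorentzD[OF assms E fin]) auto
  finally show "(\<integral>\<^sup>+x. c * g x * indicator E x \<partial>lborel) \<le> c * K * ennreal (measure lborel E powr \<kappa>)"
    by (simp add: mult.assoc)
qed

text \<open>Testing against sets is additive and loses no constant, whereas the quasi-norm
  \<open>weak_norm\<close> may lose a factor with every sum.\<close>

lemma lorentz_suminf:
  assumes "\<And>i::nat. lorentz \<kappa> (K i) (g i)"
  shows "lorentz \<kappa> (\<Sum>i. K i) (\<lambda>x. \<Sum>i. g i x)"
proof (rule lorentzI)
  note [measurable] = lorentz_measurable[OF assms]
  show "(\<lambda>x. \<Sum>i. g i x) \<in> borel_measurable borel" by measurable
  fix E :: "'a set" assume E[measurable]: "E \<in> sets borel" and fin: "emeasure lborel E < \<infinity>"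
  have "(\<integral>\<^sup>+x. (\<Sum>i. g i x) * indicator E x \<partial>lborel) = (\<Sum>i. \<integral>\<^sup>+x. g i x * indicator E x \<partial>lborel)"
    by (subst nn_integral_suminf[symmetric]) auto
  also have "\<dots> \<le> (\<Sum>i. K i * ennreal (measure lborel E powr \<kappa>))"
    by (intro suminf_le lorentzD[OF assms E fin]) auto
  finally show "(\<integral>\<^sup>+x. (\<Sum>i. g i x) * indicator E x \<partial>lborel) \<le> (\<Sum>i. K i) * ennreal (measure lborel E powr \<kappa>)"
    by simp
qed

lemma lorentz_add:
  assumes "lorentz \<kappa> K f" "lorentz \<kappa> L g"
  shows "lorentz \<kappa> (K + L) (\<lambda>x. f x + g x)"
proof (rule lorentzI)
  note [measurable] = lorentz_measurable[OF assms(1)] lorentz_measurable[OF assms(2)]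
  show "(\<lambda>x. f x + g x) \<in> borel_measurable borel" by measurable
  fix E :: "'a set" assume E[measurable]: "E \<in> sets borel" and fin: "emeasure lborel E < \<infinity>"
  have "(\<integral>\<^sup>+x. (f x + g x) * indicator E x \<partial>lborel)
      = (\<integral>\<^sup>+x. f x * indicator E x \<partial>lborel) + (\<integral>\<^sup>+x. g x * indicator E x \<partial>lborel)"
    by (subst nn_integral_add[symmetric]) (auto simp: distrib_right)
  also have "\<dots> \<le> K * ennreal (measure lborel E powr \<kappa>) + L * ennreal (measure lborel E powr \<kappa>)"
    by (intro add_mono lorentzD[OF _ E fin] assms)
  finally show "(\<integral>\<^sup>+x. (f x + g x) * indicator E x \<partial>lborel) \<le> (K + L) * ennreal (measure lborel E powr \<kappa>)"
    by (simp add: distrib_right)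
qed

lemma lorentz_sum:
  assumes "finite I" "\<And>i. i \<in> I \<Longrightarrow> lorentz \<kappa> (K i) (g i)"
  shows "lorentz \<kappa> (\<Sum>i\<in>I. K i) (\<lambda>x. \<Sum>i\<in>I. g i x)"
  using assms by (induction I rule: finite_induct) (auto intro!: lorentz_zero lorentz_add)

text \<open>Monotone convergence takes the place of completeness: a bound uniform in the iteration
  passes to the limit of the majorants.\<close>

lemma lorentz_SUP:
  assumes "\<And>n::nat. lorentz \<kappa> K (g n)" "incseq g"
  shows "lorentz \<kappa> K (\<lambda>x. SUP n. g n x)"
proof (rule lorentzI)
  note [measurable] = lorentz_measurable[OF assms(1)]
  show "(\<lambda>x. SUP n. g n x) \<in> borel_measurable borel" by measurable
  fix E :: "'a set" assume E[measurable]: "E \<in> sets borel" and fin: "emeasure lborel E < \<infinity>"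
  have "(\<integral>\<^sup>+x. (SUP n. g n x) * indicator E x \<partial>lborel) = (\<integral>\<^sup>+x. (SUP n. g n x * indicator E x) \<partial>lborel)"
    by (intro nn_integral_cong) (simp add: SUP_mult_right_ennreal)
  also have "\<dots> = (SUP n. \<integral>\<^sup>+x. g n x * indicator E x \<partial>lborel)"
    using assms(2) by (intro nn_integral_monotone_convergence_SUP)
      (auto simp: incseq_def le_fun_def intro!: mult_right_mono)
  also have "\<dots> \<le> K * ennreal (measure lborel E powr \<kappa>)"
    by (intro SUP_least lorentzD[OF assms(1) E fin])
  finally show "(\<integral>\<^sup>+x. (SUP n. g n x) * indicator E x \<partial>lborel) \<le> K * ennreal (measure lborel E powr \<kappa>)" .
qed

text \<open>Minkowski's inequality in weak spaces. Testing against \<open>E\<close> is itself an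
  integral, so it can be exchanged with the one over \<open>s\<close>; Duhamel integrals are
  estimated this way.\<close>

lemma lorentz_integral:
  fixes g :: "'b::euclidean_space \<Rightarrow> 'a::euclidean_space \<Rightarrow> ennreal"
  assumes "\<And>s. lorentz \<kappa> (K s) (g s)"
    and [measurable]: "(\<lambda>(s,x). g s x) \<in> borel_measurable (borel \<Otimes>\<^sub>M borel)" "K \<in> borel_measurable borel"
  shows "lorentz \<kappa> (\<integral>\<^sup>+s. K s \<partial>lborel) (\<lambda>x. \<integral>\<^sup>+s. g s x \<partial>lborel)"
proof (rule lorentzI)
  show "(\<lambda>x. \<integral>\<^sup>+s. g s x \<partial>lborel) \<in> borel_measurable borel" by measurable
  fix E :: "'a set" assume E[measurable]: "E \<in> sets borel" and fin: "emeasure lborel E < \<infinity>"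
  have "(\<integral>\<^sup>+x. (\<integral>\<^sup>+s. g s x \<partial>lborel) * indicator E x \<partial>lborel)
      = (\<integral>\<^sup>+x. \<integral>\<^sup>+s. g s x * indicator E x \<partial>lborel \<partial>lborel)"
    by (intro nn_integral_cong, subst nn_integral_multc) auto
  also have "\<dots> = (\<integral>\<^sup>+s. \<integral>\<^sup>+x. g s x * indicator E x \<partial>lborel \<partial>lborel)"
    by (rule lborel_pair.Fubini') measurable
  also have "\<dots> \<le> (\<integral>\<^sup>+s. K s * ennreal (measure lborel E powr \<kappa>) \<partial>lborel)"
    by (intro nn_integral_mono lorentzD[OF assms(1) E fin])
  finally show "(\<integral>\<^sup>+x. (\<integral>\<^sup>+s. g s x \<partial>lborel) * indicator E x \<partial>lborel)
      \<le> (\<integral>\<^sup>+s. K s \<partial>lborel) * ennreal (measure lborel E powr \<kappa>)"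
    by (simp add: nn_integral_multc)
qed

text \<open>Testing on the level set itself, of measure m, gives
  \<open>a * m \<le> K * m powr \<kappa>\<close>, which bounds m as \<kappa> < 1. The level set
  might have infinite measure a priori, so it is first cut off by balls.\<close>

lemma lorentz_distribution:
  fixes f :: "'a::euclidean_space \<Rightarrow> ennreal"
  assumes "lorentz \<kappa> (ennreal K) f" "0 \<le> K" "\<kappa> < 1" "0 < a"
  shows "emeasure lborel {x. ennreal a < f x} \<le> ennreal ((K / a) powr (1 / (1 - \<kappa>)))"
proof -
  note [measurable] = lorentz_measurable[OF assms(1)]
  define F where "F n = {x. ennreal a < f x} \<inter> ball 0 (real n)" for n :: nat
  have [measurable]: "F n \<in> sets borel" for n unfolding F_def by measurable
  have F: "emeasure lborel (F n) \<le> ennreal ((K / a) powr (1 / (1 - \<kappa>)))" for n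
  proof -
    have fin: "emeasure lborel (F n) < \<infinity>"
      using emeasure_mono[of "F n" "ball 0 (real n)" lborel]
        emeasure_lborel_ball_finite[of "0::'a" "real n"]
      by (auto simp: F_def intro: le_less_trans)
    define m where "m = measure lborel (F n)"
    have m: "emeasure lborel (F n) = ennreal m" "0 \<le> m"
      using fin by (auto simp: m_def emeasure_eq_ennreal_measure)
    have "ennreal a * ennreal m = (\<integral>\<^sup>+x. ennreal a * indicator (F n) x \<partial>lborel)"
      using m by (simp add: nn_integral_cmult_indicator)
    also have "\<dots> \<le> (\<integral>\<^sup>+x. f x * indicator (F n) x \<partial>lborel)"
      by (intro nn_integral_mono) (auto simp: F_def indicator_def less_imp_le)
    also have "\<dots> \<le> ennreal K * ennreal (m powr \<kappa>)"
      unfolding m_def by (rule lorentzD[OF assms(1) _ fin]) simp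
    finally have am: "a * m \<le> K * m powr \<kappa>"
      using assms m by (simp add: ennreal_mult[symmetric])
    show ?thesis
    proof (cases "m = 0")
      case False
      then have mp: "0 < m" using m by simp
      have "m = m powr (1 - \<kappa>) * m powr \<kappa>"
        using mp by (simp add: powr_add[symmetric])
      then have "a * m powr (1 - \<kappa>) * m powr \<kappa> \<le> K * m powr \<kappa>"
        using am by (simp add: mult.assoc)
      then have "a * m powr (1 - \<kappa>) \<le> K"
        using mp by simp
      then have "m powr (1 - \<kappa>) \<le> K / a"
        using assms by (simp add: field_simps)
      then have "(m powr (1 - \<kappa>)) powr (1 / (1 - \<kappa>)) \<le> (K / a) powr (1 / (1 - \<kappa>))"
        using assms by (intro powr_mono2) auto
      then have "m \<le> (K / a) powr (1 / (1 - \<kappa>))"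
        using assms mp by (simp add: powr_powr)
      then show ?thesis by (simp add: m ennreal_leI)
    qed (simp add: m)
  qed
  have "{x. ennreal a < f x} = (\<Union>n. F n)"
    using reals_Archimedean2 by (auto simp: F_def)
  moreover have "(SUP n. emeasure lborel (F n)) = emeasure lborel (\<Union>n. F n)"
    by (intro SUP_emeasure_incseq) (auto simp: incseq_def F_def)
  ultimately show ?thesis
    using F by (metis SUP_least)
qed

lemma AE_zero_if_level_sets_null:
  fixes w :: "'a \<Rightarrow> ennreal"
  assumes [measurable]: "w \<in> borel_measurable M"
    and "\<And>a. 0 < a \<Longrightarrow> emeasure M {x \<in> space M. ennreal a < w x} = 0"
  shows "AE x in M. w x = 0"
proof -
  have "AE x in M. \<forall>n::nat. w x \<le> ennreal (1 / Suc n)"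
  proof (subst AE_all_countable, rule allI)
    fix n :: nat
    show "AE x in M. w x \<le> ennreal (1 / Suc n)"
      using assms(2)[of "1 / Suc n"]
      by (intro AE_I[of _ _ "{x \<in> space M. ennreal (1 / Suc n) < w x}"]) (auto simp: not_le)
  qed
  then show ?thesis
  proof eventually_elim
    case (elim x)
    have "w x \<le> 0"
      by (rule LIMSEQ_le_const[OF tendsto_ennrealI[OF LIMSEQ_Suc[OF lim_1_over_n], simplified]])
        (use elim in auto)
    then show ?case by simp
  qed
qed

lemma lorentz_zero_AE:
  fixes f :: "'a::euclidean_space \<Rightarrow> ennreal"
  assumes "lorentz \<kappa> 0 f" "\<kappa> < 1"
  shows "AE x in lborel. f x = 0"
  using lorentz_measurable[OF assms(1)] lorentz_distribution[of \<kappa> 0 f] assms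
  by (intro AE_zero_if_level_sets_null) auto

section \<open>Dyadic decompositions; weak Hoelder and Young inequalities\<close>

lemma ennreal_le_suminf: "f i \<le> (\<Sum>i. f i)" for f :: "nat \<Rightarrow> ennreal"
  using sum_le_suminf[of f "{i}"] by simp

text \<open>For finite \<open>w\<close> above \<open>l\<close> the summand at the last dyadic level
  strictly below \<open>w\<close> already reaches \<open>w\<close>. For infinite \<open>w\<close>
  all summands are present and the series diverges.\<close>

lemma ennreal_dyadic_upper:
  fixes w :: ennreal
  assumes "0 < l"
  shows "w \<le> ennreal l + (\<Sum>i. ennreal (2 ^ Suc i * l) * indicator {ennreal (2 ^ i * l)<..} w)"
    (is "_ \<le> _ + (\<Sum>i. ?t i)")
proof (cases w)
  case (real r)
  show ?thesis
  proof (cases "r \<le> l")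
    case True
    then show ?thesis using real by (simp add: ennreal_leI add_increasing2)
  next
    case False
    obtain n where "r / l < 2 ^ n" using real_arch_pow[of 2 "r / l"] by auto
    then have ex: "\<exists>n. r \<le> 2 ^ n * l" using assms by (auto simp: field_simps intro: less_imp_le)
    define n where "n = (LEAST n. r \<le> 2 ^ n * l)"
    have n: "r \<le> 2 ^ n * l" unfolding n_def by (rule LeastI_ex[OF ex])
    then have "n \<noteq> 0" using False by (auto intro: ccontr)
    then obtain i where i: "n = Suc i" by (cases n) auto
    have "\<not> r \<le> 2 ^ i * l" using not_less_Least[of i "\<lambda>n. r \<le> 2 ^ n * l"] i n_def by auto
    then have "?t i = ennreal (2 ^ Suc i * l)"
      using real assms by (simp add: indicator_def ennreal_less_iff)
    then have "w \<le> ?t i" using n i real by (simp add: ennreal_leI)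
    also have "\<dots> \<le> (\<Sum>i. ?t i)" by (rule ennreal_le_suminf)
    finally show ?thesis by (simp add: add_increasing)
  qed
next
  case top
  have le: "ennreal (2 ^ Suc i * l) \<le> (\<Sum>i. ?t i)" for i
    using ennreal_le_suminf[of ?t i] top by simp
  have "(\<Sum>i. ?t i) = \<infinity>"
  proof (rule ccontr)
    assume "(\<Sum>i. ?t i) \<noteq> \<infinity>"
    then obtain r where r: "(\<Sum>i. ?t i) = ennreal r" "0 \<le> r" by (cases "\<Sum>i. ?t i") auto
    obtain n where "r / l < 2 ^ n" using real_arch_pow[of 2 "r / l"] by auto
    then have "r < 2 ^ n * l" using assms by (simp add: field_simps)
    also have "\<dots> \<le> 2 ^ Suc n * l" using assms by simp
    finally have "ennreal r < ennreal (2 ^ Suc n * l)" using r by (simp add: ennreal_less_iff)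
    then show False using le[of n] r by (simp add: not_le[symmetric])
  qed
  then show ?thesis by simp
qed

text \<open>The mirror image, downwards from \<open>l\<close>: values above \<open>l\<close> are
  left to the first term, and a value in the dyadic interval ending at \<open>(1/2) ^ i * l\<close>
  is reached by the \<open>i\<close>-th summand.\<close>

lemma ennreal_dyadic_lower:
  fixes w :: ennreal
  assumes "0 < l"
  shows "w \<le> w * indicator {ennreal l<..} w
      + (\<Sum>i. ennreal ((1/2) ^ i * l) * indicator {ennreal ((1/2) ^ Suc i * l)<..} w)"
    (is "_ \<le> _ + (\<Sum>i. ?t i)")
proof (cases "ennreal l < w")
  case True
  then show ?thesis by (simp add: indicator_def)
next
  case False
  then obtain r where r: "w = ennreal r" "0 \<le> r" by (cases w) auto
  then have rl: "r \<le> l" using False assms by (simp add: ennreal_less_iff not_less)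
  show ?thesis
  proof (cases "r = 0")
    case False
    then have rp: "0 < r" using r by simp
    obtain n where "(1/2) ^ n < r / l" using real_arch_pow_inv[of "r / l" "1/2"] rp assms by auto
    then have ex: "\<exists>n. (1/2) ^ n * l < r" using assms by (auto simp: field_simps)
    define n where "n = (LEAST n. (1/2) ^ n * l < r)"
    have n: "(1/2) ^ n * l < r" unfolding n_def by (rule LeastI_ex[OF ex])
    then have "n \<noteq> 0" using rl by (auto intro: ccontr)
    then obtain i where i: "n = Suc i" by (cases n) auto
    have le: "r \<le> (1/2) ^ i * l" using not_less_Least[of i "\<lambda>n. (1/2) ^ n * l < r"] i n_def by auto
    have "ennreal ((1/2) ^ Suc i * l) < w"
      using n i r assms by (simp add: ennreal_less_iff)
    then have "?t i = ennreal ((1/2) ^ i * l)" by (simp add: indicator_def)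
    then have "w \<le> ?t i" using le r by (simp add: ennreal_leI)
    also have "\<dots> \<le> (\<Sum>i. ?t i)" by (rule ennreal_le_suminf)
    finally show ?thesis by (simp add: add_increasing)
  qed (simp add: r)
qed

lemma suminf_ennreal_geometric:
  assumes "0 \<le> r" "r < 1" "0 \<le> c"
  shows "(\<Sum>i. ennreal (c * r ^ i)) = ennreal (c / (1 - r))"
  using sums_mult[OF geometric_sums[of r], of c] assms by (intro suminf_ennreal_eq) auto

text \<open>Splitting \<open>w\<close> dyadically above the level \<open>Y |E| powr (- 1 / P)\<close> bounds its pairing with \<open>g\<close> by a
  geometric series, which converges because of \<open>P * \<kappa> > 1\<close>.\<close>

lemma lorentz_mult:
  fixes g w :: "'a::euclidean_space \<Rightarrow> ennreal"
  assumes g: "lorentz \<kappa> X g" and [measurable]: "w \<in> borel_measurable borel"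
    and w: "\<And>a. 0 < a \<Longrightarrow> emeasure lborel {x. ennreal a < w x} \<le> ennreal ((Y / a) powr P)"
    and "0 < \<kappa>" "0 \<le> Y" "1 < P * \<kappa>"
  shows "lorentz (\<kappa> - 1 / P) (ennreal (1 + 2 / (1 - 2 powr (1 - P * \<kappa>))) * X * ennreal Y) (\<lambda>x. g x * w x)"
proof (rule lorentzI)
  note [measurable] = lorentz_measurable[OF g]
  show "(\<lambda>x. g x * w x) \<in> borel_measurable borel" by measurable
  have P: "0 < P" using assms by (metis less_trans zero_less_mult_pos2 zero_less_one)
  fix E :: "'a set" assume E[measurable]: "E \<in> sets borel" and fin: "emeasure lborel E < \<infinity>"
    and pos: "0 < measure lborel E"
  define M where "M = measure lborel E"
  have M: "0 < M" using pos by (simp add: M_def)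
  show "(\<integral>\<^sup>+x. g x * w x * indicator E x \<partial>lborel) \<le>
    ennreal (1 + 2 / (1 - 2 powr (1 - P * \<kappa>))) * X * ennreal Y * ennreal (measure lborel E powr (\<kappa> - 1 / P))"
  proof (cases "Y = 0")
    case True
    have "AE x in lborel. w x = 0"
      using w True by (intro AE_zero_if_level_sets_null) auto
    then have "(\<integral>\<^sup>+x. g x * w x * indicator E x \<partial>lborel) = 0"
      by (subst nn_integral_0_iff_AE) auto
    then show ?thesis by simp
  next
    case False
    then have Y: "0 < Y" using assms by simp
    define l where "l = Y * M powr (- (1 / P))"
    have l: "0 < l" using Y M by (simp add: l_def)
    \<comment> \<open>Doubling the level doubles the height and multiplies the bound for the measure
      of the level set by \<open>2 powr (- P)\<close>. The summands therefore shrink by this ratio,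
      which is below 1 because \<open>1 < P * \<kappa>\<close>.\<close>
    define r where "r = 2 powr (1 - P * \<kappa>)"
    have r: "0 < r" "r < 1" using assms by (auto simp: r_def powr_less_one)
    let ?S = "\<lambda>i. {x. ennreal (2 ^ i * l) < w x}"
    have term_le: "(\<integral>\<^sup>+x. g x * indicator (?S i) x \<partial>lborel) * ennreal (2 ^ Suc i * l)
        \<le> X * ennreal (Y * M powr (\<kappa> - 1 / P)) * ennreal (2 * r ^ i)" for i
    proof -
      have eq: "((Y / (2 ^ i * l)) powr P) = M * 2 powr (- real i * P)"
        using Y M P by (simp add: l_def powr_divide powr_mult powr_powr powr_minus powr_realpow[symmetric] field_simps)
      have "(\<integral>\<^sup>+x. g x * indicator (?S i) x \<partial>lborel) \<le> X * ennreal (((Y / (2 ^ i * l)) powr P) powr \<kappa>)"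
        using l assms by (intro lorentz_le[OF g]) auto
      also have "((Y / (2 ^ i * l)) powr P) powr \<kappa> = M powr \<kappa> * 2 powr (- real i * P * \<kappa>)"
        unfolding eq using M by (simp add: powr_mult powr_powr)
      finally have "(\<integral>\<^sup>+x. g x * indicator (?S i) x \<partial>lborel) * ennreal (2 ^ Suc i * l)
          \<le> X * ennreal (M powr \<kappa> * 2 powr (- real i * P * \<kappa>)) * ennreal (2 ^ Suc i * l)"
        by (rule mult_right_mono) simp
      also have "\<dots> = X * ennreal (M powr \<kappa> * 2 powr (- real i * P * \<kappa>) * (2 ^ Suc i * l))"
        using l by (simp add: ennreal_mult mult.assoc)
      also have "M powr \<kappa> * 2 powr (- real i * P * \<kappa>) * (2 ^ Suc i * l) = Y * M powr (\<kappa> - 1 / P) * (2 * r ^ i)"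
      proof -
        have "r ^ i = 2 powr (real i + - real i * P * \<kappa>)"
          by (simp add: r_def powr_realpow[symmetric] powr_powr algebra_simps)
        also have "\<dots> = 2 ^ i * 2 powr (- real i * P * \<kappa>)"
          unfolding powr_add by (simp add: powr_realpow)
        moreover have "M powr (\<kappa> - 1 / P) = M powr \<kappa> * M powr (- (1 / P))"
          by (simp add: powr_add[symmetric])
        ultimately show ?thesis by (simp add: l_def)
      qed
      also have "X * ennreal (Y * M powr (\<kappa> - 1 / P) * (2 * r ^ i)) = X * ennreal (Y * M powr (\<kappa> - 1 / P)) * ennreal (2 * r ^ i)"
        using Y r by (subst ennreal_mult) (auto simp: mult.assoc)
      finally show ?thesis .
    qed
    have "(\<integral>\<^sup>+x. g x * w x * indicator E x \<partial>lborel)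
        \<le> (\<integral>\<^sup>+x. ennreal l * (g x * indicator E x) + (\<Sum>i. ennreal (2 ^ Suc i * l) * (g x * indicator (?S i) x)) \<partial>lborel)"
    proof (rule nn_integral_mono)
      fix x
      have "w x \<le> ennreal l + (\<Sum>i. ennreal (2 ^ Suc i * l) * indicator (?S i) x)"
        using ennreal_dyadic_upper[OF l, of "w x"] by (simp add: indicator_def)
      then have "g x * w x * indicator E x
          \<le> g x * (ennreal l + (\<Sum>i. ennreal (2 ^ Suc i * l) * indicator (?S i) x)) * indicator E x"
        by (intro mult_right_mono mult_left_mono) auto
      also have "\<dots> = ennreal l * (g x * indicator E x)
          + (\<Sum>i. ennreal (2 ^ Suc i * l) * (g x * indicator (?S i) x)) * indicator E x"
        by (simp add: distrib_left distrib_right ennreal_suminf_cmult[symmetric] mult_ac del: ennreal_suminf_cmult)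
      also have "\<dots> \<le> ennreal l * (g x * indicator E x) + (\<Sum>i. ennreal (2 ^ Suc i * l) * (g x * indicator (?S i) x)) * 1"
        by (intro add_left_mono mult_left_mono) (auto simp: indicator_def)
      finally show "g x * w x * indicator E x
        \<le> ennreal l * (g x * indicator E x) + (\<Sum>i. ennreal (2 ^ Suc i * l) * (g x * indicator (?S i) x))" by simp
    qed
    also have "\<dots> = ennreal l * (\<integral>\<^sup>+x. g x * indicator E x \<partial>lborel)
        + (\<Sum>i. ennreal (2 ^ Suc i * l) * (\<integral>\<^sup>+x. g x * indicator (?S i) x \<partial>lborel))"
      by (subst nn_integral_add, measurable)
        (simp add: nn_integral_cmult nn_integral_suminf del: power_Suc)
    also have "\<dots> \<le> ennreal l * (X * ennreal (M powr \<kappa>))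
        + (\<Sum>i. X * ennreal (Y * M powr (\<kappa> - 1 / P)) * ennreal (2 * r ^ i))"
      using term_le by (intro add_mono mult_left_mono suminf_le)
        (auto simp: M_def mult.commute intro!: lorentzD[OF g E fin] simp del: power_Suc)
    also have "ennreal l * (X * ennreal (M powr \<kappa>)) = X * ennreal (Y * M powr (\<kappa> - 1 / P))"
    proof -
      have "Y * M powr (\<kappa> - 1 / P) = l * M powr \<kappa>"
        by (simp add: l_def powr_add[symmetric])
      then show ?thesis using l by (simp add: ennreal_mult mult_ac)
    qed
    also have "(\<Sum>i. X * ennreal (Y * M powr (\<kappa> - 1 / P)) * ennreal (2 * r ^ i))
        = X * ennreal (Y * M powr (\<kappa> - 1 / P)) * ennreal (2 / (1 - r))"
      using r suminf_ennreal_geometric[of r 2] by (simp only: ennreal_suminf_cmult)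
    also have "X * ennreal (Y * M powr (\<kappa> - 1 / P)) + X * ennreal (Y * M powr (\<kappa> - 1 / P)) * ennreal (2 / (1 - r))
        = ennreal (1 + 2 / (1 - r)) * X * ennreal Y * ennreal (M powr (\<kappa> - 1 / P))"
      using r Y by (simp add: ennreal_plus ennreal_mult distrib_left distrib_right mult_ac)
    finally show ?thesis by (simp add: M_def r_def)
  qed
qed

lemma lorentz_Icc_finite:
  fixes v :: "real \<Rightarrow> ennreal"
  assumes "lorentz \<kappa> (ennreal X) v"
  shows "(\<integral>\<^sup>+s. v s * indicator {a..b} s \<partial>lborel) < \<infinity>"
proof -
  have "(\<integral>\<^sup>+s. v s * indicator {a..b} s \<partial>lborel) \<le> ennreal X * ennreal (measure lborel {a..b} powr \<kappa>)"
    by (rule lorentzD[OF assms]) (auto simp: emeasure_lborel_Icc_eq)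
  also have "\<dots> < \<infinity>" by (simp add: ennreal_mult_less_top)
  finally show ?thesis .
qed

lemma nn_integral_suminf_cmult:
  assumes "\<And>i. f i \<in> borel_measurable M"
  shows "(\<integral>\<^sup>+x. (\<Sum>i. c i * f i x) \<partial>M) = (\<Sum>i. c i * (\<integral>\<^sup>+x. f i x \<partial>M))"
  using assms by (simp add: nn_integral_suminf nn_integral_cmult)

text \<open>Weak Young inequality: against \<open>E\<close> the convolution pairs \<open>g\<close> with \<open>h y\<close>, the integral of
  \<open>f (x - y)\<close> over \<open>x\<close> in \<open>E\<close>. The function \<open>h\<close> is bounded and lies in the weak space of \<open>f\<close>, so a dyadic
  decomposition downwards from its supremum gives a convergent geometric series.\<close>

lemma lorentz_convolution:
  assumes k: "0 < \<kappa>1" "0 < \<kappa>2" "\<kappa>1 + \<kappa>2 < 1"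
  shows "\<exists>C>0. \<forall>K L (f::'a::euclidean_space \<Rightarrow> ennreal) g. lorentz \<kappa>1 K f \<longrightarrow> lorentz \<kappa>2 L g \<longrightarrow>
    lorentz (\<kappa>1 + \<kappa>2) (ennreal C * K * L) (\<lambda>x. \<integral>\<^sup>+y. f (x - y) * g y \<partial>lborel)"
proof -
  define P where "P = 1 / (1 - \<kappa>1)"
  have P: "0 < P" "P * \<kappa>2 < 1" using k by (auto simp: P_def field_simps)
  \<comment> \<open>Halving the level multiplies the measure bound for the level set of
    \<open>h\<close> by \<open>2 powr P\<close>, hence the bound for its pairing with
    \<open>g\<close> by the number \<open>s\<close> below, against 1/2 in height. The ratio
    \<open>r = s / 2\<close> is below 1 because \<kappa>1 + \<kappa>2 < 1.\<close>
  define r where "r = 2 powr (P * \<kappa>2 - 1)"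
  have r: "0 < r" "r < 1" using P by (auto simp: r_def powr_less_one)
  define s where "s = 2 powr (P * \<kappa>2)"
  have s: "0 < s" "s = 2 * r" by (auto simp: s_def r_def powr_diff)
  have C: "0 < s / (1 - r)" using r s by simp
  have "lorentz (\<kappa>1 + \<kappa>2) (ennreal (s / (1 - r)) * K * L) (\<lambda>x. \<integral>\<^sup>+y. f (x - y) * g y \<partial>lborel)"
    if f: "lorentz \<kappa>1 K f" and g: "lorentz \<kappa>2 L g" for K L and f g :: "'a \<Rightarrow> ennreal"
  proof (rule lorentzI)
    note [measurable] = lorentz_measurable[OF f] lorentz_measurable[OF g]
    show "(\<lambda>x. \<integral>\<^sup>+y. f (x - y) * g y \<partial>lborel) \<in> borel_measurable borel" by measurable
    fix E :: "'a set" assume E[measurable]: "E \<in> sets borel" and fin: "emeasure lborel E < \<infinity>"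
      and pos: "0 < measure lborel E"
    define M where "M = measure lborel E"
    have M: "0 < M" "emeasure lborel E = ennreal M"
      using pos fin by (auto simp: M_def emeasure_eq_ennreal_measure)
    define h where "h y = (\<integral>\<^sup>+x. f (x - y) * indicator E x \<partial>lborel)" for y
    have [measurable]: "h \<in> borel_measurable borel" unfolding h_def by measurable
    have h_le: "h y \<le> K * ennreal (M powr \<kappa>1)" for y
    proof -
      have ms: "{x. y + x \<in> E} \<in> sets borel"
        using measurable_sets_borel[of "\<lambda>x. y + x" borel E] by (simp add: vimage_def)
      have "emeasure lborel {x. y + x \<in> E} = (\<integral>\<^sup>+x. indicator E (y + x) \<partial>lborel)"
        using nn_integral_indicator[of "{x. y + x \<in> E}" lborel] ms by (simp add: indicator_def)
      also have "\<dots> = emeasure lborel E" by (subst nn_integral_lborel_shift) auto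
      finally have em: "emeasure lborel {x. y + x \<in> E} \<le> ennreal M" using M by simp
      have "h y = (\<integral>\<^sup>+x. f x * indicator {x. y + x \<in> E} x \<partial>lborel)"
        unfolding h_def using nn_integral_lborel_shift[of "\<lambda>x. f (x - y) * indicator E x" y] by (simp add: indicator_def)
      also have "\<dots> \<le> K * ennreal (M powr \<kappa>1)" by (rule lorentz_le[OF f ms em]) (use M k in auto)
      finally show ?thesis .
    qed
    have pairing: "(\<integral>\<^sup>+x. (\<integral>\<^sup>+y. f (x - y) * u y \<partial>lborel) * indicator E x \<partial>lborel) = (\<integral>\<^sup>+y. u y * h y \<partial>lborel)"
      if [measurable]: "u \<in> borel_measurable borel" for u :: "'a \<Rightarrow> ennreal"
    proof -
      have "(\<integral>\<^sup>+x. (\<integral>\<^sup>+y. f (x - y) * u y \<partial>lborel) * indicator E x \<partial>lborel)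
          = (\<integral>\<^sup>+x. \<integral>\<^sup>+y. u y * (f (x - y) * indicator E x) \<partial>lborel \<partial>lborel)"
        by (intro nn_integral_cong, subst nn_integral_multc[symmetric]) (auto simp: mult_ac)
      also have "\<dots> = (\<integral>\<^sup>+y. \<integral>\<^sup>+x. u y * (f (x - y) * indicator E x) \<partial>lborel \<partial>lborel)"
        by (rule lborel_pair.Fubini') measurable
      also have "\<dots> = (\<integral>\<^sup>+y. u y * h y \<partial>lborel)"
        unfolding h_def by (intro nn_integral_cong nn_integral_cmult) measurable
      finally show ?thesis .
    qed
    show "(\<integral>\<^sup>+x. (\<integral>\<^sup>+y. f (x - y) * g y \<partial>lborel) * indicator E x \<partial>lborel)
        \<le> ennreal (s / (1 - r)) * K * L * ennreal (measure lborel E powr (\<kappa>1 + \<kappa>2))"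
      unfolding pairing[OF lorentz_measurable[OF g]] M_def[symmetric]
    proof (cases "K = 0 \<or> L = 0 \<or> K = \<infinity>")
      \<comment> \<open>Splitting off these cases makes the starting level \<open>l\<close> below
        finite and positive. If \<open>K\<close> is infinite and \<open>L = 0\<close>, the
        right-hand side is 0 and the vanishing of \<open>g\<close> almost everywhere has to be
        used.\<close>
      case True
      then consider "K = 0" | "L = 0" | "K = \<infinity>" "L \<noteq> 0" by blast
      then show "(\<integral>\<^sup>+y. g y * h y \<partial>lborel) \<le> ennreal (s / (1 - r)) * K * L * ennreal (M powr (\<kappa>1 + \<kappa>2))"
      proof cases
        case 1
        then have "h y = 0" for y using h_le[of y] by simp
        then show ?thesis by simp
      next
        case 2
        then have "AE y in lborel. g y = 0" using g k lorentz_zero_AE[of \<kappa>2 g] by simp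
        then have "(\<integral>\<^sup>+y. g y * h y \<partial>lborel) = 0" by (subst nn_integral_0_iff_AE) (auto elim: eventually_mono)
        then show ?thesis by simp
      next
        case 3
        then show ?thesis using C M s(1) r(2) by (auto simp: ennreal_mult_top ennreal_top_mult)
      qed
    next
      case False
      then obtain k' where k': "K = ennreal k'" "0 < k'" by (cases K) (auto simp: less_le)
      define l where "l = k' * M powr \<kappa>1"
      have l: "0 < l" using k' M by (simp add: l_def)
      \<comment> \<open>Interchanging the integrals moves the test set: for each \<open>x\<close>
        the inner integral of \<open>f\<close> runs over the reflected set of all
        \<open>x - y\<close> with \<open>y\<close> in \<open>A\<close>, which has the measure of
        \<open>A\<close>. Integrating over \<open>E\<close> contributes the factor
        \<open>M\<close>.\<close>
      have lh: "lorentz \<kappa>1 (ennreal (M * k')) h"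
      proof (rule lorentzI)
        fix A :: "'a set" assume A[measurable]: "A \<in> sets borel" and finA: "emeasure lborel A < \<infinity>"
        have "(\<integral>\<^sup>+y. h y * indicator A y \<partial>lborel) = (\<integral>\<^sup>+x. (\<integral>\<^sup>+y. f (x - y) * indicator A y \<partial>lborel) * indicator E x \<partial>lborel)"
          by (subst pairing) (auto simp: mult.commute)
        also have "\<dots> \<le> (\<integral>\<^sup>+x. (K * ennreal (measure lborel A powr \<kappa>1)) * indicator E x \<partial>lborel)"
        proof (intro nn_integral_mono mult_right_mono)
          fix x
          have ms: "{z. x - z \<in> A} \<in> sets borel"
            using measurable_sets_borel[of "\<lambda>z. x - z" borel A] by (simp add: vimage_def)
          have em: "emeasure lborel {z. x - z \<in> A} = emeasure lborel A" by (rule emeasure_lborel_reflect) simp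
          have "(\<integral>\<^sup>+y. f (x - y) * indicator A y \<partial>lborel) = (\<integral>\<^sup>+z. f z * indicator {z. x - z \<in> A} z \<partial>lborel)"
            using nn_integral_lborel_reflect[of "\<lambda>z. f z * indicator {z. x - z \<in> A} z" x] by (simp add: indicator_def)
          also have "\<dots> \<le> K * ennreal (measure lborel A powr \<kappa>1)"
            using lorentzD[OF f ms] em finA by (simp add: measure_def)
          finally show "(\<integral>\<^sup>+y. f (x - y) * indicator A y \<partial>lborel) \<le> K * ennreal (measure lborel A powr \<kappa>1)" .
        qed simp
        also have "\<dots> = ennreal (M * k') * ennreal (measure lborel A powr \<kappa>1)"
          using M k' by (subst nn_integral_cmult_indicator) (auto simp: ennreal_mult mult_ac)
        finally show "(\<integral>\<^sup>+y. h y * indicator A y \<partial>lborel) \<le> ennreal (M * k') * ennreal (measure lborel A powr \<kappa>1)" .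
      qed simp
      have "M * k' / l = M powr (1 - \<kappa>1)" using k' M by (simp add: l_def powr_diff)
      \<comment> \<open>At the level \<open>l\<close> the weak bound for \<open>h\<close> returns
        the measure of \<open>E\<close> itself; the geometric series starts from this value.\<close>
      then have kl: "(M * k' / l) powr P = M" using M k by (simp add: P_def powr_powr)
      let ?S = "\<lambda>i. {y. ennreal ((1/2) ^ Suc i * l) < h y}"
      have S: "(\<integral>\<^sup>+y. g y * indicator (?S i) y \<partial>lborel) \<le> L * ennreal (M powr \<kappa>2 * (s * s ^ i))" for i
      proof -
        have "(M * k' / ((1/2) ^ Suc i * l)) = (M * k' / l) * 2 powr real (Suc i)"
          by (subst powr_realpow) (auto simp: field_simps power_one_over)
        then have "(M * k' / ((1/2) ^ Suc i * l)) powr P = M * 2 powr (real (Suc i) * P)"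
          using kl M k' l by (simp only: powr_mult powr_powr)
        then have "emeasure lborel (?S i) \<le> ennreal (M * 2 powr (real (Suc i) * P))"
          using lorentz_distribution[OF lh, of "(1/2) ^ Suc i * l"] k' M k l by (simp add: P_def del: power_Suc)
        then have "(\<integral>\<^sup>+y. g y * indicator (?S i) y \<partial>lborel) \<le> L * ennreal ((M * 2 powr (real (Suc i) * P)) powr \<kappa>2)"
          by (intro lorentz_le[OF g]) (use M k in auto)
        also have "(M * 2 powr (real (Suc i) * P)) powr \<kappa>2 = M powr \<kappa>2 * (s * s ^ i)"
        proof -
          have "s * s ^ i = s powr real (Suc i)" using s(1) by (subst powr_realpow) auto
          then show ?thesis using M by (simp add: s_def powr_mult powr_powr mult_ac)
        qed
        finally show ?thesis .
      qed
      have "(\<integral>\<^sup>+y. g y * h y \<partial>lborel) \<le> (\<integral>\<^sup>+y. (\<Sum>i. ennreal ((1/2) ^ i * l) * (g y * indicator (?S i) y)) \<partial>lborel)"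
      proof (rule nn_integral_mono)
        fix y
        have "h y \<le> ennreal l" using h_le[of y] k' by (simp add: l_def ennreal_mult)
        then have "h y \<le> (\<Sum>i. ennreal ((1/2) ^ i * l) * indicator (?S i) y)"
          using ennreal_dyadic_lower[OF l, of "h y"] by (simp add: indicator_def not_less[symmetric])
        then have "g y * h y \<le> g y * (\<Sum>i. ennreal ((1/2) ^ i * l) * indicator (?S i) y)"
          by (rule mult_left_mono) simp
        then show "g y * h y \<le> (\<Sum>i. ennreal ((1/2) ^ i * l) * (g y * indicator (?S i) y))"
          by (simp only: ennreal_suminf_cmult[symmetric] mult.left_commute)
      qed
      also have "\<dots> = (\<Sum>i. ennreal ((1/2) ^ i * l) * (\<integral>\<^sup>+y. g y * indicator (?S i) y \<partial>lborel))"
        by (rule nn_integral_suminf_cmult) measurable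
      also have "\<dots> \<le> (\<Sum>i. L * ennreal ((l * M powr \<kappa>2 * s) * r ^ i))"
      proof (intro suminf_le)
        fix i
        have "ennreal ((1/2) ^ i * l) * (\<integral>\<^sup>+y. g y * indicator (?S i) y \<partial>lborel)
            \<le> ennreal ((1/2) ^ i * l) * (L * ennreal (M powr \<kappa>2 * (s * s ^ i)))"
          by (intro mult_left_mono S) simp
        also have "\<dots> = L * ennreal ((1/2) ^ i * l * (M powr \<kappa>2 * (s * s ^ i)))"
          using l s by (subst ennreal_mult) (auto simp: mult_ac)
        also have "(1/2) ^ i * l * (M powr \<kappa>2 * (s * s ^ i)) = (l * M powr \<kappa>2 * s) * r ^ i"
        proof -
          have "(1/2) * s = r" using s(2) by simp
          then have "(1/2) ^ i * s ^ i = r ^ i" by (simp only: flip: power_mult_distrib)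
          then show ?thesis by (simp only: mult_ac flip: \<open>(1/2) ^ i * s ^ i = r ^ i\<close>)
        qed
        finally show "ennreal ((1/2) ^ i * l) * (\<integral>\<^sup>+y. g y * indicator (?S i) y \<partial>lborel) \<le> L * ennreal ((l * M powr \<kappa>2 * s) * r ^ i)" .
      qed auto
      also have "\<dots> = L * ennreal (l * M powr \<kappa>2 * s / (1 - r))"
        using r l s(1) by (subst ennreal_suminf_cmult, subst suminf_ennreal_geometric) auto
      also have "l * M powr \<kappa>2 * s / (1 - r) = s / (1 - r) * k' * M powr (\<kappa>1 + \<kappa>2)" by (simp add: l_def powr_add)
      also have "L * ennreal (s / (1 - r) * k' * M powr (\<kappa>1 + \<kappa>2)) = ennreal (s / (1 - r)) * K * L * ennreal (M powr (\<kappa>1 + \<kappa>2))"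
        unfolding k'(1) using less_imp_le[OF C] less_imp_le[OF k'(2)]
        by (simp only: ennreal_mult mult_nonneg_nonneg powr_ge_zero mult_ac)
      finally show "(\<integral>\<^sup>+y. g y * h y \<partial>lborel) \<le> ennreal (s / (1 - r)) * K * L * ennreal (M powr (\<kappa>1 + \<kappa>2))" .
    qed
  qed
  then show ?thesis using C by blast
qed

text \<open>The superlevel sets of the weight are balls of volume proportional to
  \<open>a powr (- DIM('a) / \<sigma>)\<close>, so it belongs to the weak space with exponent d /
  \<sigma>. The weak Hoelder inequality then lowers the index by \<sigma> / d.\<close>

lemma lorentz_weight:
  assumes "0 \<le> (\<sigma>::real)" "\<sigma> < real DIM('a::euclidean_space) * \<kappa>"
  shows "\<exists>C>0. \<forall>K (G::'a \<Rightarrow> ennreal). lorentz \<kappa> K G \<longrightarrow>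
    lorentz (\<kappa> - \<sigma> / DIM('a)) (ennreal C * K) (\<lambda>x. ennreal (norm x powr (- \<sigma>)) * G x)"
proof (cases "\<sigma> = 0")
  \<comment> \<open>For \<sigma> = 0 the exponent \<open>P\<close> below would be infinite. The
    weight is then 0 at the origin and 1 elsewhere.\<close>
  case True
  have "lorentz \<kappa> (ennreal 1 * K) (\<lambda>x. ennreal (norm x powr (- \<sigma>)) * G x)" if G: "lorentz \<kappa> K G" for K and G :: "'a \<Rightarrow> ennreal"
  proof (rule lorentz_mono[OF G])
    note [measurable] = lorentz_measurable[OF G]
    show "(\<lambda>x. ennreal (norm x powr (- \<sigma>)) * G x) \<in> borel_measurable borel" by measurable
  qed (use True in auto)
  then show ?thesis using True by (intro exI[of _ 1]) auto
next
  case False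
  define d where "d = real DIM('a)"
  have d: "0 < d" and \<sigma>: "0 < \<sigma>" using assms False by (auto simp: d_def)
  define c where "c = unit_ball_vol d"
  have c: "0 < c" unfolding c_def d_def by (rule unit_ball_vol_pos) simp
  define P where "P = d / \<sigma>"
  have kpos: "0 < \<kappa>" using assms by (metis DIM_positive le_less_trans of_nat_0_less_iff zero_less_mult_pos)
  have P: "1 < P * \<kappa>" "1 / P = \<sigma> / d" using assms \<sigma> d by (auto simp: P_def d_def field_simps)
  have level: "emeasure lborel {x::'a. ennreal a < ennreal (norm x powr (- \<sigma>))} \<le> ennreal ((c powr (1 / P) / a) powr P)" if a: "0 < a" for a
  proof -
    have "norm x < a powr (- (1 / \<sigma>))" if "a < norm x powr (- \<sigma>)" for x :: 'a
    proof -
      have x: "0 < norm x" using that a by (cases "x = 0") auto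
      have "(norm x powr (- \<sigma>)) powr (- (1 / \<sigma>)) < a powr (- (1 / \<sigma>))"
        using that a \<sigma> by (intro powr_less_mono2_neg) auto
      then show ?thesis using x \<sigma> by (simp add: powr_powr)
    qed
    then have "emeasure lborel {x::'a. ennreal a < ennreal (norm x powr (- \<sigma>))} \<le> emeasure lborel (ball (0::'a) (a powr (- (1 / \<sigma>))))"
      using a by (intro emeasure_mono) (auto simp: ennreal_less_iff)
    also have "\<dots> = ennreal (c * (a powr (- (1 / \<sigma>))) ^ DIM('a))" by (subst emeasure_ball) (auto simp: c_def d_def)
    also have "c * (a powr (- (1 / \<sigma>))) ^ DIM('a) = (c powr (1 / P) / a) powr P"
      using a c \<sigma> d by (subst powr_realpow[symmetric]) (auto simp: d_def P_def powr_powr powr_divide powr_minus_divide)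
    finally show ?thesis .
  qed
  define C where "C = 1 + 2 / (1 - 2 powr (1 - P * \<kappa>))"
  have "2 powr (1 - P * \<kappa>) < 1" using P by (intro powr_less_one) auto
  then have C: "0 < C" unfolding C_def by (intro add_pos_nonneg divide_nonneg_pos) auto
  have "lorentz (\<kappa> - \<sigma> / d) (ennreal (C * c powr (1 / P)) * K) (\<lambda>x. ennreal (norm x powr (- \<sigma>)) * G x)"
    if G: "lorentz \<kappa> K G" for K and G :: "'a \<Rightarrow> ennreal"
  proof -
    have "(\<lambda>x::'a. ennreal (norm x powr (- \<sigma>))) \<in> borel_measurable borel" by measurable
    from lorentz_mult[OF G this level kpos _ P(1)] show ?thesis
      using C by (simp add: P(2) C_def[symmetric] ennreal_mult mult_ac)
  qed
  then show ?thesis using C c by (intro exI[of _ "C * c powr (1 / P)"]) (auto simp: d_def)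
qed

section \<open>Polynomial decay weights\<close>

definition decay :: "nat \<Rightarrow> 'a::real_normed_vector \<Rightarrow> real" where
  "decay N x = 1 / (1 + norm x) ^ N"

lemma decay_pos: "0 < decay N x"
  by (auto simp: decay_def intro!: divide_pos_pos zero_less_power add_pos_nonneg)

lemma decay_nonneg [simp]: "0 \<le> decay N x"
  using decay_pos less_imp_le by blast

lemma decay_add: "decay (N + M) x = decay N x * decay M x"
  by (simp add: decay_def power_add)

lemma power_decay [simp]: "(1 + norm x) ^ N * decay N x = 1"
proof -
  have "0 < (1 + norm x) ^ N" by (auto intro!: zero_less_power add_pos_nonneg)
  then have "(1 + norm x) ^ N \<noteq> 0" by (rule dual_order.strict_implies_not_eq)
  then show ?thesis unfolding decay_def times_divide_eq_right mult_1_right by (rule divide_self)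
qed

lemma decay_antimono: "M \<le> N \<Longrightarrow> decay N x \<le> decay M x"
  unfolding decay_def by (intro divide_left_mono mult_pos_pos power_increasing zero_less_power add_pos_nonneg) auto

lemma decay_measurable [measurable]: "decay N \<in> borel_measurable borel"
  unfolding decay_def[abs_def] by measurable

lemma decay_bound: "(1 + norm x) ^ N * y \<le> B \<Longrightarrow> y \<le> B * decay N x"
proof -
  assume "(1 + norm x) ^ N * y \<le> B"
  then have "((1 + norm x) ^ N * y) * decay N x \<le> B * decay N x" by (intro mult_right_mono) auto
  moreover have "((1 + norm x) ^ N * y) * decay N x = ((1 + norm x) ^ N * decay N x) * y" by (simp only: mult_ac)
  ultimately show ?thesis by simp
qed

text \<open>On the ball of radius \<open>2 ^ Suc i\<close> the integral of \<open>G\<close> grows at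
  most like the volume, that is like \<open>2 ^ (i * DIM('a))\<close>, because \<kappa> \<le> 1. The
  weight has one power more to offer, which leaves a geometric series of ratio 1/2.\<close>

lemma lorentz_decay_integral:
  assumes "0 \<le> \<kappa>" "\<kappa> \<le> 1"
  shows "\<exists>C>0. \<forall>K (G::'a::euclidean_space \<Rightarrow> ennreal). lorentz \<kappa> K G \<longrightarrow>
    (\<integral>\<^sup>+x. G x * ennreal (decay (Suc DIM('a)) x) \<partial>lborel) \<le> ennreal C * K"
proof -
  let ?n = "DIM('a)"
  \<comment> \<open>The maximum with 1 makes every volume bound at least 1, so that its power
    \<kappa> \<le> 1 is dominated by the first power.\<close>
  define c where "c = max 1 (unit_ball_vol (real ?n))"
  have c: "1 \<le> c" "unit_ball_vol (real ?n) \<le> c" by (auto simp: c_def)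
  define B where "B i = ball (0::'a) (2 ^ Suc i)" for i
  have [measurable]: "B i \<in> sets borel" for i by (simp add: B_def)
  define p :: "nat \<Rightarrow> real" where "p i = 1 / 2 ^ (i * Suc ?n)" for i
  have "(\<integral>\<^sup>+x. G x * ennreal (1 / (1 + norm x) ^ Suc ?n) \<partial>lborel) \<le> ennreal (c * 2 ^ ?n * 2) * K"
    if G: "lorentz \<kappa> K G" for K and G :: "'a \<Rightarrow> ennreal"
  proof -
    note [measurable] = lorentz_measurable[OF G]
    have pt: "G x * ennreal (1 / (1 + norm x) ^ Suc ?n)
        \<le> (\<Sum>i. ennreal (p i) * (G x * indicator (B i) x))" for x
    proof -
      obtain n where "norm x < 2 ^ n" using real_arch_pow[of 2 "norm x"] by auto
      then have ex: "\<exists>n. norm x < 2 ^ Suc n" by (intro exI[of _ n]) (simp add: less_le_trans)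
      define i where "i = (LEAST n. norm x < 2 ^ Suc n)"
      have i: "norm x < 2 ^ Suc i" unfolding i_def by (rule LeastI_ex[OF ex])
      have "2 ^ i \<le> 1 + norm x"
      proof (cases i)
        case (Suc j)
        then have "\<not> norm x < 2 ^ Suc j" using not_less_Least[of j "\<lambda>n. norm x < 2 ^ Suc n"] i_def by auto
        then show ?thesis using Suc by auto
      qed auto
      then have "(2 ^ i) ^ Suc ?n \<le> (1 + norm x) ^ Suc ?n" by (rule power_mono) simp
      then have "1 / (1 + norm x) ^ Suc ?n \<le> p i"
        unfolding power_mult p_def by (intro divide_left_mono mult_pos_pos) (auto simp: add_pos_nonneg)
      then have "G x * ennreal (1 / (1 + norm x) ^ Suc ?n) \<le> G x * ennreal (p i)"
        by (intro mult_left_mono ennreal_leI) auto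
      also have "\<dots> = ennreal (p i) * (G x * indicator (B i) x)"
        using i by (simp add: mult.commute B_def)
      also have "\<dots> \<le> (\<Sum>i. ennreal (p i) * (G x * indicator (B i) x))"
        by (rule ennreal_le_suminf)
      finally show ?thesis .
    qed
    have ball: "(\<integral>\<^sup>+x. G x * indicator (B i) x \<partial>lborel) \<le> K * ennreal (c * (2 ^ Suc i) ^ ?n)" for i
    proof -
      have ge1: "1 \<le> c * (2 ^ Suc i) ^ ?n"
        using c mult_mono[of 1 c 1 "(2 ^ Suc i) ^ ?n"] one_le_power[of "2 ^ Suc i :: real" ?n]
          one_le_power[of "2::real" "Suc i"] by simp
      have "(\<integral>\<^sup>+x. G x * indicator (B i) x \<partial>lborel) \<le> K * ennreal ((c * (2 ^ Suc i) ^ ?n) powr \<kappa>)"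
        using assms c by (intro lorentz_le[OF G]) (auto simp: B_def emeasure_ball mult_right_mono simp del: power_Suc intro!: ennreal_leI)
      also have "\<dots> \<le> K * ennreal ((c * (2 ^ Suc i) ^ ?n) powr 1)"
        using ge1 assms by (intro mult_left_mono ennreal_leI powr_mono) auto
      finally show ?thesis using c by simp
    qed
    have "(\<integral>\<^sup>+x. G x * ennreal (1 / (1 + norm x) ^ Suc ?n) \<partial>lborel)
        \<le> (\<integral>\<^sup>+x. (\<Sum>i. ennreal (p i) * (G x * indicator (B i) x)) \<partial>lborel)"
      by (intro nn_integral_mono pt)
    also have "\<dots> = (\<Sum>i. ennreal (p i) * (\<integral>\<^sup>+x. G x * indicator (B i) x \<partial>lborel))"
      by (rule nn_integral_suminf_cmult) measurable
    also have "\<dots> \<le> (\<Sum>i. K * ennreal (c * 2 ^ ?n * (1/2) ^ i))"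
    proof (intro suminf_le)
      fix i
      have "ennreal (p i) * (\<integral>\<^sup>+x. G x * indicator (B i) x \<partial>lborel)
          \<le> ennreal (p i) * (K * ennreal (c * (2 ^ Suc i) ^ ?n))"
        by (intro mult_left_mono ball) auto
      also have "\<dots> = K * ennreal (p i * (c * (2 ^ Suc i) ^ ?n))"
      proof -
        have "ennreal (p i * (c * (2 ^ Suc i) ^ ?n)) = ennreal (p i) * ennreal (c * (2 ^ Suc i) ^ ?n)"
          using c by (intro ennreal_mult) (auto simp: p_def simp del: power_Suc mult_Suc_right)
        then show ?thesis by (simp only: mult.left_commute)
      qed
      also have "p i * (c * (2 ^ Suc i) ^ ?n) = c * 2 ^ ?n * (1/2) ^ i"
      proof -
        have "(2::real) ^ (i * Suc ?n) = 2 ^ i * 2 ^ (i * ?n)" "((2::real) ^ Suc i) ^ ?n = 2 ^ ?n * 2 ^ (i * ?n)"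
          by (simp_all add: power_add power_mult_distrib power_mult)
        then show ?thesis by (simp add: p_def power_one_over)
      qed
      finally show "ennreal (p i) * (\<integral>\<^sup>+x. G x * indicator (B i) x \<partial>lborel)
        \<le> K * ennreal (c * 2 ^ ?n * (1/2) ^ i)" .
    qed auto
    also have "\<dots> = K * ennreal (c * 2 ^ ?n * 2)"
      using c by (subst ennreal_suminf_cmult, subst suminf_ennreal_geometric) auto
    finally show ?thesis by (simp add: mult.commute)
  qed
  then show ?thesis using c unfolding decay_def by (intro exI[of _ "c * 2 ^ ?n * 2"]) auto
qed

lemma lorentz_of_distribution:
  fixes w :: "'a::euclidean_space \<Rightarrow> ennreal"
  assumes "w \<in> borel_measurable borel" "0 \<le> Y" "1 < P"
    and "\<And>a. 0 < a \<Longrightarrow> emeasure lborel {x. ennreal a < w x} \<le> ennreal ((Y / a) powr P)"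
  shows "lorentz (1 - 1 / P) (ennreal (1 + 2 / (1 - 2 powr (1 - P))) * ennreal Y) w"
  using lorentz_mult[OF lorentz_one assms(1) assms(4)] assms by simp

text \<open>Weak Hoelder inequality: reciprocal exponents add, which in terms of \<kappa> = 1 - 1 /
  q means \<kappa>1 + \<kappa>2 - 1. The second factor enters through its level sets, hence its
  finite constant \<open>Y\<close>.\<close>

lemma lorentz_product:
  assumes "0 < \<kappa>1" "\<kappa>2 < 1" "1 < \<kappa>1 + \<kappa>2"
  shows "\<exists>C>0. \<forall>X Y (f::'a::euclidean_space \<Rightarrow> ennreal) g. 0 \<le> Y \<longrightarrow> lorentz \<kappa>1 X f \<longrightarrow> lorentz \<kappa>2 (ennreal Y) g \<longrightarrow>
    lorentz (\<kappa>1 + \<kappa>2 - 1) (ennreal C * X * ennreal Y) (\<lambda>x. f x * g x)"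
proof -
  define P where "P = 1 / (1 - \<kappa>2)"
  have P: "1 < P * \<kappa>1" "\<kappa>1 - 1 / P = \<kappa>1 + \<kappa>2 - 1" using assms by (auto simp: P_def field_simps)
  have r: "2 powr (1 - P * \<kappa>1) < 1" using P by (intro powr_less_one) auto
  show ?thesis
  proof (intro exI[of _ "1 + 2 / (1 - 2 powr (1 - P * \<kappa>1))"] conjI allI impI)
    show "0 < 1 + 2 / (1 - 2 powr (1 - P * \<kappa>1))" using r by (intro add_pos_pos divide_pos_pos) auto
    fix X and Y :: real and f g :: "'a \<Rightarrow> ennreal"
    assume Y: "0 \<le> Y" and f: "lorentz \<kappa>1 X f" and g: "lorentz \<kappa>2 (ennreal Y) g"
    have "emeasure lborel {x. ennreal a < g x} \<le> ennreal ((Y / a) powr P)" if "0 < a" for a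
      using lorentz_distribution[OF g Y assms(2) that] by (simp add: P_def)
    from lorentz_mult[OF f lorentz_measurable[OF g] this assms(1) Y P(1)]
    show "lorentz (\<kappa>1 + \<kappa>2 - 1) (ennreal (1 + 2 / (1 - 2 powr (1 - P * \<kappa>1))) * X * ennreal Y) (\<lambda>x. f x * g x)"
      by (simp add: P)
  qed
qed

text \<open>A pure power of time lies in no Lebesgue space on the line but in exactly one weak
  space. Both the time kernels and the decay of the heat flow of the initial data are of this
  form.\<close>

lemma lorentz_abs_powr:
  assumes "0 < \<kappa>" "\<kappa> < 1"
  shows "\<exists>C>0. lorentz \<kappa> (ennreal C) (\<lambda>t::real. ennreal (\<bar>t\<bar> powr (- (1 - \<kappa>))))"
proof -
  obtain C where "0 < C" "\<And>K (G::real \<Rightarrow> ennreal). lorentz 1 K G \<Longrightarrow>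
    lorentz (1 - (1 - \<kappa>) / DIM(real)) (ennreal C * K) (\<lambda>x. ennreal (norm x powr (- (1 - \<kappa>))) * G x)"
    using lorentz_weight[of "1 - \<kappa>" 1, where 'a = real] assms by auto
  from this(1) this(2)[OF lorentz_one] show ?thesis by auto
qed

lemma lorentz_product_Icc_finite:
  fixes v w :: "real \<Rightarrow> ennreal"
  assumes "lorentz \<kappa>1 (ennreal X) v" "lorentz \<kappa>2 (ennreal Y) w" "0 \<le> X" "0 \<le> Y" "0 < \<kappa>1" "\<kappa>2 < 1" "1 < \<kappa>1 + \<kappa>2"
  shows "(\<integral>\<^sup>+s. (v s * w s) * indicator {a..b} s \<partial>lborel) < \<infinity>"
proof -
  obtain C where "0 < C" "lorentz (\<kappa>1 + \<kappa>2 - 1) (ennreal C * ennreal X * ennreal Y) (\<lambda>x. v x * w x)"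
    using lorentz_product[OF assms(5-7), where 'a = real] assms(1,2,4) by blast
  then have "lorentz (\<kappa>1 + \<kappa>2 - 1) (ennreal (C * X * Y)) (\<lambda>x. v x * w x)"
    using assms(3,4) by (simp add: ennreal_mult)
  then show ?thesis by (rule lorentz_Icc_finite)
qed

text \<open>Weak Young inequality with the kernel in its own weak space; \<kappa> < b keeps the
  resulting index below 1.\<close>

lemma lorentz_fractional_integral:
  assumes "0 < b" "b < 1" "0 < \<kappa>" "\<kappa> < b"
  shows "\<exists>C>0. \<forall>K g. lorentz \<kappa> K g \<longrightarrow>
    lorentz (1 - b + \<kappa>) (ennreal C * K) (\<lambda>t::real. \<integral>\<^sup>+s. ennreal (\<bar>t - s\<bar> powr (- b)) * g s \<partial>lborel)"
proof -
  obtain C where C: "0 < C" "lorentz (1 - b) (ennreal C) (\<lambda>t::real. ennreal (\<bar>t\<bar> powr (- b)))"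
    using lorentz_abs_powr[of "1 - b"] assms by auto
  have "0 < 1 - b" "1 - b + \<kappa> < 1" using assms by auto
  then obtain D where D: "0 < D" "\<And>K L (f::real \<Rightarrow> ennreal) g. lorentz (1 - b) K f \<Longrightarrow> lorentz \<kappa> L g \<Longrightarrow>
      lorentz (1 - b + \<kappa>) (ennreal D * K * L) (\<lambda>x. \<integral>\<^sup>+y. f (x - y) * g y \<partial>lborel)"
    using lorentz_convolution[of "1 - b" \<kappa>, where 'a = real] assms(3) by blast
  show ?thesis using C(1) D(1) D(2)[OF C(2)] by (intro exI[of _ "D * C"]) (simp add: ennreal_mult)
qed

section \<open>Comparison with the weak norms, and their measurability\<close>

lemma ennreal_powr_le_iff:
  assumes "0 < l" "0 \<le> c" "0 < q"
  shows "ennreal l * ennreal_powr E (1 / q) \<le> ennreal c \<longleftrightarrow> E \<le> ennreal ((c / l) powr q)"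
proof (cases E)
  case (real e)
  have "e powr (1 / q) \<le> c / l \<longleftrightarrow> e \<le> (c / l) powr q"
  proof
    assume "e powr (1 / q) \<le> c / l"
    then have "(e powr (1 / q)) powr q \<le> (c / l) powr q" using assms by (intro powr_mono2) auto
    then show "e \<le> (c / l) powr q" using assms real by (simp add: powr_powr)
  next
    assume "e \<le> (c / l) powr q"
    then have "e powr (1 / q) \<le> ((c / l) powr q) powr (1 / q)" using assms real by (intro powr_mono2) auto
    then show "e powr (1 / q) \<le> c / l" using assms by (simp add: powr_powr)
  qed
  then show ?thesis
    using real assms by (simp add: ennreal_powr_def ennreal_mult[symmetric] field_simps)
next
  case top
  then show ?thesis using assms by (simp add: ennreal_powr_def ennreal_mult_top top_unique)
qed

lemma weak_norm_le_iff:
  assumes "0 \<le> c" "0 < q"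
  shows "weak_norm M q g \<le> ennreal c \<longleftrightarrow>
    (\<forall>l>0. emeasure M {x \<in> space M. ennreal l < g x} \<le> ennreal ((c / l) powr q))"
  unfolding weak_norm_def SUP_le_iff using ennreal_powr_le_iff[OF _ assms] by auto

text \<open>The two descriptions of the weak space are equivalent, and a constant is lost in this
  direction only: \<open>lorentz_weak_norm\<close> goes back with the same bound.\<close>

lemma weak_norm_lorentz:
  assumes "1 < q"
  shows "\<exists>C>0. \<forall>K (g::'a::euclidean_space \<Rightarrow> ennreal). g \<in> borel_measurable borel \<longrightarrow>
    weak_norm lborel q g \<le> K \<longrightarrow> lorentz (1 - 1 / q) (ennreal C * K) g"
proof -
  have r: "2 powr (1 - q) < 1" using assms by (intro powr_less_one) auto
  show ?thesis
  proof (intro exI[of _ "1 + 2 / (1 - 2 powr (1 - q))"] conjI allI impI)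
    show pos: "0 < 1 + 2 / (1 - 2 powr (1 - q))" using r by (intro add_pos_pos divide_pos_pos) auto
    fix K and g :: "'a \<Rightarrow> ennreal" assume g: "g \<in> borel_measurable borel" and K: "weak_norm lborel q g \<le> K"
    show "lorentz (1 - 1 / q) (ennreal (1 + 2 / (1 - 2 powr (1 - q))) * K) g"
    proof (cases K)
      case (real k)
      then show ?thesis
        using lorentz_of_distribution[OF g real(1) assms] K weak_norm_le_iff[of k q lborel g] assms by simp
    next
      case top
      then have "ennreal (1 + 2 / (1 - 2 powr (1 - q))) * K = \<infinity>"
        using pos by (simp only: ennreal_mult_top infinity_ennreal_def) (simp add: ennreal_mult_top)
      then show ?thesis using lorentz_top[OF g] by simp
    qed
  qed
qed

lemma lorentz_weak_norm:
  assumes "1 < q" "lorentz (1 - 1 / q) K g"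
  shows "weak_norm lborel q g \<le> K"
proof (cases K)
  case (real k)
  have "emeasure lborel {x. ennreal a < g x} \<le> ennreal ((k / a) powr q)" if "0 < a" for a
    using lorentz_distribution[of "1 - 1 / q" k g a] assms real that by simp
  then show ?thesis using weak_norm_le_iff[of k q lborel g] real assms by simp
qed auto

text \<open>Superlevel sets are continuous from the right in the level: the set at \<open>l\<close>
  is the increasing union of those at rational levels tending to \<open>l\<close> from above. A
  countable supremum is what makes the norm measurable in a parameter.\<close>

lemma weak_norm_rational:
  assumes [measurable]: "g \<in> borel_measurable M" and "0 < q"
  shows "weak_norm M q g = (SUP l\<in>\<rat> \<inter> {0<..}. ennreal l * ennreal_powr (emeasure M {x \<in> space M. ennreal l < g x}) (1 / q))"
    (is "_ = ?S")
proof (rule antisym)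
  show "weak_norm M q g \<le> ?S"
  proof (cases ?S)
    case (real c)
    have rat: "emeasure M {x \<in> space M. ennreal r < g x} \<le> ennreal ((c / r) powr q)" if "r \<in> \<rat>" "0 < r" for r
      using real that assms(2) SUP_upper[of r "\<rat> \<inter> {0<..}" "\<lambda>l. ennreal l * ennreal_powr (emeasure M {x \<in> space M. ennreal l < g x}) (1 / q)"]
      by (simp add: ennreal_powr_le_iff[symmetric])
    have "emeasure M {x \<in> space M. ennreal l < g x} \<le> ennreal ((c / l) powr q)" if l: "0 < l" for l
    proof -
      have "\<exists>r. r \<in> \<rat> \<and> l < r \<and> r < l + 1 / Suc n" for n
        using Rats_dense_in_real[of l "l + 1 / Suc n"] by auto
      then obtain r where r: "\<And>n. r n \<in> \<rat>" "\<And>n. l < r n" "\<And>n. r n < l + 1 / Suc n" by metis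
      \<comment> \<open>The levels \<open>r n\<close> tend to \<open>l\<close> but need not
        decrease; finite unions produce an increasing sequence, each equal to the superlevel set of
        the smallest level involved.\<close>
      define G where "G n = {x \<in> space M. \<exists>i\<in>{..n}. ennreal (r i) < g x}" for n :: nat
      have [measurable]: "G n \<in> sets M" for n unfolding G_def by measurable
      have G: "emeasure M (G n) \<le> ennreal ((c / l) powr q)" for n
      proof -
        have "Min (r ` {..n}) \<in> r ` {..n}" by (intro Min_in) auto
        then obtain j where j: "Min (r ` {..n}) = r j" "j \<in> {..n}" by (rule imageE)
        have "r j \<le> r i" if "i \<in> {..n}" for i
          unfolding j(1)[symmetric] using that by (intro Min_le) auto
        then have "G n \<subseteq> {x \<in> space M. ennreal (r j) < g x}"
          unfolding G_def by (blast intro: le_less_trans[OF ennreal_leI])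
        then have "emeasure M (G n) \<le> emeasure M {x \<in> space M. ennreal (r j) < g x}"
          by (intro emeasure_mono) auto
        also have "\<dots> \<le> ennreal ((c / r j) powr q)"
          by (intro rat r less_trans[OF l r(2)])
        also have "\<dots> \<le> ennreal ((c / l) powr q)"
          using real l r(2)[of j] assms by (intro ennreal_leI powr_mono2 divide_left_mono) auto
        finally show ?thesis .
      qed
      have "{x \<in> space M. ennreal l < g x} = (\<Union>n. G n)"
      proof (intro equalityI subsetI)
        fix x assume x: "x \<in> {x \<in> space M. ennreal l < g x}"
        then have "ennreal l < g x" by simp
        then obtain y where y: "ennreal l < y" "y < g x" using dense by blast
        then obtain z where z: "y = ennreal z" "0 \<le> z" by (cases y) auto
        then have "l < z" using y l by (simp add: ennreal_less_iff)
        then obtain n where "1 / real (Suc n) < z - l" using nat_approx_posE[of "z - l"] by auto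
        then have "r n \<le> z" using r(3)[of n] by linarith
        then have "ennreal (r n) \<le> y" unfolding z(1) by (rule ennreal_leI)
        then have "ennreal (r n) < g x" using y(2) by (rule le_less_trans)
        then have "x \<in> G n" using x unfolding G_def by blast
        then show "x \<in> (\<Union>n. G n)" by blast
      next
        fix x assume "x \<in> (\<Union>n. G n)"
        then obtain i where i: "ennreal (r i) < g x" "x \<in> space M" unfolding G_def by blast
        have "ennreal l \<le> ennreal (r i)" using r(2)[of i] by (intro ennreal_leI) simp
        then have "ennreal l < g x" using i(1) by (rule le_less_trans)
        then show "x \<in> {x \<in> space M. ennreal l < g x}" using i(2) by blast
      qed
      moreover have "(SUP n. emeasure M (G n)) = emeasure M (\<Union>n. G n)"
      proof (intro SUP_emeasure_incseq)
        show "incseq G"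
          by (rule incseq_SucI) (simp add: G_def, blast intro: le_SucI)
      qed auto
      ultimately have "emeasure M {x \<in> space M. ennreal l < g x} = (SUP n. emeasure M (G n))" by simp
      also have "\<dots> \<le> ennreal ((c / l) powr q)" by (rule SUP_least[OF G])
      finally show ?thesis .
    qed
    then show ?thesis using real assms(2) weak_norm_le_iff[of c q M g] by simp
  next
    case top
    then show ?thesis by (simp only: top_greatest)
  qed
  show "?S \<le> weak_norm M q g" unfolding weak_norm_def by (intro SUP_subset_mono) auto
qed

lemma ennreal_powr_measurable [measurable]: "(\<lambda>x. ennreal_powr x a) \<in> borel_measurable borel"
  unfolding ennreal_powr_def by measurable

text \<open>The frequency norm at time \<open>t\<close> must be measurable in \<open>t\<close>
  before its weak norm in time can be bounded through \<open>lorentz\<close>.\<close>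

lemma weak_norm_measurable:
  fixes g :: "'b \<Rightarrow> 'a::euclidean_space \<Rightarrow> ennreal"
  assumes [measurable]: "(\<lambda>(t,x). g t x) \<in> borel_measurable (N \<Otimes>\<^sub>M borel)" and q: "0 < q"
  shows "(\<lambda>t. weak_norm lborel q (g t)) \<in> borel_measurable N"
proof -
  have [measurable]: "(\<lambda>t. emeasure lborel {x \<in> space lborel. ennreal l < g t x}) \<in> borel_measurable N" for l
  proof -
    have "emeasure lborel {x \<in> space lborel. ennreal l < g t x} = (\<integral>\<^sup>+x. indicator {ennreal l<..} (g t x) \<partial>lborel)"
      if "t \<in> space N" for t
    proof -
      have "g t \<in> borel_measurable borel"
        using measurable_compose[OF measurable_Pair1'[OF that] assms(1)] by simp
      then have "{x \<in> space lborel. ennreal l < g t x} \<in> sets lborel" by measurable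
      then show ?thesis
        using nn_integral_indicator[of "{x \<in> space lborel. ennreal l < g t x}" lborel] by (simp add: indicator_def)
    qed
    moreover have "(\<lambda>t. \<integral>\<^sup>+x. indicator {ennreal l<..} (g t x) \<partial>lborel) \<in> borel_measurable N"
      by measurable
    ultimately show ?thesis by (simp cong: measurable_cong)
  qed
  have "weak_norm lborel q (g t) = (SUP l\<in>\<rat> \<inter> {0<..}. ennreal l * ennreal_powr (emeasure lborel {x \<in> space lborel. ennreal l < g t x}) (1 / q))"
    if "t \<in> space N" for t
    using measurable_compose[OF measurable_Pair1'[OF that] assms(1)] q by (intro weak_norm_rational) simp_all
  moreover have "(\<lambda>t. SUP l\<in>\<rat> \<inter> {0<..}. ennreal l * ennreal_powr (emeasure lborel {x \<in> space lborel. ennreal l < g t x}) (1 / q)) \<in> borel_measurable N"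
    by (intro borel_measurable_SUP) (auto intro: countable_rat countable_subset)
  ultimately show ?thesis by (simp cong: measurable_cong)
qed

text \<open>With y = t x^\<alpha>, the inequality ln z \<le> z - 1 at z = y / a gives exp (- y)
  \<le> a^a y^(- a); a further factor exp (- a) is dropped. The constant is a^a written with
  \<open>exp\<close>.\<close>

lemma exp_powr_le:
  assumes "0 < a" "0 < t" "0 \<le> (x::real)"
  shows "exp (- t * x powr \<alpha>) * x powr k \<le> exp (a * ln a) * t powr (- a) * x powr (k - \<alpha> * a)"
proof (cases "x = 0")
  case False
  then have x: "0 < x" using assms by simp
  define y where "y = t * x powr \<alpha>"
  have y: "0 < y" using x assms by (simp add: y_def)
  have "ln (y / a) \<le> y / a - 1" using y assms by (intro ln_le_minus_one) auto
  then have "a * (ln y - ln a) \<le> a * (y / a - 1)" using y assms by (intro mult_left_mono) (auto simp: ln_div)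
  then have "- y \<le> a * ln a - a * ln y" using assms by (simp add: algebra_simps)
  then have "exp (- y) \<le> exp (a * ln a - a * ln y)" by simp
  also have "\<dots> = exp (a * ln a) * y powr (- a)" using y by (simp add: powr_def exp_diff exp_minus field_simps)
  also have "y powr (- a) = t powr (- a) * x powr (- (\<alpha> * a))"
    using x assms by (simp add: y_def powr_mult powr_powr)
  finally have "exp (- y) * x powr k \<le> exp (a * ln a) * (t powr (- a) * x powr (- (\<alpha> * a))) * x powr k"
    by (intro mult_right_mono) auto
  also have "\<dots> = exp (a * ln a) * t powr (- a) * (x powr (- (\<alpha> * a)) * x powr k)" by (simp only: mult_ac)
  also have "x powr (- (\<alpha> * a)) * x powr k = x powr (k - \<alpha> * a)"
    by (simp flip: powr_add)
  finally show ?thesis by (simp add: y_def)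
qed simp

lemma pd_eqI: "(\<phi> has_derivative D) (at x) \<Longrightarrow> pd i \<phi> x = D (axis i 1)"
  unfolding pd_def by (simp add: frechet_derivative_at[symmetric])

section \<open>Schwartz functions and the Fourier transform\<close>

text \<open>Iterated derivatives stay in any class closed under \<open>pd\<close>, so only single
  derivatives ever need a formula. The classes used below are chosen just large enough to be
  closed.\<close>

lemma schwartz_coinduct:
  assumes "X \<phi>"
    and "\<And>\<phi> x. X \<phi> \<Longrightarrow> \<phi> differentiable (at x)"
    and "\<And>\<phi> N. X \<phi> \<Longrightarrow> \<exists>B. \<forall>x. (1 + norm x) ^ N * norm (\<phi> x) \<le> B"
    and "\<And>\<phi> i. X \<phi> \<Longrightarrow> X (pd i \<phi>)"
  shows "schwartz \<phi>"
proof -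
  have X: "X (pds is \<phi>)" for "is"
    using assms(1,4) by (induction "is") (auto simp: pds_def)
  show ?thesis unfolding schwartz_def
  proof (intro conjI allI)
    show "pds is \<phi> differentiable_on UNIV" for "is"
      using assms(2)[OF X] by (auto simp: differentiable_on_def)
    show "bounded (range (\<lambda>x. (1 + norm x) ^ N *\<^sub>R pds is \<phi> x))" for "is" N
      using assms(3)[OF X, of N "is"] by (auto simp: bounded_iff)
  qed
qed

lemma schwartz_pd: "schwartz \<phi> \<Longrightarrow> schwartz (pd i \<phi>)"
proof -
  have eq: "pds is (pd i \<phi>) = pds (is @ [i]) \<phi>" for "is" by (simp add: pds_def)
  show "schwartz \<phi> \<Longrightarrow> schwartz (pd i \<phi>)"
    unfolding schwartz_def eq by blast
qed

lemma schwartz_differentiable: "schwartz \<phi> \<Longrightarrow> \<phi> differentiable (at x)"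
proof -
  assume "schwartz \<phi>"
  then have "pds [] \<phi> differentiable_on UNIV" unfolding schwartz_def by blast
  then show ?thesis by (simp add: pds_def differentiable_on_def)
qed

lemma schwartz_has_derivative:
  "schwartz \<phi> \<Longrightarrow> (\<phi> has_derivative frechet_derivative \<phi> (at x)) (at x)"
  using schwartz_differentiable frechet_derivative_works by blast

lemma schwartz_bound: "schwartz \<phi> \<Longrightarrow> \<exists>B. \<forall>x. (1 + norm x) ^ N * norm (\<phi> x) \<le> B"
proof -
  assume "schwartz \<phi>"
  then have "bounded (range (\<lambda>x. (1 + norm x) ^ N *\<^sub>R pds [] \<phi> x))" unfolding schwartz_def by blast
  then show ?thesis by (simp add: pds_def bounded_iff abs_mult)
qed

lemma schwartz_continuous: "schwartz \<phi> \<Longrightarrow> continuous_on S \<phi>"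
  by (meson continuous_at_imp_continuous_on differentiable_imp_continuous_within schwartz_differentiable)

lemma schwartz_measurable: "schwartz \<phi> \<Longrightarrow> \<phi> \<in> borel_measurable borel"
  using schwartz_continuous borel_measurable_continuous_onI by blast

lemma schwartz_add:
  assumes "schwartz \<phi>" "schwartz \<psi>"
  shows "schwartz (\<lambda>x. \<phi> x + \<psi> x)"
proof (rule schwartz_coinduct[where X = "\<lambda>\<eta>. \<exists>\<phi> \<psi>. schwartz \<phi> \<and> schwartz \<psi> \<and> \<eta> = (\<lambda>x. \<phi> x + \<psi> x)"])
  fix \<eta> :: "real^'a \<Rightarrow> complex" and i :: 'a and N :: nat and x
  assume "\<exists>\<phi> \<psi>. schwartz \<phi> \<and> schwartz \<psi> \<and> \<eta> = (\<lambda>x. \<phi> x + \<psi> x)"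
  then obtain \<phi> \<psi> where *: "schwartz \<phi>" "schwartz \<psi>" "\<eta> = (\<lambda>x. \<phi> x + \<psi> x)" by blast
  show "\<eta> differentiable at x"
    unfolding * using * by (intro differentiable_add schwartz_differentiable)
  obtain B where B: "\<And>x. (1 + norm x) ^ N * norm (\<phi> x) \<le> B" using schwartz_bound *(1) by blast
  obtain C where C: "\<And>x. (1 + norm x) ^ N * norm (\<psi> x) \<le> C" using schwartz_bound *(2) by blast
  have "(1 + norm x) ^ N * norm (\<eta> x) \<le> B + C" for x
  proof -
    have "(1 + norm x) ^ N * norm (\<eta> x) \<le> (1 + norm x) ^ N * (norm (\<phi> x) + norm (\<psi> x))"
      unfolding * by (intro mult_left_mono norm_triangle_ineq) auto
    also have "\<dots> \<le> B + C" unfolding distrib_left by (intro add_mono B C)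
    finally show ?thesis .
  qed
  then show "\<exists>B. \<forall>x. (1 + norm x) ^ N * norm (\<eta> x) \<le> B" by blast
  have "pd i \<eta> = (\<lambda>x. pd i \<phi> x + pd i \<psi> x)"
  proof
    fix x
    show "pd i \<eta> x = pd i \<phi> x + pd i \<psi> x"
      unfolding * using pd_eqI[OF has_derivative_add[OF schwartz_has_derivative[OF *(1)] schwartz_has_derivative[OF *(2)]]]
      by (simp add: pd_def)
  qed
  then show "\<exists>\<phi> \<psi>. schwartz \<phi> \<and> schwartz \<psi> \<and> pd i \<eta> = (\<lambda>x. \<phi> x + \<psi> x)"
    using * schwartz_pd by blast
qed (use assms in blast)

text \<open>Real linearity is enough, so that one argument covers both scalar multiples and complex
  conjugation.\<close>

lemma schwartz_bounded_linear:
  assumes L: "bounded_linear L" and "schwartz \<phi>"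
  shows "schwartz (\<lambda>x. L (\<phi> x))"
proof (rule schwartz_coinduct[where X = "\<lambda>\<eta>. \<exists>\<phi>. schwartz \<phi> \<and> \<eta> = (\<lambda>x. L (\<phi> x))"])
  fix \<eta> :: "real^'a \<Rightarrow> complex" and i :: 'a and N :: nat and x
  assume "\<exists>\<phi>. schwartz \<phi> \<and> \<eta> = (\<lambda>x. L (\<phi> x))"
  then obtain \<phi> where *: "schwartz \<phi>" "\<eta> = (\<lambda>x. L (\<phi> x))" by blast
  note der = bounded_linear.has_derivative[OF L schwartz_has_derivative[OF *(1)]]
  show "\<eta> differentiable at x" unfolding * using der by (auto simp: differentiable_def)
  obtain B where B: "\<And>x. (1 + norm x) ^ N * norm (\<phi> x) \<le> B" using schwartz_bound *(1) by blast
  obtain K where K: "0 \<le> K" "\<And>y. norm (L y) \<le> norm y * K" using bounded_linear.nonneg_bounded[OF L] by blast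
  have "(1 + norm x) ^ N * norm (\<eta> x) \<le> B * K" for x
  proof -
    have "(1 + norm x) ^ N * norm (\<eta> x) \<le> (1 + norm x) ^ N * (norm (\<phi> x) * K)"
      unfolding * by (intro mult_left_mono K) auto
    also have "\<dots> \<le> B * K" unfolding mult.assoc[symmetric] by (intro mult_right_mono B K)
    finally show ?thesis .
  qed
  then show "\<exists>B. \<forall>x. (1 + norm x) ^ N * norm (\<eta> x) \<le> B" by blast
  have "pd i \<eta> = (\<lambda>x. L (pd i \<phi> x))"
    unfolding * using pd_eqI[OF der] by (auto simp: pd_def fun_eq_iff)
  then show "\<exists>\<phi>. schwartz \<phi> \<and> pd i \<eta> = (\<lambda>x. L (\<phi> x))"
    using * schwartz_pd by blast
qed (use assms in blast)

lemma schwartz_cmult: "schwartz \<phi> \<Longrightarrow> schwartz (\<lambda>x. c * \<phi> x)"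
  by (rule schwartz_bounded_linear[OF bounded_linear_mult_right])

lemma schwartz_cnj: "schwartz \<phi> \<Longrightarrow> schwartz (\<lambda>x. cnj (\<phi> x))"
  by (rule schwartz_bounded_linear[OF bounded_linear_cnj])

lemma schwartz_uminus_arg:
  assumes "schwartz \<phi>"
  shows "schwartz (\<lambda>x. \<phi> (- x))"
proof (rule schwartz_coinduct[where X = "\<lambda>\<eta>. \<exists>\<phi>. schwartz \<phi> \<and> \<eta> = (\<lambda>x. \<phi> (- x))"])
  fix \<eta> :: "real^'a \<Rightarrow> complex" and i :: 'a and N :: nat and x
  assume "\<exists>\<phi>. schwartz \<phi> \<and> \<eta> = (\<lambda>x. \<phi> (- x))"
  then obtain \<phi> where *: "schwartz \<phi>" "\<eta> = (\<lambda>x. \<phi> (- x))" by blast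
  have der: "(\<eta> has_derivative (\<lambda>h. frechet_derivative \<phi> (at (- x)) (- h))) (at x)" for x
    unfolding * by (rule has_derivative_compose[of uminus uminus x UNIV \<phi>])
      (auto intro!: derivative_eq_intros schwartz_has_derivative *)
  show "\<eta> differentiable at x" using der by (auto simp: differentiable_def)
  obtain B where B: "\<And>x. (1 + norm x) ^ N * norm (\<phi> x) \<le> B" using schwartz_bound *(1) by blast
  have "(1 + norm x) ^ N * norm (\<eta> x) \<le> B" for x using B[of "- x"] * by simp
  then show "\<exists>B. \<forall>x. (1 + norm x) ^ N * norm (\<eta> x) \<le> B" by blast
  have lin: "frechet_derivative \<phi> (at y) (- h) = - frechet_derivative \<phi> (at y) h" for y h
    using schwartz_has_derivative[OF *(1), of y] linear_neg has_derivative_linear by blast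
  have "pd i \<eta> = (\<lambda>x. - 1 * pd i \<phi> (- x))"
    using pd_eqI[OF der] lin by (auto simp: pd_def fun_eq_iff)
  then show "\<exists>\<phi>. schwartz \<phi> \<and> pd i \<eta> = (\<lambda>x. \<phi> (- x))"
    using schwartz_cmult[OF schwartz_pd[OF *(1)], of "-1"] by blast
qed (use assms in blast)

lemma schwartz_coord:
  fixes \<phi> :: "real^'n::finite \<Rightarrow> complex"
  assumes "schwartz \<phi>"
  shows "schwartz (\<lambda>x. of_real (x $ k) * \<phi> x)"
\<comment> \<open>Differentiating the coordinate in the product leaves a multiple of the function
  without it; the extra summand \<open>\<psi>\<close> keeps the class closed.\<close>
proof (rule schwartz_coinduct[where X = "\<lambda>\<eta>. \<exists>\<phi> \<psi>. schwartz \<phi> \<and> schwartz \<psi> \<and> \<eta> = (\<lambda>x. of_real (x $ k) * \<phi> x + \<psi> x)"])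
  have "schwartz (\<lambda>x::real^'n. 0 * \<phi> x)" by (rule schwartz_cmult[OF assms])
  then show "\<exists>\<phi>' \<psi>. schwartz \<phi>' \<and> schwartz \<psi> \<and> (\<lambda>x. of_real (x $ k) * \<phi> x) = (\<lambda>x. of_real (x $ k) * \<phi>' x + \<psi> x)"
    using assms by (intro exI[of _ \<phi>] exI[of _ "\<lambda>x. 0"]) simp
next
  fix \<eta> :: "real^'n \<Rightarrow> complex" and i :: 'n and N :: nat and x
  assume "\<exists>\<phi> \<psi>. schwartz \<phi> \<and> schwartz \<psi> \<and> \<eta> = (\<lambda>x. of_real (x $ k) * \<phi> x + \<psi> x)"
  then obtain \<phi> \<psi> where *: "schwartz \<phi>" "schwartz \<psi>" "\<eta> = (\<lambda>x. of_real (x $ k) * \<phi> x + \<psi> x)" by blast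
  have coord: "((\<lambda>x. complex_of_real (x $ k)) has_derivative (\<lambda>h. of_real (h $ k))) (at x)" for x :: "real^'n"
    by (intro bounded_linear_imp_has_derivative bounded_linear_compose[OF bounded_linear_of_real] bounded_linear_vec_nth)
  note der = has_derivative_add[OF has_derivative_mult[OF coord schwartz_has_derivative[OF *(1)]] schwartz_has_derivative[OF *(2)]]
  show "\<eta> differentiable at x" unfolding * using der[of x] by (auto simp: differentiable_def)
  obtain B where B: "\<And>x. (1 + norm x) ^ Suc N * norm (\<phi> x) \<le> B" using schwartz_bound *(1) by blast
  obtain C where C: "\<And>x. (1 + norm x) ^ N * norm (\<psi> x) \<le> C" using schwartz_bound *(2) by blast
  have "(1 + norm x) ^ N * norm (\<eta> x) \<le> B + C" for x
  proof -
    have "norm (\<eta> x) \<le> (1 + norm x) * norm (\<phi> x) + norm (\<psi> x)"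
      unfolding * using component_le_norm_cart[of x k]
      by (intro order_trans[OF norm_triangle_ineq] add_mono) (auto simp: norm_mult intro!: mult_right_mono)
    then have "(1 + norm x) ^ N * norm (\<eta> x) \<le> (1 + norm x) ^ N * ((1 + norm x) * norm (\<phi> x) + norm (\<psi> x))"
      by (intro mult_left_mono) auto
    also have "\<dots> = (1 + norm x) ^ Suc N * norm (\<phi> x) + (1 + norm x) ^ N * norm (\<psi> x)"
      by (simp add: algebra_simps)
    also have "\<dots> \<le> B + C" by (intro add_mono B C)
    finally show ?thesis .
  qed
  then show "\<exists>B. \<forall>x. (1 + norm x) ^ N * norm (\<eta> x) \<le> B" by blast
  define c :: complex where "c = of_real ((axis i (1::real)) $ k)"
  have "pd i \<eta> x = of_real (x $ k) * pd i \<phi> x + (c * \<phi> x + pd i \<psi> x)" for x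
    unfolding * using pd_eqI[OF der, of i x] by (simp add: pd_def c_def)
  then show "\<exists>\<phi> \<psi>. schwartz \<phi> \<and> schwartz \<psi> \<and> pd i \<eta> = (\<lambda>x. of_real (x $ k) * \<phi> x + \<psi> x)"
    using schwartz_pd[OF *(1)] schwartz_add[OF schwartz_cmult[OF *(1)] schwartz_pd[OF *(2)]] by blast
qed

text \<open>A supremum of reals is meaningful only when bounded: there are finitely many lists of
  length at most \<open>N\<close>, and each contributes a bounded function.\<close>

lemma schwartz_seminorm_upper:
  fixes \<phi> :: "real^'n::finite \<Rightarrow> complex"
  assumes "schwartz \<phi>" "length is \<le> N"
  shows "(1 + norm x) ^ N * norm (pds is \<phi> x) \<le> schwartz_seminorm N \<phi>"
proof -
  have "\<exists>B. \<forall>x. (1 + norm x) ^ N * norm (pds is \<phi> x) \<le> B" for "is"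
  proof -
    have "bounded (range (\<lambda>x. (1 + norm x) ^ N *\<^sub>R pds is \<phi> x))" using assms unfolding schwartz_def by blast
    then show ?thesis by (simp add: bounded_iff abs_mult)
  qed
  then obtain B where B: "\<And>is x. (1 + norm x) ^ N * norm (pds is \<phi> x) \<le> B is" by metis
  let ?L = "{is :: 'n list. length is \<le> N}"
  have fin: "finite ?L" using finite_lists_length_le[of "UNIV :: 'n set" N] by simp
  have nn: "0 \<le> B is" for "is" by (rule order_trans[OF _ B[of 0]]) simp
  have "(case p of (is, x) \<Rightarrow> (1 + norm x) ^ N * norm (pds is \<phi> x)) \<le> sum B ?L"
    if "p \<in> ?L \<times> UNIV" for p
  proof (cases p)
    case (Pair js y)
    then have "B js \<le> sum B ?L" using that fin nn by (intro member_le_sum) auto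
    then show ?thesis using Pair B[of y js] by simp
  qed
  then have "bdd_above ((\<lambda>(is, x). (1 + norm x) ^ N * norm (pds is \<phi> x)) ` (?L \<times> UNIV))"
    by (intro bdd_aboveI2)
  then have "(case (is, x) of (is, x) \<Rightarrow> (1 + norm x) ^ N * norm (pds is \<phi> x)) \<le> schwartz_seminorm N \<phi>"
    unfolding schwartz_seminorm_def using assms by (intro cSUP_upper) auto
  then show ?thesis by simp
qed

lemma schwartz_seminorm_pointwise:
  assumes "schwartz \<phi>" "M \<le> N"
  shows "(1 + norm x) ^ M * norm (\<phi> x) \<le> schwartz_seminorm N \<phi>"
proof -
  have "(1 + norm x) ^ M * norm (\<phi> x) \<le> (1 + norm x) ^ N * norm (\<phi> x)"
    using assms by (intro mult_right_mono power_increasing) auto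
  also have "\<dots> \<le> schwartz_seminorm N \<phi>"
    using schwartz_seminorm_upper[OF assms(1), of "[]" N x] by (simp add: pds_def)
  finally show ?thesis .
qed

lemma schwartz_seminorm_nonneg: "schwartz \<phi> \<Longrightarrow> 0 \<le> schwartz_seminorm N \<phi>"
  using order_trans[OF norm_ge_zero[of "\<phi> 0"], of "schwartz_seminorm N \<phi>"]
    schwartz_seminorm_pointwise[of \<phi> 0 N 0] by simp

lemma schwartz_seminorm_least:
  assumes "\<And>is x. length is \<le> N \<Longrightarrow> (1 + norm x) ^ N * norm (pds is \<phi> x) \<le> B"
  shows "schwartz_seminorm N \<phi> \<le> B"
  unfolding schwartz_seminorm_def using assms by (intro cSUP_least) (auto intro: exI[of _ "[]"])

lemma schwartz_seminorm_mono:
  assumes "schwartz \<phi>" "M \<le> N"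
  shows "schwartz_seminorm M \<phi> \<le> schwartz_seminorm N \<phi>"
proof (rule schwartz_seminorm_least)
  fix "is" :: "'a list" and x :: "real^'a" assume "length is \<le> M"
  have "(1 + norm x) ^ M * norm (pds is \<phi> x) \<le> (1 + norm x) ^ N * norm (pds is \<phi> x)"
    using assms by (intro mult_right_mono power_increasing) auto
  also have "\<dots> \<le> schwartz_seminorm N \<phi>"
    using assms \<open>length is \<le> M\<close> by (intro schwartz_seminorm_upper) auto
  finally show "(1 + norm x) ^ M * norm (pds is \<phi> x) \<le> schwartz_seminorm N \<phi>" .
qed

lemma schwartz_seminorm_pd:
  assumes "schwartz \<phi>"
  shows "schwartz_seminorm N (pd i \<phi>) \<le> schwartz_seminorm (Suc N) \<phi>"
proof (rule schwartz_seminorm_least)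
  fix "is" :: "'a list" and x :: "real^'a" assume len: "length is \<le> N"
  have "(1 + norm x) ^ N * norm (pds is (pd i \<phi>) x) \<le> (1 + norm x) ^ Suc N * norm (pds (is @ [i]) \<phi> x)"
    by (intro mult_mono power_increasing) (auto simp: pds_def)
  also have "\<dots> \<le> schwartz_seminorm (Suc N) \<phi>"
    using assms len by (intro schwartz_seminorm_upper) auto
  finally show "(1 + norm x) ^ N * norm (pds is (pd i \<phi>) x) \<le> schwartz_seminorm (Suc N) \<phi>" .
qed

section \<open>The Fourier transform on Schwartz functions\<close>

lemma nn_integral_decay_finite:
  "\<exists>C>0. (\<integral>\<^sup>+x. ennreal (1 / (1 + norm (x::'a::euclidean_space)) ^ Suc DIM('a)) \<partial>lborel) \<le> ennreal C"
proof -
  obtain C where C: "0 < C" "\<And>K (G::'a \<Rightarrow> ennreal). lorentz 1 K G \<Longrightarrow>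
      (\<integral>\<^sup>+x. G x * ennreal (decay (Suc DIM('a)) x) \<partial>lborel) \<le> ennreal C * K"
    using lorentz_decay_integral[of 1, where 'a = 'a] by auto
  show ?thesis using C(1) C(2)[OF lorentz_one] by (intro exI[of _ C]) (simp add: decay_def)
qed

lemma schwartz_nn_integral:
  "\<exists>C>0. \<forall>\<phi>::real^'n::finite \<Rightarrow> complex. schwartz \<phi> \<longrightarrow>
    (\<integral>\<^sup>+x. ennreal (norm (\<phi> x)) \<partial>lborel) \<le> ennreal (C * schwartz_seminorm (Suc CARD('n)) \<phi>)"
proof -
  obtain C where C: "0 < C" "(\<integral>\<^sup>+x. ennreal (1 / (1 + norm (x::real^'n)) ^ Suc CARD('n)) \<partial>lborel) \<le> ennreal C"
    using nn_integral_decay_finite[where 'a = "real^'n"] by auto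
  show ?thesis
  proof (intro exI[of _ C] conjI allI impI)
    fix \<phi> :: "real^'n \<Rightarrow> complex" assume \<phi>: "schwartz \<phi>"
    let ?S = "schwartz_seminorm (Suc CARD('n)) \<phi>"
    have "(\<integral>\<^sup>+x. ennreal (norm (\<phi> x)) \<partial>lborel) \<le> (\<integral>\<^sup>+x. ennreal ?S * ennreal (1 / (1 + norm (x::real^'n)) ^ Suc CARD('n)) \<partial>lborel)"
    proof (rule nn_integral_mono)
      fix x :: "real^'n"
      have pos: "0 < (1 + norm x) ^ Suc CARD('n)" by (simp add: add_pos_nonneg)
      have "norm (\<phi> x) \<le> ?S * (1 / (1 + norm x) ^ Suc CARD('n))"
        using schwartz_seminorm_pointwise[OF \<phi> order_refl, of x "Suc CARD('n)"] pos by (simp add: field_simps del: power_Suc)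
      then show "ennreal (norm (\<phi> x)) \<le> ennreal ?S * ennreal (1 / (1 + norm x) ^ Suc CARD('n))"
        using schwartz_seminorm_nonneg[OF \<phi>] pos by (subst ennreal_mult[symmetric]) (auto intro: ennreal_leI simp del: power_Suc)
    qed
    also have "\<dots> = ennreal ?S * (\<integral>\<^sup>+x. ennreal (1 / (1 + norm (x::real^'n)) ^ Suc CARD('n)) \<partial>lborel)"
      by (rule nn_integral_cmult) measurable
    also have "\<dots> \<le> ennreal ?S * ennreal C" by (intro mult_left_mono C) simp
    finally show "(\<integral>\<^sup>+x. ennreal (norm (\<phi> x)) \<partial>lborel) \<le> ennreal (C * ?S)"
      using C schwartz_seminorm_nonneg[OF \<phi>] by (simp add: ennreal_mult mult.commute)
  qed (rule C)
qed

lemma schwartz_integrable: "schwartz \<phi> \<Longrightarrow> integrable lborel \<phi>"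
proof -
  assume \<phi>: "schwartz \<phi>"
  obtain C where "\<And>\<phi>::real^'a \<Rightarrow> complex. schwartz \<phi> \<Longrightarrow>
    (\<integral>\<^sup>+x. ennreal (norm (\<phi> x)) \<partial>lborel) \<le> ennreal (C * schwartz_seminorm (Suc CARD('a)) \<phi>)"
    using schwartz_nn_integral by blast
  from this[OF \<phi>] show ?thesis
    using schwartz_measurable[OF \<phi>] by (intro integrableI_bounded) (auto intro: le_less_trans)
qed

lemma cis_schwartz_integrable: "schwartz \<phi> \<Longrightarrow> integrable lborel (\<lambda>x. cis (f x) * \<phi> x)"
  if "f \<in> borel_measurable borel"
proof -
  assume \<phi>: "schwartz \<phi>"
  have f: "f \<in> borel_measurable lborel" using that by simp
  note [measurable] = schwartz_measurable[OF \<phi>]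
  have "(\<lambda>x. cis (f x)) \<in> borel_measurable lborel"
    by (rule measurable_compose[OF f borel_measurable_continuous_onI]) (intro continuous_intros)
  then show ?thesis
    by (intro Bochner_Integration.integrable_bound[OF schwartz_integrable[OF \<phi>]]) (auto simp: norm_mult)
qed

lemma fourier_integrable: "schwartz \<phi> \<Longrightarrow> integrable lborel (\<lambda>x. cis (- (x \<bullet> \<xi>)) * \<phi> x)"
  by (rule cis_schwartz_integrable) measurable

lemma fourier_add:
  assumes "schwartz \<phi>" "schwartz \<psi>"
  shows "fourier (\<lambda>x. a * \<phi> x + b * \<psi> x) \<xi> = a * fourier \<phi> \<xi> + b * fourier \<psi> \<xi>"
proof -
  have "fourier (\<lambda>x. a * \<phi> x + b * \<psi> x) \<xi>
      = (LINT x|lborel. a * (cis (- (x \<bullet> \<xi>)) * \<phi> x) + b * (cis (- (x \<bullet> \<xi>)) * \<psi> x))"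
    unfolding fourier_def by (intro Bochner_Integration.integral_cong) (auto simp: algebra_simps)
  then show ?thesis
    using fourier_integrable[OF assms(1), of \<xi>] fourier_integrable[OF assms(2), of \<xi>]
    by (simp add: fourier_def)
qed

lemma fourier_bound:
  "\<exists>C>0. \<forall>\<phi>::real^'n::finite \<Rightarrow> complex. schwartz \<phi> \<longrightarrow>
    (\<forall>\<xi>. norm (fourier \<phi> \<xi>) \<le> C * schwartz_seminorm (Suc CARD('n)) \<phi>)"
proof -
  obtain C where C: "0 < C" "\<And>\<phi>::real^'n \<Rightarrow> complex. schwartz \<phi> \<Longrightarrow>
    (\<integral>\<^sup>+x. ennreal (norm (\<phi> x)) \<partial>lborel) \<le> ennreal (C * schwartz_seminorm (Suc CARD('n)) \<phi>)"
    using schwartz_nn_integral by blast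
  show ?thesis
  proof (intro exI[of _ C] conjI allI impI)
    fix \<phi> :: "real^'n \<Rightarrow> complex" and \<xi> assume \<phi>: "schwartz \<phi>"
    have "ennreal (norm (fourier \<phi> \<xi>)) \<le> (\<integral>\<^sup>+x. ennreal (norm (cis (- (x \<bullet> \<xi>)) * \<phi> x)) \<partial>lborel)"
      unfolding fourier_def by (rule integral_norm_bound_ennreal[OF fourier_integrable[OF \<phi>]])
    also have "\<dots> \<le> ennreal (C * schwartz_seminorm (Suc CARD('n)) \<phi>)"
      using C(2)[OF \<phi>] by (simp add: norm_mult)
    finally show "norm (fourier \<phi> \<xi>) \<le> C * schwartz_seminorm (Suc CARD('n)) \<phi>"
      using C schwartz_seminorm_nonneg[OF \<phi>] by simp
  qed (rule C)
qed

text \<open>Difference quotients along the steps 1 / (n + 1) form a sequence, to which dominated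
  convergence applies.\<close>

lemma has_vector_derivative_sequentially:
  fixes F :: "real \<Rightarrow> 'a::real_normed_vector"
  assumes "(F has_vector_derivative D) (at x)"
  shows "(\<lambda>n. real (Suc n) *\<^sub>R (F (x + 1 / Suc n) - F x)) \<longlonglongrightarrow> D"
proof -
  have "((\<lambda>h. norm (F (x + h) - F x - h *\<^sub>R D) / norm h) \<longlongrightarrow> 0) (at 0)"
    using assms unfolding has_vector_derivative_def has_derivative_at by simp
  moreover have "filterlim (\<lambda>n. 1 / real (Suc n)) (at 0) sequentially"
    unfolding filterlim_at using LIMSEQ_Suc[OF lim_1_over_n] by auto
  ultimately have "(\<lambda>n. norm (F (x + 1 / Suc n) - F x - (1 / Suc n) *\<^sub>R D) / norm (1 / real (Suc n))) \<longlonglongrightarrow> 0"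
    by (rule filterlim_compose)
  moreover have "norm (F (x + 1 / Suc n) - F x - (1 / Suc n) *\<^sub>R D) / norm (1 / real (Suc n))
      = norm (real (Suc n) *\<^sub>R (F (x + 1 / Suc n) - F x) - D)" for n
  proof -
    have "real (Suc n) *\<^sub>R (F (x + 1 / Suc n) - F x) - D = real (Suc n) *\<^sub>R (F (x + 1 / Suc n) - F x - (1 / Suc n) *\<^sub>R D)"
      by (simp add: scaleR_diff_right del: of_nat_Suc)
    then show ?thesis by (simp del: of_nat_Suc)
  qed
  ultimately have "(\<lambda>n. norm (real (Suc n) *\<^sub>R (F (x + 1 / Suc n) - F x) - D)) \<longlonglongrightarrow> 0" by simp
  then show ?thesis by (metis LIM_zero_iff tendsto_norm_zero_iff)
qed

lemma integral_lborel_shift: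
  fixes h :: "'a::euclidean_space \<Rightarrow> 'b::{banach,second_countable_topology}"
  assumes [measurable]: "h \<in> borel_measurable borel"
  shows "(LINT x|lborel. h (c + x)) = (LINT x|lborel. h x)"
proof -
  have "(LINT x|lborel. h x) = (LINT x|distr lborel borel ((+) c). h x)"
    by (simp add: lborel_distr_plus)
  also have "\<dots> = (LINT x|lborel. h (c + x))"
    by (subst integral_distr) auto
  finally show ?thesis by simp
qed

lemma integrable_lborel_shift:
  fixes h :: "'a::euclidean_space \<Rightarrow> 'b::{banach,second_countable_topology}"
  assumes "integrable lborel h"
  shows "integrable lborel (\<lambda>x. h (c + x))"
  by (rule integrable_distr[of "(+) c" lborel borel]) (use assms in \<open>simp_all add: lborel_distr_plus\<close>)

lemma schwartz_line_derivative:
  assumes "schwartz \<phi>"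
  shows "((\<lambda>t. \<phi> (x + t *\<^sub>R axis j 1)) has_vector_derivative pd j \<phi> (x + t *\<^sub>R axis j 1)) (at t)"
proof -
  have "((\<lambda>t. \<phi> (x + t *\<^sub>R axis j 1)) has_derivative
      (\<lambda>h. frechet_derivative \<phi> (at (x + t *\<^sub>R axis j 1)) (h *\<^sub>R axis j 1))) (at t)"
    by (rule has_derivative_compose[of "\<lambda>t. x + t *\<^sub>R axis j 1" "\<lambda>h. h *\<^sub>R axis j 1" t UNIV \<phi>])
      (auto intro!: derivative_eq_intros schwartz_has_derivative assms)
  moreover have "frechet_derivative \<phi> (at y) (h *\<^sub>R axis j 1) = h *\<^sub>R pd j \<phi> y" for y h
    unfolding pd_def using schwartz_has_derivative[OF assms, of y] linear_cmul has_derivative_linear by blast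
  ultimately show ?thesis by (simp add: has_vector_derivative_def)
qed

text \<open>Instead of integrating by parts, the derivative is replaced by difference quotients.
  Translating \<phi> multiplies its transform by a phase, so the transforms of the quotients are
  quotients of the phase, and both sides are limits of the same sequence.\<close>

lemma fourier_pd:
  fixes \<phi> :: "real^'n::finite \<Rightarrow> complex"
  assumes \<phi>: "schwartz \<phi>"
  shows "fourier (pd j \<phi>) \<xi> = \<i> * of_real (\<xi> $ j) * fourier \<phi> \<xi>"
proof -
  note [measurable] = schwartz_measurable[OF \<phi>] schwartz_measurable[OF schwartz_pd[OF \<phi>]]
  let ?e = "axis j (1::real) :: real^'n"
  define q where "q n x = real (Suc n) *\<^sub>R (\<phi> (x + (1 / Suc n) *\<^sub>R ?e) - \<phi> x)" for n x
  let ?N = "Suc CARD('n)"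
  obtain B where B: "\<And>x. (1 + norm x) ^ ?N * norm (pd j \<phi> x) \<le> B" using schwartz_bound[OF schwartz_pd[OF \<phi>]] by blast
  have B0: "0 \<le> B" by (rule order_trans[OF _ B[of 0]]) simp
  obtain C where C: "0 < C" "(\<integral>\<^sup>+x. ennreal (1 / (1 + norm (x::real^'n)) ^ ?N) \<partial>lborel) \<le> ennreal C"
    using nn_integral_decay_finite[where 'a = "real^'n"] by auto
  \<comment> \<open>Mean value inequality on a segment of length at most 1; along it the weight
    \<open>1 + norm x\<close> changes by a factor of at most 2, whence the power
    \<open>2 ^ ?N\<close>.\<close>
  have dom: "norm (q n x) \<le> B * 2 ^ ?N * (1 / (1 + norm x) ^ ?N)" for n x
  proof -
    define K where "K = B * 2 ^ ?N / (1 + norm x) ^ ?N"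
    have pdb: "norm (pd j \<phi> (x + t *\<^sub>R ?e)) \<le> K" if "0 < t" "t < 1 / Suc n" for t
    proof -
      have "1 / real (Suc n) \<le> 1" by simp
      with that have t: "0 < t" "t < 1" by linarith+
      have "norm x \<le> norm (x + t *\<^sub>R ?e) + norm (t *\<^sub>R ?e)" by (metis add_diff_cancel norm_triangle_ineq4)
      then have "norm x \<le> norm (x + t *\<^sub>R ?e) + t" using t by (simp add: norm_axis_1)
      moreover have "1 + a \<le> 2 * (1 + b)" if "a \<le> b + t" "0 \<le> b" for a b :: real
        using that t by simp
      ultimately have "1 + norm x \<le> 2 * (1 + norm (x + t *\<^sub>R ?e))" by simp
      then have "(1 + norm x) ^ ?N \<le> (2 * (1 + norm (x + t *\<^sub>R ?e))) ^ ?N" by (intro power_mono) auto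
      then have "(1 + norm x) ^ ?N * norm (pd j \<phi> (x + t *\<^sub>R ?e))
          \<le> 2 ^ ?N * ((1 + norm (x + t *\<^sub>R ?e)) ^ ?N * norm (pd j \<phi> (x + t *\<^sub>R ?e)))"
        unfolding power_mult_distrib mult.assoc[symmetric] by (intro mult_right_mono) auto
      also have "\<dots> \<le> 2 ^ ?N * B" by (intro mult_left_mono B) auto
      finally have le: "(1 + norm x) ^ ?N * norm (pd j \<phi> (x + t *\<^sub>R ?e)) \<le> 2 ^ ?N * B" .
      have "0 < (1 + norm x) ^ ?N" by (intro zero_less_power) (simp add: add_pos_nonneg)
      then show ?thesis using le unfolding K_def by (simp only: pos_le_divide_eq mult.commute)
    qed
    have "norm (\<phi> (x + (1 / Suc n) *\<^sub>R ?e) - \<phi> (x + 0 *\<^sub>R ?e)) \<le> K * (1 / Suc n) - K * 0"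
    proof (rule differentiable_bound_general)
      show "continuous_on {0..1 / real (Suc n)} (\<lambda>t. \<phi> (x + t *\<^sub>R ?e))"
        by (intro continuous_on_compose2[OF schwartz_continuous[OF \<phi>, of UNIV]] continuous_intros) auto
      show "((\<lambda>t. \<phi> (x + t *\<^sub>R ?e)) has_vector_derivative pd j \<phi> (x + t *\<^sub>R ?e)) (at t)" for t
        by (rule schwartz_line_derivative[OF \<phi>])
      show "((*) K has_vector_derivative K) (at t)" for t
        by (auto intro!: derivative_eq_intros)
      show "continuous_on {0..1 / real (Suc n)} ((*) K)" by (intro continuous_intros)
    qed (use pdb in auto)
    moreover have "norm (q n x) = real (Suc n) * norm (\<phi> (x + (1 / Suc n) *\<^sub>R ?e) - \<phi> x)"
      by (simp add: q_def del: of_nat_Suc)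
    moreover have "0 < real (Suc n)" by simp
    ultimately have "norm (q n x) \<le> K" by (simp add: pos_le_divide_eq mult.commute del: of_nat_Suc)
    then show ?thesis by (simp add: K_def)
  qed
  have lim: "(\<lambda>n. q n x) \<longlonglongrightarrow> pd j \<phi> x" for x
    using has_vector_derivative_sequentially[OF schwartz_line_derivative[OF \<phi>, of x j 0]] by (simp add: q_def)
  have "(\<lambda>n. LINT x|lborel. cis (- (x \<bullet> \<xi>)) * q n x) \<longlonglongrightarrow> (LINT x|lborel. cis (- (x \<bullet> \<xi>)) * pd j \<phi> x)"
  proof (rule integral_dominated_convergence)
    have [measurable]: "(\<lambda>x::real^'n. cis (- (x \<bullet> \<xi>))) \<in> borel_measurable borel"
      by (intro borel_measurable_continuous_onI continuous_intros)
    show "(\<lambda>x. cis (- (x \<bullet> \<xi>)) * pd j \<phi> x) \<in> borel_measurable lborel" by measurable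
    show "(\<lambda>x. cis (- (x \<bullet> \<xi>)) * q n x) \<in> borel_measurable lborel" for n unfolding q_def by measurable
    have "integrable lborel (\<lambda>x::real^'n. 1 / (1 + norm x) ^ ?N)"
      using C by (intro integrableI_bounded) (auto intro: le_less_trans simp del: power_Suc)
    then show "integrable lborel (\<lambda>x::real^'n. B * 2 ^ ?N * (1 / (1 + norm x) ^ ?N))"
      by (rule integrable_mult_right)
    show "AE x in lborel. (\<lambda>n. cis (- (x \<bullet> \<xi>)) * q n x) \<longlonglongrightarrow> cis (- (x \<bullet> \<xi>)) * pd j \<phi> x"
      by (intro AE_I2 tendsto_intros lim)
    show "AE x in lborel. norm (cis (- (x \<bullet> \<xi>)) * q n x) \<le> B * 2 ^ ?N * (1 / (1 + norm x) ^ ?N)" for n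
      using dom by (simp add: norm_mult del: power_Suc)
  qed
  moreover have "(LINT x|lborel. cis (- (x \<bullet> \<xi>)) * q n x)
      = (real (Suc n) *\<^sub>R (cis ((0 + 1 / Suc n) * (\<xi> $ j)) - cis (0 * (\<xi> $ j)))) * fourier \<phi> \<xi>" for n
  proof -
    let ?h = "(1 / real (Suc n)) *\<^sub>R ?e"
    \<comment> \<open>The phase is evaluated at the point shifted back, so that translating
      \<open>H\<close> by \<open>?h\<close> gives the shifted part of the quotient while the
      integral of \<open>H\<close> is a phase times the transform of \<phi>.\<close>
    define H where "H y = cis (- ((y - ?h) \<bullet> \<xi>)) * \<phi> y" for y
    have H: "H y = cis (?h \<bullet> \<xi>) * (cis (- (y \<bullet> \<xi>)) * \<phi> y)" for y
      by (simp add: H_def cis_mult inner_diff_left)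
    have Hi: "integrable lborel H" unfolding H by (intro integrable_mult_right fourier_integrable[OF \<phi>])
    then have [measurable]: "H \<in> borel_measurable borel" by simp
    have H': "cis (- (x \<bullet> \<xi>)) * \<phi> (x + ?h) = H (?h + x)" for x
      by (simp add: H_def add.commute)
    have "(LINT x|lborel. H (?h + x)) = (LINT y|lborel. H y)"
      by (rule integral_lborel_shift) simp
    also have "\<dots> = (LINT y|lborel. cis (?h \<bullet> \<xi>) * (cis (- (y \<bullet> \<xi>)) * \<phi> y))"
      by (simp only: H)
    also have "\<dots> = cis (?h \<bullet> \<xi>) * fourier \<phi> \<xi>"
      unfolding fourier_def by (rule integral_mult_right_zero)
    finally have LH: "(LINT x|lborel. H (?h + x)) = cis (?h \<bullet> \<xi>) * fourier \<phi> \<xi>" .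
    have "(LINT x|lborel. cis (- (x \<bullet> \<xi>)) * q n x)
        = (LINT x|lborel. real (Suc n) *\<^sub>R (H (?h + x) - cis (- (x \<bullet> \<xi>)) * \<phi> x))"
      unfolding H'[symmetric] q_def by (simp only: right_diff_distrib scaleR_diff_right mult_scaleR_right)
    also have "\<dots> = real (Suc n) *\<^sub>R ((LINT x|lborel. H (?h + x)) - (LINT x|lborel. cis (- (x \<bullet> \<xi>)) * \<phi> x))"
      by (subst integral_scaleR_right, subst Bochner_Integration.integral_diff[OF integrable_lborel_shift[OF Hi] fourier_integrable[OF \<phi>]]) simp
    also have "\<dots> = real (Suc n) *\<^sub>R (cis (?h \<bullet> \<xi>) * fourier \<phi> \<xi> - fourier \<phi> \<xi>)"
      unfolding LH by (simp only: fourier_def)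
    also have "?h \<bullet> \<xi> = (0 + 1 / Suc n) * (\<xi> $ j)" by (simp add: inner_axis' del: of_nat_Suc)
    finally show ?thesis by (simp add: left_diff_distrib del: of_nat_Suc)
  qed
  moreover have "(\<lambda>n. (real (Suc n) *\<^sub>R (cis ((0 + 1 / Suc n) * (\<xi> $ j)) - cis (0 * (\<xi> $ j)))) * fourier \<phi> \<xi>)
      \<longlonglongrightarrow> \<i> * of_real (\<xi> $ j) * fourier \<phi> \<xi>"
  proof (intro tendsto_mult tendsto_const has_vector_derivative_sequentially)
    have "((\<lambda>z. exp (\<i> * of_real (\<xi> $ j) * z)) has_field_derivative \<i> * of_real (\<xi> $ j)) (at (of_real 0))"
      by (auto intro!: derivative_eq_intros)
    from has_vector_derivative_real_field[OF this]
    show "((\<lambda>t. cis (t * \<xi> $ j)) has_vector_derivative \<i> * of_real (\<xi> $ j)) (at 0)"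
      by (simp add: cis_conv_exp mult_ac)
  qed
  ultimately show ?thesis
    unfolding fourier_def[of "pd j \<phi>"] by (simp only: LIMSEQ_unique)
qed

text \<open>By induction: one more factor \<open>1 + norm \<xi>\<close> is at most 1 plus the sum of
  the coordinates' moduli, and each coordinate is absorbed by a derivative of \<phi>, at the price
  of one order in the seminorm.\<close>

lemma fourier_decay:
  "\<exists>C>0. \<forall>\<phi>::real^'n::finite \<Rightarrow> complex. schwartz \<phi> \<longrightarrow>
    (\<forall>\<xi>. (1 + norm \<xi>) ^ N * norm (fourier \<phi> \<xi>) \<le> C * schwartz_seminorm (N + Suc CARD('n)) \<phi>)"
proof (induction N)
  case 0
  then show ?case using fourier_bound[where 'n = 'n] by simp
next
  case (Suc N)
  let ?k = "Suc CARD('n)"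
  obtain C where C: "0 < C" "\<And>\<phi>::real^'n \<Rightarrow> complex. \<And>\<xi>. schwartz \<phi> \<Longrightarrow>
      (1 + norm \<xi>) ^ N * norm (fourier \<phi> \<xi>) \<le> C * schwartz_seminorm (N + ?k) \<phi>"
    using Suc by blast
  have "(1 + norm \<xi>) ^ Suc N * norm (fourier \<phi> \<xi>) \<le> C * (1 + real CARD('n)) * schwartz_seminorm (Suc N + ?k) \<phi>"
    if \<phi>: "schwartz \<phi>" for \<phi> :: "real^'n \<Rightarrow> complex" and \<xi>
  proof -
    let ?S = "schwartz_seminorm (Suc N + ?k) \<phi>"
    have n1: "(1 + norm \<xi>) ^ N * norm (fourier \<phi> \<xi>) \<le> C * ?S"
      using C(1) by (intro order_trans[OF C(2)[OF \<phi>]] mult_left_mono schwartz_seminorm_mono \<phi>) auto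
    have n2: "(1 + norm \<xi>) ^ N * norm (fourier (pd j \<phi>) \<xi>) \<le> C * ?S" for j
      using C(1) schwartz_seminorm_pd[OF \<phi>, of "N + ?k" j]
      by (intro order_trans[OF C(2)[OF schwartz_pd[OF \<phi>]]] mult_left_mono) auto
    have "(1 + norm \<xi>) * norm (fourier \<phi> \<xi>) \<le> (1 + (\<Sum>j\<in>UNIV. \<bar>\<xi> $ j\<bar>)) * norm (fourier \<phi> \<xi>)"
      by (intro mult_right_mono add_left_mono norm_le_l1_cart) auto
    also have "\<dots> = norm (fourier \<phi> \<xi>) + (\<Sum>j\<in>UNIV. norm (fourier (pd j \<phi>) \<xi>))"
      by (simp add: fourier_pd[OF \<phi>] norm_mult distrib_right sum_distrib_right)
    finally have "(1 + norm \<xi>) ^ N * ((1 + norm \<xi>) * norm (fourier \<phi> \<xi>))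
        \<le> (1 + norm \<xi>) ^ N * (norm (fourier \<phi> \<xi>) + (\<Sum>j\<in>UNIV. norm (fourier (pd j \<phi>) \<xi>)))"
      by (intro mult_left_mono) auto
    also have "\<dots> = (1 + norm \<xi>) ^ N * norm (fourier \<phi> \<xi>) + (\<Sum>j\<in>UNIV. (1 + norm \<xi>) ^ N * norm (fourier (pd j \<phi>) \<xi>))"
      by (simp add: distrib_left sum_distrib_left)
    also have "\<dots> \<le> C * ?S + (\<Sum>j\<in>(UNIV::'n set). C * ?S)"
      by (intro add_mono sum_mono n1 n2)
    finally show ?thesis by (simp add: algebra_simps)
  qed
  then show ?case using C(1) by (intro exI[of _ "C * (1 + real CARD('n))"]) (auto intro: mult_pos_pos add_pos_nonneg)
qed

lemma norm_cis_minus_linear: "norm (cis a - 1 - \<i> * of_real a) \<le> a\<^sup>2"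
proof -
  have "cis a - 1 - \<i> * of_real a = iexp a - (\<Sum>k\<le>Suc 0. (\<i> * of_real a) ^ k / fact k)"
    by (simp add: cis_conv_exp)
  also have "norm \<dots> \<le> \<bar>a\<bar> ^ Suc (Suc 0) / fact (Suc (Suc 0))" by (rule iexp_approx1)
  also have "\<dots> \<le> a\<^sup>2" by (simp add: power2_eq_square)
  finally show ?thesis .
qed

lemma schwartz_norm_square_integrable:
  fixes \<phi> :: "real^'n::finite \<Rightarrow> complex"
  assumes "schwartz \<phi>"
  shows "integrable lborel (\<lambda>x. (norm x)\<^sup>2 * norm (\<phi> x))"
proof -
  have "integrable lborel (\<lambda>x. \<Sum>j\<in>UNIV. norm (complex_of_real (x $ j) * (complex_of_real (x $ j) * \<phi> x)))"
    by (intro Bochner_Integration.integrable_sum integrable_norm schwartz_integrable schwartz_coord assms)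
  moreover have "norm (complex_of_real (x $ j) * (complex_of_real (x $ j) * \<phi> x)) = (x $ j)\<^sup>2 * norm (\<phi> x)" for x j
    by (simp add: norm_mult power2_eq_square mult.assoc[symmetric])
  then have "(\<Sum>j\<in>UNIV. norm (complex_of_real (x $ j) * (complex_of_real (x $ j) * \<phi> x))) = (norm x)\<^sup>2 * norm (\<phi> x)" for x
    by (simp add: norm_vec_def L2_set_def sum_nonneg sum_distrib_right)
  ultimately show ?thesis by simp
qed

text \<open>The phase differs from its linear part by at most the square of its argument, so the
  remainder is at most \<open>(norm h)\<^sup>2\<close> times the integral of
  \<open>(norm x)\<^sup>2 * norm (\<phi> x)\<close>.\<close>

lemma fourier_has_derivative:
  fixes \<phi> :: "real^'n::finite \<Rightarrow> complex"
  assumes \<phi>: "schwartz \<phi>"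
  shows "(fourier \<phi> has_derivative (\<lambda>h. \<Sum>j\<in>UNIV. (h $ j) *\<^sub>R fourier (\<lambda>x. - \<i> * (of_real (x $ j) * \<phi> x)) \<xi>)) (at \<xi>)"
    (is "(_ has_derivative ?D) _")
  unfolding has_derivative_at_alt
proof (intro conjI allI impI)
  show "bounded_linear ?D"
    by (intro bounded_linear_sum bounded_linear_compose[OF bounded_linear_scaleR_left] bounded_linear_vec_nth)
  define K where "K = (LINT x|lborel. (norm x)\<^sup>2 * norm (\<phi> x))"
  have K: "0 \<le> K" unfolding K_def by (intro integral_nonneg_AE) auto
  have xj: "schwartz (\<lambda>x. - \<i> * (of_real (x $ j) * \<phi> x))" for j
    by (intro schwartz_cmult schwartz_coord \<phi>)
  have bound: "norm (fourier \<phi> \<eta> - fourier \<phi> \<xi> - ?D (\<eta> - \<xi>)) \<le> (norm (\<eta> - \<xi>))\<^sup>2 * K" for \<eta>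
  proof -
    let ?h = "\<eta> - \<xi>"
    let ?R = "\<lambda>x. cis (- (x \<bullet> \<eta>)) * \<phi> x - cis (- (x \<bullet> \<xi>)) * \<phi> x
        - (\<Sum>j\<in>UNIV. (?h $ j) *\<^sub>R (cis (- (x \<bullet> \<xi>)) * (- \<i> * (of_real (x $ j) * \<phi> x))))"
    define G where "G j x = cis (- (x \<bullet> \<xi>)) * (- \<i> * (of_real (x $ j) * \<phi> x))" for j x
    have G: "integrable lborel (G j)" for j unfolding G_def by (rule fourier_integrable[OF xj])
    note int = fourier_integrable[OF \<phi>, of \<eta>] fourier_integrable[OF \<phi>, of \<xi>]
    have intR: "integrable lborel ?R"
      unfolding G_def[symmetric]
      by (intro Bochner_Integration.integrable_diff Bochner_Integration.integrable_sum integrable_scaleR_right int G)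
    have FG: "fourier (\<lambda>x. - \<i> * (of_real (x $ j) * \<phi> x)) \<xi> = (LINT x|lborel. G j x)" for j
      by (simp only: fourier_def G_def)
    have "(LINT x|lborel. ?R x) = fourier \<phi> \<eta> - fourier \<phi> \<xi> - (LINT x|lborel. (\<Sum>j\<in>UNIV. (?h $ j) *\<^sub>R G j x))"
      unfolding G_def[symmetric] fourier_def
      by (subst Bochner_Integration.integral_diff,
          intro Bochner_Integration.integrable_diff int,
          intro Bochner_Integration.integrable_sum integrable_scaleR_right G,
          subst Bochner_Integration.integral_diff[OF int]) (rule refl)
    also have "(LINT x|lborel. (\<Sum>j\<in>UNIV. (?h $ j) *\<^sub>R G j x)) = ?D ?h"
      unfolding FG by (subst Bochner_Integration.integral_sum) (intro integrable_scaleR_right G, simp)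
    finally have eq: "fourier \<phi> \<eta> - fourier \<phi> \<xi> - ?D ?h = (LINT x|lborel. ?R x)" by (rule sym)
    have R: "norm (?R x) \<le> (norm ?h)\<^sup>2 * ((norm x)\<^sup>2 * norm (\<phi> x))" for x
    proof -
      let ?a = "- (x \<bullet> ?h)"
      have "(\<Sum>j\<in>UNIV. (?h $ j) *\<^sub>R (cis (- (x \<bullet> \<xi>)) * (- \<i> * (of_real (x $ j) * \<phi> x))))
          = cis (- (x \<bullet> \<xi>)) * (\<i> * of_real ?a) * \<phi> x"
        by (simp add: inner_vec_def scaleR_conv_of_real sum_distrib_left sum_distrib_right sum_negf mult_ac)
      moreover have "cis (- (x \<bullet> \<eta>)) = cis (- (x \<bullet> \<xi>)) * cis ?a"
        by (simp add: cis_mult inner_diff_right)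
      ultimately have "?R x = cis (- (x \<bullet> \<xi>)) * (cis ?a - 1 - \<i> * of_real ?a) * \<phi> x"
        by (simp add: algebra_simps)
      then have "norm (?R x) = norm (cis ?a - 1 - \<i> * of_real ?a) * norm (\<phi> x)"
        by (simp only: norm_mult norm_cis mult_1)
      also have "\<dots> \<le> ?a\<^sup>2 * norm (\<phi> x)"
        by (intro mult_right_mono norm_cis_minus_linear) auto
      also have "?a\<^sup>2 \<le> (norm x * norm ?h)\<^sup>2"
        using Cauchy_Schwarz_ineq2[of x ?h] by (intro abs_le_square_iff[THEN iffD1]) auto
      finally show ?thesis by (simp add: power_mult_distrib mult_ac mult_right_mono)
    qed
    have "norm (LINT x|lborel. ?R x) \<le> (LINT x|lborel. norm (?R x))" by (rule integral_norm_bound)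
    also have "\<dots> \<le> (LINT x|lborel. (norm ?h)\<^sup>2 * ((norm x)\<^sup>2 * norm (\<phi> x)))"
      by (intro integral_mono integrable_norm intR integrable_mult_right schwartz_norm_square_integrable \<phi> R)
    finally show ?thesis unfolding eq K_def by simp
  qed
  fix e :: real assume e: "0 < e"
  show "\<exists>d>0. \<forall>y. norm (y - \<xi>) < d \<longrightarrow> norm (fourier \<phi> y - fourier \<phi> \<xi> - ?D (y - \<xi>)) \<le> e * norm (y - \<xi>)"
  proof (intro exI[of _ "e / (K + 1)"] conjI allI impI)
    show "0 < e / (K + 1)" using e K by simp
    fix y assume y: "norm (y - \<xi>) < e / (K + 1)"
    have "norm (y - \<xi>) * K \<le> norm (y - \<xi>) * (K + 1)" by (intro mult_left_mono) auto
    also have "\<dots> \<le> e" using y K by (simp add: pos_less_divide_eq)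
    finally have "norm (y - \<xi>) * (norm (y - \<xi>) * K) \<le> norm (y - \<xi>) * e" by (intro mult_left_mono) auto
    then show "norm (fourier \<phi> y - fourier \<phi> \<xi> - ?D (y - \<xi>)) \<le> e * norm (y - \<xi>)"
      using bound[of y] by (simp add: power2_eq_square mult_ac)
  qed
qed

lemma pd_fourier:
  fixes \<phi> :: "real^'n::finite \<Rightarrow> complex"
  assumes "schwartz \<phi>"
  shows "pd i (fourier \<phi>) = fourier (\<lambda>x. - \<i> * (of_real (x $ i) * \<phi> x))"
proof
  fix \<xi>
  show "pd i (fourier \<phi>) \<xi> = fourier (\<lambda>x. - \<i> * (of_real (x $ i) * \<phi> x)) \<xi>"
    by (subst pd_eqI[OF fourier_has_derivative[OF assms]]) (simp add: axis_def if_distrib[of "\<lambda>c. c *\<^sub>R _"] cong: if_cong)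
qed

text \<open>Transforms of Schwartz functions form a class closed under \<open>pd\<close>, since a
  derivative of the transform is the transform of a coordinate multiple.\<close>

lemma schwartz_fourier:
  assumes "schwartz \<phi>"
  shows "schwartz (fourier \<phi>)"
proof (rule schwartz_coinduct[where X = "\<lambda>\<eta>. \<exists>\<phi>. schwartz \<phi> \<and> \<eta> = fourier \<phi>"])
  fix \<eta> :: "real^'a \<Rightarrow> complex" and i :: 'a and N :: nat and x
  assume "\<exists>\<phi>. schwartz \<phi> \<and> \<eta> = fourier \<phi>"
  then obtain \<phi> where *: "schwartz \<phi>" "\<eta> = fourier \<phi>" by blast
  show "\<eta> differentiable at x" unfolding * using fourier_has_derivative[OF *(1)] by (auto simp: differentiable_def)
  show "\<exists>B. \<forall>x. (1 + norm x) ^ N * norm (\<eta> x) \<le> B" using fourier_decay[of N, where 'n = 'a] * by blast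
  show "\<exists>\<phi>. schwartz \<phi> \<and> pd i \<eta> = fourier \<phi>"
    unfolding *(2) pd_fourier[OF *(1)] using schwartz_cmult[OF schwartz_coord[OF *(1)]] by blast
qed (use assms in blast)

lemma inv_fourier_eq: "inv_fourier \<phi> x = fourier \<phi> (- x) / of_real ((2 * pi) ^ CARD('n))"
  for \<phi> :: "real^'n::finite \<Rightarrow> complex"
  by (simp add: inv_fourier_def fourier_def inner_commute)

lemma schwartz_inv_fourier: "schwartz \<phi> \<Longrightarrow> schwartz (inv_fourier \<phi>)"
  for \<phi> :: "real^'n::finite \<Rightarrow> complex"
  using schwartz_cmult[OF schwartz_uminus_arg[OF schwartz_fourier], of \<phi> "1 / of_real ((2 * pi) ^ CARD('n))"]
  by (simp add: inv_fourier_eq[abs_def])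

lemma inv_fourier_pd:
  assumes "schwartz \<phi>"
  shows "inv_fourier (pd j \<phi>) x = - \<i> * of_real (x $ j) * inv_fourier \<phi> x"
  by (simp add: inv_fourier_eq fourier_pd[OF assms])

lemma inv_fourier_add:
  "schwartz \<phi> \<Longrightarrow> schwartz \<psi> \<Longrightarrow>
    inv_fourier (\<lambda>x. a * \<phi> x + b * \<psi> x) x = a * inv_fourier \<phi> x + b * inv_fourier \<psi> x"
  by (simp add: inv_fourier_eq fourier_add add_divide_distrib)

lemma inv_fourier_decay:
  "\<exists>C>0. \<forall>\<phi>::real^'n::finite \<Rightarrow> complex. schwartz \<phi> \<longrightarrow>
    (\<forall>\<xi>. (1 + norm \<xi>) ^ N * norm (inv_fourier \<phi> \<xi>) \<le> C * schwartz_seminorm (N + Suc CARD('n)) \<phi>)"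
proof -
  obtain C where C: "0 < C" "\<And>\<phi>::real^'n \<Rightarrow> complex. \<And>\<xi>. schwartz \<phi> \<Longrightarrow>
      (1 + norm \<xi>) ^ N * norm (fourier \<phi> \<xi>) \<le> C * schwartz_seminorm (N + Suc CARD('n)) \<phi>"
    using fourier_decay[of N, where 'n = 'n] by blast
  let ?c = "(2 * pi) ^ CARD('n)"
  have "(1 + norm \<xi>) ^ N * norm (inv_fourier \<phi> \<xi>) \<le> C / ?c * schwartz_seminorm (N + Suc CARD('n)) \<phi>"
    if "schwartz \<phi>" for \<phi> :: "real^'n \<Rightarrow> complex" and \<xi>
    using divide_right_mono[OF C(2)[OF that, of "- \<xi>"], of ?c] by (simp add: inv_fourier_eq norm_divide norm_power norm_mult)
  then show ?thesis using C(1) by (intro exI[of _ "C / ?c"]) auto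
qed

section \<open>Gaussian integrals and Fourier inversion\<close>

lemma
  fixes f :: "'a::euclidean_space \<Rightarrow> real \<Rightarrow> 'b::{real_normed_field,banach,second_countable_topology}"
  assumes int: "\<And>b. b \<in> Basis \<Longrightarrow> integrable lborel (f b)"
  shows integrable_lborel_prod: "integrable lborel (\<lambda>x::'a. \<Prod>b\<in>Basis. f b (x \<bullet> b))"
    and integral_lborel_prod: "(LINT x|lborel. (\<Prod>b\<in>Basis. f b ((x::'a) \<bullet> b))) = (\<Prod>b\<in>Basis. LINT x|lborel. f b x)"
proof -
  interpret product_sigma_finite "\<lambda>_::'a. lborel :: real measure" by standard
  have [measurable]: "b \<in> Basis \<Longrightarrow> f b \<in> borel_measurable borel" for b using int by auto
  have m[measurable]: "(\<lambda>f. \<Sum>b\<in>Basis. f b *\<^sub>R b) \<in> (\<Pi>\<^sub>M b\<in>(Basis::'a set). (lborel::real measure)) \<rightarrow>\<^sub>M borel"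
    by measurable
  have m2[measurable]: "(\<lambda>x::'a. \<Prod>b\<in>Basis. f b (x \<bullet> b)) \<in> borel_measurable borel" by measurable
  have eq: "(\<Prod>b\<in>Basis. f b ((\<Sum>b\<in>Basis. g b *\<^sub>R b) \<bullet> b)) = (\<Prod>b\<in>Basis. f b (g b))" for g :: "'a \<Rightarrow> real"
    by (intro prod.cong) auto
  show "integrable lborel (\<lambda>x::'a. \<Prod>b\<in>Basis. f b (x \<bullet> b))"
    by (subst lborel_eq, subst integrable_distr_eq[OF m m2], unfold eq)
      (rule product_integrable_prod[OF finite_Basis int])
  show "(LINT x|lborel. (\<Prod>b\<in>Basis. f b ((x::'a) \<bullet> b))) = (\<Prod>b\<in>Basis. LINT x|lborel. f b x)"
    by (subst lborel_eq, subst integral_distr[OF m m2], unfold eq)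
      (rule product_integral_prod[OF finite_Basis int])
qed

definition gaussian :: "'a::euclidean_space \<Rightarrow> real" where
  "gaussian x = exp (- (norm x)\<^sup>2 / 2)"

lemma gaussian_measurable [measurable]: "gaussian \<in> borel_measurable borel"
  unfolding gaussian_def[abs_def] by measurable

lemma gaussian_bounds: "0 < gaussian x" "gaussian x \<le> 1"
  by (auto simp: gaussian_def)

lemma gaussian_abs [simp]: "\<bar>gaussian x\<bar> = gaussian x"
  by (auto simp: gaussian_def)

text \<open>This is the characteristic function of the standard normal distribution, freed from the
  normalising factor.\<close>

lemma gaussian_fourier_1d:
  "integrable lborel (\<lambda>x::real. cis (t * x) * of_real (exp (- x\<^sup>2 / 2)))"
  "(LINT x|lborel. cis (t * x) * of_real (exp (- x\<^sup>2 / 2))) = of_real (sqrt (2 * pi) * exp (- t\<^sup>2 / 2))"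
proof -
  have e: "complex_of_real (exp (- x\<^sup>2 / 2)) = of_real (sqrt (2 * pi)) * of_real (std_normal_density x)" for x
    by (simp add: std_normal_density_def)
  have i: "integrable lborel std_normal_density" by (rule integrable_normal_density) simp
  have "integrable lborel (\<lambda>x. complex_of_real (sqrt (2 * pi) * std_normal_density x))"
    by (intro integrable_of_real integrable_mult_right i)
  then show "integrable lborel (\<lambda>x::real. cis (t * x) * of_real (exp (- x\<^sup>2 / 2)))"
  proof (rule Bochner_Integration.integrable_bound)
    have "(\<lambda>x. cis (t * x) * of_real (exp (- x\<^sup>2 / 2))) \<in> borel_measurable borel"
      by (intro borel_measurable_continuous_onI continuous_intros) auto
    then show "(\<lambda>x. cis (t * x) * of_real (exp (- x\<^sup>2 / 2))) \<in> borel_measurable lborel" by simp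
    show "AE x in lborel. cmod (cis (t * x) * complex_of_real (exp (- x\<^sup>2 / 2)))
      \<le> cmod (complex_of_real (sqrt (2 * pi) * std_normal_density x))"
      unfolding e of_real_mult by (simp add: norm_mult)
  qed
  have "char std_normal_distribution t = (LINT x|lborel. std_normal_density x *\<^sub>R iexp (t * x))"
    unfolding char_def by (subst integral_density) (auto intro: normal_density_nonneg)
  then have "of_real (sqrt (2 * pi)) * complex_of_real (exp (- t\<^sup>2 / 2))
      = of_real (sqrt (2 * pi)) * (LINT x|lborel. std_normal_density x *\<^sub>R iexp (t * x))"
    by (simp add: char_std_normal_distribution)
  also have "\<dots> = (LINT x|lborel. of_real (sqrt (2 * pi)) * (std_normal_density x *\<^sub>R iexp (t * x)))"
    by (rule integral_mult_right_zero[symmetric])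
  also have "\<dots> = (LINT x|lborel. cis (t * x) * of_real (exp (- x\<^sup>2 / 2)))"
    unfolding e by (intro Bochner_Integration.integral_cong) (simp_all add: scaleR_conv_of_real cis_conv_exp mult_ac)
  finally show "(LINT x|lborel. cis (t * x) * of_real (exp (- x\<^sup>2 / 2))) = of_real (sqrt (2 * pi) * exp (- t\<^sup>2 / 2))"
    by simp
qed

lemma cis_inner_gaussian:
  fixes z x :: "'a::euclidean_space"
  shows "cis (z \<bullet> x) * of_real (gaussian x)
    = (\<Prod>b\<in>Basis. cis ((z \<bullet> b) * (x \<bullet> b)) * of_real (exp (- (x \<bullet> b)\<^sup>2 / 2)))"
proof -
  have "cis (z \<bullet> x) = (\<Prod>b\<in>Basis. cis ((z \<bullet> b) * (x \<bullet> b)))"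
    by (subst euclidean_inner) (simp add: cis_conv_exp sum_distrib_left exp_sum)
  moreover have "gaussian x = (\<Prod>b\<in>Basis. exp (- (x \<bullet> b)\<^sup>2 / 2))"
    unfolding gaussian_def power2_norm_eq_inner
    by (subst euclidean_inner) (simp add: power2_eq_square exp_sum[symmetric] sum_divide_distrib sum_negf)
  ultimately show ?thesis by (simp add: prod.distrib)
qed

lemma gaussian_fourier:
  fixes z :: "'a::euclidean_space"
  shows "integrable lborel (\<lambda>x. cis (z \<bullet> x) * of_real (gaussian x))"
    "(LINT x|lborel. cis (z \<bullet> x) * of_real (gaussian x)) = of_real (sqrt (2 * pi) ^ DIM('a) * gaussian z)"
proof -
  show "integrable lborel (\<lambda>x. cis (z \<bullet> x) * of_real (gaussian x))"
    unfolding cis_inner_gaussian by (rule integrable_lborel_prod[OF gaussian_fourier_1d(1)])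
  have "(LINT x|lborel. cis (z \<bullet> x) * of_real (gaussian x)) = (\<Prod>b\<in>Basis. of_real (sqrt (2 * pi) * exp (- (z \<bullet> b)\<^sup>2 / 2)))"
    unfolding cis_inner_gaussian by (subst integral_lborel_prod[OF gaussian_fourier_1d(1)]) (simp only: gaussian_fourier_1d(2))
  also have "\<dots> = of_real (sqrt (2 * pi) ^ DIM('a) * (\<Prod>b\<in>Basis. exp (- (z \<bullet> b)\<^sup>2 / 2)))"
    by (simp add: prod.distrib)
  also have "(\<Prod>b\<in>Basis. exp (- (z \<bullet> b)\<^sup>2 / 2)) = gaussian z"
    unfolding gaussian_def power2_norm_eq_inner
    by (subst euclidean_inner) (simp add: power2_eq_square exp_sum[symmetric] sum_divide_distrib sum_negf)
  finally show "(LINT x|lborel. cis (z \<bullet> x) * of_real (gaussian x)) = of_real (sqrt (2 * pi) ^ DIM('a) * gaussian z)" .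
qed

lemma integral_lborel_affine:
  fixes f :: "'a::euclidean_space \<Rightarrow> 'b::{banach,second_countable_topology}"
  assumes [measurable]: "f \<in> borel_measurable borel" and "0 < c"
  shows "(LINT x|lborel. f x) = c ^ DIM('a) *\<^sub>R (LINT x|lborel. f (t + c *\<^sub>R x))"
proof -
  have "(LINT x|lborel. f x) = (LINT x|density (distr lborel borel (\<lambda>x. t + c *\<^sub>R x)) (\<lambda>_. ennreal (c ^ DIM('a))). f x)"
    using lborel_affine[of c t] assms by simp
  also have "\<dots> = (LINT x|distr lborel borel (\<lambda>x. t + c *\<^sub>R x). c ^ DIM('a) *\<^sub>R f x)"
    using assms by (subst integral_density) auto
  also have "\<dots> = (LINT x|lborel. c ^ DIM('a) *\<^sub>R f (t + c *\<^sub>R x))"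
    by (subst integral_distr) auto
  finally show ?thesis by simp
qed

text \<open>Fubini moves the transform from \<phi> to \<open>g\<close>. With a Gaussian for
  \<open>g\<close> this turns the inversion integral into an average of \<phi>.\<close>

lemma fourier_multiplication:
  fixes g :: "real^'n::finite \<Rightarrow> complex"
  assumes \<phi>: "schwartz \<phi>" and g: "integrable lborel g"
  shows "(LINT \<xi>|lborel. g \<xi> * fourier \<phi> \<xi>) = (LINT y|lborel. (LINT \<xi>|lborel. cis (- (y \<bullet> \<xi>)) * g \<xi>) * \<phi> y)"
proof -
  note [measurable] = schwartz_measurable[OF \<phi>] borel_measurable_integrable[OF g]
  have [measurable]: "(\<lambda>p::(real^'n) \<times> (real^'n). cis (- (fst p \<bullet> snd p))) \<in> borel_measurable (lborel \<Otimes>\<^sub>M lborel)"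
  proof -
    have "(\<lambda>p::(real^'n) \<times> (real^'n). cis (- (fst p \<bullet> snd p))) \<in> borel_measurable borel"
      by (intro borel_measurable_continuous_onI continuous_intros)
    then show ?thesis by (simp add: lborel_prod)
  qed
  have "integrable (lborel \<Otimes>\<^sub>M lborel) (\<lambda>(\<xi>, y). g \<xi> * \<phi> y)"
  proof (rule lborel_pair.Fubini_integrable)
    have "integrable lborel (\<lambda>\<xi>. norm (g \<xi>) * (LINT y|lborel. norm (\<phi> y)))"
      by (intro integrable_mult_left integrable_norm g)
    then show "integrable lborel (\<lambda>\<xi>. LINT y|lborel. norm (case (\<xi>, y) of (\<xi>, y) \<Rightarrow> g \<xi> * \<phi> y))"
      by (simp add: norm_mult)
    show "AE \<xi> in lborel. integrable lborel (\<lambda>y. case (\<xi>, y) of (\<xi>, y) \<Rightarrow> g \<xi> * \<phi> y)"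
      using schwartz_integrable[OF \<phi>] by (intro AE_I2) simp
  qed measurable
  then have int: "integrable (lborel \<Otimes>\<^sub>M lborel) (\<lambda>(\<xi>, y). g \<xi> * (cis (- (y \<bullet> \<xi>)) * \<phi> y))"
  proof (rule Bochner_Integration.integrable_bound)
    have "(\<lambda>p. g (fst p) * (cis (- (fst p \<bullet> snd p)) * \<phi> (snd p))) \<in> borel_measurable (lborel \<Otimes>\<^sub>M lborel)" by measurable
    then show "(\<lambda>(\<xi>, y). g \<xi> * (cis (- (y \<bullet> \<xi>)) * \<phi> y)) \<in> borel_measurable (lborel \<Otimes>\<^sub>M lborel)"
      by (simp add: split_beta' inner_commute)
  qed (auto simp: norm_mult split_beta')
  have "(LINT \<xi>|lborel. g \<xi> * fourier \<phi> \<xi>) = (LINT \<xi>|lborel. LINT y|lborel. g \<xi> * (cis (- (y \<bullet> \<xi>)) * \<phi> y))"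
    unfolding fourier_def by simp
  also have "\<dots> = (LINT y|lborel. LINT \<xi>|lborel. g \<xi> * (cis (- (y \<bullet> \<xi>)) * \<phi> y))"
    using lborel_pair.Fubini_integral[OF int] by simp
  also have "\<dots> = (LINT y|lborel. LINT \<xi>|lborel. (cis (- (y \<bullet> \<xi>)) * g \<xi>) * \<phi> y)"
    by (simp only: mult_ac)
  finally show ?thesis by simp
qed

text \<open>Gaussian summation: a factor \<open>gaussian (\<delta> n *\<^sub>R \<xi>)\<close> is
  inserted into the inversion integral. As \<open>\<delta> n\<close> tends to 0 the integrals tend
  to the one without the factor, and also to a multiple of \<open>\<phi> x\<close>.\<close>

theorem inv_fourier_fourier:
  fixes \<phi> :: "real^'n::finite \<Rightarrow> complex"
  assumes \<phi>: "schwartz \<phi>"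
  shows "inv_fourier (fourier \<phi>) x = \<phi> x"
proof -
  let ?d = "CARD('n)"
  note [measurable] = schwartz_measurable[OF \<phi>] schwartz_measurable[OF schwartz_fourier[OF \<phi>]]
  have [measurable]: "(\<lambda>\<xi>::real^'n. cis (z \<bullet> \<xi>)) \<in> borel_measurable borel" for z
    by (intro borel_measurable_continuous_onI continuous_intros)
  define \<delta> where "\<delta> n = 1 / real (Suc n)" for n
  have \<delta>: "0 < \<delta> n" for n by (simp add: \<delta>_def)
  have \<delta>0: "\<delta> \<longlonglongrightarrow> 0" unfolding \<delta>_def[abs_def] using LIMSEQ_Suc[OF lim_1_over_n] by simp
  define I where "I n = (LINT \<xi>|lborel. (cis (x \<bullet> \<xi>) * of_real (gaussian (\<delta> n *\<^sub>R \<xi>))) * fourier \<phi> \<xi>)" for n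
  have scale: "integrable lborel (\<lambda>\<xi>::real^'n. cis (z \<bullet> \<xi>) * of_real (gaussian (\<delta> n *\<^sub>R \<xi>)))" for z n
  proof -
    have i: "integrable lborel (\<lambda>x::real^'n. gaussian x)"
      using integrable_norm[OF gaussian_fourier(1)[of "0::real^'n"]] by (simp add: norm_mult)
    have "integrable lborel (\<lambda>\<xi>::real^'n. gaussian (\<delta> n *\<^sub>R \<xi>))"
    proof -
      have "(\<integral>\<^sup>+x. ennreal (gaussian (x::real^'n)) \<partial>lborel) = (\<integral>\<^sup>+x. ennreal (gaussian x) \<partial>density (distr lborel borel (\<lambda>x::real^'n. 0 + \<delta> n *\<^sub>R x)) (\<lambda>_. ennreal (\<delta> n ^ ?d)))"
        using lborel_affine[of "\<delta> n" "0::real^'n"] \<delta>[of n] by simp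
      also have "\<dots> = (\<integral>\<^sup>+x. ennreal (\<delta> n ^ ?d) * ennreal (gaussian (\<delta> n *\<^sub>R (x::real^'n))) \<partial>lborel)"
        by (simp add: nn_integral_density nn_integral_distr)
      also have "\<dots> = ennreal (\<delta> n ^ ?d) * (\<integral>\<^sup>+x. ennreal (gaussian (\<delta> n *\<^sub>R (x::real^'n))) \<partial>lborel)"
        by (rule nn_integral_cmult) measurable
      finally have "ennreal (\<delta> n ^ ?d) * (\<integral>\<^sup>+x. ennreal (gaussian (\<delta> n *\<^sub>R (x::real^'n))) \<partial>lborel) < \<infinity>"
        using i by (simp add: integrable_iff_bounded)
      then have "(\<integral>\<^sup>+x. ennreal (gaussian (\<delta> n *\<^sub>R (x::real^'n))) \<partial>lborel) < \<infinity>"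
        using \<delta>[of n] by (auto simp: ennreal_mult_less_top)
      then show ?thesis
        by (intro integrableI_bounded) auto
    qed
    then have "integrable lborel (\<lambda>\<xi>::real^'n. complex_of_real (gaussian (\<delta> n *\<^sub>R \<xi>)))" by (rule integrable_of_real)
    then show ?thesis
      by (rule Bochner_Integration.integrable_bound) (auto simp: norm_mult)
  qed
  have "I \<longlonglongrightarrow> (LINT \<xi>|lborel. cis (x \<bullet> \<xi>) * fourier \<phi> \<xi>)"
    unfolding I_def
  proof (rule integral_dominated_convergence)
    show "(\<lambda>\<xi>. cis (x \<bullet> \<xi>) * fourier \<phi> \<xi>) \<in> borel_measurable lborel" by measurable
    show "(\<lambda>\<xi>. (cis (x \<bullet> \<xi>) * of_real (gaussian (\<delta> n *\<^sub>R \<xi>))) * fourier \<phi> \<xi>) \<in> borel_measurable lborel" for n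
      by measurable
    show "integrable lborel (\<lambda>\<xi>. norm (fourier \<phi> \<xi>))"
      by (intro integrable_norm schwartz_integrable schwartz_fourier \<phi>)
    show "AE \<xi> in lborel. (\<lambda>n. (cis (x \<bullet> \<xi>) * of_real (gaussian (\<delta> n *\<^sub>R \<xi>))) * fourier \<phi> \<xi>) \<longlonglongrightarrow> cis (x \<bullet> \<xi>) * fourier \<phi> \<xi>"
    proof (rule AE_I2)
      fix \<xi> :: "real^'n"
      have "(\<lambda>n. cis (x \<bullet> \<xi>) * of_real (gaussian (\<delta> n *\<^sub>R \<xi>)) * fourier \<phi> \<xi>)
          \<longlonglongrightarrow> cis (x \<bullet> \<xi>) * of_real (exp (- (norm (0 *\<^sub>R \<xi>))\<^sup>2 / 2)) * fourier \<phi> \<xi>"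
        unfolding gaussian_def by (intro tendsto_intros \<delta>0) auto
      then show "(\<lambda>n. cis (x \<bullet> \<xi>) * of_real (gaussian (\<delta> n *\<^sub>R \<xi>)) * fourier \<phi> \<xi>) \<longlonglongrightarrow> cis (x \<bullet> \<xi>) * fourier \<phi> \<xi>"
        by simp
    qed
    show "AE \<xi> in lborel. norm ((cis (x \<bullet> \<xi>) * of_real (gaussian (\<delta> n *\<^sub>R \<xi>))) * fourier \<phi> \<xi>) \<le> norm (fourier \<phi> \<xi>)" for n
      using gaussian_bounds less_imp_le[OF gaussian_bounds(1)]
      by (intro AE_I2) (auto simp: norm_mult intro!: mult_left_le_one_le)
  qed
  moreover have "I \<longlonglongrightarrow> of_real ((2 * pi) ^ ?d) * \<phi> x"
  proof -
    \<comment> \<open>The transform of the modulated Gaussian is a Gaussian of width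
      \<open>\<delta> n\<close> around \<open>x\<close>, and the substitution y = x + \<delta> z
      makes it fixed. One factor \<open>sqrt (2 * pi) ^ ?d\<close> appears here, the other is the
      total mass of the Gaussian.\<close>
    have Ieq: "I n = of_real (sqrt (2 * pi) ^ ?d) * (LINT z|lborel. of_real (gaussian z) * \<phi> (x + \<delta> n *\<^sub>R z))" for n
    proof -
      have J: "(LINT \<xi>|lborel. cis (- (y \<bullet> \<xi>)) * (cis (x \<bullet> \<xi>) * of_real (gaussian (\<delta> n *\<^sub>R \<xi>))))
          = of_real ((1 / \<delta> n) ^ ?d * (sqrt (2 * pi) ^ ?d * gaussian ((1 / \<delta> n) *\<^sub>R (x - y))))" for y
      proof -
        have "(LINT \<xi>|lborel. cis (- (y \<bullet> \<xi>)) * (cis (x \<bullet> \<xi>) * of_real (gaussian (\<delta> n *\<^sub>R \<xi>))))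
            = (LINT \<xi>|lborel. cis ((x - y) \<bullet> \<xi>) * of_real (gaussian (\<delta> n *\<^sub>R \<xi>)))"
          by (simp only: mult.assoc[symmetric] cis_mult) (simp add: inner_diff_left)
        also have "\<dots> = (1 / \<delta> n) ^ ?d *\<^sub>R (LINT \<xi>|lborel. cis ((x - y) \<bullet> (0 + (1 / \<delta> n) *\<^sub>R \<xi>)) * of_real (gaussian (\<delta> n *\<^sub>R (0 + (1 / \<delta> n) *\<^sub>R \<xi>))))"
          using \<delta>[of n] by (subst integral_lborel_affine[of _ "1 / \<delta> n" 0]) auto
        also have "(LINT \<xi>|lborel. cis ((x - y) \<bullet> (0 + (1 / \<delta> n) *\<^sub>R \<xi>)) * of_real (gaussian (\<delta> n *\<^sub>R (0 + (1 / \<delta> n) *\<^sub>R \<xi>))))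
            = (LINT \<xi>|lborel. cis (((1 / \<delta> n) *\<^sub>R (x - y)) \<bullet> \<xi>) * of_real (gaussian \<xi>))"
          using less_imp_neq[OF \<delta>[of n]] by simp
        also have "\<dots> = of_real (sqrt (2 * pi) ^ ?d * gaussian ((1 / \<delta> n) *\<^sub>R (x - y)))"
          by (subst gaussian_fourier(2)) simp
        finally show ?thesis by (simp add: scaleR_conv_of_real)
      qed
      have "I n = (LINT y|lborel. of_real ((1 / \<delta> n) ^ ?d * (sqrt (2 * pi) ^ ?d * gaussian ((1 / \<delta> n) *\<^sub>R (x - y)))) * \<phi> y)"
        unfolding I_def by (subst fourier_multiplication[OF \<phi> scale]) (simp only: J)
      also have "\<dots> = \<delta> n ^ ?d *\<^sub>R (LINT z|lborel. of_real ((1 / \<delta> n) ^ ?d * (sqrt (2 * pi) ^ ?d * gaussian ((1 / \<delta> n) *\<^sub>R (x - (x + \<delta> n *\<^sub>R z))))) * \<phi> (x + \<delta> n *\<^sub>R z))"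
        using \<delta>[of n] by (subst integral_lborel_affine[of _ "\<delta> n" x]) auto
      also have "\<dots> = \<delta> n ^ ?d *\<^sub>R (LINT z|lborel. of_real ((1 / \<delta> n) ^ ?d * sqrt (2 * pi) ^ ?d) * (of_real (gaussian z) * \<phi> (x + \<delta> n *\<^sub>R z)))"
        using less_imp_neq[OF \<delta>[of n]] by (simp add: gaussian_def mult_ac)
      also have "\<dots> = \<delta> n ^ ?d *\<^sub>R (of_real ((1 / \<delta> n) ^ ?d * sqrt (2 * pi) ^ ?d) * (LINT z|lborel. of_real (gaussian z) * \<phi> (x + \<delta> n *\<^sub>R z)))"
        by (subst integral_mult_right_zero) (rule refl)
      finally show ?thesis using less_imp_neq[OF \<delta>[of n]] by (simp add: scaleR_conv_of_real power_one_over)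
    qed
    obtain B where B: "\<And>x. norm (\<phi> x) \<le> B" using schwartz_bound[OF \<phi>, of 0] by auto
    have "(\<lambda>n. LINT z|lborel. of_real (gaussian z) * \<phi> (x + \<delta> n *\<^sub>R z)) \<longlonglongrightarrow> (LINT z::real^'n|lborel. of_real (gaussian z) * \<phi> x)"
    proof (rule integral_dominated_convergence)
      show "(\<lambda>z::real^'n. of_real (gaussian z) * \<phi> x) \<in> borel_measurable lborel" by measurable
      show "(\<lambda>z. of_real (gaussian z) * \<phi> (x + \<delta> n *\<^sub>R z)) \<in> borel_measurable lborel" for n by measurable
      show "integrable lborel (\<lambda>z::real^'n. B * norm (cis (0 \<bullet> z) * of_real (gaussian z)))"
        by (intro integrable_mult_right integrable_norm gaussian_fourier)
      show "AE z in lborel. (\<lambda>n. of_real (gaussian z) * \<phi> (x + \<delta> n *\<^sub>R z)) \<longlonglongrightarrow> of_real (gaussian z) * \<phi> x"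
      proof (rule AE_I2)
        fix z :: "real^'n"
        have "isCont \<phi> (x + 0 *\<^sub>R z)"
          using schwartz_differentiable[OF \<phi>] differentiable_imp_continuous_within by blast
        then have "(\<lambda>n. \<phi> (x + \<delta> n *\<^sub>R z)) \<longlonglongrightarrow> \<phi> (x + 0 *\<^sub>R z)"
          by (rule isCont_tendsto_compose) (intro tendsto_intros \<delta>0)
        then show "(\<lambda>n. of_real (gaussian z) * \<phi> (x + \<delta> n *\<^sub>R z)) \<longlonglongrightarrow> of_real (gaussian z) * \<phi> x"
          by (intro tendsto_intros) simp
      qed
      show "AE z in lborel. norm (of_real (gaussian z) * \<phi> (x + \<delta> n *\<^sub>R z)) \<le> B * norm (cis (0 \<bullet> z) * of_real (gaussian z))" for n
      proof (rule AE_I2)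
        fix z :: "real^'n"
        have "norm (\<phi> (x + \<delta> n *\<^sub>R z)) * gaussian z \<le> B * gaussian z"
          by (intro mult_right_mono B less_imp_le gaussian_bounds)
        then show "norm (of_real (gaussian z) * \<phi> (x + \<delta> n *\<^sub>R z)) \<le> B * norm (cis (0 \<bullet> z) * of_real (gaussian z))"
          by (simp add: norm_mult mult.commute)
      qed
    qed
    also have "(LINT z::real^'n|lborel. of_real (gaussian z) * \<phi> x) = of_real (sqrt (2 * pi) ^ ?d) * \<phi> x"
    proof -
      have "(LINT z::real^'n|lborel. of_real (gaussian z)) = complex_of_real (sqrt (2 * pi) ^ ?d)"
        using gaussian_fourier(2)[of "0::real^'n"] by (simp add: gaussian_def)
      then show ?thesis by (subst integral_mult_left_zero) simp
    qed
    finally have "I \<longlonglongrightarrow> of_real (sqrt (2 * pi) ^ ?d) * (of_real (sqrt (2 * pi) ^ ?d) * \<phi> x)"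
      unfolding Ieq[abs_def] by (rule tendsto_mult_left)
    moreover have "sqrt (2 * pi) ^ ?d * sqrt (2 * pi) ^ ?d = (2 * pi) ^ ?d"
      by (simp only: power_mult_distrib[symmetric] real_sqrt_mult_self) simp
    ultimately show ?thesis by (simp only: mult.assoc[symmetric] of_real_mult[symmetric])
  qed
  ultimately have "(LINT \<xi>|lborel. cis (x \<bullet> \<xi>) * fourier \<phi> \<xi>) = of_real ((2 * pi) ^ ?d) * \<phi> x"
    by (rule LIMSEQ_unique)
  then show ?thesis by (simp add: inv_fourier_def)
qed

section \<open>Uniqueness of the Fourier transform off the origin\<close>

text \<open>The cutoffs \<open>exp (- c / x)\<close> and their derivatives are multiples by polynomials in \<open>1 / x\<close>. Products
  of such cutoffs are test functions that converge to indicators of boxes as \<open>c\<close> tends to \<open>0\<close>.\<close>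

definition exp_cutoff :: "real \<Rightarrow> real poly \<Rightarrow> real \<Rightarrow> real" where
  "exp_cutoff c p x = (if 0 < x then poly p (1 / x) * exp (- c / x) else 0)"

text \<open>With y = 1 / x, whose derivative is - y^2, differentiating p(y) exp (- c y) gives y^2 (c
  p(y) - p'(y)) exp (- c y).\<close>

definition cutoff_deriv :: "real \<Rightarrow> real poly \<Rightarrow> real poly" where
  "cutoff_deriv c p = [:0, 0, 1:] * (smult c p - pderiv p)"

lemma poly_times_exp_tendsto_0:
  fixes p :: "real poly"
  assumes "0 < c"
  shows "((\<lambda>y. poly p y * exp (- (c * y))) \<longlongrightarrow> 0) at_top"
proof -
  have mono: "((\<lambda>y. y ^ k * exp (- (c * y))) \<longlongrightarrow> 0) at_top" for k
  proof -
    have "filterlim (\<lambda>y. c * y) at_top at_top"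
      using assms by (intro filterlim_tendsto_pos_mult_at_top[OF tendsto_const] filterlim_ident)
    from filterlim_compose[OF tendsto_power_div_exp_0 this, of k]
    have "((\<lambda>y. (1 / c ^ k) * ((c * y) ^ k / exp (c * y))) \<longlongrightarrow> (1 / c ^ k) * 0) at_top"
      by (intro tendsto_mult_left)
    moreover have "(1 / c ^ k) * ((c * y) ^ k / exp (c * y)) = y ^ k * exp (- (c * y))" for y
      using assms by (simp add: power_mult_distrib exp_minus field_simps)
    ultimately show ?thesis by simp
  qed
  have "((\<lambda>y. \<Sum>k\<le>degree p. coeff p k * (y ^ k * exp (- (c * y)))) \<longlongrightarrow> (\<Sum>k\<le>degree p. coeff p k * 0)) at_top"
    by (intro tendsto_sum tendsto_mult_left mono)
  then show ?thesis by (simp add: poly_altdef sum_distrib_right mult.assoc)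
qed

text \<open>The origin is the only delicate point: the difference quotient there is again a
  polynomial in 1 / x times the exponential, and it tends to 0 from the right.\<close>

lemma exp_cutoff_has_derivative:
  assumes c: "0 < c"
  shows "(exp_cutoff c p has_real_derivative exp_cutoff c (cutoff_deriv c p) x) (at x)"
proof (cases x "0::real" rule: linorder_cases)
  case less
  have "((\<lambda>_. 0) has_real_derivative 0) (at x)" by simp
  then have "(exp_cutoff c p has_real_derivative 0) (at x)"
    by (rule has_field_derivative_transform_within_open[of _ _ _ "{..<0}"])
      (use less in \<open>auto simp: exp_cutoff_def\<close>)
  then show ?thesis using less by (simp add: exp_cutoff_def)
next
  case greater
  have "((\<lambda>x. poly p (1 / x) * exp (- c / x)) has_real_derivative
      poly (pderiv p) (1 / x) * (- (1 / x\<^sup>2)) * exp (- c / x) + poly p (1 / x) * (exp (- c / x) * (c / x\<^sup>2))) (at x)"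
    using greater by (auto intro!: derivative_eq_intros poly_DERIV[THEN DERIV_chain2] simp: power2_eq_square field_simps)
  also have "poly (pderiv p) (1 / x) * (- (1 / x\<^sup>2)) * exp (- c / x) + poly p (1 / x) * (exp (- c / x) * (c / x\<^sup>2))
      = exp_cutoff c (cutoff_deriv c p) x"
    using greater by (simp add: exp_cutoff_def cutoff_deriv_def field_simps power2_eq_square)
  finally show ?thesis
    by (rule has_field_derivative_transform_within_open[of _ _ _ "{0<..}"])
      (use greater in \<open>auto simp: exp_cutoff_def\<close>)
next
  case equal
  have "((\<lambda>h. exp_cutoff c p h / h) \<longlongrightarrow> 0) (at 0)"
  proof (rule filterlim_split_at)
    show "((\<lambda>h. exp_cutoff c p h / h) \<longlongrightarrow> 0) (at_left 0)"
      by (rule tendsto_eventually) (auto simp: eventually_at_filter exp_cutoff_def)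
    have "((\<lambda>h. poly ([:0, 1:] * p) (inverse h) * exp (- (c * inverse h))) \<longlongrightarrow> 0) (at_right 0)"
      by (rule filterlim_compose[OF poly_times_exp_tendsto_0[OF c] filterlim_inverse_at_top_right])
    moreover have "\<forall>\<^sub>F h in at_right (0::real). poly ([:0, 1:] * p) (inverse h) * exp (- (c * inverse h)) = exp_cutoff c p h / h"
      by (auto simp: eventually_at_filter exp_cutoff_def field_simps)
    ultimately show "((\<lambda>h. exp_cutoff c p h / h) \<longlongrightarrow> 0) (at_right 0)"
      by (rule Lim_transform_eventually)
  qed
  then show ?thesis using equal by (simp add: DERIV_def exp_cutoff_def)
qed

definition bump_sum :: "real \<Rightarrow> real \<Rightarrow> real \<Rightarrow> (real poly \<times> real poly) list \<Rightarrow> real \<Rightarrow> real" where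
  "bump_sum c a b L x = (\<Sum>(p, q)\<leftarrow>L. exp_cutoff c p (x - a) * exp_cutoff c q (b - x))"

definition bump_sum_deriv :: "real \<Rightarrow> (real poly \<times> real poly) list \<Rightarrow> (real poly \<times> real poly) list" where
  "bump_sum_deriv c L = concat (map (\<lambda>(p, q). [(cutoff_deriv c p, q), (- p, cutoff_deriv c q)]) L)"

lemma bump_sum_has_derivative:
  assumes c: "0 < c"
  shows "(bump_sum c a b L has_real_derivative bump_sum c a b (bump_sum_deriv c L) x) (at x)"
proof (induction L)
  case Nil
  then show ?case by (simp add: bump_sum_def[abs_def] bump_sum_deriv_def)
next
  case (Cons pq L)
  obtain p q where pq: "pq = (p, q)" by (cases pq)
  have 1: "((\<lambda>x. exp_cutoff c p (x - a)) has_real_derivative exp_cutoff c (cutoff_deriv c p) (x - a)) (at x)"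
  proof -
    have "((\<lambda>x. x - a) has_real_derivative 1) (at x)" by (auto intro!: derivative_eq_intros)
    from DERIV_chain2[OF exp_cutoff_has_derivative[OF c] this] show ?thesis by simp
  qed
  have 2: "((\<lambda>x. exp_cutoff c q (b - x)) has_real_derivative - exp_cutoff c (cutoff_deriv c q) (b - x)) (at x)"
  proof -
    have "((\<lambda>x. b - x) has_real_derivative - 1) (at x)" by (auto intro!: derivative_eq_intros)
    from DERIV_chain2[OF exp_cutoff_has_derivative[OF c] this] show ?thesis by simp
  qed
  have "(bump_sum c a b (pq # L)) = (\<lambda>x. exp_cutoff c p (x - a) * exp_cutoff c q (b - x) + bump_sum c a b L x)"
    by (simp add: pq bump_sum_def fun_eq_iff)
  moreover have "exp_cutoff c (- p) y = - exp_cutoff c p y" for y by (simp add: exp_cutoff_def)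
  ultimately show ?case
    using DERIV_add[OF DERIV_mult[OF 1 2] Cons]
    by (simp add: pq bump_sum_deriv_def bump_sum_def algebra_simps)
qed

lemma bump_sum_outside: "x \<le> a \<or> b \<le> x \<Longrightarrow> bump_sum c a b L x = 0"
  by (induction L) (auto simp: bump_sum_def exp_cutoff_def)

text \<open>A derivative in direction \<open>i\<close> changes only the list attached to coordinate
  \<open>i\<close>, so products with arbitrary lists form a class closed under \<open>pd\<close>.
  Their compact support gives the decay.\<close>

lemma schwartz_bump:
  fixes a b :: "real^'n::finite"
  assumes c: "0 < c"
  shows "schwartz (\<lambda>x. complex_of_real (\<Prod>j\<in>UNIV. bump_sum c (a $ j) (b $ j) (L j) (x $ j)))"
proof (rule schwartz_coinduct[where X = "\<lambda>\<eta>. \<exists>L. \<eta> = (\<lambda>x. complex_of_real (\<Prod>j\<in>UNIV. bump_sum c (a $ j) (b $ j) (L j) (x $ j)))"])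
  fix \<eta> :: "real^'n \<Rightarrow> complex" and i :: 'n and N :: nat and x
  assume "\<exists>L. \<eta> = (\<lambda>x. complex_of_real (\<Prod>j\<in>UNIV. bump_sum c (a $ j) (b $ j) (L j) (x $ j)))"
  then obtain L where L: "\<eta> = (\<lambda>x. complex_of_real (\<Prod>j\<in>UNIV. bump_sum c (a $ j) (b $ j) (L j) (x $ j)))" by blast
  define h where "h j = bump_sum c (a $ j) (b $ j) (L j)" for j
  define h' where "h' j = bump_sum c (a $ j) (b $ j) (bump_sum_deriv c (L j))" for j
  have "((\<lambda>x. h j (x $ j)) has_derivative (\<lambda>y. h' j (x $ j) * (y $ j))) (at x)" for j and x :: "real^'n"
  proof -
    have 1: "((\<lambda>x::real^'n. x $ j) has_derivative (\<lambda>y. y $ j)) (at x)"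
      by (rule bounded_linear_imp_has_derivative[OF bounded_linear_vec_nth])
    have 2: "(h j has_derivative (\<lambda>y. h' j (x $ j) * y)) (at (x $ j))"
      using bump_sum_has_derivative[OF c] unfolding h_def h'_def has_field_derivative_def by blast
    show ?thesis by (rule has_derivative_compose[OF 1 2])
  qed
  then have "((\<lambda>x. \<Prod>j\<in>UNIV. h j (x $ j)) has_derivative
      (\<lambda>y. \<Sum>i\<in>UNIV. h' i (x $ i) * (y $ i) * (\<Prod>j\<in>UNIV - {i}. h j (x $ j)))) (at x)" for x :: "real^'n"
    by (intro has_derivative_prod) auto
  from has_derivative_of_real[OF this]
  have der: "(\<eta> has_derivative (\<lambda>y. complex_of_real (\<Sum>i\<in>UNIV. h' i (x $ i) * (y $ i) * (\<Prod>j\<in>UNIV - {i}. h j (x $ j))))) (at x)" for x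
    unfolding L h_def[symmetric] .
  show "\<eta> differentiable at x" using der by (auto simp: differentiable_def)
  have cont: "continuous_on UNIV \<eta>"
    by (meson der continuous_at_imp_continuous_on has_derivative_continuous)
  have out: "\<eta> x = 0" if nb: "x \<notin> cbox a b" for x
  proof -
    obtain j where "\<not> (a $ j \<le> x $ j \<and> x $ j \<le> b $ j)" using nb unfolding mem_box_cart by blast
    then have "bump_sum c (a $ j) (b $ j) (L j) (x $ j) = 0" by (intro bump_sum_outside) auto
    then show ?thesis unfolding L by (auto intro!: prod_zero)
  qed
  have "bounded ((\<lambda>x. (1 + norm x) ^ N *\<^sub>R \<eta> x) ` cbox a b)"
    by (intro compact_imp_bounded compact_continuous_image compact_cbox continuous_intros continuous_on_subset[OF cont]) auto
  then obtain B where B: "\<And>x. x \<in> cbox a b \<Longrightarrow> (1 + norm x) ^ N * norm (\<eta> x) \<le> B"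
    by (auto simp: bounded_iff abs_mult)
  have "(1 + norm x) ^ N * norm (\<eta> x) \<le> max B 0" for x
    using B[of x] out[of x] by (cases "x \<in> cbox a b") auto
  then show "\<exists>B. \<forall>x. (1 + norm x) ^ N * norm (\<eta> x) \<le> B" by blast
  have "pd i \<eta> x = complex_of_real (\<Prod>j\<in>UNIV. bump_sum c (a $ j) (b $ j) ((L(i := bump_sum_deriv c (L i))) j) (x $ j))" for x
  proof -
    have "pd i \<eta> x = complex_of_real (\<Sum>k\<in>UNIV. h' k (x $ k) * (axis i 1 $ k) * (\<Prod>j\<in>UNIV - {k}. h j (x $ j)))"
      by (rule pd_eqI[OF der])
    also have "(\<Sum>k\<in>UNIV. h' k (x $ k) * (axis i 1 $ k) * (\<Prod>j\<in>UNIV - {k}. h j (x $ j))) = h' i (x $ i) * (\<Prod>j\<in>UNIV - {i}. h j (x $ j))"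
      by (subst sum.remove[of _ i]) (auto simp: axis_def)
    also have "\<dots> = (\<Prod>j\<in>UNIV. bump_sum c (a $ j) (b $ j) ((L(i := bump_sum_deriv c (L i))) j) (x $ j))"
      by (subst prod.remove[of UNIV i]) (auto simp: h_def h'_def intro!: prod.cong)
    finally show ?thesis .
  qed
  then show "\<exists>L. pd i \<eta> = (\<lambda>x. complex_of_real (\<Prod>j\<in>UNIV. bump_sum c (a $ j) (b $ j) (L j) (x $ j)))"
    by blast
qed blast

definition box_bump :: "real \<Rightarrow> real^'n::finite \<Rightarrow> real^'n \<Rightarrow> real^'n \<Rightarrow> complex" where
  "box_bump c a b x = complex_of_real (\<Prod>j\<in>UNIV. bump_sum c (a $ j) (b $ j) [(1, 1)] (x $ j))"

lemma box_bump_schwartz: "0 < c \<Longrightarrow> schwartz (box_bump c a b)"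
  using schwartz_bump[of c a b "\<lambda>_. [(1, 1)]"] by (simp add: box_bump_def[abs_def])

lemma bump_one: "bump_sum c a b [(1, 1)] x = (if a < x \<and> x < b then exp (- c / (x - a)) * exp (- c / (b - x)) else 0)"
  by (simp add: bump_sum_def exp_cutoff_def)

lemma box_bump_outside: "x \<notin> box a b \<Longrightarrow> box_bump c a b x = 0"
  by (auto simp: box_bump_def bump_one mem_box_cart not_less intro!: prod_zero)

lemma box_bump_le_one: "0 < c \<Longrightarrow> norm (box_bump c a b x) \<le> 1"
proof -
  assume c: "0 < c"
  have "0 \<le> bump_sum c (a $ j) (b $ j) [(1, 1)] (x $ j) \<and> bump_sum c (a $ j) (b $ j) [(1, 1)] (x $ j) \<le> 1" for j
    using c by (auto simp: bump_one intro!: mult_le_one)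
  then have "(\<Prod>j\<in>UNIV. bump_sum c (a $ j) (b $ j) [(1, 1)] (x $ j)) \<le> 1"
    "0 \<le> (\<Prod>j\<in>UNIV. bump_sum c (a $ j) (b $ j) [(1, 1)] (x $ j))"
    by (auto intro: prod_le_1 prod_nonneg)
  then show ?thesis unfolding box_bump_def norm_of_real by simp
qed

lemma box_bump_tendsto:
  "(\<lambda>n. box_bump (1 / Suc n) a b x) \<longlonglongrightarrow> indicator (box a b) x"
proof (cases "x \<in> box a b")
  case True
  then have x: "a $ j < x $ j" "x $ j < b $ j" for j by (auto simp: mem_box_cart)
  have "(\<lambda>n. complex_of_real (\<Prod>j\<in>UNIV. exp (- (1 / Suc n) / (x $ j - a $ j)) * exp (- (1 / Suc n) / (b $ j - x $ j))))
      \<longlonglongrightarrow> complex_of_real (\<Prod>j\<in>UNIV. exp (- 0 / (x $ j - a $ j)) * exp (- 0 / (b $ j - x $ j)))"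
  proof -
    have ne: "x $ j - a $ j \<noteq> 0" "b $ j - x $ j \<noteq> 0" for j using x[of j] by auto
    have "(\<lambda>n. 1 / real (Suc n)) \<longlonglongrightarrow> 0" by (rule LIMSEQ_Suc[OF lim_1_over_n])
    then show ?thesis by (intro tendsto_intros ne)
  qed
  then show ?thesis using True x by (simp add: box_bump_def bump_one)
qed (simp add: box_bump_outside)

text \<open>Boxes are stable under intersection and generate the Borel sets, so vanishing integrals
  extend to all Borel sets by a Dynkin argument, with \<open>total\<close> accounting for
  complements.\<close>

lemma AE_zero_if_box_integrals_zero:
  fixes e :: "'a::euclidean_space \<Rightarrow> 'b::{banach, second_countable_topology}"
  assumes e: "integrable lborel e" and box: "\<And>a b. (LINT x:box a b|lborel. e x) = 0"
    and total: "(LINT x|lborel. e x) = 0"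
  shows "AE x in lborel. e x = 0"
proof (rule sigma_finite_measure.density_zero[OF lborel.sigma_finite_measure_axioms e])
  fix A :: "'a set" assume A: "A \<in> sets lborel"
  let ?G = "range (\<lambda>(a, b). box a b :: 'a set)"
  have si: "set_integrable lborel S e" if "S \<in> sets borel" for S
    unfolding set_integrable_def using e that by (intro integrable_mult_indicator) auto
  have G: "Int_stable ?G" by (auto simp: Int_stable_def box_Int_box)
  have "A \<in> sigma_sets UNIV ?G" using A by (simp add: borel_eq_box)
  with G subset_UNIV[of ?G, unfolded Pow_UNIV[symmetric]] show "(LINT x:A|lborel. e x) = 0"
  proof (induction A rule: sigma_sets_induct_disjoint)
    case (compl A)
    then have Am: "A \<in> sets borel" by (simp add: borel_eq_box)
    have "(LINT x:UNIV - A|lborel. e x) = (LINT x|lborel. e x) - (LINT x:A|lborel. e x)"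
    proof -
      have "(LINT x:UNIV - A|lborel. e x) = (LINT x|lborel. e x - indicator A x *\<^sub>R e x)"
        unfolding set_lebesgue_integral_def by (intro Bochner_Integration.integral_cong) (auto simp: indicator_def)
      then show ?thesis
        using si[OF Am] e by (simp add: set_lebesgue_integral_def set_integrable_def)
    qed
    then show ?case using compl total by simp
  next
    case (union F)
    then have Fm: "F i \<in> sets borel" for i by (auto simp: borel_eq_box)
    have "(LINT x:(\<Union>i. F i)|lborel. e x) = (\<Sum>i. LINT x:F i|lborel. e x)"
      using union(1) Fm by (intro lebesgue_integral_countable_add si) (auto simp: disjoint_family_on_def)
    then show ?case using union by simp
  qed (use box in \<open>auto simp: set_lebesgue_integral_def\<close>)
qed

text \<open>No local integrability of \<open>d\<close> is given. It is extracted from the pairing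
  with a bump that is bounded below on a slightly smaller box. Bumps tending to indicators then show
  that box integrals vanish, first for boxes away from the origin, and countably many of these cover
  all points but the origin.\<close>

lemma AE_zero_off_origin:
  fixes d :: "real^'n::finite \<Rightarrow> complex"
  assumes [measurable]: "d \<in> borel_measurable borel"
    and d: "\<And>\<phi> r R. schwartz \<phi> \<Longrightarrow> 0 < r \<Longrightarrow> (\<forall>\<xi>. norm \<xi> < r \<or> R < norm \<xi> \<longrightarrow> \<phi> \<xi> = 0) \<Longrightarrow>
      integrable lborel (\<lambda>\<xi>. d \<xi> * \<phi> \<xi>) \<and> (LINT \<xi>|lborel. d \<xi> * \<phi> \<xi>) = 0"
  shows "AE \<xi> in lborel. d \<xi> = 0"
proof -
  \<comment> \<open>Some coordinate keeps one sign and a positive distance from 0 on such a box, so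
    bumps supported there vanish near the origin. The condition is inherited by smaller
    boxes.\<close>
  define good where "good a b \<longleftrightarrow> (\<exists>i. 0 < a $ i \<or> b $ i < 0)" for a b :: "real^'n"
  have test: "integrable lborel (\<lambda>\<xi>. d \<xi> * box_bump c a b \<xi>) \<and> (LINT \<xi>|lborel. d \<xi> * box_bump c a b \<xi>) = 0"
    if g: "good a b" and c: "0 < c" for a b c
  proof -
    obtain i where i: "0 < a $ i \<or> b $ i < 0" using g by (auto simp: good_def)
    obtain R where R: "\<And>x. x \<in> box a b \<Longrightarrow> norm x \<le> R"
      using bounded_box[of a b] by (auto simp: bounded_iff)
    define r where "r = (if 0 < a $ i then a $ i else - (b $ i))"
    have "0 < r" using i by (auto simp: r_def)
    moreover have "box_bump c a b \<xi> = 0" if "norm \<xi> < r \<or> R < norm \<xi>" for \<xi>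
    proof (rule box_bump_outside, rule notI)
      assume x: "\<xi> \<in> box a b"
      then have "r \<le> \<bar>\<xi> $ i\<bar>" using i by (auto simp: r_def mem_box_cart less_imp_le abs_if dest: spec[of _ i])
        (use x[unfolded mem_box_cart] in \<open>metis (no_types) less_trans less_imp_le neg_less_0_iff_less not_less_iff_gr_or_eq\<close>)?
      then show False using that R[OF x] component_le_norm_cart[of \<xi> i] by linarith
    qed
    ultimately show ?thesis using d[OF box_bump_schwartz[OF c]] by blast
  qed
  have loc: "integrable lborel (\<lambda>x. indicator (cbox a b) x *\<^sub>R d x)" if g: "good a b" for a b
  proof -
    obtain i where i: "0 < a $ i \<or> b $ i < 0" using g by (auto simp: good_def)
    \<comment> \<open>Half the distance to the coordinate hyperplane: a box enlarged by
      \<open>h\<close> on all sides is still good.\<close>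
    define h where "h = (if 0 < a $ i then a $ i else - (b $ i)) / 2"
    have h: "0 < h" using i by (auto simp: h_def)
    define a' b' where "a' = (\<chi> j. a $ j - h)" and "b' = (\<chi> j. b $ j + h)"
    have g': "good a' b'" unfolding good_def using i h by (intro exI[of _ i]) (auto simp: a'_def b'_def h_def split: if_splits)
    define m where "m = (\<Prod>j\<in>(UNIV::'n set). exp (- 1 / h) * exp (- 1 / h))"
    have m: "0 < m" by (auto simp: m_def intro!: prod_pos)
    have low: "m \<le> norm (box_bump 1 a' b' x)" if "x \<in> cbox a b" for x
    proof -
      have x: "h \<le> x $ j - a' $ j" "h \<le> b' $ j - x $ j" for j
        using that by (auto simp: mem_box_cart a'_def b'_def)
      then have x': "a' $ j < x $ j" "x $ j < b' $ j" for j using h by (smt (verit))+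
      have "m \<le> (\<Prod>j\<in>UNIV. exp (- 1 / (x $ j - a' $ j)) * exp (- 1 / (b' $ j - x $ j)))"
      proof -
        have e: "exp (- 1 / h) \<le> exp (- 1 / y)" if "h \<le> y" for y
          using divide_left_mono[of h y 1] h that by (simp add: mult_pos_pos less_le_trans)
        then show ?thesis unfolding m_def by (intro prod_mono conjI mult_mono e x) auto
      qed
      also have "\<dots> \<le> norm (box_bump 1 a' b' x)"
      proof -
        have "box_bump 1 a' b' x = of_real (\<Prod>j\<in>UNIV. exp (- 1 / (x $ j - a' $ j)) * exp (- 1 / (b' $ j - x $ j)))"
          unfolding box_bump_def bump_one using x' by simp
        then show ?thesis by (simp only: norm_of_real abs_ge_self)
      qed
      finally show ?thesis .
    qed
    have "integrable lborel (\<lambda>x. d x * box_bump 1 a' b' x)" using test[OF g', of 1] by simp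
    then have "integrable lborel (\<lambda>x. (1 / m) *\<^sub>R (d x * box_bump 1 a' b' x))" by (rule integrable_scaleR_right)
    then show ?thesis
    proof (rule Bochner_Integration.integrable_bound)
      show "AE x in lborel. norm (indicat_real (cbox a b) x *\<^sub>R d x) \<le> norm ((1 / m) *\<^sub>R (d x * box_bump 1 a' b' x))"
      proof (rule AE_I2)
        fix x
        show "norm (indicat_real (cbox a b) x *\<^sub>R d x) \<le> norm ((1 / m) *\<^sub>R (d x * box_bump 1 a' b' x))"
        proof (cases "x \<in> cbox a b")
          case True
          have "norm (d x) * m \<le> norm (d x) * norm (box_bump 1 a' b' x)"
            by (intro mult_left_mono low True) auto
          then show ?thesis using True m by (simp add: norm_mult field_simps)
        qed simp
      qed
    qed measurable
  qed
  have zero: "(LINT x|lborel. indicat_real (box a b) x *\<^sub>R d x) = 0" if g: "good a b" for a b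
  proof -
    have "(\<lambda>n. LINT x|lborel. d x * box_bump (1 / Suc n) a b x) \<longlonglongrightarrow> (LINT x|lborel. d x * indicator (box a b) x)"
    proof (rule integral_dominated_convergence)
      show "(\<lambda>x. d x * indicator (box a b) x) \<in> borel_measurable lborel" by measurable
      show "(\<lambda>x. d x * box_bump (1 / Suc n) a b x) \<in> borel_measurable lborel" for n
        using schwartz_measurable[OF box_bump_schwartz[of "1 / Suc n" a b]] by measurable
      show "integrable lborel (\<lambda>x. norm (indicator (cbox a b) x *\<^sub>R d x))" by (intro integrable_norm loc g)
      show "AE x in lborel. (\<lambda>n. d x * box_bump (1 / Suc n) a b x) \<longlonglongrightarrow> d x * indicator (box a b) x"
        by (intro AE_I2 tendsto_mult_left box_bump_tendsto)
      show "AE x in lborel. norm (d x * box_bump (1 / Suc n) a b x) \<le> norm (indicat_real (cbox a b) x *\<^sub>R d x)" for n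
      proof (rule AE_I2)
        fix x
        show "norm (d x * box_bump (1 / Suc n) a b x) \<le> norm (indicat_real (cbox a b) x *\<^sub>R d x)"
        proof (cases "x \<in> box a b")
          case True
          then have "x \<in> cbox a b" using box_subset_cbox by blast
          then show ?thesis using box_bump_le_one[of "1 / Suc n" a b x] by (simp add: norm_mult mult_left_le)
        qed (simp add: box_bump_outside)
      qed
    qed
    then have "(LINT x|lborel. d x * indicator (box a b) x) = 0"
      using test[OF g] by (simp add: LIMSEQ_const_iff)
    moreover have "(\<lambda>x. d x * indicator (box a b) x) = (\<lambda>x. indicat_real (box a b) x *\<^sub>R d x)"
      by (auto simp: indicator_def)
    ultimately show ?thesis by simp
  qed
  have good_zero: "AE x in lborel. x \<in> box a b \<longrightarrow> d x = 0" if g: "good a b" for a b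
  proof -
    let ?e = "\<lambda>x. indicat_real (box a b) x *\<^sub>R d x"
    have "AE x in lborel. ?e x = 0"
    proof (rule AE_zero_if_box_integrals_zero)
      show "integrable lborel ?e"
        by (rule Bochner_Integration.integrable_bound[OF loc[OF g]])
          (use box_subset_cbox[of a b] in \<open>auto simp: indicator_def\<close>)
      show "(LINT x|lborel. ?e x) = 0" by (rule zero[OF g])
      fix u v :: "real^'n"
      define u' v' where "u' = (\<chi> j. max (a $ j) (u $ j))" and "v' = (\<chi> j. min (b $ j) (v $ j))"
      have "good u' v'" using g by (auto simp: good_def u'_def v'_def less_max_iff_disj min_less_iff_disj)
      have "(LINT x:box u v|lborel. ?e x) = (LINT x|lborel. indicat_real (box u' v') x *\<^sub>R d x)"
        unfolding set_lebesgue_integral_def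
        by (intro Bochner_Integration.integral_cong) (auto simp: indicator_def mem_box_cart u'_def v'_def)
      also have "\<dots> = 0" by (rule zero[OF \<open>good u' v'\<close>])
      finally show "(LINT x:box u v|lborel. ?e x) = 0" .
    qed
    then show ?thesis by eventually_elim (auto simp: indicator_def split: if_splits)
  qed
  \<comment> \<open>In these boxes one coordinate exceeds \<open>1 / Suc n\<close> in modulus with a
    fixed sign and all coordinates stay below \<open>n\<close>; over all \<open>n\<close> and
    \<open>i\<close> they exhaust the complement of the origin.\<close>
  have "AE x in lborel. \<forall>n::nat. \<forall>i\<in>UNIV.
      (x \<in> box (\<chi> j. if j = i then 1 / Suc n else - real n) (\<chi> j. real n) \<longrightarrow> d x = 0) \<and>
      (x \<in> box (\<chi> j. - real n) (\<chi> j. if j = i then - (1 / Suc n) else real n) \<longrightarrow> d x = 0)"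
    by (subst AE_all_countable, intro allI AE_finite_allI finite_UNIV AE_conjI good_zero)
      (auto simp: good_def intro: exI[of _ "_"])
  with AE_lborel_singleton[of "0::real^'n"] show ?thesis
  proof eventually_elim
    case (elim x)
    then obtain i where i: "x $ i \<noteq> 0" by (metis vec_eq_iff zero_index)
    obtain n1 where n1: "1 / real (Suc n1) < \<bar>x $ i\<bar>" using nat_approx_posE[of "\<bar>x $ i\<bar>"] i by auto
    obtain n2 where n2: "norm x < real n2" using reals_Archimedean2 by blast
    define n where "n = max n1 n2"
    have "1 / real (Suc n) \<le> 1 / real (Suc n1)" by (intro divide_left_mono) (auto simp: n_def)
    then have a: "1 / real (Suc n) < \<bar>x $ i\<bar>" using n1 by linarith
    have b: "\<bar>x $ j\<bar> < real n" for j using component_le_norm_cart[of x j] n2 by (auto simp: n_def)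
    have "x \<in> box (\<chi> j. if j = i then 1 / Suc n else - real n) (\<chi> j. real n) \<or>
        x \<in> box (\<chi> j. - real n) (\<chi> j. if j = i then - (1 / Suc n) else real n)"
    proof (cases "0 < x $ i")
      case True
      have "x \<in> box (\<chi> j. if j = i then 1 / Suc n else - real n) (\<chi> j. real n)"
        unfolding mem_box_cart
      proof (intro allI conjI)
        fix j show "(\<chi> j. if j = i then 1 / Suc n else - real n) $ j < x $ j" "x $ j < (\<chi> j. real n) $ j"
          using a True b[of j] by (auto simp: abs_less_iff)
      qed
      then show ?thesis ..
    next
      case False
      have "x \<in> box (\<chi> j. - real n) (\<chi> j. if j = i then - (1 / Suc n) else real n)"
        unfolding mem_box_cart
      proof (intro allI conjI)
        fix j show "(\<chi> j. - real n) $ j < x $ j" "x $ j < (\<chi> j. if j = i then - (1 / Suc n) else real n) $ j"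
          using a False b[of j] by (auto simp: abs_less_iff)
      qed
      then show ?thesis ..
    qed
    then show ?case using elim(2) by blast
  qed
qed

text \<open>This makes the choice in \<open>fhat\<close> harmless: it is determined almost
  everywhere by any function known to represent the transform.\<close>

lemma fourier_off_origin_unique:
  assumes g: "fourier_off_origin T g" and g': "fourier_off_origin T g'"
  shows "AE \<xi> in lborel. g \<xi> = g' \<xi>"
proof -
  have "AE \<xi> in lborel. g \<xi> - g' \<xi> = 0"
  proof (rule AE_zero_off_origin)
    have [measurable]: "g \<in> borel_measurable borel" "g' \<in> borel_measurable borel"
      using g g' by (auto simp: fourier_off_origin_def)
    show "(\<lambda>\<xi>. g \<xi> - g' \<xi>) \<in> borel_measurable borel" by measurable
    fix \<phi> :: "real^'a \<Rightarrow> complex" and r R :: real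
    assume *: "schwartz \<phi>" "0 < r" "\<forall>\<xi>. norm \<xi> < r \<or> R < norm \<xi> \<longrightarrow> \<phi> \<xi> = 0"
    have "integrable lborel (\<lambda>\<xi>. g \<xi> * \<phi> \<xi>) \<and> dist_fourier T \<phi> = (LINT \<xi>|lborel. g \<xi> * \<phi> \<xi>)"
      "integrable lborel (\<lambda>\<xi>. g' \<xi> * \<phi> \<xi>) \<and> dist_fourier T \<phi> = (LINT \<xi>|lborel. g' \<xi> * \<phi> \<xi>)"
      using g g' * unfolding fourier_off_origin_def by blast+
    then show "integrable lborel (\<lambda>\<xi>. (g \<xi> - g' \<xi>) * \<phi> \<xi>) \<and> (LINT \<xi>|lborel. (g \<xi> - g' \<xi>) * \<phi> \<xi>) = 0"
      by (auto simp: left_diff_distrib)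
  qed
  then show ?thesis by eventually_elim simp
qed

section \<open>Distributions with prescribed Fourier transform\<close>

lemma fourier_off_origin_cong:
  assumes "\<And>\<phi>. schwartz \<phi> \<Longrightarrow> T \<phi> = T' \<phi>"
  shows "fourier_off_origin T = fourier_off_origin T'"
proof -
  have "dist_fourier T \<phi> = dist_fourier T' \<phi>" if "schwartz \<phi>" for \<phi>
    using assms[OF schwartz_fourier[OF that]] by (simp add: dist_fourier_def)
  then show ?thesis unfolding fourier_off_origin_def fun_eq_iff by auto
qed

text \<open>Functionals that agree on Schwartz functions satisfy the same defining predicate, so the
  choice operator returns the very same function and not merely an equivalent one.\<close>

lemma fhat_cong: "(\<And>\<phi>. schwartz \<phi> \<Longrightarrow> T \<phi> = T' \<phi>) \<Longrightarrow> fhat T = fhat T'"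
  unfolding fhat_def by (simp add: fourier_off_origin_cong[of T T'])

lemma tempered_cong:
  assumes "\<And>\<phi>. schwartz \<phi> \<Longrightarrow> T \<phi> = T' \<phi>"
  shows "tempered T \<longleftrightarrow> tempered T'"
proof -
  have lin: "schwartz (\<lambda>x. a * \<phi> x + b * \<psi> x)" if "schwartz \<phi>" "schwartz \<psi>" for \<phi> \<psi> :: "real^'a \<Rightarrow> complex" and a b
    using that by (intro schwartz_add schwartz_cmult)
  show ?thesis unfolding tempered_def using assms lin by auto
qed

lemma fourier_regular_cong:
  assumes "\<And>\<phi>. schwartz \<phi> \<Longrightarrow> T \<phi> = T' \<phi>"
  shows "fourier_regular T \<longleftrightarrow> fourier_regular T'"
proof -
  have "dist_fourier T \<phi> = dist_fourier T' \<phi>" if "schwartz \<phi>" for \<phi>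
    using assms[OF schwartz_fourier[OF that]] by (simp add: dist_fourier_def)
  then show ?thesis
    using tempered_cong[of T T'] fhat_cong[of T T'] fourier_off_origin_cong[of T T'] assms
    unfolding fourier_regular_def by auto
qed

lemma fhat_off_origin: "fourier_off_origin T g \<Longrightarrow> fourier_off_origin T (fhat T)"
  unfolding fhat_def by (rule someI[of "fourier_off_origin T"])

lemma fhat_AE_eq: "fourier_off_origin T g \<Longrightarrow> AE \<xi> in lborel. fhat T \<xi> = g \<xi>"
  using fourier_off_origin_unique fhat_off_origin by blast

lemma fhat_measurable: "fourier_off_origin T g \<Longrightarrow> fhat T \<in> borel_measurable borel"
  using fhat_off_origin by (auto simp: fourier_off_origin_def)

lemma tempered_fun_iff:
  fixes g :: "real^'n::finite \<Rightarrow> complex"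
  shows "tempered_fun g \<longleftrightarrow> g \<in> borel_measurable borel \<and>
    (\<exists>N. (\<integral>\<^sup>+\<xi>. ennreal (norm (g \<xi>)) * ennreal (decay N \<xi>) \<partial>lborel) < \<infinity>)"
proof -
  have "integrable lborel (\<lambda>\<xi>. g \<xi> / of_real ((1 + norm \<xi>) ^ N)) \<longleftrightarrow>
      (\<integral>\<^sup>+\<xi>. ennreal (norm (g \<xi>)) * ennreal (decay N \<xi>) \<partial>lborel) < \<infinity>"
    if [measurable]: "g \<in> borel_measurable borel" for N
  proof -
    have eq: "norm (g \<xi> / of_real ((1 + norm \<xi>) ^ N)) = norm (g \<xi>) * decay N \<xi>" for \<xi>
      unfolding norm_divide norm_of_real by (simp add: decay_def)
    show ?thesis
      unfolding integrable_iff_bounded eq by (simp add: ennreal_mult)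
  qed
  then show ?thesis unfolding tempered_fun_def by blast
qed

lemma tempered_fun_measurable: "tempered_fun g \<Longrightarrow> g \<in> borel_measurable borel"
  by (simp add: tempered_fun_def)

lemma tempered_funI:
  "g \<in> borel_measurable borel \<Longrightarrow>
    (\<integral>\<^sup>+\<xi>. ennreal (norm (g \<xi>)) * ennreal (decay N \<xi>) \<partial>lborel) < \<infinity> \<Longrightarrow> tempered_fun g"
  unfolding tempered_fun_iff by blast

text \<open>Multipliers of polynomial growth are absorbed by raising the power of the decay
  weight.\<close>

lemma tempered_fun_bound:
  assumes f: "tempered_fun f" and [measurable]: "g \<in> borel_measurable borel"
    and "AE \<xi> in lborel. norm (g \<xi>) \<le> C * (1 + norm \<xi>) ^ k * norm (f \<xi>)" "0 \<le> C"
  shows "tempered_fun g"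
proof -
  note [measurable] = tempered_fun_measurable[OF f]
  obtain N where N: "(\<integral>\<^sup>+\<xi>. ennreal (norm (f \<xi>)) * ennreal (decay N \<xi>) \<partial>lborel) < \<infinity>"
    using f unfolding tempered_fun_iff by blast
  have "(\<integral>\<^sup>+\<xi>. ennreal (norm (g \<xi>)) * ennreal (decay (N + k) \<xi>) \<partial>lborel)
      \<le> (\<integral>\<^sup>+\<xi>. ennreal C * (ennreal (norm (f \<xi>)) * ennreal (decay N \<xi>)) \<partial>lborel)"
  proof (rule nn_integral_mono_AE)
    show "AE \<xi> in lborel. ennreal (norm (g \<xi>)) * ennreal (decay (N + k) \<xi>)
      \<le> ennreal C * (ennreal (norm (f \<xi>)) * ennreal (decay N \<xi>))"
      using assms(3)
    proof eventually_elim
      case (elim \<xi>)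
      have "norm (g \<xi>) * (decay (N + k) \<xi>) \<le> (C * (1 + norm \<xi>) ^ k * norm (f \<xi>)) * (decay (N + k) \<xi>)"
        by (intro mult_right_mono elim) auto
      also have "\<dots> = C * (norm (f \<xi>) * (decay N \<xi>)) * ((1 + norm \<xi>) ^ k * decay k \<xi>)"
        unfolding decay_add by (simp only: mult_ac)
      also have "\<dots> = C * (norm (f \<xi>) * (decay N \<xi>))" by simp
      finally have "ennreal (norm (g \<xi>) * (decay (N + k) \<xi>)) \<le> ennreal (C * (norm (f \<xi>) * (decay N \<xi>)))"
        by (rule ennreal_leI)
      then show ?case using assms(4) by (simp add: ennreal_mult)
    qed
  qed
  also have "\<dots> = ennreal C * (\<integral>\<^sup>+\<xi>. ennreal (norm (f \<xi>)) * ennreal (decay N \<xi>) \<partial>lborel)"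
    by (rule nn_integral_cmult) measurable
  also have "\<dots> < \<infinity>" using N by (simp add: ennreal_mult_less_top)
  finally show ?thesis by (intro tempered_funI) auto
qed

lemma tempered_fun_cong_AE:
  assumes "tempered_fun f" "g \<in> borel_measurable borel" "AE \<xi> in lborel. g \<xi> = f \<xi>"
  shows "tempered_fun g"
  by (rule tempered_fun_bound[OF assms(1,2), of 1 0]) (use assms(3) in auto)

lemma tempered_fun_coord: "tempered_fun g \<Longrightarrow> tempered_fun (\<lambda>\<xi>. \<i> * of_real (\<xi> $ j) * g \<xi>)"
proof (rule tempered_fun_bound[of g _ 1 1])
  assume g: "tempered_fun g"
  note [measurable] = tempered_fun_measurable[OF g]
  show "(\<lambda>\<xi>. \<i> * of_real (\<xi> $ j) * g \<xi>) \<in> borel_measurable borel" by measurable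
  show "AE \<xi> in lborel. norm (\<i> * of_real (\<xi> $ j) * g \<xi>) \<le> 1 * (1 + norm \<xi>) ^ 1 * norm (g \<xi>)"
    by (intro AE_I2) (auto simp: norm_mult intro!: mult_right_mono order_trans[OF component_le_norm_cart])
qed auto

lemma tempered_fun_zero: "tempered_fun (\<lambda>_. 0)"
  by (rule tempered_funI[of _ 0]) auto

lemma tempered_fun_add:
  assumes f: "tempered_fun f" and g: "tempered_fun g"
  shows "tempered_fun (\<lambda>\<xi>. f \<xi> + g \<xi>)"
proof -
  note [measurable] = tempered_fun_measurable[OF f] tempered_fun_measurable[OF g]
  obtain N where N: "(\<integral>\<^sup>+\<xi>. ennreal (norm (f \<xi>)) * ennreal (decay N \<xi>) \<partial>lborel) < \<infinity>"
    using f unfolding tempered_fun_iff by blast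
  obtain M where M: "(\<integral>\<^sup>+\<xi>. ennreal (norm (g \<xi>)) * ennreal (decay M \<xi>) \<partial>lborel) < \<infinity>"
    using g unfolding tempered_fun_iff by blast
  have dec: "ennreal (decay (N + M) \<xi>) \<le> ennreal (decay K \<xi>)" if "K \<le> N + M" for K and \<xi> :: "real^'a"
    using that by (intro ennreal_leI decay_antimono)
  have "(\<integral>\<^sup>+\<xi>. ennreal (norm (f \<xi> + g \<xi>)) * ennreal (decay (N + M) \<xi>) \<partial>lborel)
      \<le> (\<integral>\<^sup>+\<xi>. ennreal (norm (f \<xi>)) * ennreal (decay N \<xi>) + ennreal (norm (g \<xi>)) * ennreal (decay M \<xi>) \<partial>lborel)"
  proof (rule nn_integral_mono)
    fix \<xi> :: "real^'a"
    have "ennreal (norm (f \<xi> + g \<xi>)) \<le> ennreal (norm (f \<xi>)) + ennreal (norm (g \<xi>))"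
      by (simp add: ennreal_plus[symmetric] norm_triangle_ineq ennreal_leI del: ennreal_plus)
    then have "ennreal (norm (f \<xi> + g \<xi>)) * ennreal (decay (N + M) \<xi>)
        \<le> (ennreal (norm (f \<xi>)) + ennreal (norm (g \<xi>))) * ennreal (decay (N + M) \<xi>)"
      by (rule mult_right_mono) simp
    also have "\<dots> \<le> ennreal (norm (f \<xi>)) * ennreal (decay N \<xi>) + ennreal (norm (g \<xi>)) * ennreal (decay M \<xi>)"
      unfolding distrib_right by (intro add_mono mult_left_mono dec) auto
    finally show "ennreal (norm (f \<xi> + g \<xi>)) * ennreal (decay (N + M) \<xi>)
      \<le> ennreal (norm (f \<xi>)) * ennreal (decay N \<xi>) + ennreal (norm (g \<xi>)) * ennreal (decay M \<xi>)" .
  qed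
  also have "\<dots> = (\<integral>\<^sup>+\<xi>. ennreal (norm (f \<xi>)) * ennreal (decay N \<xi>) \<partial>lborel) + (\<integral>\<^sup>+\<xi>. ennreal (norm (g \<xi>)) * ennreal (decay M \<xi>) \<partial>lborel)"
    by (rule nn_integral_add) measurable
  also have "\<dots> < \<infinity>" using N M by simp
  finally show ?thesis by (intro tempered_funI) auto
qed

lemma tempered_fun_sum: "finite I \<Longrightarrow> (\<And>i. i \<in> I \<Longrightarrow> tempered_fun (f i)) \<Longrightarrow> tempered_fun (\<lambda>\<xi>. \<Sum>i\<in>I. f i \<xi>)"
  by (induction I rule: finite_induct) (auto intro: tempered_fun_zero tempered_fun_add)

lemma tempered_fun_pairing:
  fixes g :: "real^'n::finite \<Rightarrow> complex"
  assumes g: "tempered_fun g" and \<phi>: "schwartz \<phi>"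
  shows "integrable lborel (\<lambda>\<xi>. g \<xi> * \<phi> \<xi>)"
proof -
  note [measurable] = tempered_fun_measurable[OF g] schwartz_measurable[OF \<phi>]
  obtain N where N: "integrable lborel (\<lambda>\<xi>. g \<xi> / of_real ((1 + norm \<xi>) ^ N))"
    using g unfolding tempered_fun_def by blast
  obtain B where B: "\<And>x. (1 + norm x) ^ N * norm (\<phi> x) \<le> B" using schwartz_bound[OF \<phi>] by blast
  from integrable_scaleR_right[OF N, of B] show ?thesis
  proof (rule Bochner_Integration.integrable_bound)
    show "AE \<xi> in lborel. norm (g \<xi> * \<phi> \<xi>) \<le> norm (B *\<^sub>R (g \<xi> / of_real ((1 + norm \<xi>) ^ N)))"
    proof (rule AE_I2)
      fix \<xi> :: "real^'n"
      have "norm (\<phi> \<xi>) \<le> B * decay N \<xi>" by (rule decay_bound[OF B])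
      also have "\<dots> \<le> \<bar>B\<bar> * decay N \<xi>" by (intro mult_right_mono) auto
      finally have le: "norm (g \<xi>) * norm (\<phi> \<xi>) \<le> norm (g \<xi>) * (\<bar>B\<bar> * decay N \<xi>)"
        by (rule mult_left_mono) simp
      have eq: "norm (B *\<^sub>R (g \<xi> / of_real ((1 + norm \<xi>) ^ N))) = norm (g \<xi>) * (\<bar>B\<bar> * decay N \<xi>)"
        unfolding norm_scaleR norm_divide norm_of_real by (simp add: decay_def)
      show "norm (g \<xi> * \<phi> \<xi>) \<le> norm (B *\<^sub>R (g \<xi> / of_real ((1 + norm \<xi>) ^ N)))"
        unfolding eq norm_mult by (rule le)
    qed
  qed measurable
qed

lemma tempered_dist_inv_fourier:
  fixes g :: "real^'n::finite \<Rightarrow> complex"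
  assumes g: "tempered_fun g"
  shows "tempered (dist_inv_fourier g)"
  unfolding tempered_def
proof (intro conjI allI impI)
  fix \<phi> \<psi> :: "real^'n \<Rightarrow> complex" and a b
  assume s: "schwartz \<phi>" "schwartz \<psi>"
  note i = tempered_fun_pairing[OF g schwartz_inv_fourier[OF s(1)]] tempered_fun_pairing[OF g schwartz_inv_fourier[OF s(2)]]
  have "dist_inv_fourier g (\<lambda>x. a * \<phi> x + b * \<psi> x)
      = (LINT \<xi>|lborel. a * (g \<xi> * inv_fourier \<phi> \<xi>) + b * (g \<xi> * inv_fourier \<psi> \<xi>))"
    unfolding dist_inv_fourier_def using s by (simp add: inv_fourier_add algebra_simps)
  also have "\<dots> = a * dist_inv_fourier g \<phi> + b * dist_inv_fourier g \<psi>"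
    unfolding dist_inv_fourier_def using i by simp
  finally show "dist_inv_fourier g (\<lambda>x. a * \<phi> x + b * \<psi> x) = a * dist_inv_fourier g \<phi> + b * dist_inv_fourier g \<psi>" .
next
  note [measurable] = tempered_fun_measurable[OF g]
  obtain N where N: "integrable lborel (\<lambda>\<xi>. g \<xi> / of_real ((1 + norm \<xi>) ^ N))"
    using g unfolding tempered_fun_def by blast
  obtain C where C: "0 < C" "\<And>\<phi>::real^'n \<Rightarrow> complex. \<And>\<xi>. schwartz \<phi> \<Longrightarrow>
      (1 + norm \<xi>) ^ N * norm (inv_fourier \<phi> \<xi>) \<le> C * schwartz_seminorm (N + Suc CARD('n)) \<phi>"
    using inv_fourier_decay[of N, where 'n = 'n] by blast
  define D where "D = (LINT \<xi>|lborel. norm (g \<xi> / of_real ((1 + norm \<xi>) ^ N)))"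
  show "\<exists>C N. \<forall>\<phi>. schwartz \<phi> \<longrightarrow> norm (dist_inv_fourier g \<phi>) \<le> C * schwartz_seminorm N \<phi>"
  proof (intro exI allI impI)
    fix \<phi> :: "real^'n \<Rightarrow> complex" assume \<phi>: "schwartz \<phi>"
    let ?S = "C * schwartz_seminorm (N + Suc CARD('n)) \<phi>"
    have "norm (dist_inv_fourier g \<phi>) \<le> (LINT \<xi>|lborel. norm (g \<xi> * inv_fourier \<phi> \<xi>))"
      unfolding dist_inv_fourier_def by (rule integral_norm_bound)
    also have "\<dots> \<le> (LINT \<xi>|lborel. ?S * norm (g \<xi> / of_real ((1 + norm \<xi>) ^ N)))"
    proof (intro integral_mono integrable_norm integrable_mult_right N tempered_fun_pairing g schwartz_inv_fourier \<phi>)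
      fix \<xi> :: "real^'n"
      have "norm (g \<xi>) * norm (inv_fourier \<phi> \<xi>) \<le> norm (g \<xi>) * (?S * decay N \<xi>)"
        by (intro mult_left_mono decay_bound C(2)[OF \<phi>]) simp
      then show "norm (g \<xi> * inv_fourier \<phi> \<xi>) \<le> ?S * norm (g \<xi> / of_real ((1 + norm \<xi>) ^ N))"
        unfolding norm_mult norm_divide norm_of_real by (simp add: mult_ac decay_def)
    qed
    also have "\<dots> = C * D * schwartz_seminorm (N + Suc CARD('n)) \<phi>" by (simp add: D_def)
    finally show "norm (dist_inv_fourier g \<phi>) \<le> C * D * schwartz_seminorm (N + Suc CARD('n)) \<phi>" .
  qed
qed

text \<open>The dual form of Fourier inversion on test functions.\<close>

lemma dist_fourier_dist_inv_fourier:
  "schwartz \<phi> \<Longrightarrow> dist_fourier (dist_inv_fourier g) \<phi> = (LINT \<xi>|lborel. g \<xi> * \<phi> \<xi>)"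
  by (simp add: dist_fourier_def dist_inv_fourier_def inv_fourier_fourier)

lemma off_origin_dist_inv_fourier: "tempered_fun g \<Longrightarrow> fourier_off_origin (dist_inv_fourier g) g"
  unfolding fourier_off_origin_def
  by (auto simp: tempered_fun_measurable tempered_fun_pairing dist_fourier_dist_inv_fourier)

lemma fhat_dist_inv_fourier: "tempered_fun g \<Longrightarrow> AE \<xi> in lborel. fhat (dist_inv_fourier g) \<xi> = g \<xi>"
  by (rule fhat_AE_eq[OF off_origin_dist_inv_fourier])

lemma fourier_regular_dist_inv_fourier:
  assumes g: "tempered_fun g"
  shows "fourier_regular (dist_inv_fourier g)"
  unfolding fourier_regular_def
proof (intro conjI allI impI)
  note off = off_origin_dist_inv_fourier[OF g]
  have [measurable]: "fhat (dist_inv_fourier g) \<in> borel_measurable borel" by (rule fhat_measurable[OF off])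
  show "tempered (dist_inv_fourier g)" by (rule tempered_dist_inv_fourier[OF g])
  show "\<exists>g'. fourier_off_origin (dist_inv_fourier g) g'" using off by blast
  show "tempered_fun (fhat (dist_inv_fourier g))"
    by (rule tempered_fun_cong_AE[OF g _ fhat_dist_inv_fourier[OF g]]) measurable
  fix \<phi> :: "real^'a \<Rightarrow> complex" assume \<phi>: "schwartz \<phi>"
  note [measurable] = schwartz_measurable[OF \<phi>] tempered_fun_measurable[OF g]
  have "(LINT \<xi>|lborel. fhat (dist_inv_fourier g) \<xi> * \<phi> \<xi>) = (LINT \<xi>|lborel. g \<xi> * \<phi> \<xi>)"
    using fhat_dist_inv_fourier[OF g] by (intro integral_cong_AE) (auto elim!: eventually_mono)
  then show "dist_fourier (dist_inv_fourier g) \<phi> = (LINT \<xi>|lborel. fhat (dist_inv_fourier g) \<xi> * \<phi> \<xi>)"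
    by (simp add: dist_fourier_dist_inv_fourier[OF \<phi>])
qed

lemma dist_inv_fourier_cong_AE:
  assumes [measurable]: "f \<in> borel_measurable borel" "g \<in> borel_measurable borel"
    and eq: "AE \<xi> in lborel. f \<xi> = g \<xi>" and \<phi>: "schwartz \<phi>"
  shows "dist_inv_fourier f \<phi> = dist_inv_fourier g \<phi>"
proof -
  note [measurable] = schwartz_measurable[OF schwartz_inv_fourier[OF \<phi>]]
  show ?thesis unfolding dist_inv_fourier_def
    using eq by (intro integral_cong_AE) (auto elim!: eventually_mono)
qed

text \<open>The minus sign in the distributional derivative cancels the one that
  \<open>inv_fourier_pd\<close> produces on the test function.\<close>

lemma dist_div_dist_inv_fourier:
  fixes g :: "'n::finite \<Rightarrow> real^'n \<Rightarrow> complex"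
  assumes g: "\<And>j. tempered_fun (g j)" and \<phi>: "schwartz \<phi>"
  shows "dist_div (\<chi> j. dist_inv_fourier (g j)) \<phi> = dist_inv_fourier (\<lambda>\<xi>. \<Sum>j\<in>UNIV. \<i> * of_real (\<xi> $ j) * g j \<xi>) \<phi>"
proof -
  have i: "integrable lborel (\<lambda>\<xi>. \<i> * of_real (\<xi> $ j) * g j \<xi> * inv_fourier \<phi> \<xi>)" for j
    by (intro tempered_fun_pairing tempered_fun_coord g schwartz_inv_fourier \<phi>)
  have "dist_div (\<chi> j. dist_inv_fourier (g j)) \<phi>
      = (\<Sum>j\<in>UNIV. - (LINT \<xi>|lborel. g j \<xi> * (- \<i> * of_real (\<xi> $ j) * inv_fourier \<phi> \<xi>)))"
    unfolding dist_div_def dist_pd_def dist_inv_fourier_def by (simp only: vec_lambda_beta inv_fourier_pd[OF \<phi>])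
  also have "\<dots> = (\<Sum>j\<in>UNIV. (LINT \<xi>|lborel. \<i> * of_real (\<xi> $ j) * g j \<xi> * inv_fourier \<phi> \<xi>))"
    by (intro sum.cong refl, subst Bochner_Integration.integral_minus[symmetric])
      (auto intro!: Bochner_Integration.integral_cong)
  also have "\<dots> = (LINT \<xi>|lborel. (\<Sum>j\<in>UNIV. \<i> * of_real (\<xi> $ j) * g j \<xi> * inv_fourier \<phi> \<xi>))"
    using i by (simp only: Bochner_Integration.integral_sum)
  finally show ?thesis by (simp add: dist_inv_fourier_def sum_distrib_right)
qed

section \<open>Real distributions and Hermitian transforms\<close>

lemma integral_lborel_uminus:
  fixes h :: "'a::euclidean_space \<Rightarrow> 'b::{banach,second_countable_topology}"
  assumes [measurable]: "h \<in> borel_measurable borel"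
  shows "(LINT x|lborel. h (- x)) = (LINT x|lborel. h x)"
proof -
  have "(LINT x|lborel. h x) = (LINT x|distr lborel borel (\<lambda>x. - x). h x)"
    by (simp add: lborel_distr_uminus_euclidean)
  also have "\<dots> = (LINT x|lborel. h (- x))"
    by (subst integral_distr) auto
  finally show ?thesis by simp
qed

lemma integrable_lborel_uminus:
  fixes h :: "'a::euclidean_space \<Rightarrow> 'b::{banach,second_countable_topology}"
  assumes "integrable lborel h"
  shows "integrable lborel (\<lambda>x. h (- x))"
  by (rule integrable_distr[of uminus lborel borel]) (use assms in \<open>simp_all add: lborel_distr_uminus_euclidean\<close>)

lemma fourier_cnj:
  fixes \<phi> :: "real^'n::finite \<Rightarrow> complex"
  assumes \<phi>: "schwartz \<phi>"
  shows "fourier (\<lambda>x. cnj (\<phi> x)) \<xi> = cnj (fourier \<phi> (- \<xi>))"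
  unfolding fourier_def by (simp add: cis_cnj flip: Bochner_Integration.integral_cnj)

lemma fourier_reflect:
  fixes \<phi> :: "real^'n::finite \<Rightarrow> complex"
  assumes \<phi>: "schwartz \<phi>"
  shows "fourier (\<lambda>x. \<phi> (- x)) \<xi> = fourier \<phi> (- \<xi>)"
proof -
  have "(\<lambda>x. cis (- (x \<bullet> - \<xi>)) * \<phi> x) \<in> borel_measurable borel"
    using fourier_integrable[OF \<phi>, of "- \<xi>"] by simp
  from integral_lborel_uminus[OF this] show ?thesis by (simp add: fourier_def)
qed

text \<open>The function \<open>cnj (g (- \<xi>))\<close> represents the transform of a real
  distribution as well, and uniqueness off the origin identifies it with \<open>g\<close>.\<close>

lemma real_valued_fhat_symmetric:
  fixes T :: "'n::finite tdist"
  assumes g: "fourier_off_origin T g" and T: "real_valued T"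
  shows "AE \<xi> in lborel. g (- \<xi>) = cnj (g \<xi>)"
proof -
  have gm[measurable]: "g \<in> borel_measurable borel" using g by (simp add: fourier_off_origin_def)
  have cm: "(\<lambda>\<xi>. cnj (g (- \<xi>))) \<in> borel_measurable borel"
    by (rule measurable_compose[OF _ borel_measurable_continuous_onI[OF continuous_on_cnj[OF continuous_on_id]]]) measurable
  have "fourier_off_origin T (\<lambda>\<xi>. cnj (g (- \<xi>)))"
    unfolding fourier_off_origin_def
  proof (intro conjI allI impI cm)
    fix \<phi> :: "real^'n \<Rightarrow> complex" and r R :: real
    assume \<phi>: "schwartz \<phi>" and r: "0 < r" and z: "\<forall>\<xi>. norm \<xi> < r \<or> R < norm \<xi> \<longrightarrow> \<phi> \<xi> = 0"
    define \<psi> where "\<psi> x = cnj (\<phi> (- x))" for x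
    have \<psi>: "schwartz \<psi>" unfolding \<psi>_def[abs_def] by (intro schwartz_cnj schwartz_uminus_arg \<phi>)
    have off: "integrable lborel (\<lambda>\<xi>. g \<xi> * \<psi> \<xi>)" "dist_fourier T \<psi> = (LINT \<xi>|lborel. g \<xi> * \<psi> \<xi>)"
    proof -
      have "\<forall>\<xi>. norm \<xi> < r \<or> R < norm \<xi> \<longrightarrow> \<psi> \<xi> = 0" using z by (simp add: \<psi>_def)
      then show "integrable lborel (\<lambda>\<xi>. g \<xi> * \<psi> \<xi>)" "dist_fourier T \<psi> = (LINT \<xi>|lborel. g \<xi> * \<psi> \<xi>)"
        using g \<psi> r unfolding fourier_off_origin_def by blast+
    qed
    have eq: "cnj (g (- \<xi>)) * \<phi> \<xi> = cnj (g (- \<xi>) * \<psi> (- \<xi>))" for \<xi> by (simp add: \<psi>_def)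
    show "integrable lborel (\<lambda>\<xi>. cnj (g (- \<xi>)) * \<phi> \<xi>)"
      unfolding eq by (intro integrable_bounded_linear[OF bounded_linear_cnj] integrable_lborel_uminus[OF off(1)])
    have "fourier \<psi> x = cnj (fourier \<phi> x)" for x
      unfolding \<psi>_def[abs_def] using fourier_cnj[OF schwartz_uminus_arg[OF \<phi>]] fourier_reflect[OF \<phi>] by simp
    then have "fourier \<psi> = (\<lambda>x. cnj (fourier \<phi> x))" by (rule ext)
    then have "dist_fourier T \<psi> = cnj (dist_fourier T \<phi>)"
      using T schwartz_fourier[OF \<phi>] by (simp add: dist_fourier_def real_valued_def)
    then have "dist_fourier T \<phi> = cnj (LINT \<xi>|lborel. g \<xi> * \<psi> \<xi>)"
      using off(2) by (metis complex_cnj_cnj)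
    also have "(LINT \<xi>|lborel. g \<xi> * \<psi> \<xi>) = (LINT \<xi>|lborel. g (- \<xi>) * \<psi> (- \<xi>))"
      using integral_lborel_uminus[of "\<lambda>\<xi>. g \<xi> * \<psi> \<xi>"] schwartz_measurable[OF \<psi>] by simp
    also have "cnj \<dots> = (LINT \<xi>|lborel. cnj (g (- \<xi>)) * \<phi> \<xi>)"
      unfolding eq Bochner_Integration.integral_cnj ..
    finally show "dist_fourier T \<phi> = (LINT \<xi>|lborel. cnj (g (- \<xi>)) * \<phi> \<xi>)" .
  qed
  from fourier_off_origin_unique[OF g this] show ?thesis
    by eventually_elim (metis complex_cnj_cnj)
qed

lemma real_valued_dist_inv_fourier:
  assumes [measurable]: "g \<in> borel_measurable borel" and sym: "AE \<xi> in lborel. g (- \<xi>) = cnj (g \<xi>)"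
  shows "real_valued (dist_inv_fourier g)"
  unfolding real_valued_def
proof (intro allI impI)
  fix \<phi> :: "real^'a \<Rightarrow> complex" assume \<phi>: "schwartz \<phi>"
  note [measurable] = schwartz_measurable[OF schwartz_inv_fourier[OF \<phi>]]
    schwartz_measurable[OF schwartz_cnj[OF schwartz_inv_fourier[OF \<phi>]]]
  have inv: "inv_fourier (\<lambda>x. cnj (\<phi> x)) \<xi> = cnj (inv_fourier \<phi> (- \<xi>))" for \<xi>
    by (simp add: inv_fourier_eq fourier_cnj[OF \<phi>])
  have [measurable]: "(\<lambda>\<xi>. cnj (g \<xi>)) \<in> borel_measurable borel"
    by (rule measurable_compose[OF _ borel_measurable_continuous_onI[OF continuous_on_cnj[OF continuous_on_id]]]) measurable
  have "dist_inv_fourier g (\<lambda>x. cnj (\<phi> x)) = (LINT \<xi>|lborel. g (- \<xi>) * cnj (inv_fourier \<phi> \<xi>))"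
    unfolding dist_inv_fourier_def inv
    using integral_lborel_uminus[of "\<lambda>\<xi>. g (- \<xi>) * cnj (inv_fourier \<phi> \<xi>)"] by simp
  also have "\<dots> = (LINT \<xi>|lborel. cnj (g \<xi> * inv_fourier \<phi> \<xi>))"
    using sym by (intro integral_cong_AE) (auto elim!: eventually_mono)
  also have "\<dots> = cnj (dist_inv_fourier g \<phi>)"
    unfolding dist_inv_fourier_def Bochner_Integration.integral_cnj ..
  finally show "dist_inv_fourier g (\<lambda>x. cnj (\<phi> x)) = cnj (dist_inv_fourier g \<phi>)" .
qed

text \<open>The integrand of \<open>duhamel\<close> is known to agree with a Borel function only up
  to a null set of times; completeness of the measure makes it measurable all the same.\<close>

lemma borel_measurable_completion_AE_eq:
  fixes f g :: "'a \<Rightarrow> 'b::topological_space"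
  assumes g: "g \<in> borel_measurable M" and eq: "AE x in M. f x = g x"
  shows "f \<in> borel_measurable (completion M)"
proof (rule measurableI)
  fix B :: "'b set" assume B: "B \<in> sets borel"
  have [measurable]: "Measurable.pred (completion M) (\<lambda>x. g x \<in> B)"
    using measurable_sets[OF measurable_completion[OF g] B] by (simp add: Measurable.pred_def vimage_def Int_def conj_commute)
  have [measurable]: "Measurable.pred (completion M) (\<lambda>x. f x \<noteq> g x)"
    using eq by (intro sets_completion_AE) auto
  have [measurable]: "Measurable.pred (completion M) (\<lambda>x. f x \<noteq> g x \<and> f x \<in> B)"
    using eq by (intro sets_completion_AE) (auto elim!: eventually_mono)
  have "Measurable.pred (completion M) (\<lambda>x. (g x \<in> B \<and> \<not> (f x \<noteq> g x)) \<or> (f x \<noteq> g x \<and> f x \<in> B))"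
    by measurable
  also have "(\<lambda>x. (g x \<in> B \<and> \<not> (f x \<noteq> g x)) \<or> (f x \<noteq> g x \<and> f x \<in> B)) = (\<lambda>x. f x \<in> B)" by (auto simp: fun_eq_iff)
  finally show "f -` B \<inter> space (completion M) \<in> sets (completion M)"
    by (simp add: Measurable.pred_def vimage_def Int_def conj_commute)
qed auto

section \<open>Weak time integrals on the Fourier side\<close>

lemma AE_lebesgue_on_iff:
  "S \<in> sets borel \<Longrightarrow> (AE s in lebesgue_on S. P s) \<longleftrightarrow> (AE s in lborel. s \<in> S \<longrightarrow> P s)"
  by (simp add: AE_restrict_space_iff AE_completion_iff)

lemma heat_symbol_measurable [measurable]:
  "(\<lambda>(s, \<xi>::real^'n::finite). heat_symbol \<alpha> (t - s) \<xi>) \<in> borel_measurable (borel \<Otimes>\<^sub>M borel)"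
  unfolding heat_symbol_def by measurable

lemma norm_heat_symbol_le: "0 \<le> t \<Longrightarrow> norm (heat_symbol \<alpha> t \<xi>) \<le> 1"
  by (simp add: heat_symbol_def)

text \<open>Fubini in time and frequency turns the weak time integral into the pairing with a single
  function of the frequency. Domination comes from the heat symbol, bounded by 1 for
  \<open>s \<le> t\<close>, and from the decay of the test function. The function \<open>H\<close>
  is a jointly measurable version of the transforms, since \<open>fhat (F s)\<close> is chosen
  separately for each \<open>s\<close>.\<close>

lemma
  fixes F :: "real \<Rightarrow> 'n::finite tdist" and H :: "real \<Rightarrow> real^'n \<Rightarrow> complex"
  assumes [measurable]: "(\<lambda>(s, \<xi>). H s \<xi>) \<in> borel_measurable (borel \<Otimes>\<^sub>M borel)"
    and F: "AE s in lebesgue_on {0..}. fourier_regular (F s) \<and> (AE \<xi> in lborel. fhat (F s) \<xi> = H s \<xi>)"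
    and fin: "(\<integral>\<^sup>+s\<in>{0..t}. (\<integral>\<^sup>+\<xi>. ennreal (norm (H s \<xi>)) * ennreal (decay N \<xi>) \<partial>lborel) \<partial>lborel) < \<infinity>"
    and t: "0 < t"
  shows duhamel_defined_fourier: "duhamel_defined \<alpha> t F"
    and duhamel_fourier_integrable: "schwartz \<phi> \<Longrightarrow>
      integrable lborel (\<lambda>\<xi>. (LINT s:{0..t}|lborel. heat_symbol \<alpha> (t - s) \<xi> * H s \<xi>) * inv_fourier \<phi> \<xi>)"
    and duhamel_fourier: "schwartz \<phi> \<Longrightarrow> duhamel \<alpha> t F \<phi> =
      (LINT \<xi>|lborel. (LINT s:{0..t}|lborel. heat_symbol \<alpha> (t - s) \<xi> * H s \<xi>) * inv_fourier \<phi> \<xi>)"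
proof -
  have F': "AE s in lborel. 0 \<le> s \<longrightarrow> fourier_regular (F s) \<and> (AE \<xi> in lborel. fhat (F s) \<xi> = H s \<xi>)"
    using F by (subst (asm) AE_lebesgue_on_iff) auto
  define K where "K \<phi> s \<xi> = indicat_real {0..t} s *\<^sub>R (heat_symbol \<alpha> (t - s) \<xi> * H s \<xi> * inv_fourier \<phi> \<xi>)" for \<phi> s \<xi>
  have main: "integrable (lborel \<Otimes>\<^sub>M lborel) (\<lambda>(s, \<xi>). K \<phi> s \<xi>)" if \<phi>: "schwartz \<phi>" for \<phi> :: "real^'n \<Rightarrow> complex"
  proof -
    note [measurable] = schwartz_measurable[OF schwartz_inv_fourier[OF \<phi>]]
    obtain B where B: "\<And>x. (1 + norm x) ^ N * norm (inv_fourier \<phi> x) \<le> B"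
      using schwartz_bound[OF schwartz_inv_fourier[OF \<phi>]] by blast
    have B0: "0 \<le> B" by (rule order_trans[OF _ B[of 0]]) simp
    have Km: "(\<lambda>p. K \<phi> (fst p) (snd p)) \<in> borel_measurable (lborel \<Otimes>\<^sub>M lborel)"
    proof -
      have [measurable]: "(\<lambda>p. heat_symbol \<alpha> (t - fst p) (snd p :: real^'n)) \<in> borel_measurable (borel \<Otimes>\<^sub>M borel)"
        using heat_symbol_measurable[of \<alpha> t] by (simp add: split_beta')
      have [measurable]: "(\<lambda>p. H (fst p) (snd p)) \<in> borel_measurable (borel \<Otimes>\<^sub>M borel)"
        using assms(1) by (simp add: split_beta')
      show ?thesis unfolding K_def by measurable
    qed
    show ?thesis
    proof (rule integrableI_bounded)
      show "(\<lambda>(s, \<xi>). K \<phi> s \<xi>) \<in> borel_measurable (lborel \<Otimes>\<^sub>M lborel)" using Km by (simp add: split_beta')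
      have "(\<integral>\<^sup>+p. ennreal (norm (case p of (s, \<xi>) \<Rightarrow> K \<phi> s \<xi>)) \<partial>(lborel \<Otimes>\<^sub>M lborel))
          = (\<integral>\<^sup>+s. \<integral>\<^sup>+\<xi>. ennreal (norm (K \<phi> s \<xi>)) \<partial>lborel \<partial>lborel)"
        using Km by (subst lborel.nn_integral_fst[symmetric]) (auto simp: split_beta')
      also have "\<dots> \<le> (\<integral>\<^sup>+s. \<integral>\<^sup>+\<xi>. ennreal B * (ennreal (norm (H s \<xi>)) * ennreal (decay N \<xi>)) * indicator {0..t} s \<partial>lborel \<partial>lborel)"
      proof (intro nn_integral_mono)
        fix s and \<xi> :: "real^'n"
        show "ennreal (norm (K \<phi> s \<xi>)) \<le> ennreal B * (ennreal (norm (H s \<xi>)) * ennreal (decay N \<xi>)) * indicator {0..t} s"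
        proof (cases "s \<in> {0..t}")
          case True
          have "norm (heat_symbol \<alpha> (t - s) \<xi>) * (norm (H s \<xi>) * norm (inv_fourier \<phi> \<xi>)) \<le> 1 * (norm (H s \<xi>) * norm (inv_fourier \<phi> \<xi>))"
            using True by (intro mult_right_mono norm_heat_symbol_le) auto
          also have "\<dots> \<le> norm (H s \<xi>) * (B * (decay N \<xi>))"
            unfolding mult_1 by (intro mult_left_mono decay_bound B) simp
          finally have "norm (K \<phi> s \<xi>) \<le> B * (norm (H s \<xi>) * (decay N \<xi>))"
            using True by (simp add: K_def norm_mult mult_ac)
          then have "ennreal (norm (K \<phi> s \<xi>)) \<le> ennreal (B * (norm (H s \<xi>) * (decay N \<xi>)))" by (rule ennreal_leI)
          also have "\<dots> = ennreal B * (ennreal (norm (H s \<xi>)) * ennreal (decay N \<xi>))"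
            using B0 by (simp add: ennreal_mult)
          finally show ?thesis using True by simp
        qed (simp add: K_def)
      qed
      also have "\<dots> = (\<integral>\<^sup>+s. ennreal B * ((\<integral>\<^sup>+\<xi>. ennreal (norm (H s \<xi>)) * ennreal (decay N \<xi>) \<partial>lborel) * indicator {0..t} s) \<partial>lborel)"
      proof (rule nn_integral_cong)
        fix s
        have [measurable]: "H s \<in> borel_measurable borel"
          using measurable_compose[OF measurable_Pair1'[of s borel borel] assms(1)] by simp
        show "(\<integral>\<^sup>+\<xi>. ennreal B * (ennreal (norm (H s \<xi>)) * ennreal (decay N \<xi>)) * indicator {0..t} s \<partial>lborel)
          = ennreal B * ((\<integral>\<^sup>+\<xi>. ennreal (norm (H s \<xi>)) * ennreal (decay N \<xi>) \<partial>lborel) * indicator {0..t} s)"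
          by (subst nn_integral_multc, measurable, subst nn_integral_cmult, measurable, rule mult.assoc)
      qed
      also have "\<dots> = ennreal B * (\<integral>\<^sup>+s\<in>{0..t}. (\<integral>\<^sup>+\<xi>. ennreal (norm (H s \<xi>)) * ennreal (decay N \<xi>) \<partial>lborel) \<partial>lborel)"
        by (rule nn_integral_cmult) measurable
      also have "\<dots> < \<infinity>" using fin by (simp add: ennreal_mult_less_top)
      finally show "(\<integral>\<^sup>+p. ennreal (norm (case p of (s, \<xi>) \<Rightarrow> K \<phi> s \<xi>)) \<partial>(lborel \<Otimes>\<^sub>M lborel)) < \<infinity>" .
    qed
  qed
  define k where "k \<phi> s = (LINT \<xi>|lborel. K \<phi> s \<xi>)" for \<phi> s
  have ki: "integrable lborel (k \<phi>)" if "schwartz \<phi>" for \<phi>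
    using lborel_pair.integrable_fst[OF main[OF that]] by (simp add: k_def[abs_def])
  have heat_eq: "AE s in lborel. indicat_real {0..t} s *\<^sub>R heat \<alpha> (t - s) (F s) \<phi> = k \<phi> s"
    if \<phi>: "schwartz \<phi>" for \<phi> :: "real^'n \<Rightarrow> complex"
    using F'
  proof eventually_elim
    case (elim s)
    note [measurable] = schwartz_measurable[OF schwartz_inv_fourier[OF \<phi>]]
    have [measurable]: "H s \<in> borel_measurable borel"
      using measurable_compose[OF measurable_Pair1'[of s borel borel] assms(1)] by simp
    have [measurable]: "heat_symbol \<alpha> (t - s) \<in> borel_measurable (borel :: (real^'n) measure)"
      unfolding heat_symbol_def[abs_def] by measurable
    show ?case
    proof (cases "s \<in> {0..t}")
      case True
      then have reg: "fourier_regular (F s)" and eq: "AE \<xi> in lborel. fhat (F s) \<xi> = H s \<xi>" using elim by auto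
      have [measurable]: "fhat (F s) \<in> borel_measurable borel"
        using reg by (simp add: fourier_regular_def tempered_fun_measurable)
      have "heat \<alpha> (t - s) (F s) \<phi> = (LINT \<xi>|lborel. heat_symbol \<alpha> (t - s) \<xi> * H s \<xi> * inv_fourier \<phi> \<xi>)"
        unfolding heat_def dist_inv_fourier_def using eq
        by (intro integral_cong_AE) (auto elim!: eventually_mono)
      then show ?thesis using True by (simp add: k_def K_def)
    qed (simp add: k_def K_def)
  qed
  have heat_int: "set_integrable lebesgue {0..t} (\<lambda>s. heat \<alpha> (t - s) (F s) \<phi>) \<and>
      duhamel \<alpha> t F \<phi> = (LINT s|lborel. k \<phi> s)"
    if \<phi>: "schwartz \<phi>" for \<phi> :: "real^'n \<Rightarrow> complex"
  proof -
    have km: "k \<phi> \<in> borel_measurable lborel" using ki[OF \<phi>] by auto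
    have m: "(\<lambda>s. indicat_real {0..t} s *\<^sub>R heat \<alpha> (t - s) (F s) \<phi>) \<in> borel_measurable lebesgue"
      by (rule borel_measurable_completion_AE_eq[OF km heat_eq[OF \<phi>]])
    have ae: "AE s in lebesgue. indicat_real {0..t} s *\<^sub>R heat \<alpha> (t - s) (F s) \<phi> = k \<phi> s"
      by (rule AE_completion[OF heat_eq[OF \<phi>]])
    have "integrable lebesgue (k \<phi>)" using ki[OF \<phi>] km by (simp add: integrable_completion)
    then have 1: "integrable lebesgue (\<lambda>s. indicat_real {0..t} s *\<^sub>R heat \<alpha> (t - s) (F s) \<phi>)"
      using integrable_cong_AE[OF m measurable_completion[OF km] ae] by simp
    have "(LINT s|lebesgue. indicat_real {0..t} s *\<^sub>R heat \<alpha> (t - s) (F s) \<phi>) = (LINT s|lebesgue. k \<phi> s)"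
      by (rule integral_cong_AE[OF m measurable_completion[OF km] ae])
    also have "\<dots> = (LINT s|lborel. k \<phi> s)" by (rule integral_completion[OF km])
    finally show ?thesis using 1 by (simp add: set_integrable_def duhamel_def set_lebesgue_integral_def)
  qed
  have "AE s in lebesgue_on {0..t}. fourier_regular (F s)"
  proof -
    have "AE s in lborel. s \<in> {0..t} \<longrightarrow> fourier_regular (F s)" using F' by eventually_elim auto
    then show ?thesis by (subst AE_lebesgue_on_iff) auto
  qed
  then show "duhamel_defined \<alpha> t F" using heat_int by (simp add: duhamel_defined_def)
  assume \<phi>: "schwartz \<phi>"
  have K_eq: "(LINT s|lborel. K \<phi> s \<xi>) = (LINT s:{0..t}|lborel. heat_symbol \<alpha> (t - s) \<xi> * H s \<xi>) * inv_fourier \<phi> \<xi>" for \<xi>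
    unfolding K_def set_lebesgue_integral_def by (simp flip: mult_scaleR_left)
  show "integrable lborel (\<lambda>\<xi>. (LINT s:{0..t}|lborel. heat_symbol \<alpha> (t - s) \<xi> * H s \<xi>) * inv_fourier \<phi> \<xi>)"
    using lborel_pair.integrable_snd[OF main[OF \<phi>]] by (simp add: K_eq)
  show "duhamel \<alpha> t F \<phi> = (LINT \<xi>|lborel. (LINT s:{0..t}|lborel. heat_symbol \<alpha> (t - s) \<xi> * H s \<xi>) * inv_fourier \<phi> \<xi>)"
    using heat_int[OF \<phi>] lborel_pair.Fubini_integral[OF main[OF \<phi>]] by (simp add: k_def K_eq)
qed

section \<open>Quadratic Duhamel equations and their majorants\<close>

definition jointly_measurable :: "(real \<Rightarrow> 'a::euclidean_space \<Rightarrow> 'b::topological_space) \<Rightarrow> bool" where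
  "jointly_measurable F \<longleftrightarrow> (\<lambda>p. F (fst p) (snd p)) \<in> borel_measurable (borel \<Otimes>\<^sub>M borel)"

text \<open>Arbitrary measurable arguments are allowed, so that this can act as a raw measurability
  rule for shifted arguments such as \<xi> - \<eta>.\<close>

lemma jointly_measurable_app:
  assumes "jointly_measurable F" "f \<in> borel_measurable M" "g \<in> borel_measurable M"
  shows "(\<lambda>x. F (f x) (g x)) \<in> borel_measurable M"
  using measurable_compose[OF measurable_Pair[OF assms(2,3)] assms(1)[unfolded jointly_measurable_def]] by simp

lemma jointly_measurable_section: "jointly_measurable F \<Longrightarrow> F t \<in> borel_measurable borel"
  using jointly_measurable_app[of F "\<lambda>_. t" borel "\<lambda>x. x"] by simp

lemma jointly_measurable_heat: "jointly_measurable (\<lambda>s \<xi>::real^'n::finite. heat_symbol \<alpha> (t - s) \<xi>)"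
  unfolding jointly_measurable_def heat_symbol_def by measurable

text \<open>A non-integrable function has Bochner integral 0 by convention, so the bound holds
  unconditionally and majorants can be built without checking integrability.\<close>

lemma norm_integral_le_nn_integral:
  "ennreal (norm (LINT x|M. f x)) \<le> (\<integral>\<^sup>+x. ennreal (norm (f x)) \<partial>M)"
proof (cases "integrable M f")
  case True
  then show ?thesis by (rule integral_norm_bound_ennreal)
qed (simp add: not_integrable_integral_eq)

text \<open>One step of an iteration and of its majorant: the bound on the increment telescopes, which yields
  absolute convergence as soon as the majorants stay finite.\<close>

definition dominated_step :: "complex \<Rightarrow> complex \<Rightarrow> ennreal \<Rightarrow> ennreal \<Rightarrow> bool" where
  "dominated_step x x' X X' \<longleftrightarrow> ennreal (norm (x' - x)) + X \<le> X'"

lemma dominated_step_top: "dominated_step x x' X \<top>"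
  by (simp add: dominated_step_def)

lemma ennreal_norm_triangle: "ennreal (norm (x + y)) \<le> ennreal (norm x) + ennreal (norm y)"
  by (simp add: ennreal_plus[symmetric] norm_triangle_ineq ennreal_leI del: ennreal_plus)

lemma dominated_step_bound:
  assumes "dominated_step x x' X X'" "ennreal (norm x) \<le> X"
  shows "ennreal (norm x') \<le> X'"
proof -
  have "ennreal (norm ((x' - x) + x)) \<le> ennreal (norm (x' - x)) + ennreal (norm x)"
    by (rule ennreal_norm_triangle)
  also have "\<dots> \<le> ennreal (norm (x' - x)) + X" using assms(2) by (intro add_left_mono)
  also have "\<dots> \<le> X'" using assms(1) by (simp add: dominated_step_def)
  finally show ?thesis by simp
qed

lemma dominated_step_mono: "dominated_step x x' X X' \<Longrightarrow> X \<le> X'"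
  unfolding dominated_step_def by (metis add_increasing order_trans order_refl zero_le)

lemma dominated_step_add:
  assumes "dominated_step x x' X X'" "dominated_step y y' Y Y'"
  shows "dominated_step (x + y) (x' + y') (X + Y) (X' + Y')"
proof -
  have "ennreal (norm ((x' - x) + (y' - y))) + (X + Y) \<le> ennreal (norm (x' - x)) + ennreal (norm (y' - y)) + (X + Y)"
    by (intro add_right_mono ennreal_norm_triangle)
  also have "\<dots> = (ennreal (norm (x' - x)) + X) + (ennreal (norm (y' - y)) + Y)" by (simp only: ac_simps)
  also have "\<dots> \<le> X' + Y'" using assms unfolding dominated_step_def by (rule add_mono)
  finally show ?thesis by (simp add: dominated_step_def algebra_simps)
qed

lemma dominated_step_sum:
  assumes "finite I" "\<And>i. i \<in> I \<Longrightarrow> dominated_step (x i) (x' i) (X i) (X' i)"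
  shows "dominated_step (\<Sum>i\<in>I. x i) (\<Sum>i\<in>I. x' i) (\<Sum>i\<in>I. X i) (\<Sum>i\<in>I. X' i)"
  using assms by (induction I rule: finite_induct) (simp_all add: dominated_step_add, simp add: dominated_step_def)

lemma dominated_step_cmult:
  assumes "dominated_step x x' X X'"
  shows "dominated_step (c * x) (c * x') (ennreal (norm c) * X) (ennreal (norm c) * X')"
proof -
  have "ennreal (norm (c * x' - c * x)) = ennreal (norm c) * ennreal (norm (x' - x))"
    by (simp add: right_diff_distrib[symmetric] norm_mult ennreal_mult)
  then have "ennreal (norm (c * x' - c * x)) + ennreal (norm c) * X = ennreal (norm c) * (ennreal (norm (x' - x)) + X)"
    by (simp only: distrib_left)
  also have "\<dots> \<le> ennreal (norm c) * X'" using assms unfolding dominated_step_def by (rule mult_left_mono) simp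
  finally show ?thesis by (simp add: dominated_step_def)
qed

text \<open>The increment of a product is (a' - a) b' + a (b' - b). Estimating the factors by B' and
  A lets the two increments be absorbed one after the other, from A B to A B' and then to A'
  B'.\<close>

lemma dominated_step_mult:
  assumes a: "dominated_step a a' A A'" "ennreal (norm a) \<le> A" and b: "dominated_step b b' B B'" "ennreal (norm b) \<le> B"
  shows "dominated_step (a * b) (a' * b') (A * B) (A' * B')"
proof -
  have b': "ennreal (norm b') \<le> B'" by (rule dominated_step_bound[OF b])
  have "ennreal (norm (a' * b' - a * b)) = ennreal (norm ((a' - a) * b' + a * (b' - b)))"
    by (simp add: algebra_simps)
  also have "\<dots> \<le> ennreal (norm (a' - a)) * ennreal (norm b') + ennreal (norm a) * ennreal (norm (b' - b))"
    using ennreal_norm_triangle[of "(a' - a) * b'" "a * (b' - b)"] by (simp add: norm_mult ennreal_mult)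
  also have "\<dots> \<le> ennreal (norm (a' - a)) * B' + A * ennreal (norm (b' - b))"
    using a(2) b' by (intro add_mono mult_mono) auto
  finally have "ennreal (norm (a' * b' - a * b)) + A * B \<le> ennreal (norm (a' - a)) * B' + A * ennreal (norm (b' - b)) + A * B"
    by (rule add_right_mono)
  also have "\<dots> = ennreal (norm (a' - a)) * B' + A * (ennreal (norm (b' - b)) + B)"
    by (simp only: distrib_left add.assoc)
  also have "\<dots> \<le> ennreal (norm (a' - a)) * B' + A * B'"
    using b(1) unfolding dominated_step_def by (intro add_left_mono mult_left_mono) auto
  also have "\<dots> = (ennreal (norm (a' - a)) + A) * B'" by (simp only: distrib_right)
  also have "\<dots> \<le> A' * B'" using a(1) unfolding dominated_step_def by (intro mult_right_mono) auto
  finally show ?thesis by (simp add: dominated_step_def)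
qed

text \<open>If the new majorant has infinite integral there is nothing to prove; otherwise both
  functions are integrable and the integral of the increment may be split.\<close>

lemma dominated_step_integral:
  assumes [measurable]: "f \<in> borel_measurable M" "f' \<in> borel_measurable M" "G \<in> borel_measurable M"
    and step: "\<And>x. x \<in> space M \<Longrightarrow> dominated_step (f x) (f' x) (G x) (G' x)"
    and dom: "\<And>x. x \<in> space M \<Longrightarrow> ennreal (norm (f x)) \<le> G x"
  shows "dominated_step (LINT x|M. f x) (LINT x|M. f' x) (\<integral>\<^sup>+x. G x \<partial>M) (\<integral>\<^sup>+x. G' x \<partial>M)"
proof (cases "(\<integral>\<^sup>+x. G' x \<partial>M) = \<top>")
  case True
  then show ?thesis by (simp add: dominated_step_top)
next
  case False
  then have fin: "(\<integral>\<^sup>+x. G' x \<partial>M) < \<infinity>" by (simp add: less_top)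
  have f': "integrable M f'"
  proof (rule integrableI_bounded)
    have "(\<integral>\<^sup>+x. ennreal (norm (f' x)) \<partial>M) \<le> (\<integral>\<^sup>+x. G' x \<partial>M)"
      by (intro nn_integral_mono dominated_step_bound[OF step dom])
    then show "(\<integral>\<^sup>+x. ennreal (norm (f' x)) \<partial>M) < \<infinity>" using fin by (rule le_less_trans)
  qed measurable
  have f: "integrable M f"
  proof (rule integrableI_bounded)
    have "(\<integral>\<^sup>+x. ennreal (norm (f x)) \<partial>M) \<le> (\<integral>\<^sup>+x. G' x \<partial>M)"
      by (intro nn_integral_mono order_trans[OF dom dominated_step_mono[OF step]])
    then show "(\<integral>\<^sup>+x. ennreal (norm (f x)) \<partial>M) < \<infinity>" using fin by (rule le_less_trans)
  qed measurable
  have "ennreal (norm ((LINT x|M. f' x) - (LINT x|M. f x))) = ennreal (norm (LINT x|M. f' x - f x))"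
    using f f' by simp
  also have "\<dots> \<le> (\<integral>\<^sup>+x. ennreal (norm (f' x - f x)) \<partial>M)" by (rule norm_integral_le_nn_integral)
  finally have "ennreal (norm ((LINT x|M. f' x) - (LINT x|M. f x))) + (\<integral>\<^sup>+x. G x \<partial>M)
      \<le> (\<integral>\<^sup>+x. ennreal (norm (f' x - f x)) + G x \<partial>M)"
    by (subst nn_integral_add) (auto intro: add_right_mono)
  also have "\<dots> \<le> (\<integral>\<^sup>+x. G' x \<partial>M)"
    using step unfolding dominated_step_def by (intro nn_integral_mono)
  finally show ?thesis by (simp add: dominated_step_def)
qed

section \<open>Duhamel integrals as functions of the frequency, with majorants\<close>

lemma heat_kernel_measurable:
  "(\<lambda>p::(real \<times> (real^'n::finite)) \<times> real. heat_symbol \<alpha> (fst (fst p) - snd p) (snd (fst p)))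
    \<in> borel_measurable ((borel \<Otimes>\<^sub>M borel) \<Otimes>\<^sub>M borel)"
  unfolding heat_symbol_def by measurable

lemma indicator_triangle_measurable:
  "(\<lambda>p::(real \<times> (real^'n::finite)) \<times> real. indicator {0..fst (fst p)} (snd p) :: 'b::{zero_neq_one,topological_space})
    \<in> borel_measurable ((borel \<Otimes>\<^sub>M borel) \<Otimes>\<^sub>M borel)"
  unfolding indicator_def atLeastAtMost_iff by measurable

definition heat_duhamel :: "real \<Rightarrow> (real \<Rightarrow> real^'n::finite \<Rightarrow> complex) \<Rightarrow> real \<Rightarrow> real^'n \<Rightarrow> complex" where
  "heat_duhamel \<alpha> H t \<xi> = (LINT s|lborel. indicator {0..t} s *\<^sub>R (heat_symbol \<alpha> (t - s) \<xi> * H s \<xi>))"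

lemma heat_duhamel_measurable:
  fixes H :: "real \<Rightarrow> real^'n::finite \<Rightarrow> complex"
  assumes H: "jointly_measurable H"
  shows "jointly_measurable (heat_duhamel \<alpha> H)"
proof -
  note [measurable (raw)] = jointly_measurable_app[OF H]
  note [measurable] = heat_kernel_measurable indicator_triangle_measurable
  have "(\<lambda>p::(real \<times> (real^'n)) \<times> real. indicat_real {0..fst (fst p)} (snd p) *\<^sub>R
      (heat_symbol \<alpha> (fst (fst p) - snd p) (snd (fst p)) * H (snd p) (snd (fst p)))) \<in> borel_measurable ((borel \<Otimes>\<^sub>M borel) \<Otimes>\<^sub>M lborel)"
    by measurable
  then show ?thesis unfolding jointly_measurable_def heat_duhamel_def
    by (intro lborel.borel_measurable_lebesgue_integral) (simp add: split_beta')
qed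

definition heat_duhamel_maj :: "real \<Rightarrow> (real \<Rightarrow> real^'n::finite \<Rightarrow> ennreal) \<Rightarrow> real \<Rightarrow> real^'n \<Rightarrow> ennreal" where
  "heat_duhamel_maj \<alpha> W t \<xi> = (\<integral>\<^sup>+s. indicator {0..t} s * (ennreal (norm (heat_symbol \<alpha> (t - s) \<xi>)) * W s \<xi>) \<partial>lborel)"

lemma heat_duhamel_maj_measurable:
  fixes W :: "real \<Rightarrow> real^'n::finite \<Rightarrow> ennreal"
  assumes W: "jointly_measurable W"
  shows "jointly_measurable (heat_duhamel_maj \<alpha> W)"
proof -
  note [measurable (raw)] = jointly_measurable_app[OF W]
  note [measurable] = heat_kernel_measurable indicator_triangle_measurable
  have "(\<lambda>p::(real \<times> (real^'n)) \<times> real. indicator {0..fst (fst p)} (snd p) *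
      (ennreal (norm (heat_symbol \<alpha> (fst (fst p) - snd p) (snd (fst p)))) * W (snd p) (snd (fst p)))) \<in> borel_measurable ((borel \<Otimes>\<^sub>M borel) \<Otimes>\<^sub>M lborel)"
    by measurable
  then show ?thesis unfolding jointly_measurable_def heat_duhamel_maj_def
    by (intro lborel.borel_measurable_nn_integral) (simp add: split_beta')
qed

lemma heat_duhamel_uminus:
  assumes "\<And>s \<xi>. H s (- \<xi>) = cnj (H s \<xi>)"
  shows "heat_duhamel \<alpha> H t (- \<xi>) = cnj (heat_duhamel \<alpha> H t \<xi>)"
proof -
  have "indicator {0..t} s *\<^sub>R (heat_symbol \<alpha> (t - s) (- \<xi>) * H s (- \<xi>)) = cnj (indicator {0..t} s *\<^sub>R (heat_symbol \<alpha> (t - s) \<xi> * H s \<xi>))" for s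
    by (simp add: assms heat_symbol_def)
  then show ?thesis unfolding heat_duhamel_def by (simp only: Bochner_Integration.integral_cnj)
qed

lemma indicator_heat_le:
  assumes "ennreal (norm z) \<le> w"
  shows "ennreal (norm (indicat_real E s *\<^sub>R (c * z :: complex))) \<le> indicator E s * (ennreal (norm c) * w)"
  using mult_left_mono[OF assms, of "ennreal (norm c)"] by (cases "s \<in> E") (auto simp: norm_mult ennreal_mult)

lemma heat_duhamel_dom:
  assumes "\<And>s. ennreal (norm (H s \<xi>)) \<le> W s \<xi>"
  shows "ennreal (norm (heat_duhamel \<alpha> H t \<xi>)) \<le> heat_duhamel_maj \<alpha> W t \<xi>"
  unfolding heat_duhamel_def heat_duhamel_maj_def
  by (rule order_trans[OF norm_integral_le_nn_integral]) (intro nn_integral_mono indicator_heat_le assms)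

lemma heat_duhamel_step:
  assumes H: "jointly_measurable H" "jointly_measurable H'" "jointly_measurable W"
    and dom: "\<And>s. ennreal (norm (H s \<xi>)) \<le> W s \<xi>"
    and step: "\<And>s. dominated_step (H s \<xi>) (H' s \<xi>) (W s \<xi>) (W' s \<xi>)"
  shows "dominated_step (heat_duhamel \<alpha> H t \<xi>) (heat_duhamel \<alpha> H' t \<xi>) (heat_duhamel_maj \<alpha> W t \<xi>) (heat_duhamel_maj \<alpha> W' t \<xi>)"
  unfolding heat_duhamel_def heat_duhamel_maj_def
proof (rule dominated_step_integral)
  note [measurable (raw)] = jointly_measurable_app[OF H(1)] jointly_measurable_app[OF H(2)] jointly_measurable_app[OF H(3)]
    jointly_measurable_app[OF jointly_measurable_heat]
  let ?c = "\<lambda>s. heat_symbol \<alpha> (t - s) \<xi>"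
  show "(\<lambda>s. indicat_real {0..t} s *\<^sub>R (?c s * H s \<xi>)) \<in> borel_measurable lborel"
    "(\<lambda>s. indicat_real {0..t} s *\<^sub>R (?c s * H' s \<xi>)) \<in> borel_measurable lborel"
    "(\<lambda>s. indicator {0..t} s * (ennreal (norm (?c s)) * W s \<xi>)) \<in> borel_measurable lborel" by measurable
  show "dominated_step (indicat_real {0..t} s *\<^sub>R (?c s * H s \<xi>)) (indicat_real {0..t} s *\<^sub>R (?c s * H' s \<xi>))
      (indicator {0..t} s * (ennreal (norm (?c s)) * W s \<xi>)) (indicator {0..t} s * (ennreal (norm (?c s)) * W' s \<xi>))" for s
    using dominated_step_cmult[OF step, of "?c s" s] by (cases "s \<in> {0..t}") (auto simp: dominated_step_def)
qed (intro indicator_heat_le dom)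

text \<open>Dominated convergence with an extended-real majorant. Its integral being finite, it is
  finite almost everywhere, so convergence is asked only at such points.\<close>

lemma integral_tendsto_majorant:
  fixes f :: "nat \<Rightarrow> 'a \<Rightarrow> complex"
  assumes [measurable]: "\<And>n. f n \<in> borel_measurable M" "g \<in> borel_measurable M" "W \<in> borel_measurable M"
    and fin: "(\<integral>\<^sup>+x. W x \<partial>M) < \<infinity>" and le: "\<And>n x. ennreal (norm (f n x)) \<le> W x"
    and lim: "\<And>x. W x < \<infinity> \<Longrightarrow> (\<lambda>n. f n x) \<longlonglongrightarrow> g x"
  shows "(\<lambda>n. LINT x|M. f n x) \<longlonglongrightarrow> (LINT x|M. g x)"
proof (rule integral_dominated_convergence)
  have ae: "AE x in M. W x \<noteq> \<infinity>" using fin by (intro nn_integral_PInf_AE) auto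
  show "integrable M (\<lambda>x. enn2real (W x))"
  proof (rule integrableI_bounded)
    have "(\<integral>\<^sup>+x. ennreal (norm (enn2real (W x))) \<partial>M) \<le> (\<integral>\<^sup>+x. W x \<partial>M)"
      using ae by (intro nn_integral_mono_AE) (auto elim!: eventually_mono simp: less_top)
    then show "(\<integral>\<^sup>+x. ennreal (norm (enn2real (W x))) \<partial>M) < \<infinity>" using fin by (rule le_less_trans)
  qed measurable
  show "AE x in M. norm (f n x) \<le> enn2real (W x)" for n
    using ae
  proof eventually_elim
    case (elim x)
    then have "enn2real (ennreal (norm (f n x))) \<le> enn2real (W x)"
      using le by (intro enn2real_mono) (auto simp: less_top)
    then show ?case by simp
  qed
  show "AE x in M. (\<lambda>n. f n x) \<longlonglongrightarrow> g x" using ae by eventually_elim (auto intro: lim simp: less_top)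
qed measurable

lemma heat_duhamel_tendsto:
  assumes H: "\<And>n::nat. jointly_measurable (H n)" "jointly_measurable H'" "jointly_measurable W"
    and dom: "\<And>n s. ennreal (norm (H n s \<xi>)) \<le> W s \<xi>" and lim: "\<And>s. W s \<xi> < \<infinity> \<Longrightarrow> (\<lambda>n. H n s \<xi>) \<longlonglongrightarrow> H' s \<xi>"
    and fin: "heat_duhamel_maj \<alpha> W t \<xi> < \<infinity>"
  shows "(\<lambda>n. heat_duhamel \<alpha> (H n) t \<xi>) \<longlonglongrightarrow> heat_duhamel \<alpha> H' t \<xi>"
  unfolding heat_duhamel_def
proof (rule integral_tendsto_majorant)
  note [measurable (raw)] = jointly_measurable_app[OF H(1)] jointly_measurable_app[OF H(2)] jointly_measurable_app[OF H(3)]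
    jointly_measurable_app[OF jointly_measurable_heat]
  let ?c = "\<lambda>s. heat_symbol \<alpha> (t - s) \<xi>" and ?w = "\<lambda>s. indicator {0..t} s * (ennreal (norm (heat_symbol \<alpha> (t - s) \<xi>)) * W s \<xi>)"
  show "(\<lambda>s. indicat_real {0..t} s *\<^sub>R (?c s * H n s \<xi>)) \<in> borel_measurable lborel" for n by measurable
  show "(\<lambda>s. indicat_real {0..t} s *\<^sub>R (?c s * H' s \<xi>)) \<in> borel_measurable lborel" "?w \<in> borel_measurable lborel" by measurable
  show "(\<integral>\<^sup>+s. ?w s \<partial>lborel) < \<infinity>" using fin by (simp only: heat_duhamel_maj_def)
  show "ennreal (norm (indicat_real {0..t} s *\<^sub>R (?c s * H n s \<xi>))) \<le> ?w s" for n s by (rule indicator_heat_le[OF dom])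
  show "(\<lambda>n. indicat_real {0..t} s *\<^sub>R (?c s * H n s \<xi>)) \<longlonglongrightarrow> indicat_real {0..t} s *\<^sub>R (?c s * H' s \<xi>)" if w: "?w s < \<infinity>" for s
  proof (cases "s \<in> {0..t}")
    case True
    \<comment> \<open>The heat symbol never vanishes; otherwise a finite product could hide an
      infinite \<open>W s \<xi>\<close>, as \<open>0 * \<infinity>\<close> is 0.\<close>
    have "norm (?c s) \<noteq> 0" by (simp add: heat_symbol_def)
    then have "W s \<xi> < \<infinity>" using w True by (auto simp: ennreal_mult_less_top)
    then show ?thesis by (intro tendsto_scaleR tendsto_const tendsto_mult_left lim)
  qed simp
qed

text \<open>All unknowns are gathered in one family indexed by \<open>'m\<close>: \<beta> carries
  the quadratic symbols, \<gamma> the linear ones and \<open>A\<close> the contribution of the data.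
  A coupled system thus becomes one equation.\<close>

locale quadratic_duhamel =
  fixes \<alpha> :: real
    and \<beta> :: "'m::finite \<Rightarrow> 'm \<Rightarrow> 'm \<Rightarrow> real^'n::finite \<Rightarrow> complex"
    and \<gamma> :: "'m \<Rightarrow> 'm \<Rightarrow> real^'n \<Rightarrow> complex"
    and A :: "'m \<Rightarrow> real \<Rightarrow> real^'n \<Rightarrow> complex"
  assumes \<beta>_measurable [measurable]: "\<And>m j k. \<beta> m j k \<in> borel_measurable borel"
    and \<gamma>_measurable [measurable]: "\<And>m j. \<gamma> m j \<in> borel_measurable borel"
    and A_measurable: "\<And>m. jointly_measurable (A m)"
begin

definition nonlin :: "('m \<Rightarrow> real \<Rightarrow> real^'n \<Rightarrow> complex) \<Rightarrow> 'm \<Rightarrow> real \<Rightarrow> real^'n \<Rightarrow> complex" where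
  "nonlin Z m s \<xi> = (\<Sum>j\<in>UNIV. \<Sum>k\<in>UNIV. \<beta> m j k \<xi> * Defs.convolution (Z j s) (Z k s) \<xi>) + (\<Sum>j\<in>UNIV. \<gamma> m j \<xi> * Z j s \<xi>)"

definition nonlin_maj :: "('m \<Rightarrow> real \<Rightarrow> real^'n \<Rightarrow> ennreal) \<Rightarrow> 'm \<Rightarrow> real \<Rightarrow> real^'n \<Rightarrow> ennreal" where
  "nonlin_maj Y m s \<xi> = (\<Sum>j\<in>UNIV. \<Sum>k\<in>UNIV. ennreal (norm (\<beta> m j k \<xi>)) * (\<integral>\<^sup>+\<eta>. Y j s (\<xi> - \<eta>) * Y k s \<eta> \<partial>lborel))
    + (\<Sum>j\<in>UNIV. ennreal (norm (\<gamma> m j \<xi>)) * Y j s \<xi>)"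

abbreviation "duh Z m \<equiv> heat_duhamel \<alpha> (nonlin Z m)"

abbreviation "duh_maj Y m \<equiv> heat_duhamel_maj \<alpha> (nonlin_maj Y m)"

primrec picard :: "nat \<Rightarrow> 'm \<Rightarrow> real \<Rightarrow> real^'n \<Rightarrow> complex" where
  "picard 0 = (\<lambda>m t \<xi>. 0)"
| "picard (Suc n) = (\<lambda>m t \<xi>. A m t \<xi> + duh (picard n) m t \<xi>)"

primrec majorant :: "nat \<Rightarrow> 'm \<Rightarrow> real \<Rightarrow> real^'n \<Rightarrow> ennreal" where
  "majorant 0 = (\<lambda>m t \<xi>. 0)"
| "majorant (Suc n) = (\<lambda>m t \<xi>. ennreal (norm (A m t \<xi>)) + duh_maj (majorant n) m t \<xi>)"

lemma nonlin_measurable: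
  assumes Z: "\<And>m. jointly_measurable (Z m)"
  shows "jointly_measurable (nonlin Z m)"
proof -
  note [measurable (raw)] = jointly_measurable_app[OF Z]
  show ?thesis unfolding jointly_measurable_def nonlin_def Defs.convolution_def by measurable
qed

lemma nonlin_maj_measurable:
  assumes Y: "\<And>m. jointly_measurable (Y m)"
  shows "jointly_measurable (nonlin_maj Y m)"
proof -
  note [measurable (raw)] = jointly_measurable_app[OF Y]
  show ?thesis unfolding jointly_measurable_def nonlin_maj_def by measurable
qed

lemma picard_measurable: "jointly_measurable (picard n m)"
proof (induction n arbitrary: m)
  case (Suc n)
  note [measurable (raw)] = jointly_measurable_app[OF heat_duhamel_measurable[OF nonlin_measurable[OF Suc]]] jointly_measurable_app[OF A_measurable]
  show ?case unfolding jointly_measurable_def picard.simps by measurable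
qed (simp add: jointly_measurable_def)

lemma majorant_measurable: "jointly_measurable (majorant n m)"
proof (induction n arbitrary: m)
  case (Suc n)
  note [measurable (raw)] = jointly_measurable_app[OF heat_duhamel_maj_measurable[OF nonlin_maj_measurable[OF Suc]]] jointly_measurable_app[OF A_measurable]
  show ?case unfolding jointly_measurable_def majorant.simps by measurable
qed (simp add: jointly_measurable_def)

lemma nonlin_step:
  assumes Z: "\<And>m. jointly_measurable (Z m)" "\<And>m. jointly_measurable (Z' m)" "\<And>m. jointly_measurable (Y m)"
    and dom: "\<And>m t \<xi>. ennreal (norm (Z m t \<xi>)) \<le> Y m t \<xi>"
    and step: "\<And>m t \<xi>. dominated_step (Z m t \<xi>) (Z' m t \<xi>) (Y m t \<xi>) (Y' m t \<xi>)"
  shows "dominated_step (nonlin Z m s \<xi>) (nonlin Z' m s \<xi>) (nonlin_maj Y m s \<xi>) (nonlin_maj Y' m s \<xi>)"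
proof -
  note [measurable] = jointly_measurable_section[OF Z(1)] jointly_measurable_section[OF Z(2)] jointly_measurable_section[OF Z(3)]
  have "dominated_step (Defs.convolution (Z j s) (Z k s) \<xi>) (Defs.convolution (Z' j s) (Z' k s) \<xi>)
      (\<integral>\<^sup>+\<eta>. Y j s (\<xi> - \<eta>) * Y k s \<eta> \<partial>lborel) (\<integral>\<^sup>+\<eta>. Y' j s (\<xi> - \<eta>) * Y' k s \<eta> \<partial>lborel)" for j k
    unfolding Defs.convolution_def
  proof (rule dominated_step_integral)
    show "dominated_step (Z j s (\<xi> - \<eta>) * Z k s \<eta>) (Z' j s (\<xi> - \<eta>) * Z' k s \<eta>) (Y j s (\<xi> - \<eta>) * Y k s \<eta>) (Y' j s (\<xi> - \<eta>) * Y' k s \<eta>)" for \<eta>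
      by (intro dominated_step_mult step dom)
    show "ennreal (norm (Z j s (\<xi> - \<eta>) * Z k s \<eta>)) \<le> Y j s (\<xi> - \<eta>) * Y k s \<eta>" for \<eta>
      unfolding norm_mult ennreal_mult[OF norm_ge_zero norm_ge_zero] by (intro mult_mono dom) auto
  qed measurable
  then show ?thesis
    unfolding nonlin_def nonlin_maj_def
    by (intro dominated_step_add dominated_step_sum dominated_step_cmult step finite)
qed

lemma nonlin_dom:
  assumes dom: "\<And>m t \<xi>. ennreal (norm (Z m t \<xi>)) \<le> Y m t \<xi>"
  shows "ennreal (norm (nonlin Z m s \<xi>)) \<le> nonlin_maj Y m s \<xi>"
proof -
  have sum: "ennreal (norm (\<Sum>i\<in>I. x i)) \<le> (\<Sum>i\<in>I. X i)" if "finite I" "\<And>i. ennreal (norm (x i)) \<le> X i"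
    for I :: "'i set" and x :: "'i \<Rightarrow> complex" and X
    using that by (induction I rule: finite_induct) (auto intro: order_trans[OF ennreal_norm_triangle] add_mono)
  have conv: "ennreal (norm (Defs.convolution (Z j s) (Z k s) \<xi>)) \<le> (\<integral>\<^sup>+\<eta>. Y j s (\<xi> - \<eta>) * Y k s \<eta> \<partial>lborel)" for j k
  proof -
    have "ennreal (norm (Defs.convolution (Z j s) (Z k s) \<xi>)) \<le> (\<integral>\<^sup>+\<eta>. ennreal (norm (Z j s (\<xi> - \<eta>) * Z k s \<eta>)) \<partial>lborel)"
      unfolding Defs.convolution_def by (rule norm_integral_le_nn_integral)
    also have "\<dots> \<le> (\<integral>\<^sup>+\<eta>. Y j s (\<xi> - \<eta>) * Y k s \<eta> \<partial>lborel)"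
      unfolding norm_mult ennreal_mult[OF norm_ge_zero norm_ge_zero] by (intro nn_integral_mono mult_mono dom) auto
    finally show ?thesis .
  qed
  have mult: "ennreal (norm (c * x)) \<le> ennreal (norm c) * X" if "ennreal (norm x) \<le> X" for c x :: complex and X
    unfolding norm_mult ennreal_mult[OF norm_ge_zero norm_ge_zero] by (intro mult_left_mono that) auto
  show ?thesis unfolding nonlin_def nonlin_maj_def
    by (intro order_trans[OF ennreal_norm_triangle] add_mono sum mult conv dom finite)
qed

lemma picard_dom: "ennreal (norm (picard n m t \<xi>)) \<le> majorant n m t \<xi>"
proof (induction n arbitrary: m t \<xi>)
  case (Suc n)
  show ?case unfolding picard.simps majorant.simps
    by (intro order_trans[OF ennreal_norm_triangle] add_left_mono heat_duhamel_dom nonlin_dom Suc)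
qed simp

text \<open>The majorants start from 0, so for \<open>n = 0\<close> the claim is the domination of
  the first iterate. Afterwards it propagates because sums, products, convolutions and Duhamel
  integrals all preserve \<open>dominated_step\<close>.\<close>

lemma picard_step: "dominated_step (picard n m t \<xi>) (picard (Suc n) m t \<xi>) (majorant n m t \<xi>) (majorant (Suc n) m t \<xi>)"
proof (induction n arbitrary: m t \<xi>)
  case 0
  have "ennreal (norm (A m t \<xi> + duh (picard 0) m t \<xi>)) \<le> ennreal (norm (A m t \<xi>)) + duh_maj (majorant 0) m t \<xi>"
    using picard_dom[of "Suc 0" m t \<xi>] by (simp only: picard.simps majorant.simps)
  then show ?case by (simp add: dominated_step_def)
next
  case (Suc n)
  have "dominated_step (A m t \<xi>) (A m t \<xi>) (ennreal (norm (A m t \<xi>))) (ennreal (norm (A m t \<xi>)))"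
    by (simp add: dominated_step_def)
  from dominated_step_add[OF this heat_duhamel_step[OF nonlin_measurable[OF picard_measurable] nonlin_measurable[OF picard_measurable]
      nonlin_maj_measurable[OF majorant_measurable] nonlin_dom[OF picard_dom]
      nonlin_step[OF picard_measurable picard_measurable majorant_measurable picard_dom Suc]]]
  have "dominated_step (A m t \<xi> + duh (picard n) m t \<xi>) (A m t \<xi> + duh (picard (Suc n)) m t \<xi>)
      (ennreal (norm (A m t \<xi>)) + duh_maj (majorant n) m t \<xi>) (ennreal (norm (A m t \<xi>)) + duh_maj (majorant (Suc n)) m t \<xi>)" .
  moreover have "picard (Suc k) m t \<xi> = A m t \<xi> + duh (picard k) m t \<xi>"
    "majorant (Suc k) m t \<xi> = ennreal (norm (A m t \<xi>)) + duh_maj (majorant k) m t \<xi>" for k by simp_all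
  ultimately show ?case by (simp only:)
qed

lemma majorant_incseq: "incseq (\<lambda>n. majorant n m t \<xi>)"
  by (rule incseq_SucI) (rule dominated_step_mono[OF picard_step])

definition majorant_lim :: "'m \<Rightarrow> real \<Rightarrow> real^'n \<Rightarrow> ennreal" where
  "majorant_lim m t \<xi> = (SUP n. majorant n m t \<xi>)"

text \<open>The value 0 where the majorant is infinite keeps the function dominated and jointly
  measurable everywhere.\<close>

definition solution :: "'m \<Rightarrow> real \<Rightarrow> real^'n \<Rightarrow> complex" where
  "solution m t \<xi> = (if majorant_lim m t \<xi> < \<infinity> then lim (\<lambda>n. picard n m t \<xi>) else 0)"

lemma majorant_le_lim: "majorant n m t \<xi> \<le> majorant_lim m t \<xi>"
  unfolding majorant_lim_def by (rule SUP_upper) simp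

lemma majorant_lim_measurable: "jointly_measurable (majorant_lim m)"
proof -
  note [measurable (raw)] = jointly_measurable_app[OF majorant_measurable]
  show ?thesis unfolding jointly_measurable_def majorant_lim_def by measurable
qed

lemma solution_measurable: "jointly_measurable (solution m)"
proof -
  note [measurable (raw)] = jointly_measurable_app[OF majorant_lim_measurable] jointly_measurable_app[OF picard_measurable]
  have [measurable]: "(\<lambda>p. lim (\<lambda>n. picard n m (fst p) (snd p))) \<in> borel_measurable (borel \<Otimes>\<^sub>M borel)"
    by (intro borel_measurable_lim_metric) measurable
  show ?thesis unfolding jointly_measurable_def solution_def by measurable
qed

text \<open>The moduli of the increments add up to at most the majorant, by telescoping, so the
  series of increments converges absolutely.\<close>

lemma picard_tendsto:
  assumes fin: "majorant_lim m t \<xi> < \<infinity>"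
  shows "(\<lambda>n. picard n m t \<xi>) \<longlonglongrightarrow> solution m t \<xi>"
proof -
  define d where "d n = picard (Suc n) m t \<xi> - picard n m t \<xi>" for n
  obtain B where B: "majorant_lim m t \<xi> = ennreal B" "0 \<le> B" using fin by (cases "majorant_lim m t \<xi>") auto
  have "ennreal (\<Sum>i<n. norm (d i)) \<le> majorant n m t \<xi>" for n
  proof (induction n)
    case (Suc n)
    have "ennreal (\<Sum>i<Suc n. norm (d i)) = ennreal (norm (d n)) + ennreal (\<Sum>i<n. norm (d i))"
      by (simp add: ennreal_plus[symmetric] sum_nonneg add.commute del: ennreal_plus)
    also have "\<dots> \<le> ennreal (norm (d n)) + majorant n m t \<xi>" by (intro add_left_mono Suc)
    also have "\<dots> \<le> majorant (Suc n) m t \<xi>" using picard_step[of n m t \<xi>] by (simp only: dominated_step_def d_def)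
    finally show ?case .
  qed simp
  then have "ennreal (\<Sum>i<n. norm (d i)) \<le> ennreal B" for n
    using order_trans[OF _ majorant_le_lim] B(1) by metis
  then have "(\<Sum>i<n. norm (d i)) \<le> B" for n using B(2) by (simp add: sum_nonneg)
  then have "summable (\<lambda>i. norm (d i))"
    by (intro bounded_imp_summable[of _ B]) (simp_all only: norm_ge_zero lessThan_Suc_atMost[symmetric])
  then have "summable d" by (rule summable_norm_cancel)
  then have "(\<lambda>n. \<Sum>i<n. d i) \<longlonglongrightarrow> suminf d" by (rule summable_LIMSEQ)
  moreover have "(\<Sum>i<n. d i) = picard n m t \<xi>" for n
    unfolding d_def by (subst sum_lessThan_telescope) simp
  ultimately have "convergent (\<lambda>n. picard n m t \<xi>)" by (auto simp: convergent_def)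
  then show ?thesis using fin by (simp add: solution_def convergent_LIMSEQ_iff)
qed

lemma solution_dom: "ennreal (norm (solution m t \<xi>)) \<le> majorant_lim m t \<xi>"
proof (cases "majorant_lim m t \<xi> < \<infinity>")
  case True
  have "(\<lambda>n. ennreal (norm (picard n m t \<xi>))) \<longlonglongrightarrow> ennreal (norm (solution m t \<xi>))"
    by (intro tendsto_ennrealI tendsto_norm picard_tendsto True)
  then show ?thesis
    by (rule LIMSEQ_le_const2) (use order_trans[OF picard_dom majorant_le_lim] in blast)
qed (simp add: not_less top_unique)

lemma picard_dom_lim: "ennreal (norm (picard n m t \<xi>)) \<le> majorant_lim m t \<xi>"
  by (rule order_trans[OF picard_dom majorant_le_lim])

lemma convolution_tendsto:
  assumes fin: "(\<integral>\<^sup>+\<eta>. majorant_lim j s (\<xi> - \<eta>) * majorant_lim k s \<eta> \<partial>lborel) < \<infinity>"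
  shows "(\<lambda>n. Defs.convolution (picard n j s) (picard n k s) \<xi>) \<longlonglongrightarrow> Defs.convolution (solution j s) (solution k s) \<xi>"
  unfolding Defs.convolution_def
proof (rule integral_tendsto_majorant[OF _ _ _ fin])
  note [measurable] = jointly_measurable_section[OF majorant_lim_measurable] jointly_measurable_section[OF picard_measurable]
    jointly_measurable_section[OF solution_measurable]
  show "(\<lambda>\<eta>. picard n j s (\<xi> - \<eta>) * picard n k s \<eta>) \<in> borel_measurable lborel" for n by measurable
  show "(\<lambda>\<eta>. solution j s (\<xi> - \<eta>) * solution k s \<eta>) \<in> borel_measurable lborel"
    "(\<lambda>\<eta>. majorant_lim j s (\<xi> - \<eta>) * majorant_lim k s \<eta>) \<in> borel_measurable lborel" by measurable
  show "ennreal (norm (picard n j s (\<xi> - \<eta>) * picard n k s \<eta>)) \<le> majorant_lim j s (\<xi> - \<eta>) * majorant_lim k s \<eta>" for n \<eta>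
    unfolding norm_mult ennreal_mult[OF norm_ge_zero norm_ge_zero] by (intro mult_mono picard_dom_lim) auto
  fix \<eta> assume w: "majorant_lim j s (\<xi> - \<eta>) * majorant_lim k s \<eta> < \<infinity>"
  \<comment> \<open>A finite product of majorants may have one factor infinite and the other 0. In
    that case both the iterates and the limit contain a vanishing factor.\<close>
  have zero: "picard n m s x = 0" "solution m s x = 0" if "majorant_lim m s x = 0" for n m x
    using picard_dom_lim[of n m s x] solution_dom[of m s x] that by auto
  consider "majorant_lim j s (\<xi> - \<eta>) = 0" | "majorant_lim k s \<eta> = 0" |
    "majorant_lim j s (\<xi> - \<eta>) < \<infinity>" "majorant_lim k s \<eta> < \<infinity>"
    using w by (auto simp: ennreal_mult_less_top)
  then show "(\<lambda>n. picard n j s (\<xi> - \<eta>) * picard n k s \<eta>) \<longlonglongrightarrow> solution j s (\<xi> - \<eta>) * solution k s \<eta>"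
  proof cases
    case 3
    then show ?thesis by (intro tendsto_mult picard_tendsto)
  qed (simp_all add: zero)
qed

lemma nonlin_tendsto:
  assumes fin: "nonlin_maj majorant_lim m s \<xi> < \<infinity>"
  shows "(\<lambda>n. nonlin (picard n) m s \<xi>) \<longlonglongrightarrow> nonlin solution m s \<xi>"
  unfolding nonlin_def
proof (intro tendsto_add tendsto_sum)
  fix j k
  show "(\<lambda>n. \<beta> m j k \<xi> * Defs.convolution (picard n j s) (picard n k s) \<xi>) \<longlonglongrightarrow> \<beta> m j k \<xi> * Defs.convolution (solution j s) (solution k s) \<xi>"
  \<comment> \<open>Where the symbol vanishes, finiteness of the sum says nothing about the
    convolution, because \<open>0 * \<infinity>\<close> is 0; the term is then identically
    0.\<close>
  proof (cases "\<beta> m j k \<xi> = 0")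
    case False
    have "ennreal (norm (\<beta> m j k \<xi>)) * (\<integral>\<^sup>+\<eta>. majorant_lim j s (\<xi> - \<eta>) * majorant_lim k s \<eta> \<partial>lborel) \<noteq> \<top>"
      using fin by (simp add: nonlin_maj_def less_top)
    then have "(\<integral>\<^sup>+\<eta>. majorant_lim j s (\<xi> - \<eta>) * majorant_lim k s \<eta> \<partial>lborel) < \<infinity>"
      using False by (auto simp: ennreal_mult_eq_top_iff less_top)
    then show ?thesis by (intro tendsto_mult_left convolution_tendsto)
  qed simp
next
  fix j
  show "(\<lambda>n. \<gamma> m j \<xi> * picard n j s \<xi>) \<longlonglongrightarrow> \<gamma> m j \<xi> * solution j s \<xi>"
  proof (cases "\<gamma> m j \<xi> = 0")
    case False
    have "ennreal (norm (\<gamma> m j \<xi>)) * majorant_lim j s \<xi> \<noteq> \<top>"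
      using fin by (simp add: nonlin_maj_def less_top)
    then have "majorant_lim j s \<xi> < \<infinity>" using False by (auto simp: ennreal_mult_eq_top_iff less_top)
    then show ?thesis by (intro tendsto_mult_left picard_tendsto)
  qed simp
qed

lemma nonlin_maj_mono:
  assumes "\<And>m t \<xi>. Y m t \<xi> \<le> Y' m t \<xi>"
  shows "nonlin_maj Y m s \<xi> \<le> nonlin_maj Y' m s \<xi>"
  unfolding nonlin_maj_def by (intro add_mono sum_mono mult_left_mono nn_integral_mono mult_mono assms) auto

text \<open>Each majorant arises from its predecessor by a monotone operation, and the predecessor
  lies below the limit. Finiteness of the Duhamel majorant thereby gives finiteness of the
  limit.\<close>

lemma majorant_lim_le: "majorant_lim m t \<xi> \<le> ennreal (norm (A m t \<xi>)) + duh_maj majorant_lim m t \<xi>"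
  unfolding majorant_lim_def[of m t \<xi>]
proof (rule SUP_least)
  fix n
  show "majorant n m t \<xi> \<le> ennreal (norm (A m t \<xi>)) + duh_maj majorant_lim m t \<xi>"
  proof (cases n)
    case (Suc k)
    show ?thesis unfolding Suc majorant.simps heat_duhamel_maj_def
      by (intro add_left_mono nn_integral_mono mult_left_mono nonlin_maj_mono majorant_le_lim) auto
  qed simp
qed

text \<open>The limit is taken pointwise in the recursion. A single finite number, the Duhamel
  majorant at this time and frequency, controls convergence of the time integral and of the
  convolutions inside it.\<close>

theorem solution_eq:
  assumes fin: "duh_maj majorant_lim m t \<xi> < \<infinity>"
  shows "solution m t \<xi> = A m t \<xi> + duh solution m t \<xi>"
proof -
  have "majorant_lim m t \<xi> < \<infinity>"
    by (rule le_less_trans[OF majorant_lim_le]) (use fin in auto)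
  from LIMSEQ_Suc[OF picard_tendsto[OF this]]
  have "(\<lambda>n. A m t \<xi> + duh (picard n) m t \<xi>) \<longlonglongrightarrow> solution m t \<xi>" by simp
  moreover have "(\<lambda>n. A m t \<xi> + duh (picard n) m t \<xi>) \<longlonglongrightarrow> A m t \<xi> + duh solution m t \<xi>"
    by (intro tendsto_add tendsto_const heat_duhamel_tendsto[OF nonlin_measurable[OF picard_measurable] nonlin_measurable[OF solution_measurable]
      nonlin_maj_measurable[OF majorant_lim_measurable] nonlin_dom[OF picard_dom_lim] nonlin_tendsto fin])
  ultimately show ?thesis by (rule LIMSEQ_unique)
qed

lemma picard_symmetric:
  assumes "\<And>m j k \<xi>. \<beta> m j k (- \<xi>) = cnj (\<beta> m j k \<xi>)" "\<And>m j \<xi>. \<gamma> m j (- \<xi>) = cnj (\<gamma> m j \<xi>)"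
    and "\<And>m t \<xi>. A m t (- \<xi>) = cnj (A m t \<xi>)"
  shows "picard n m t (- \<xi>) = cnj (picard n m t \<xi>)"
proof (induction n arbitrary: m t \<xi>)
  case (Suc n)
  have conv: "Defs.convolution (picard n j s) (picard n k s) (- \<xi>) = cnj (Defs.convolution (picard n j s) (picard n k s) \<xi>)" for j k s \<xi>
  proof -
    note [measurable] = jointly_measurable_section[OF picard_measurable]
    \<comment> \<open>Reflecting the integration variable turns the convolution at - \<xi> into one
      of reflected factors, to which the induction hypothesis applies.\<close>
    have "Defs.convolution (picard n j s) (picard n k s) (- \<xi>) = (LINT \<eta>|lborel. picard n j s (- \<xi> - (- \<eta>)) * picard n k s (- \<eta>))"
      unfolding Defs.convolution_def using integral_lborel_uminus[of "\<lambda>\<eta>. picard n j s (- \<xi> - \<eta>) * picard n k s \<eta>"] by simp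
    also have "\<dots> = (LINT \<eta>|lborel. cnj (picard n j s (\<xi> - \<eta>) * picard n k s \<eta>))"
    proof (intro Bochner_Integration.integral_cong refl)
      fix \<eta>
      have "- \<xi> - (- \<eta>) = - (\<xi> - \<eta>)" by simp
      then show "picard n j s (- \<xi> - (- \<eta>)) * picard n k s (- \<eta>) = cnj (picard n j s (\<xi> - \<eta>) * picard n k s \<eta>)"
        by (simp only: Suc complex_cnj_mult)
    qed
    also have "\<dots> = cnj (Defs.convolution (picard n j s) (picard n k s) \<xi>)"
      unfolding Defs.convolution_def by (rule Bochner_Integration.integral_cnj)
    finally show ?thesis .
  qed
  have nl: "nonlin (picard n) m s (- \<xi>) = cnj (nonlin (picard n) m s \<xi>)" for m s \<xi>
    unfolding nonlin_def by (simp add: assms conv Suc)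
  show ?case by (simp add: assms heat_duhamel_uminus nl)
qed simp

lemma solution_symmetric:
  assumes "\<And>m j k \<xi>. \<beta> m j k (- \<xi>) = cnj (\<beta> m j k \<xi>)" "\<And>m j \<xi>. \<gamma> m j (- \<xi>) = cnj (\<gamma> m j \<xi>)"
    and "\<And>m t \<xi>. A m t (- \<xi>) = cnj (A m t \<xi>)"
    and fin: "majorant_lim m t \<xi> < \<infinity>" "majorant_lim m t (- \<xi>) < \<infinity>"
  shows "solution m t (- \<xi>) = cnj (solution m t \<xi>)"
proof -
  have "(\<lambda>n. cnj (picard n m t \<xi>)) \<longlonglongrightarrow> cnj (solution m t \<xi>)"
    by (intro tendsto_cnj picard_tendsto fin)
  moreover have "(\<lambda>n. cnj (picard n m t \<xi>)) \<longlonglongrightarrow> solution m t (- \<xi>)"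
    using picard_tendsto[OF fin(2)] picard_symmetric[OF assms(1-3)] by simp
  ultimately show ?thesis by (rule LIMSEQ_unique[symmetric])
qed

end

section \<open>Majorants at the critical exponents\<close>

text \<open>The exponential is traded for \<open>t powr (- a)\<close> and a decay of order \<alpha>
  a in frequency. After paying for the factor \<open>norm \<xi> powr k\<close> a weight of order
  \<alpha> a - k remains, which lowers the index.\<close>

lemma lorentz_heat_weight:
  assumes "0 < a" "0 \<le> \<alpha> * a - k" "\<alpha> * a - k < real DIM('a::euclidean_space) * \<kappa>"
  shows "\<exists>C>0. \<forall>K (G::'a \<Rightarrow> ennreal) t. lorentz \<kappa> K G \<longrightarrow> 0 < t \<longrightarrow>
    lorentz (\<kappa> - (\<alpha> * a - k) / DIM('a)) (ennreal C * ennreal (t powr (- a)) * K)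
      (\<lambda>\<xi>. ennreal (exp (- t * norm \<xi> powr \<alpha>)) * (ennreal (norm \<xi> powr k) * G \<xi>))"
proof -
  obtain C where C: "0 < C" "\<And>K (G::'a \<Rightarrow> ennreal). lorentz \<kappa> K G \<Longrightarrow>
      lorentz (\<kappa> - (\<alpha> * a - k) / DIM('a)) (ennreal C * K) (\<lambda>x. ennreal (norm x powr (- (\<alpha> * a - k))) * G x)"
    using lorentz_weight[OF assms(2,3)] by blast
  define D where "D = exp (a * ln a)"
  have "lorentz (\<kappa> - (\<alpha> * a - k) / DIM('a)) (ennreal (C * D) * ennreal (t powr (- a)) * K)
      (\<lambda>\<xi>. ennreal (exp (- t * norm \<xi> powr \<alpha>)) * (ennreal (norm \<xi> powr k) * G \<xi>))"
    if G: "lorentz \<kappa> K G" and t: "0 < t" for K and G :: "'a \<Rightarrow> ennreal" and t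
  proof (rule lorentz_mono[OF lorentz_cmult[OF C(2)[OF G], of "ennreal (D * t powr (- a))"]])
    note [measurable] = lorentz_measurable[OF G]
    show "(\<lambda>\<xi>. ennreal (exp (- t * norm \<xi> powr \<alpha>)) * (ennreal (norm \<xi> powr k) * G \<xi>)) \<in> borel_measurable borel"
      by measurable
    show "AE \<xi> in lborel. ennreal (exp (- t * norm \<xi> powr \<alpha>)) * (ennreal (norm \<xi> powr k) * G \<xi>)
        \<le> ennreal (D * t powr (- a)) * (ennreal (norm \<xi> powr (- (\<alpha> * a - k))) * G \<xi>)"
    proof (rule AE_I2)
      fix \<xi> :: 'a
      have "ennreal (exp (- t * norm \<xi> powr \<alpha>) * norm \<xi> powr k) \<le> ennreal (D * t powr (- a) * norm \<xi> powr (k - \<alpha> * a))"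
        unfolding D_def by (intro ennreal_leI exp_powr_le assms t) simp
      then have "ennreal (exp (- t * norm \<xi> powr \<alpha>) * norm \<xi> powr k) * G \<xi> \<le> ennreal (D * t powr (- a) * norm \<xi> powr (k - \<alpha> * a)) * G \<xi>"
        by (rule mult_right_mono) simp
      then show "ennreal (exp (- t * norm \<xi> powr \<alpha>)) * (ennreal (norm \<xi> powr k) * G \<xi>)
        \<le> ennreal (D * t powr (- a)) * (ennreal (norm \<xi> powr (- (\<alpha> * a - k))) * G \<xi>)"
        by (simp add: ennreal_mult D_def mult.assoc)
    qed
    show "ennreal (D * t powr (- a)) * (ennreal C * K) \<le> ennreal (C * D) * ennreal (t powr (- a)) * K"
      using C(1) by (simp add: ennreal_mult D_def mult_ac)
  qed
  then show ?thesis using C(1) by (intro exI[of _ "C * D"]) (auto simp: D_def)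
qed

lemma sum_UNIV_option: "(\<Sum>j\<in>(UNIV::'a::finite option set). f j) = f None + (\<Sum>l\<in>UNIV. f (Some l))"
  by (simp add: UNIV_option_conv sum.reindex inj_on_def)

text \<open>Each \<kappa> is one minus a reciprocal exponent: \<open>\<kappa>p\<close>,
  \<open>\<kappa>P\<close> in time and \<open>\<kappa>q\<close>, \<open>\<kappa>Q\<close> in
  frequency, the lower-case pair for the velocity and the upper-case pair for the temperature. The
  conditions p > 2, q < 2 and those comparing an exponent with a conjugate one become inequalities
  between sums, and the two scaling relations become linear equations.\<close>

locale critical_exponents =
  fixes \<alpha> \<kappa>p \<kappa>q \<kappa>P \<kappa>Q d :: real and space :: "'n::finite itself"
  assumes d: "d = real CARD('n)"
    and \<alpha>: "0 < \<alpha>"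
    and \<kappa>p: "0 < \<kappa>p" "\<kappa>p < 1" "1 < 2 * \<kappa>p"
    and \<kappa>q: "0 < \<kappa>q" "2 * \<kappa>q < 1"
    and \<kappa>P: "0 < \<kappa>P" "\<kappa>P < \<kappa>p" "1 < \<kappa>P + \<kappa>p"
    and \<kappa>Q: "\<kappa>q \<le> \<kappa>Q" "\<kappa>q + \<kappa>Q < 1"
    and critical_u: "d * \<kappa>q = \<alpha> * \<kappa>p - 1"
    and critical_\<theta>: "\<alpha> * (1 + \<kappa>P - \<kappa>p) = d * (\<kappa>Q - \<kappa>q)"
begin

lemma d_pos: "0 < d" unfolding d by simp

text \<open>The components bound the weak norms in frequency of the majorants of velocity and temperature.\<close>

primrec time_maj :: "real \<Rightarrow> real \<Rightarrow> real \<Rightarrow> (real \<Rightarrow> ennreal) \<Rightarrow> (real \<Rightarrow> ennreal) \<Rightarrow> nat \<Rightarrow> (real \<Rightarrow> ennreal) \<times> (real \<Rightarrow> ennreal)" where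
  "time_maj c1 c2 c3 a0 b0 0 = ((\<lambda>_. 0), (\<lambda>_. 0))"
| "time_maj c1 c2 c3 a0 b0 (Suc n) = (case time_maj c1 c2 c3 a0 b0 n of (v, w) \<Rightarrow>
    ((\<lambda>t. a0 t + (ennreal c1 * (\<integral>\<^sup>+s. ennreal (\<bar>t - s\<bar> powr (- \<kappa>p)) * (v s * v s) \<partial>lborel)
        + ennreal c2 * (\<integral>\<^sup>+s. ennreal (\<bar>t - s\<bar> powr (- (1 + \<kappa>P - \<kappa>p))) * w s \<partial>lborel))),
     (\<lambda>t. b0 t + ennreal c3 * (\<integral>\<^sup>+s. ennreal (\<bar>t - s\<bar> powr (- \<kappa>p)) * (v s * w s) \<partial>lborel))))"

lemma time_maj_mono:
  "fst (time_maj c1 c2 c3 a0 b0 n) t \<le> fst (time_maj c1 c2 c3 a0 b0 (Suc n)) t \<and>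
   snd (time_maj c1 c2 c3 a0 b0 n) t \<le> snd (time_maj c1 c2 c3 a0 b0 (Suc n)) t"
proof (induction n arbitrary: t)
  case (Suc n)
  obtain v w where vw: "time_maj c1 c2 c3 a0 b0 n = (v, w)" by fastforce
  obtain v' w' where vw': "time_maj c1 c2 c3 a0 b0 (Suc n) = (v', w')" by fastforce
  have le: "v s \<le> v' s" "w s \<le> w' s" for s using Suc[of s] unfolding vw vw' by auto
  have 1: "fst (time_maj c1 c2 c3 a0 b0 (Suc n)) t = a0 t + (ennreal c1 * (\<integral>\<^sup>+s. ennreal (\<bar>t - s\<bar> powr (- \<kappa>p)) * (v s * v s) \<partial>lborel)
        + ennreal c2 * (\<integral>\<^sup>+s. ennreal (\<bar>t - s\<bar> powr (- (1 + \<kappa>P - \<kappa>p))) * w s \<partial>lborel))"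
    "snd (time_maj c1 c2 c3 a0 b0 (Suc n)) t = b0 t + ennreal c3 * (\<integral>\<^sup>+s. ennreal (\<bar>t - s\<bar> powr (- \<kappa>p)) * (v s * w s) \<partial>lborel)"
    using vw by simp_all
  have 2: "fst (time_maj c1 c2 c3 a0 b0 (Suc (Suc n))) t = a0 t + (ennreal c1 * (\<integral>\<^sup>+s. ennreal (\<bar>t - s\<bar> powr (- \<kappa>p)) * (v' s * v' s) \<partial>lborel)
        + ennreal c2 * (\<integral>\<^sup>+s. ennreal (\<bar>t - s\<bar> powr (- (1 + \<kappa>P - \<kappa>p))) * w' s \<partial>lborel))"
    "snd (time_maj c1 c2 c3 a0 b0 (Suc (Suc n))) t = b0 t + ennreal c3 * (\<integral>\<^sup>+s. ennreal (\<bar>t - s\<bar> powr (- \<kappa>p)) * (v' s * w' s) \<partial>lborel)"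
    unfolding time_maj.simps(2)[of c1 c2 c3 a0 b0 "Suc n"] vw' by simp_all
  show ?case unfolding 1 2
    by (intro conjI add_left_mono add_mono mult_left_mono nn_integral_mono mult_mono le) auto
qed simp

text \<open>The time indices close up: the kernels take \<open>v * v\<close> from 2 \<kappa>p - 1 to
  \<kappa>p, \<open>w\<close> from \<kappa>P to \<kappa>p, and \<open>v * w\<close> from \<kappa>p +
  \<kappa>P - 1 to \<kappa>P. The constant of the term linear in \<open>w\<close> is not small, so
  \<open>w\<close> is kept below \<open>2 * \<epsilon>\<close> and \<open>v\<close> below
  \<open>x\<close>, with \<epsilon> chosen after \<open>x\<close>. All numbers are fixed before the
  data.\<close>

lemma time_maj_bound:
  assumes c: "0 \<le> c1" "0 \<le> c2" "0 \<le> c3"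
  shows "\<exists>\<epsilon>>0. \<exists>X Y. \<forall>a0 b0. lorentz \<kappa>p (ennreal \<epsilon>) a0 \<longrightarrow> lorentz \<kappa>P (ennreal \<epsilon>) b0 \<longrightarrow>
    (\<forall>n. lorentz \<kappa>p (ennreal X) (fst (time_maj c1 c2 c3 a0 b0 n)) \<and> lorentz \<kappa>P (ennreal Y) (snd (time_maj c1 c2 c3 a0 b0 n)))
    \<and> 0 \<le> X \<and> 0 \<le> Y"
proof -
  obtain D1 where D1: "0 < D1" "\<And>X Y (f::real \<Rightarrow> ennreal) g. 0 \<le> Y \<Longrightarrow> lorentz \<kappa>p X f \<Longrightarrow> lorentz \<kappa>p (ennreal Y) g \<Longrightarrow>
      lorentz (\<kappa>p + \<kappa>p - 1) (ennreal D1 * X * ennreal Y) (\<lambda>x. f x * g x)"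
    using lorentz_product[of \<kappa>p \<kappa>p, where 'a = real] \<kappa>p by auto
  obtain D2 where D2: "0 < D2" "\<And>X Y (f::real \<Rightarrow> ennreal) g. 0 \<le> Y \<Longrightarrow> lorentz \<kappa>p X f \<Longrightarrow> lorentz \<kappa>P (ennreal Y) g \<Longrightarrow>
      lorentz (\<kappa>p + \<kappa>P - 1) (ennreal D2 * X * ennreal Y) (\<lambda>x. f x * g x)"
    using lorentz_product[of \<kappa>p \<kappa>P, where 'a = real] \<kappa>p \<kappa>P by auto
  obtain E1 where E1: "0 < E1" "\<And>K g. lorentz (\<kappa>p + \<kappa>p - 1) K g \<Longrightarrow>
      lorentz (1 - \<kappa>p + (\<kappa>p + \<kappa>p - 1)) (ennreal E1 * K) (\<lambda>t::real. \<integral>\<^sup>+s. ennreal (\<bar>t - s\<bar> powr (- \<kappa>p)) * g s \<partial>lborel)"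
    using lorentz_fractional_integral[of \<kappa>p "\<kappa>p + \<kappa>p - 1"] \<kappa>p by auto
  obtain E2 where E2: "0 < E2" "\<And>K g. lorentz \<kappa>P K g \<Longrightarrow>
      lorentz (1 - (1 + \<kappa>P - \<kappa>p) + \<kappa>P) (ennreal E2 * K) (\<lambda>t::real. \<integral>\<^sup>+s. ennreal (\<bar>t - s\<bar> powr (- (1 + \<kappa>P - \<kappa>p))) * g s \<partial>lborel)"
    using lorentz_fractional_integral[of "1 + \<kappa>P - \<kappa>p" \<kappa>P] \<kappa>p \<kappa>P by auto
  obtain E3 where E3: "0 < E3" "\<And>K g. lorentz (\<kappa>p + \<kappa>P - 1) K g \<Longrightarrow>
      lorentz (1 - \<kappa>p + (\<kappa>p + \<kappa>P - 1)) (ennreal E3 * K) (\<lambda>t::real. \<integral>\<^sup>+s. ennreal (\<bar>t - s\<bar> powr (- \<kappa>p)) * g s \<partial>lborel)"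
    using lorentz_fractional_integral[of \<kappa>p "\<kappa>p + \<kappa>P - 1"] \<kappa>p \<kappa>P by auto
  define k1 where "k1 = c1 * (E1 * D1)"
  define k2 where "k2 = c2 * E2"
  define k3 where "k3 = c3 * (E3 * D2)"
  have k: "0 \<le> k1" "0 \<le> k2" "0 \<le> k3" using c D1(1) D2(1) E1(1) E2(1) E3(1) by (auto simp: k1_def k2_def k3_def)
  \<comment> \<open>Small enough for the quadratic terms to use up at most half of the bounds: both
    \<open>2 * k1 * x\<close> and \<open>2 * k3 * x\<close> are at most 1.\<close>
  define x where "x = 1 / (1 + 2 * k1 + 2 * k3)"
  have den: "0 < 1 + 2 * k1 + 2 * k3" using k by linarith
  have x: "0 < x" "2 * k1 * x \<le> 1" "2 * k3 * x \<le> 1"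
    unfolding x_def using den k by (auto simp: field_simps)
  \<comment> \<open>The data contribute \<epsilon> and the linear term
    \<open>2 * k2 * \<epsilon>\<close>; this choice makes their sum the remaining half of
    \<open>x\<close>.\<close>
  define \<epsilon> where "\<epsilon> = x / (2 * (1 + 2 * k2))"
  have den2: "0 < 1 + 2 * k2" using k by linarith
  have \<epsilon>: "0 < \<epsilon>" using x den2 by (simp add: \<epsilon>_def)
  have \<epsilon>x: "2 * (\<epsilon> + 2 * k2 * \<epsilon>) = x"
  proof -
    have "2 * (\<epsilon> + 2 * k2 * \<epsilon>) = \<epsilon> * (2 * (1 + 2 * k2))" by (simp add: algebra_simps)
    also have "\<dots> = x" unfolding \<epsilon>_def using den2 by simp
    finally show ?thesis .
  qed
  have k1x: "k1 * x * x \<le> x / 2" using mult_right_mono[OF x(2), of x] x(1) by simp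
  have step1: "\<epsilon> + (k1 * x * x + k2 * (2 * \<epsilon>)) \<le> x" using \<epsilon>x k1x by (simp add: algebra_simps)
  have step2: "\<epsilon> + k3 * x * (2 * \<epsilon>) \<le> 2 * \<epsilon>" using mult_right_mono[OF x(3), of \<epsilon>] \<epsilon> by (simp add: algebra_simps)
  have main: "lorentz \<kappa>p (ennreal x) (fst (time_maj c1 c2 c3 a0 b0 n)) \<and> lorentz \<kappa>P (ennreal (2 * \<epsilon>)) (snd (time_maj c1 c2 c3 a0 b0 n))"
    if a0: "lorentz \<kappa>p (ennreal \<epsilon>) a0" and b0: "lorentz \<kappa>P (ennreal \<epsilon>) b0" for a0 b0 n
  proof (induction n)
    case 0
    then show ?case by (simp add: lorentz_zero)
  next
    case (Suc n)
    obtain v w where vw: "time_maj c1 c2 c3 a0 b0 n = (v, w)" by fastforce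
    have v: "lorentz \<kappa>p (ennreal x) v" and w: "lorentz \<kappa>P (ennreal (2 * \<epsilon>)) w" using Suc vw by auto
    have x0: "0 \<le> x" "0 \<le> 2 * \<epsilon>" using x(1) \<epsilon> by auto
    have l1: "lorentz \<kappa>p (ennreal (k1 * x * x)) (\<lambda>t. ennreal c1 * (\<integral>\<^sup>+s. ennreal (\<bar>t - s\<bar> powr (- \<kappa>p)) * (v s * v s) \<partial>lborel))"
      using lorentz_cmult[OF E1(2)[OF D1(2)[OF x0(1) v v]], of "ennreal c1"] c D1(1) E1(1) x0
      by (simp add: k1_def ennreal_mult mult.assoc)
    have l2: "lorentz \<kappa>p (ennreal (k2 * (2 * \<epsilon>))) (\<lambda>t. ennreal c2 * (\<integral>\<^sup>+s. ennreal (\<bar>t - s\<bar> powr (- (1 + \<kappa>P - \<kappa>p))) * w s \<partial>lborel))"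
    proof -
      have "1 - (1 + \<kappa>P - \<kappa>p) + \<kappa>P = \<kappa>p" by simp
      then have "lorentz \<kappa>p (ennreal c2 * (ennreal E2 * ennreal (2 * \<epsilon>))) (\<lambda>t. ennreal c2 * (\<integral>\<^sup>+s. ennreal (\<bar>t - s\<bar> powr (- (1 + \<kappa>P - \<kappa>p))) * w s \<partial>lborel))"
        using lorentz_cmult[OF E2(2)[OF w], of "ennreal c2"] by (simp only:)
      moreover have "ennreal c2 * (ennreal E2 * ennreal (2 * \<epsilon>)) = ennreal (k2 * (2 * \<epsilon>))"
        using c E2(1) x0 by (simp add: k2_def ennreal_mult[symmetric] mult.assoc)
      ultimately show ?thesis by (simp only:)
    qed
    have l3: "lorentz \<kappa>P (ennreal (k3 * x * (2 * \<epsilon>))) (\<lambda>t. ennreal c3 * (\<integral>\<^sup>+s. ennreal (\<bar>t - s\<bar> powr (- \<kappa>p)) * (v s * w s) \<partial>lborel))"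
    proof -
      have "1 - \<kappa>p + (\<kappa>p + \<kappa>P - 1) = \<kappa>P" by simp
      then have "lorentz \<kappa>P (ennreal c3 * (ennreal E3 * (ennreal D2 * ennreal x * ennreal (2 * \<epsilon>)))) (\<lambda>t. ennreal c3 * (\<integral>\<^sup>+s. ennreal (\<bar>t - s\<bar> powr (- \<kappa>p)) * (v s * w s) \<partial>lborel))"
        using lorentz_cmult[OF E3(2)[OF D2(2)[OF x0(2) v w]], of "ennreal c3"] by (simp only:)
      moreover have "ennreal c3 * (ennreal E3 * (ennreal D2 * ennreal x * ennreal (2 * \<epsilon>))) = ennreal (k3 * x * (2 * \<epsilon>))"
        using c E3(1) D2(1) x0 by (simp add: k3_def ennreal_mult[symmetric] mult.assoc)
      ultimately show ?thesis by (simp only:)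
    qed
    have nn: "0 \<le> k1 * x * x" "0 \<le> k2 * (2 * \<epsilon>)" "0 \<le> k3 * x * (2 * \<epsilon>)" "0 \<le> \<epsilon>"
      using k x0 \<epsilon> by auto
    have "ennreal \<epsilon> + (ennreal (k1 * x * x) + ennreal (k2 * (2 * \<epsilon>))) = ennreal (\<epsilon> + (k1 * x * x + k2 * (2 * \<epsilon>)))"
      using nn by (simp only: ennreal_plus add_nonneg_nonneg)
    then have sum: "ennreal \<epsilon> + (ennreal (k1 * x * x) + ennreal (k2 * (2 * \<epsilon>))) \<le> ennreal x"
      using ennreal_leI[OF step1] by (simp only:)
    have "ennreal \<epsilon> + ennreal (k3 * x * (2 * \<epsilon>)) = ennreal (\<epsilon> + k3 * x * (2 * \<epsilon>))"
      using nn by (simp only: ennreal_plus)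
    then have sum2: "ennreal \<epsilon> + ennreal (k3 * x * (2 * \<epsilon>)) \<le> ennreal (2 * \<epsilon>)"
      using ennreal_leI[OF step2] by (simp only:)
    note r1 = lorentz_add[OF a0 lorentz_add[OF l1 l2]]
    note r2 = lorentz_add[OF b0 l3]
    show ?case
      using lorentz_mono[OF r1 lorentz_measurable[OF r1] _ sum] lorentz_mono[OF r2 lorentz_measurable[OF r2] _ sum2]
      by (simp add: vw)
  qed
  show ?thesis
    using main \<epsilon> x(1) by (intro exI[of _ \<epsilon>] conjI exI[of _ x] exI[of _ "2 * \<epsilon>"]) auto
qed

end

context critical_exponents
begin

text \<open>The three estimates at a single time lag \<tau>, for convection, buoyancy and transport
  of the temperature. The powers of \<tau> are the kernels of \<open>time_maj\<close>. Bundling them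
  allows the constants to be fixed before the data.\<close>

definition space_constants :: "real \<Rightarrow> real \<Rightarrow> real \<Rightarrow> bool" where
  "space_constants c1 c2 c3 \<longleftrightarrow> 0 \<le> c1 \<and> 0 \<le> c2 \<and> 0 \<le> c3 \<and>
    (\<forall>v w (y :: 'n \<Rightarrow> real^'n \<Rightarrow> ennreal) z \<tau>. (\<forall>i. lorentz \<kappa>q v (y i)) \<longrightarrow> lorentz \<kappa>Q w z \<longrightarrow> 0 < \<tau> \<longrightarrow>
      lorentz \<kappa>q (ennreal c1 * (ennreal (\<tau> powr (- \<kappa>p)) * (v * v)))
        (\<lambda>\<xi>. ennreal (exp (- \<tau> * norm \<xi> powr \<alpha>)) * (ennreal (2 * norm \<xi>) * (\<Sum>l\<in>UNIV. \<Sum>k\<in>UNIV. \<integral>\<^sup>+\<eta>. y l (\<xi> - \<eta>) * y k \<eta> \<partial>lborel))) \<and>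
      lorentz \<kappa>q (ennreal c2 * (ennreal (\<tau> powr (- (1 + \<kappa>P - \<kappa>p))) * w))
        (\<lambda>\<xi>. ennreal (exp (- \<tau> * norm \<xi> powr \<alpha>)) * (2 * z \<xi>)) \<and>
      lorentz \<kappa>Q (ennreal c3 * (ennreal (\<tau> powr (- \<kappa>p)) * (v * w)))
        (\<lambda>\<xi>. ennreal (exp (- \<tau> * norm \<xi> powr \<alpha>)) * (ennreal (2 * norm \<xi>) * (\<Sum>k\<in>UNIV. \<integral>\<^sup>+\<eta>. z (\<xi> - \<eta>) * y k \<eta> \<partial>lborel))))"

lemma exponents_pos: "0 < \<kappa>Q" "\<kappa>Q < 1" "\<kappa>q < 1" "0 < 1 + \<kappa>P - \<kappa>p"
  using \<kappa>q \<kappa>Q \<kappa>P \<kappa>p by auto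

text \<open>Weak Young inequality for each pair of components; one constant serves both estimates,
  and the sums over components cost \<open>d * d\<close> and \<open>d\<close>.\<close>

lemma convolution_bounds:
  "\<exists>C>0. (\<forall>v (y :: 'n \<Rightarrow> real^'n \<Rightarrow> ennreal). (\<forall>i. lorentz \<kappa>q v (y i)) \<longrightarrow>
      lorentz (2 * \<kappa>q) (ennreal C * (v * v)) (\<lambda>\<xi>. \<Sum>l\<in>UNIV. \<Sum>k\<in>UNIV. \<integral>\<^sup>+\<eta>. y l (\<xi> - \<eta>) * y k \<eta> \<partial>lborel)) \<and>
    (\<forall>v w (y :: 'n \<Rightarrow> real^'n \<Rightarrow> ennreal) z. (\<forall>i. lorentz \<kappa>q v (y i)) \<longrightarrow> lorentz \<kappa>Q w z \<longrightarrow>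
      lorentz (\<kappa>q + \<kappa>Q) (ennreal C * (v * w)) (\<lambda>\<xi>. \<Sum>k\<in>UNIV. \<integral>\<^sup>+\<eta>. z (\<xi> - \<eta>) * y k \<eta> \<partial>lborel))"
proof -
  obtain C1 where C1: "0 < C1" "\<And>K L (f::real^'n \<Rightarrow> ennreal) g. lorentz \<kappa>q K f \<Longrightarrow> lorentz \<kappa>q L g \<Longrightarrow>
      lorentz (\<kappa>q + \<kappa>q) (ennreal C1 * K * L) (\<lambda>x. \<integral>\<^sup>+y. f (x - y) * g y \<partial>lborel)"
    using lorentz_convolution[of \<kappa>q \<kappa>q, where 'a = "real^'n"] \<kappa>q by auto
  obtain C2 where C2: "0 < C2" "\<And>K L (f::real^'n \<Rightarrow> ennreal) g. lorentz \<kappa>Q K f \<Longrightarrow> lorentz \<kappa>q L g \<Longrightarrow>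
      lorentz (\<kappa>Q + \<kappa>q) (ennreal C2 * K * L) (\<lambda>x. \<integral>\<^sup>+y. f (x - y) * g y \<partial>lborel)"
    using lorentz_convolution[of \<kappa>Q \<kappa>q, where 'a = "real^'n"] \<kappa>q \<kappa>Q exponents_pos by auto
  define C where "C = d * d * C1 + d * C2"
  have "0 < d * d * C1" "0 < d * C2" using C1(1) C2(1) d_pos by simp_all
  then have C: "0 < C" "d * d * C1 \<le> C" "d * C2 \<le> C" by (simp_all add: C_def)
  show ?thesis
  proof (intro exI[of _ C] conjI allI impI C(1))
    fix v and y :: "'n \<Rightarrow> real^'n \<Rightarrow> ennreal" assume y: "\<forall>i. lorentz \<kappa>q v (y i)"
    let ?G = "\<lambda>\<xi>::real^'n. \<Sum>l\<in>UNIV. \<Sum>k\<in>UNIV. \<integral>\<^sup>+(\<eta>::real^'n). y l (\<xi> - \<eta>) * y k \<eta> \<partial>lborel"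
    have G: "lorentz (\<kappa>q + \<kappa>q) (\<Sum>l\<in>(UNIV::'n set). \<Sum>k\<in>(UNIV::'n set). ennreal C1 * v * v) ?G"
      using y by (intro lorentz_sum finite C1(2)) auto
    have "(\<Sum>l\<in>(UNIV::'n set). \<Sum>k\<in>(UNIV::'n set). ennreal C1 * v * v) = ennreal (d * d * C1) * (v * v)"
      using C1(1) d_pos by (simp add: d ennreal_mult mult.assoc ennreal_of_nat_eq_real_of_nat)
    also have "\<dots> \<le> ennreal C * (v * v)" by (intro mult_right_mono ennreal_leI C) simp
    finally show "lorentz (2 * \<kappa>q) (ennreal C * (v * v)) ?G"
      using lorentz_mono[OF G lorentz_measurable[OF G]] by simp
  next
    fix v w and y :: "'n \<Rightarrow> real^'n \<Rightarrow> ennreal" and z :: "real^'n \<Rightarrow> ennreal" assume y: "\<forall>i. lorentz \<kappa>q v (y i)" and z: "lorentz \<kappa>Q w z"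
    let ?G = "\<lambda>\<xi>::real^'n. \<Sum>k\<in>UNIV. \<integral>\<^sup>+(\<eta>::real^'n). z (\<xi> - \<eta>) * y k \<eta> \<partial>lborel"
    have G: "lorentz (\<kappa>Q + \<kappa>q) (\<Sum>k\<in>(UNIV::'n set). ennreal C2 * w * v) ?G"
      using y z by (intro lorentz_sum finite C2(2)) auto
    have "(\<Sum>k\<in>(UNIV::'n set). ennreal C2 * w * v) = ennreal (d * C2) * (v * w)"
      using C2(1) d_pos by (simp add: d ennreal_mult mult_ac ennreal_of_nat_eq_real_of_nat)
    also have "\<dots> \<le> ennreal C * (v * w)" by (intro mult_right_mono ennreal_leI C) simp
    finally show "lorentz (\<kappa>q + \<kappa>Q) (ennreal C * (v * w)) ?G"
      using lorentz_mono[OF G lorentz_measurable[OF G]] by (simp add: add.commute)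
  qed
qed

text \<open>Criticality enters here. The symbol \<open>norm \<xi>\<close> and the kernel \<tau>^(-
  \<kappa>p) leave a weight that lowers the index by (\<alpha> \<kappa>p - 1) / d = \<kappa>q, which
  undoes exactly the gain of a convolution with a velocity component. The buoyancy kernel lowers
  \<kappa>Q to \<kappa>q by the second scaling relation.\<close>

lemma space_constants_exist: "\<exists>c1 c2 c3. space_constants c1 c2 c3"
proof -
  obtain C where C: "0 < C" and Cu: "\<And>v (y :: 'n \<Rightarrow> real^'n \<Rightarrow> ennreal). (\<forall>i. lorentz \<kappa>q v (y i)) \<Longrightarrow>
      lorentz (2 * \<kappa>q) (ennreal C * (v * v)) (\<lambda>\<xi>. \<Sum>l\<in>UNIV. \<Sum>k\<in>UNIV. \<integral>\<^sup>+\<eta>. y l (\<xi> - \<eta>) * y k \<eta> \<partial>lborel)"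
    and Ct: "\<And>v w (y :: 'n \<Rightarrow> real^'n \<Rightarrow> ennreal) z. (\<forall>i. lorentz \<kappa>q v (y i)) \<Longrightarrow> lorentz \<kappa>Q w z \<Longrightarrow>
      lorentz (\<kappa>q + \<kappa>Q) (ennreal C * (v * w)) (\<lambda>\<xi>. \<Sum>k\<in>UNIV. \<integral>\<^sup>+\<eta>. z (\<xi> - \<eta>) * y k \<eta> \<partial>lborel)"
    using convolution_bounds by blast
  have dk: "0 < d * \<kappa>q" using d_pos \<kappa>q by simp
  have D: "DIM(real^'n) = CARD('n)" by simp
  have e1: "2 * \<kappa>q - (\<alpha> * \<kappa>p - 1) / d = \<kappa>q" "\<kappa>q + \<kappa>Q - (\<alpha> * \<kappa>p - 1) / d = \<kappa>Q"
    using d_pos by (auto simp: critical_u[symmetric])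
  have e2: "\<kappa>Q - (\<alpha> * (1 + \<kappa>P - \<kappa>p) - 0) / d = \<kappa>q"
    using d_pos by (simp add: critical_\<theta>)
  obtain E1 where E1: "0 < E1" "\<And>K (G::real^'n \<Rightarrow> ennreal) t. lorentz (2 * \<kappa>q) K G \<Longrightarrow> 0 < t \<Longrightarrow>
      lorentz \<kappa>q (ennreal E1 * ennreal (t powr (- \<kappa>p)) * K) (\<lambda>\<xi>. ennreal (exp (- t * norm \<xi> powr \<alpha>)) * (ennreal (norm \<xi> powr 1) * G \<xi>))"
  proof -
    have "\<alpha> * \<kappa>p - 1 < real DIM(real^'n) * (2 * \<kappa>q)" unfolding D d[symmetric] using dk critical_u by simp
    then show thesis using lorentz_heat_weight[of \<kappa>p \<alpha> 1 "2 * \<kappa>q", where 'a = "real^'n"] \<kappa>p dk critical_u that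
      unfolding D d[symmetric] e1 by auto
  qed
  obtain E2 where E2: "0 < E2" "\<And>K (G::real^'n \<Rightarrow> ennreal) t. lorentz \<kappa>Q K G \<Longrightarrow> 0 < t \<Longrightarrow>
      lorentz \<kappa>q (ennreal E2 * ennreal (t powr (- (1 + \<kappa>P - \<kappa>p))) * K) (\<lambda>\<xi>. ennreal (exp (- t * norm \<xi> powr \<alpha>)) * (ennreal (norm \<xi> powr 0) * G \<xi>))"
  proof -
    have "\<alpha> * (1 + \<kappa>P - \<kappa>p) - 0 < real DIM(real^'n) * \<kappa>Q" unfolding D d[symmetric] using dk critical_\<theta> by (simp add: right_diff_distrib mult.commute)
    moreover have "0 \<le> \<alpha> * (1 + \<kappa>P - \<kappa>p) - 0" using exponents_pos \<alpha> by simp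
    ultimately show thesis using lorentz_heat_weight[of "1 + \<kappa>P - \<kappa>p" \<alpha> 0 \<kappa>Q, where 'a = "real^'n"] exponents_pos that
      unfolding D d[symmetric] e2 by auto
  qed
  obtain E3 where E3: "0 < E3" "\<And>K (G::real^'n \<Rightarrow> ennreal) t. lorentz (\<kappa>q + \<kappa>Q) K G \<Longrightarrow> 0 < t \<Longrightarrow>
      lorentz \<kappa>Q (ennreal E3 * ennreal (t powr (- \<kappa>p)) * K) (\<lambda>\<xi>. ennreal (exp (- t * norm \<xi> powr \<alpha>)) * (ennreal (norm \<xi> powr 1) * G \<xi>))"
  proof -
    have "\<alpha> * \<kappa>p - 1 < real DIM(real^'n) * (\<kappa>q + \<kappa>Q)" unfolding D d[symmetric]
      using mult_pos_pos[OF d_pos exponents_pos(1)] by (simp add: critical_u[symmetric] distrib_left)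
    then show thesis using lorentz_heat_weight[of \<kappa>p \<alpha> 1 "\<kappa>q + \<kappa>Q", where 'a = "real^'n"] \<kappa>p dk critical_u that
      unfolding D d[symmetric] e1 by auto
  qed
  have "space_constants (2 * E1 * C) (2 * E2) (2 * E3 * C)"
    unfolding space_constants_def
  proof (intro conjI allI impI)
    fix v w and y :: "'n \<Rightarrow> real^'n \<Rightarrow> ennreal" and z :: "real^'n \<Rightarrow> ennreal" and \<tau> :: real
    assume y: "\<forall>i. lorentz \<kappa>q v (y i)" and z: "lorentz \<kappa>Q w z" and \<tau>: "0 < \<tau>"
    let ?e = "\<lambda>\<xi>::real^'n. ennreal (exp (- \<tau> * norm \<xi> powr \<alpha>))"
    have two: "ennreal (2 * norm \<xi>) = 2 * ennreal (norm \<xi> powr 1)" for \<xi> :: "real^'n" by (simp add: ennreal_mult)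
    let ?G = "\<lambda>\<xi>::real^'n. \<Sum>l\<in>UNIV. \<Sum>k\<in>UNIV. \<integral>\<^sup>+(\<eta>::real^'n). y l (\<xi> - \<eta>) * y k \<eta> \<partial>lborel"
    have 1: "lorentz \<kappa>q (2 * (ennreal E1 * ennreal (\<tau> powr (- \<kappa>p)) * (ennreal C * (v * v))))
        (\<lambda>\<xi>. 2 * (?e \<xi> * (ennreal (norm \<xi> powr 1) * ?G \<xi>)))"
      by (rule lorentz_cmult[OF E1(2)[OF Cu[OF y] \<tau>]])
    moreover have "2 * (ennreal E1 * ennreal (\<tau> powr (- \<kappa>p)) * (ennreal C * (v * v))) = ennreal (2 * E1 * C) * (ennreal (\<tau> powr (- \<kappa>p)) * (v * v))"
      using E1(1) C by (simp add: ennreal_mult mult_ac)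
    moreover have "2 * (?e \<xi> * (ennreal (norm \<xi> powr 1) * ?G \<xi>)) = ?e \<xi> * (ennreal (2 * norm \<xi>) * ?G \<xi>)" for \<xi>
      unfolding two by (simp only: mult_ac)
    ultimately show "lorentz \<kappa>q (ennreal (2 * E1 * C) * (ennreal (\<tau> powr (- \<kappa>p)) * (v * v)))
        (\<lambda>\<xi>. ?e \<xi> * (ennreal (2 * norm \<xi>) * ?G \<xi>))" by (simp only:)
    let ?H = "\<lambda>\<xi>::real^'n. \<Sum>k\<in>UNIV. \<integral>\<^sup>+(\<eta>::real^'n). z (\<xi> - \<eta>) * y k \<eta> \<partial>lborel"
    have 3: "lorentz \<kappa>Q (2 * (ennreal E3 * ennreal (\<tau> powr (- \<kappa>p)) * (ennreal C * (v * w))))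
        (\<lambda>\<xi>. 2 * (?e \<xi> * (ennreal (norm \<xi> powr 1) * ?H \<xi>)))"
      by (rule lorentz_cmult[OF E3(2)[OF Ct[OF y z] \<tau>]])
    moreover have "2 * (ennreal E3 * ennreal (\<tau> powr (- \<kappa>p)) * (ennreal C * (v * w))) = ennreal (2 * E3 * C) * (ennreal (\<tau> powr (- \<kappa>p)) * (v * w))"
      using E3(1) C by (simp add: ennreal_mult mult_ac)
    moreover have "2 * (?e \<xi> * (ennreal (norm \<xi> powr 1) * ?H \<xi>)) = ?e \<xi> * (ennreal (2 * norm \<xi>) * ?H \<xi>)" for \<xi>
      unfolding two by (simp only: mult_ac)
    ultimately show "lorentz \<kappa>Q (ennreal (2 * E3 * C) * (ennreal (\<tau> powr (- \<kappa>p)) * (v * w)))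
        (\<lambda>\<xi>. ?e \<xi> * (ennreal (2 * norm \<xi>) * ?H \<xi>))" by (simp only:)
    note [measurable] = lorentz_measurable[OF z]
    have 2: "lorentz \<kappa>q (2 * (ennreal E2 * ennreal (\<tau> powr (- (1 + \<kappa>P - \<kappa>p))) * w))
        (\<lambda>\<xi>. 2 * (?e \<xi> * (ennreal (norm \<xi> powr 0) * z \<xi>)))"
      by (rule lorentz_cmult[OF E2(2)[OF z \<tau>]])
    show "lorentz \<kappa>q (ennreal (2 * E2) * (ennreal (\<tau> powr (- (1 + \<kappa>P - \<kappa>p))) * w))
        (\<lambda>\<xi>. ?e \<xi> * (2 * z \<xi>))"
    proof (rule lorentz_mono[OF 2])
      show "(\<lambda>\<xi>. ?e \<xi> * (2 * z \<xi>)) \<in> borel_measurable borel" by measurable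
      \<comment> \<open>\<open>norm \<xi> powr 0\<close> is 0 at the origin, which is therefore
        excluded.\<close>
      show "AE \<xi> in lborel. ?e \<xi> * (2 * z \<xi>) \<le> 2 * (?e \<xi> * (ennreal (norm \<xi> powr 0) * z \<xi>))"
        using AE_lborel_singleton[of "0::real^'n"] by eventually_elim (simp add: mult_ac)
      show "2 * (ennreal E2 * ennreal (\<tau> powr (- (1 + \<kappa>P - \<kappa>p))) * w) \<le> ennreal (2 * E2) * (ennreal (\<tau> powr (- (1 + \<kappa>P - \<kappa>p))) * w)"
        using E2(1) by (simp add: ennreal_mult mult.assoc)
    qed
  qed (use E1(1) E2(1) E3(1) C in auto)
  then show ?thesis by blast
qed

end

text \<open>Minkowski's inequality in time. The estimates at a fixed lag need \<open>t - s\<close>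
  to be positive, so the endpoint \<open>s = t\<close>, a null set, is taken out of the
  interval.\<close>

lemma lorentz_heat_duhamel:
  fixes H :: "real \<Rightarrow> real^'n::finite \<Rightarrow> ennreal"
  assumes H: "jointly_measurable H" and [measurable]: "K \<in> borel_measurable borel"
    and b: "\<And>s. 0 \<le> s \<Longrightarrow> s < t \<Longrightarrow> lorentz \<kappa> (K s) (\<lambda>\<xi>. ennreal (exp (- (t - s) * norm \<xi> powr \<alpha>)) * H s \<xi>)"
  shows "lorentz \<kappa> (\<integral>\<^sup>+s. K s \<partial>lborel)
    (heat_duhamel_maj \<alpha> H t)"
proof -
  note [measurable (raw)] = jointly_measurable_app[OF H]
  have "heat_duhamel_maj \<alpha> H t \<xi>
      = (\<integral>\<^sup>+s. indicator {0..<t} s * (ennreal (exp (- (t - s) * norm \<xi> powr \<alpha>)) * H s \<xi>) \<partial>lborel)" for \<xi>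
    unfolding heat_duhamel_maj_def
  proof (rule nn_integral_cong_AE)
    show "AE s in lborel. indicator {0..t} s * (ennreal (norm (heat_symbol \<alpha> (t - s) \<xi>)) * H s \<xi>)
        = indicator {0..<t} s * (ennreal (exp (- (t - s) * norm \<xi> powr \<alpha>)) * H s \<xi>)"
      using AE_lborel_singleton[of t] by eventually_elim (auto simp: indicator_def heat_symbol_def)
  qed
  moreover have "lorentz \<kappa> (\<integral>\<^sup>+s. K s \<partial>lborel) (\<lambda>\<xi>. \<integral>\<^sup>+s. indicator {0..<t} s * (ennreal (exp (- (t - s) * norm \<xi> powr \<alpha>)) * H s \<xi>) \<partial>lborel)"
  proof (rule lorentz_integral)
    show "lorentz \<kappa> (K s) (\<lambda>\<xi>. indicator {0..<t} s * (ennreal (exp (- (t - s) * norm \<xi> powr \<alpha>)) * H s \<xi>))" for s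
      using b[of s] by (cases "s \<in> {0..<t}") (simp_all add: lorentz_zero)
    show "(\<lambda>(s, \<xi>). indicator {0..<t} s * (ennreal (exp (- (t - s) * norm \<xi> powr \<alpha>)) * H s \<xi>)) \<in> borel_measurable (borel \<Otimes>\<^sub>M borel)"
      by measurable
  qed measurable
  ultimately show ?thesis by presburger
qed

text \<open>Tonelli together with the bound 1 for the heat symbol. Weighted integrability of the
  nonlinearity over \<open>{0..t}\<close> thus carries over to its Duhamel integral at the same time
  \<open>t\<close>.\<close>

lemma heat_duhamel_decay_le:
  fixes H :: "real \<Rightarrow> real^'n::finite \<Rightarrow> ennreal"
  assumes H: "jointly_measurable H"
  shows "(\<integral>\<^sup>+\<xi>. heat_duhamel_maj \<alpha> H t \<xi> * ennreal (decay N \<xi>) \<partial>lborel)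
    \<le> (\<integral>\<^sup>+s\<in>{0..t}. (\<integral>\<^sup>+\<xi>. H s \<xi> * ennreal (decay N \<xi>) \<partial>lborel) \<partial>lborel)"
proof -
  note [measurable (raw)] = jointly_measurable_app[OF H] jointly_measurable_app[OF jointly_measurable_heat]
  have "(\<integral>\<^sup>+\<xi>. heat_duhamel_maj \<alpha> H t \<xi> * ennreal (decay N \<xi>) \<partial>lborel)
      = (\<integral>\<^sup>+\<xi>. \<integral>\<^sup>+s. indicator {0..t} s * (ennreal (norm (heat_symbol \<alpha> (t - s) \<xi>)) * H s \<xi>) * ennreal (decay N \<xi>) \<partial>lborel \<partial>lborel)"
    unfolding heat_duhamel_maj_def by (intro nn_integral_cong, subst nn_integral_multc) measurable
  also have "\<dots> = (\<integral>\<^sup>+s. \<integral>\<^sup>+\<xi>. indicator {0..t} s * (ennreal (norm (heat_symbol \<alpha> (t - s) \<xi>)) * H s \<xi>) * ennreal (decay N \<xi>) \<partial>lborel \<partial>lborel)"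
    by (rule lborel_pair.Fubini') measurable
  also have "\<dots> \<le> (\<integral>\<^sup>+s. (\<integral>\<^sup>+\<xi>. H s \<xi> * ennreal (decay N \<xi>) \<partial>lborel) * indicator {0..t} s \<partial>lborel)"
  proof (rule nn_integral_mono)
    fix s
    show "(\<integral>\<^sup>+\<xi>. indicator {0..t} s * (ennreal (norm (heat_symbol \<alpha> (t - s) \<xi>)) * H s \<xi>) * ennreal (decay N \<xi>) \<partial>lborel)
      \<le> (\<integral>\<^sup>+\<xi>. H s \<xi> * ennreal (decay N \<xi>) \<partial>lborel) * indicator {0..t} s"
    proof (cases "s \<in> {0..t}")
      case True
      have "ennreal (norm (heat_symbol \<alpha> (t - s) \<xi>)) * H s \<xi> \<le> 1 * H s \<xi>" for \<xi> :: "real^'n"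
        using True norm_heat_symbol_le[of "t - s" \<alpha> \<xi>] by (intro mult_right_mono) (auto simp: ennreal_le_1)
      then show ?thesis using True by (auto intro!: nn_integral_mono mult_right_mono)
    qed simp
  qed
  finally show ?thesis .
qed

text \<open>The vanishing conditions record the coupling: velocity components interact with each
  other in the velocity equations, the temperature only with the velocity as second factor in its
  own equation, and linearly in the velocity equations.\<close>

locale boussinesq_symbols =
  critical_exponents \<alpha> \<kappa>p \<kappa>q \<kappa>P \<kappa>Q d space + quadratic_duhamel \<alpha> \<beta> \<gamma> A
  for \<alpha> \<kappa>p \<kappa>q \<kappa>P \<kappa>Q d and space :: "'n::finite itself"
    and \<beta> :: "'n option \<Rightarrow> 'n option \<Rightarrow> 'n option \<Rightarrow> real^'n \<Rightarrow> complex"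
    and \<gamma> :: "'n option \<Rightarrow> 'n option \<Rightarrow> real^'n \<Rightarrow> complex"
    and A :: "'n option \<Rightarrow> real \<Rightarrow> real^'n \<Rightarrow> complex" +
  assumes \<beta>_le: "norm (\<beta> m j k \<xi>) \<le> 2 * norm \<xi>"
    and \<beta>_zero: "\<beta> (Some i) None k \<xi> = 0" "\<beta> (Some i) j None \<xi> = 0" "\<beta> None (Some l) k \<xi> = 0" "\<beta> None j None \<xi> = 0"
    and \<gamma>_le: "norm (\<gamma> m j \<xi>) \<le> 2"
    and \<gamma>_zero: "\<gamma> (Some i) (Some l) \<xi> = 0" "\<gamma> None j \<xi> = 0"
begin

lemma nonlin_maj_Some_le:
  "nonlin_maj Y (Some i) s \<xi> \<le> ennreal (2 * norm \<xi>) *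
      (\<Sum>l\<in>UNIV. \<Sum>k\<in>UNIV. \<integral>\<^sup>+\<eta>. Y (Some l) s (\<xi> - \<eta>) * Y (Some k) s \<eta> \<partial>lborel) + 2 * Y None s \<xi>"
proof -
  have "ennreal (norm (\<gamma> (Some i) None \<xi>)) \<le> 2"
    using ennreal_leI[OF \<gamma>_le[of "Some i" None \<xi>]] by simp
  then show ?thesis
    unfolding nonlin_maj_def sum_UNIV_option
    by (simp add: \<beta>_zero \<gamma>_zero sum_distrib_left) (intro add_mono sum_mono mult_right_mono ennreal_leI \<beta>_le, auto)
qed

lemma nonlin_maj_None_le:
  "nonlin_maj Y None s \<xi> \<le> ennreal (2 * norm \<xi>) * (\<Sum>k\<in>UNIV. \<integral>\<^sup>+\<eta>. Y None s (\<xi> - \<eta>) * Y (Some k) s \<eta> \<partial>lborel)"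
  unfolding nonlin_maj_def sum_UNIV_option
  by (simp add: \<beta>_zero \<gamma>_zero sum_distrib_left) (intro sum_mono mult_right_mono ennreal_leI \<beta>_le, auto)

text \<open>Induction along the two iterations at once. The frequency estimate at time
  \<open>s\<close> passes through the lag \<open>t - s\<close> with the kernels of
  \<open>space_constants\<close>, and Minkowski over \<open>s\<close> reproduces the recursion of
  \<open>time_maj\<close> literally.\<close>

lemma majorant_lorentz:
  assumes c: "space_constants c1 c2 c3"
    and a0[measurable]: "a0 \<in> borel_measurable borel" and b0[measurable]: "b0 \<in> borel_measurable borel"
    and Au: "\<And>i t. lorentz \<kappa>q (a0 t) (\<lambda>\<xi>. ennreal (norm (A (Some i) t \<xi>)))"
    and At: "\<And>t. lorentz \<kappa>Q (b0 t) (\<lambda>\<xi>. ennreal (norm (A None t \<xi>)))"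
  shows "(\<forall>i t. lorentz \<kappa>q (fst (time_maj c1 c2 c3 a0 b0 n) t) (majorant n (Some i) t)) \<and>
    (\<forall>t. lorentz \<kappa>Q (snd (time_maj c1 c2 c3 a0 b0 n) t) (majorant n None t)) \<and>
    fst (time_maj c1 c2 c3 a0 b0 n) \<in> borel_measurable borel \<and> snd (time_maj c1 c2 c3 a0 b0 n) \<in> borel_measurable borel"
proof (induction n)
  case 0
  show ?case by (simp add: lorentz_zero)
next
  case (Suc n)
  obtain v w where vw: "time_maj c1 c2 c3 a0 b0 n = (v, w)" by fastforce
  have v: "lorentz \<kappa>q (v s) (majorant n (Some i) s)" and w: "lorentz \<kappa>Q (w s) (majorant n None s)" for i s
    using Suc vw by auto
  have [measurable]: "v \<in> borel_measurable borel" "w \<in> borel_measurable borel" using Suc vw by auto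
  let ?ku = "\<lambda>t s. ennreal (\<bar>t - s\<bar> powr (- \<kappa>p)) * (v s * v s)"
  let ?kw = "\<lambda>t s. ennreal (\<bar>t - s\<bar> powr (- (1 + \<kappa>P - \<kappa>p))) * w s"
  let ?kt = "\<lambda>t s. ennreal (\<bar>t - s\<bar> powr (- \<kappa>p)) * (v s * w s)"
  have meas: "(\<lambda>\<xi>. ennreal (exp (- (t - s) * norm \<xi> powr \<alpha>)) * nonlin_maj (majorant n) m s \<xi>) \<in> borel_measurable borel" for t s m
  proof -
    note [measurable] = jointly_measurable_section[OF nonlin_maj_measurable[OF majorant_measurable]]
    show ?thesis by measurable
  qed
  have "lorentz \<kappa>q (\<integral>\<^sup>+s. ennreal c1 * ?ku t s + ennreal c2 * ?kw t s \<partial>lborel) (duh_maj (majorant n) (Some i) t)" for i t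
  proof (rule lorentz_heat_duhamel[OF nonlin_maj_measurable[OF majorant_measurable]])
    fix s assume s: "0 \<le> s" "s < t"
    have 1: "lorentz \<kappa>q (ennreal c1 * ?ku t s) (\<lambda>\<xi>. ennreal (exp (- (t - s) * norm \<xi> powr \<alpha>)) *
        (ennreal (2 * norm \<xi>) * (\<Sum>l\<in>UNIV. \<Sum>k\<in>UNIV. \<integral>\<^sup>+\<eta>. majorant n (Some l) s (\<xi> - \<eta>) * majorant n (Some k) s \<eta> \<partial>lborel)))"
      and 2: "lorentz \<kappa>q (ennreal c2 * ?kw t s) (\<lambda>\<xi>. ennreal (exp (- (t - s) * norm \<xi> powr \<alpha>)) * (2 * majorant n None s \<xi>))"
      using c[unfolded space_constants_def, THEN conjunct2, THEN conjunct2, THEN conjunct2, rule_format,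
          of "v s" "\<lambda>l. majorant n (Some l) s" "w s" "majorant n None s" "t - s"] s v w by auto
    show "lorentz \<kappa>q (ennreal c1 * ?ku t s + ennreal c2 * ?kw t s) (\<lambda>\<xi>. ennreal (exp (- (t - s) * norm \<xi> powr \<alpha>)) * nonlin_maj (majorant n) (Some i) s \<xi>)"
      by (rule lorentz_mono[OF lorentz_add[OF 1 2] meas])
        (auto simp: distrib_left[symmetric] intro!: AE_I2 mult_left_mono nonlin_maj_Some_le)
  qed measurable
  moreover have "(\<integral>\<^sup>+s. ennreal c1 * ?ku t s + ennreal c2 * ?kw t s \<partial>lborel) = ennreal c1 * (\<integral>\<^sup>+s. ?ku t s \<partial>lborel) + ennreal c2 * (\<integral>\<^sup>+s. ?kw t s \<partial>lborel)" for t
    by (subst nn_integral_add, measurable) (subst (1 2) nn_integral_cmult, measurable)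
  ultimately have u: "lorentz \<kappa>q (a0 t + (ennreal c1 * (\<integral>\<^sup>+s. ?ku t s \<partial>lborel) + ennreal c2 * (\<integral>\<^sup>+s. ?kw t s \<partial>lborel))) (majorant (Suc n) (Some i) t)" for i t
    using lorentz_add[OF Au] by simp
  have "lorentz \<kappa>Q (\<integral>\<^sup>+s. ennreal c3 * ?kt t s \<partial>lborel) (duh_maj (majorant n) None t)" for t
  proof (rule lorentz_heat_duhamel[OF nonlin_maj_measurable[OF majorant_measurable]])
    fix s assume s: "0 \<le> s" "s < t"
    have 1: "lorentz \<kappa>Q (ennreal c3 * ?kt t s) (\<lambda>\<xi>. ennreal (exp (- (t - s) * norm \<xi> powr \<alpha>)) *
        (ennreal (2 * norm \<xi>) * (\<Sum>k\<in>UNIV. \<integral>\<^sup>+\<eta>. majorant n None s (\<xi> - \<eta>) * majorant n (Some k) s \<eta> \<partial>lborel)))"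
      using c[unfolded space_constants_def, THEN conjunct2, THEN conjunct2, THEN conjunct2, rule_format,
          of "v s" "\<lambda>l. majorant n (Some l) s" "w s" "majorant n None s" "t - s"] s v w by auto
    show "lorentz \<kappa>Q (ennreal c3 * ?kt t s) (\<lambda>\<xi>. ennreal (exp (- (t - s) * norm \<xi> powr \<alpha>)) * nonlin_maj (majorant n) None s \<xi>)"
      by (rule lorentz_mono[OF 1 meas]) (auto intro!: AE_I2 mult_left_mono nonlin_maj_None_le)
  qed measurable
  moreover have "(\<integral>\<^sup>+s. ennreal c3 * ?kt t s \<partial>lborel) = ennreal c3 * (\<integral>\<^sup>+s. ?kt t s \<partial>lborel)" for t
    by (rule nn_integral_cmult) measurable
  ultimately have \<theta>: "lorentz \<kappa>Q (b0 t + ennreal c3 * (\<integral>\<^sup>+s. ?kt t s \<partial>lborel)) (majorant (Suc n) None t)" for t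
    using lorentz_add[OF At] by simp
  have "(\<lambda>t. a0 t + (ennreal c1 * (\<integral>\<^sup>+s. ?ku t s \<partial>lborel) + ennreal c2 * (\<integral>\<^sup>+s. ?kw t s \<partial>lborel))) \<in> borel_measurable borel"
    "(\<lambda>t. b0 t + ennreal c3 * (\<integral>\<^sup>+s. ?kt t s \<partial>lborel)) \<in> borel_measurable borel" by measurable
  with u \<theta> show ?case by (simp add: vw del: majorant.simps)
qed

text \<open>Both iterations increase, so the suprema of the time bounds dominate the frequency norms
  of the limiting majorants and inherit the uniform weak bounds in time.\<close>

lemma majorant_lim_lorentz:
  assumes c: "space_constants c1 c2 c3"
    and a0: "a0 \<in> borel_measurable borel" and b0: "b0 \<in> borel_measurable borel"
    and Au: "\<And>i t. lorentz \<kappa>q (a0 t) (\<lambda>\<xi>. ennreal (norm (A (Some i) t \<xi>)))"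
    and At: "\<And>t. lorentz \<kappa>Q (b0 t) (\<lambda>\<xi>. ennreal (norm (A None t \<xi>)))"
    and bound: "\<And>n. lorentz \<kappa>p X (fst (time_maj c1 c2 c3 a0 b0 n))" "\<And>n. lorentz \<kappa>P X' (snd (time_maj c1 c2 c3 a0 b0 n))"
  obtains v w where "lorentz \<kappa>p X v" "lorentz \<kappa>P X' w"
    "\<And>i t. lorentz \<kappa>q (v t) (majorant_lim (Some i) t)" "\<And>t. lorentz \<kappa>Q (w t) (majorant_lim None t)"
proof
  let ?v = "\<lambda>n. fst (time_maj c1 c2 c3 a0 b0 n)" and ?w = "\<lambda>n. snd (time_maj c1 c2 c3 a0 b0 n)"
  note m = majorant_lorentz[OF c a0 b0 Au At]
  have inc: "incseq ?v" "incseq ?w"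
    using time_maj_mono by (auto intro!: incseq_SucI le_funI)
  show "lorentz \<kappa>p X (\<lambda>t. SUP n. ?v n t)" by (rule lorentz_SUP[OF bound(1) inc(1)])
  show "lorentz \<kappa>P X' (\<lambda>t. SUP n. ?w n t)" by (rule lorentz_SUP[OF bound(2) inc(2)])
  have incm: "incseq (\<lambda>n. majorant n m t)" for m t
    using majorant_incseq[of m t] by (auto simp: incseq_def le_fun_def)
  show "lorentz \<kappa>q (SUP n. ?v n t) (majorant_lim (Some i) t)" for i t
  proof -
    have "lorentz \<kappa>q (SUP n. ?v n t) (majorant n (Some i) t)" for n
    proof -
      have l: "lorentz \<kappa>q (?v n t) (majorant n (Some i) t)" using m by blast
      show ?thesis by (rule lorentz_mono[OF l lorentz_measurable[OF l]]) (auto intro: SUP_upper)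
    qed
    from lorentz_SUP[OF this incm] show ?thesis unfolding majorant_lim_def[abs_def] .
  qed
  show "lorentz \<kappa>Q (SUP n. ?w n t) (majorant_lim None t)" for t
  proof -
    have "lorentz \<kappa>Q (SUP n. ?w n t) (majorant n None t)" for n
    proof -
      have l: "lorentz \<kappa>Q (?w n t) (majorant n None t)" using m by blast
      show ?thesis by (rule lorentz_mono[OF l lorentz_measurable[OF l]]) (auto intro: SUP_upper)
    qed
    from lorentz_SUP[OF this incm] show ?thesis unfolding majorant_lim_def[abs_def] .
  qed
qed

text \<open>The mild equation is wanted at every time, so the nonlinear majorants must be integrable
  over each interval \<open>{0..t}\<close>. In time this holds because products of weak functions
  with index sum above 1 are locally integrable; in frequency it comes from the decay
  weight.\<close>

lemma nonlin_maj_decay_finite: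
  assumes Y: "\<And>m. jointly_measurable (Y m)"
    and v: "lorentz \<kappa>p (ennreal X) v" "0 \<le> X" and w: "lorentz \<kappa>P (ennreal X') w" "0 \<le> X'"
    and Yu: "\<And>i s. lorentz \<kappa>q (v s) (Y (Some i) s)" and Yt: "\<And>s. lorentz \<kappa>Q (w s) (Y None s)"
  shows "(\<integral>\<^sup>+s\<in>{0..t}. (\<integral>\<^sup>+\<xi>. nonlin_maj Y m s \<xi> * ennreal (decay (CARD('n) + 2) \<xi>) \<partial>lborel) \<partial>lborel) < \<infinity>"
proof -
  note [measurable] = lorentz_measurable[OF v(1)] lorentz_measurable[OF w(1)]
  obtain C where C: "0 < C" and Cu: "\<And>v (y :: 'n \<Rightarrow> real^'n \<Rightarrow> ennreal). (\<forall>i. lorentz \<kappa>q v (y i)) \<Longrightarrow>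
      lorentz (2 * \<kappa>q) (ennreal C * (v * v)) (\<lambda>\<xi>. \<Sum>l\<in>UNIV. \<Sum>k\<in>UNIV. \<integral>\<^sup>+\<eta>. y l (\<xi> - \<eta>) * y k \<eta> \<partial>lborel)"
    and Ct: "\<And>v w (y :: 'n \<Rightarrow> real^'n \<Rightarrow> ennreal) z. (\<forall>i. lorentz \<kappa>q v (y i)) \<Longrightarrow> lorentz \<kappa>Q w z \<Longrightarrow>
      lorentz (\<kappa>q + \<kappa>Q) (ennreal C * (v * w)) (\<lambda>\<xi>. \<Sum>k\<in>UNIV. \<integral>\<^sup>+\<eta>. z (\<xi> - \<eta>) * y k \<eta> \<partial>lborel)"
    using convolution_bounds by blast
  have dec: "\<exists>D>0. \<forall>K (G::real^'n \<Rightarrow> ennreal). lorentz \<kappa> K G \<longrightarrow> (\<integral>\<^sup>+x. G x * ennreal (decay (CARD('n) + 1) x) \<partial>lborel) \<le> ennreal D * K"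
    if "0 \<le> \<kappa>" "\<kappa> \<le> 1" for \<kappa>
    using lorentz_decay_integral[OF that, where 'a = "real^'n"] by simp
  obtain D1 where D1: "\<And>K (G::real^'n \<Rightarrow> ennreal). lorentz (2 * \<kappa>q) K G \<Longrightarrow> (\<integral>\<^sup>+x. G x * ennreal (decay (CARD('n) + 1) x) \<partial>lborel) \<le> ennreal D1 * K"
    using dec[of "2 * \<kappa>q"] \<kappa>q by auto
  obtain D2 where D2: "\<And>K (G::real^'n \<Rightarrow> ennreal). lorentz \<kappa>Q K G \<Longrightarrow> (\<integral>\<^sup>+x. G x * ennreal (decay (CARD('n) + 1) x) \<partial>lborel) \<le> ennreal D2 * K"
    using dec[of \<kappa>Q] exponents_pos by auto
  obtain D3 where D3: "\<And>K (G::real^'n \<Rightarrow> ennreal). lorentz (\<kappa>q + \<kappa>Q) K G \<Longrightarrow> (\<integral>\<^sup>+x. G x * ennreal (decay (CARD('n) + 1) x) \<partial>lborel) \<le> ennreal D3 * K"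
    using dec[of "\<kappa>q + \<kappa>Q"] exponents_pos \<kappa>q \<kappa>Q by auto
  \<comment> \<open>The weight has \<open>CARD('n) + 1\<close> powers for integrability and one more
    for the factor \<open>norm \<xi>\<close> of the symbols.\<close>
  have wt: "ennreal (2 * norm \<xi>) * G * ennreal (decay (CARD('n) + 2) \<xi>) \<le> 2 * (G * ennreal (decay (CARD('n) + 1) \<xi>))" for \<xi> :: "real^'n" and G
  proof -
    have "norm \<xi> * decay 1 \<xi> \<le> (1 + norm \<xi>) ^ 1 * decay 1 \<xi>" by (intro mult_right_mono) auto
    then have "norm \<xi> * decay 1 \<xi> \<le> 1" by (simp only: power_decay)
    moreover have "decay (CARD('n) + 2) \<xi> = decay 1 \<xi> * decay (CARD('n) + 1) \<xi>"
      using decay_add[of 1 "CARD('n) + 1" \<xi>] by simp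
    ultimately have "2 * norm \<xi> * decay (CARD('n) + 2) \<xi> \<le> 2 * decay (CARD('n) + 1) \<xi>"
      using mult_right_mono[of "norm \<xi> * decay 1 \<xi>" 1 "decay (CARD('n) + 1) \<xi>"] by (simp add: mult.assoc)
    then have "ennreal (2 * norm \<xi> * decay (CARD('n) + 2) \<xi>) * G \<le> ennreal (2 * decay (CARD('n) + 1) \<xi>) * G"
      by (intro mult_right_mono ennreal_leI) auto
    then show ?thesis by (simp add: ennreal_mult mult_ac)
  qed
  have wt2: "G * ennreal (decay (CARD('n) + 2) \<xi>) \<le> G * ennreal (decay (CARD('n) + 1) \<xi>)" for \<xi> :: "real^'n" and G
    by (intro mult_left_mono ennreal_leI decay_antimono) auto
  have vv: "(\<integral>\<^sup>+s. (v s * v s) * indicator {0..t} s \<partial>lborel) < \<infinity>"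
    and vw: "(\<integral>\<^sup>+s. (v s * w s) * indicator {0..t} s \<partial>lborel) < \<infinity>"
    by (rule lorentz_product_Icc_finite[OF v(1) v(1) v(2) v(2)] lorentz_product_Icc_finite[OF v(1) w(1) v(2) w(2)]; use \<kappa>p \<kappa>P in simp)+
  note ww = lorentz_Icc_finite[OF w(1), of 0 t]
  show ?thesis
  proof (cases m)
    case None
    have "(\<integral>\<^sup>+\<xi>. nonlin_maj Y None s \<xi> * ennreal (decay (CARD('n) + 2) \<xi>) \<partial>lborel) \<le> 2 * (ennreal D3 * (ennreal C * (v s * w s)))" for s
    proof -
      let ?G = "\<lambda>\<xi>::real^'n. \<Sum>k\<in>UNIV. \<integral>\<^sup>+(\<eta>::real^'n). Y None s (\<xi> - \<eta>) * Y (Some k) s \<eta> \<partial>lborel"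
      have G: "lorentz (\<kappa>q + \<kappa>Q) (ennreal C * (v s * w s)) ?G" using Yu Yt by (intro Ct) auto
      note [measurable] = lorentz_measurable[OF G]
      have "(\<integral>\<^sup>+\<xi>. nonlin_maj Y None s \<xi> * ennreal (decay (CARD('n) + 2) \<xi>) \<partial>lborel) \<le> (\<integral>\<^sup>+\<xi>. 2 * (?G \<xi> * ennreal (decay (CARD('n) + 1) \<xi>)) \<partial>lborel)"
        by (intro nn_integral_mono order_trans[OF mult_right_mono[OF nonlin_maj_None_le] wt]) auto
      also have "\<dots> = 2 * (\<integral>\<^sup>+\<xi>. ?G \<xi> * ennreal (decay (CARD('n) + 1) \<xi>) \<partial>lborel)"
        by (rule nn_integral_cmult) measurable
      also have "\<dots> \<le> 2 * (ennreal D3 * (ennreal C * (v s * w s)))" by (intro mult_left_mono D3 G) auto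
      finally show ?thesis .
    qed
    then have "(\<integral>\<^sup>+s\<in>{0..t}. (\<integral>\<^sup>+\<xi>. nonlin_maj Y m s \<xi> * ennreal (decay (CARD('n) + 2) \<xi>) \<partial>lborel) \<partial>lborel)
        \<le> (\<integral>\<^sup>+s. (2 * (ennreal D3 * ennreal C)) * ((v s * w s) * indicator {0..t} s) \<partial>lborel)"
      unfolding None by (intro nn_integral_mono) (auto simp: indicator_def mult_ac)
    also have "\<dots> = (2 * (ennreal D3 * ennreal C)) * (\<integral>\<^sup>+s. (v s * w s) * indicator {0..t} s \<partial>lborel)"
      by (rule nn_integral_cmult) measurable
    also have "\<dots> < \<infinity>" using vw by (simp add: ennreal_mult_less_top)
    finally show ?thesis .
  next
    case (Some i)
    have "(\<integral>\<^sup>+\<xi>. nonlin_maj Y (Some i) s \<xi> * ennreal (decay (CARD('n) + 2) \<xi>) \<partial>lborel)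
        \<le> 2 * (ennreal D1 * (ennreal C * (v s * v s))) + 2 * (ennreal D2 * w s)" for s
    proof -
      let ?G = "\<lambda>\<xi>::real^'n. \<Sum>l\<in>UNIV. \<Sum>k\<in>UNIV. \<integral>\<^sup>+(\<eta>::real^'n). Y (Some l) s (\<xi> - \<eta>) * Y (Some k) s \<eta> \<partial>lborel"
      have G: "lorentz (2 * \<kappa>q) (ennreal C * (v s * v s)) ?G" using Yu by (intro Cu) auto
      note [measurable] = lorentz_measurable[OF G] lorentz_measurable[OF Yt]
      have "(\<integral>\<^sup>+\<xi>. nonlin_maj Y (Some i) s \<xi> * ennreal (decay (CARD('n) + 2) \<xi>) \<partial>lborel)
          \<le> (\<integral>\<^sup>+\<xi>. 2 * (?G \<xi> * ennreal (decay (CARD('n) + 1) \<xi>)) + 2 * (Y None s \<xi> * ennreal (decay (CARD('n) + 1) \<xi>)) \<partial>lborel)"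
      proof (rule nn_integral_mono)
        fix \<xi> :: "real^'n"
        have "nonlin_maj Y (Some i) s \<xi> * ennreal (decay (CARD('n) + 2) \<xi>)
            \<le> (ennreal (2 * norm \<xi>) * ?G \<xi> + 2 * Y None s \<xi>) * ennreal (decay (CARD('n) + 2) \<xi>)"
          by (intro mult_right_mono nonlin_maj_Some_le) simp
        also have "\<dots> \<le> 2 * (?G \<xi> * ennreal (decay (CARD('n) + 1) \<xi>)) + 2 * Y None s \<xi> * ennreal (decay (CARD('n) + 1) \<xi>)"
          unfolding distrib_right by (intro add_mono wt wt2)
        finally show "nonlin_maj Y (Some i) s \<xi> * ennreal (decay (CARD('n) + 2) \<xi>)
            \<le> 2 * (?G \<xi> * ennreal (decay (CARD('n) + 1) \<xi>)) + 2 * (Y None s \<xi> * ennreal (decay (CARD('n) + 1) \<xi>))"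
          by (simp only: mult.assoc)
      qed
      also have "\<dots> = 2 * (\<integral>\<^sup>+\<xi>. ?G \<xi> * ennreal (decay (CARD('n) + 1) \<xi>) \<partial>lborel) + 2 * (\<integral>\<^sup>+\<xi>. Y None s \<xi> * ennreal (decay (CARD('n) + 1) \<xi>) \<partial>lborel)"
        by (subst nn_integral_add, measurable) (subst (1 2) nn_integral_cmult, measurable)
      also have "\<dots> \<le> 2 * (ennreal D1 * (ennreal C * (v s * v s))) + 2 * (ennreal D2 * w s)"
        by (intro add_mono mult_left_mono D1 D2 G Yt) auto
      finally show ?thesis .
    qed
    then have "(\<integral>\<^sup>+s\<in>{0..t}. (\<integral>\<^sup>+\<xi>. nonlin_maj Y m s \<xi> * ennreal (decay (CARD('n) + 2) \<xi>) \<partial>lborel) \<partial>lborel)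
        \<le> (\<integral>\<^sup>+s. (2 * (ennreal D1 * ennreal C)) * ((v s * v s) * indicator {0..t} s) + (2 * ennreal D2) * (w s * indicator {0..t} s) \<partial>lborel)"
      unfolding Some by (intro nn_integral_mono) (auto simp: indicator_def mult_ac)
    also have "\<dots> = (2 * (ennreal D1 * ennreal C)) * (\<integral>\<^sup>+s. (v s * v s) * indicator {0..t} s \<partial>lborel) + (2 * ennreal D2) * (\<integral>\<^sup>+s. w s * indicator {0..t} s \<partial>lborel)"
      by (subst nn_integral_add, measurable) (subst (1 2) nn_integral_cmult, measurable)
    also have "\<dots> < \<infinity>" using vv ww by (simp add: ennreal_mult_less_top)
    finally show ?thesis .
  qed
qed

end

section \<open>Estimates for the data\<close>

lemma weak_norm_cong_AE:
  assumes [measurable]: "f \<in> borel_measurable M" "g \<in> borel_measurable M" and eq: "AE x in M. f x = g x"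
  shows "weak_norm M q f = weak_norm M q g"
proof -
  have "emeasure M {x \<in> space M. ennreal l < f x} = emeasure M {x \<in> space M. ennreal l < g x}" for l
    using eq by (intro emeasure_eq_AE) auto
  then show ?thesis by (simp add: weak_norm_def)
qed

text \<open>The time norms live on the completed measure of the half line, \<open>lorentz\<close> on
  Borel functions of the whole line. Agreement almost everywhere with a Borel function bridges the
  first difference; extension by 0, which leaves the level sets unchanged, bridges the
  second.\<close>

lemma weak_norm_half_line:
  fixes w v :: "real \<Rightarrow> ennreal"
  assumes [measurable]: "v \<in> borel_measurable borel" and eq: "AE t in lborel. 0 \<le> t \<longrightarrow> w t = v t"
  shows "weak_norm (lebesgue_on {0..}) p w = weak_norm lborel p (\<lambda>t. indicator {0..} t * v t)"
proof -
  have "emeasure (lebesgue_on {0..}) {t \<in> space (lebesgue_on {0..}). ennreal l < w t}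
      = emeasure lborel {t \<in> space lborel. ennreal l < indicator {0..} t * v t}" if "0 < l" for l
  proof -
    define W where "W = {t. ennreal l < indicator {0..} t * w t}"
    define V where "V = {t. ennreal l < indicator {0..} t * v t}"
    have V: "V \<in> sets borel" unfolding V_def by measurable
    have AE: "AE t in lborel. indicator {0..} t * w t = indicator {0..} t * v t"
      using eq by eventually_elim (auto simp: indicator_def)
    have [measurable]: "(\<lambda>t. indicator {0..} t * w t) \<in> borel_measurable lebesgue"
      by (rule borel_measurable_completion_AE_eq[OF _ AE]) measurable
    have W: "W \<in> sets lebesgue"
    proof -
      have "W = {t \<in> space lebesgue. ennreal l < indicator {0..} t * w t}" by (simp add: W_def)
      then show ?thesis by (simp only: borel_measurable_less sets.sets_Collect) measurable
    qed
    have sub: "W \<subseteq> {0..}" by (auto simp: W_def indicator_def split: if_splits)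
    have "{t \<in> space (lebesgue_on {0..}). ennreal l < w t} = W"
      using sub by (auto simp: W_def space_restrict_space indicator_def split: if_splits)
    then have "emeasure (lebesgue_on {0..}) {t \<in> space (lebesgue_on {0..}). ennreal l < w t} = emeasure lebesgue W"
      using sub by (simp add: emeasure_restrict_space)
    also have "\<dots> = emeasure lebesgue V"
    proof (rule emeasure_eq_AE)
      show "AE t in lebesgue. t \<in> W \<longleftrightarrow> t \<in> V"
        using AE_completion[OF AE] by eventually_elim (simp add: V_def W_def)
    qed (use V W in auto)
    also have "\<dots> = emeasure lborel V" using V by simp
    finally show ?thesis by (simp add: V_def)
  qed
  then show ?thesis by (simp add: weak_norm_def)
qed

text \<open>Frequencies are split where \<open>t * norm \<xi> powr \<alpha>\<close> is about 1.
  Below, the heat factor is at most 1 and the bounds for the annuli sum geometrically since r > 0.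
  Above, exp (- y) \<le> 1 / y gains \<open>2 powr (- \<alpha>)\<close> per annulus, which beats
  their growth since r < 1.\<close>

lemma lorentz_annuli_heat:
  assumes \<alpha>: "0 < \<alpha>" and r: "0 < r" "r < (1::real)"
  shows "\<exists>C>0. \<forall>X (G::real^'n::finite \<Rightarrow> ennreal). G \<in> borel_measurable borel \<longrightarrow>
    (\<forall>j. lorentz \<kappa> (ennreal (2 powr (real_of_int j * (\<alpha> * r))) * X) (\<lambda>\<xi>. indicator (annulus j) \<xi> * G \<xi>)) \<longrightarrow>
    (\<forall>t>0. lorentz \<kappa> (ennreal C * ennreal (t powr (- r)) * X) (\<lambda>\<xi>. ennreal (exp (- t * norm \<xi> powr \<alpha>)) * G \<xi>))"
proof -
  define C1 where "C1 = 1 / (1 - 2 powr (- (\<alpha> * r)))"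
  define C2 where "C2 = 2 powr (\<alpha> * r) / (1 - 2 powr (- (\<alpha> * (1 - r))))"
  have lt: "2 powr (- (\<alpha> * r)) < 1" "2 powr (- (\<alpha> * (1 - r))) < 1"
    using \<alpha> r by (auto intro!: powr_less_one)
  have C12: "0 < C1" "0 < C2" using lt by (auto simp: C1_def C2_def)
  have "lorentz \<kappa> (ennreal (C1 + C2) * ennreal (t powr (- r)) * X) (\<lambda>\<xi>. ennreal (exp (- t * norm \<xi> powr \<alpha>)) * G \<xi>)"
    if [measurable]: "G \<in> borel_measurable borel" and t: "0 < t"
      and G: "\<And>j. lorentz \<kappa> (ennreal (2 powr (real_of_int j * (\<alpha> * r))) * X) (\<lambda>\<xi>. indicator (annulus j) \<xi> * G \<xi>)"
    for X t and G :: "real^'n \<Rightarrow> ennreal"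
  proof -
    \<comment> \<open>The last annulus counted as low frequency: \<open>2 powr (j0 * \<alpha>) \<le>
      1 / t < 2 powr ((j0 + 1) * \<alpha>)\<close>.\<close>
    define j0 where "j0 = \<lfloor>log 2 (1 / t) / \<alpha>\<rfloor>"
    have j0: "real_of_int j0 * \<alpha> \<le> log 2 (1 / t)" "log 2 (1 / t) < (real_of_int j0 + 1) * \<alpha>"
      using \<alpha> floor_correct[of "log 2 (1 / t) / \<alpha>"] unfolding j0_def[symmetric]
      by (auto simp only: pos_le_divide_eq pos_divide_less_eq of_int_add of_int_1)
    have lo: "2 powr (real_of_int j0 * \<alpha>) \<le> 1 / t"
      using j0(1) t by (simp add: le_log_iff)
    have up: "1 / t < 2 powr ((real_of_int j0 + 1) * \<alpha>)"
      using j0(2) t by (simp add: log_less_iff)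
    have lor: "2 powr (real_of_int j0 * (\<alpha> * r)) \<le> t powr (- r)"
    proof -
      have "(2 powr (real_of_int j0 * \<alpha>)) powr r \<le> (1 / t) powr r" using lo r by (intro powr_mono2) auto
      then show ?thesis using t by (simp add: powr_powr powr_divide powr_minus_divide mult.assoc)
    qed
    have i0: "1 \<le> t * 2 powr ((real_of_int j0 + 1) * \<alpha>)" using up t by (simp add: field_simps)
    define K1 where "K1 i = ennreal (2 powr (real_of_int (j0 - int i) * (\<alpha> * r))) * X" for i
    define K2 where "K2 i = ennreal (2 powr (- (real i * \<alpha>))) * (ennreal (2 powr (real_of_int (j0 + 1 + int i) * (\<alpha> * r))) * X)" for i
    have 1: "lorentz \<kappa> (\<Sum>i. K1 i) (\<lambda>\<xi>. \<Sum>i. indicator (annulus (j0 - int i)) \<xi> * G \<xi>)"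
      unfolding K1_def by (intro lorentz_suminf G)
    have 2: "lorentz \<kappa> (\<Sum>i. K2 i) (\<lambda>\<xi>. \<Sum>i. ennreal (2 powr (- (real i * \<alpha>))) * (indicator (annulus (j0 + 1 + int i)) \<xi> * G \<xi>))"
      unfolding K2_def by (intro lorentz_suminf lorentz_cmult G)
    show ?thesis
    proof (rule lorentz_mono[OF lorentz_add[OF 1 2]])
      show "(\<lambda>\<xi>. ennreal (exp (- t * norm \<xi> powr \<alpha>)) * G \<xi>) \<in> borel_measurable borel" by measurable
      show "AE \<xi> in lborel. ennreal (exp (- t * norm \<xi> powr \<alpha>)) * G \<xi>
        \<le> (\<Sum>i. indicator (annulus (j0 - int i)) \<xi> * G \<xi>) + (\<Sum>i. ennreal (2 powr (- (real i * \<alpha>))) * (indicator (annulus (j0 + 1 + int i)) \<xi> * G \<xi>))"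
        using AE_lborel_singleton[of "0::real^'n"]
      proof eventually_elim
        case (elim \<xi>)
        define j where "j = \<lfloor>log 2 (norm \<xi>)\<rfloor>"
        have n: "0 < norm \<xi>" using elim by simp
        have j: "real_of_int j \<le> log 2 (norm \<xi>)" "log 2 (norm \<xi>) \<le> real_of_int j + 1"
          unfolding j_def by linarith+
        have ann: "\<xi> \<in> annulus j" unfolding annulus_def using j n by (simp add: le_log_iff log_le_iff)
        show ?case
        proof (cases "j \<le> j0")
          case True
          have "ennreal (exp (- t * norm \<xi> powr \<alpha>)) * G \<xi> \<le> 1 * G \<xi>"
            using t by (intro mult_right_mono) (auto simp: ennreal_le_1)
          also have "\<dots> = indicator (annulus (j0 - int (nat (j0 - j)))) \<xi> * G \<xi>" using True ann by simp
          also have "\<dots> \<le> (\<Sum>i. indicator (annulus (j0 - int i)) \<xi> * G \<xi>)" by (rule ennreal_le_suminf)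
          finally show ?thesis by (rule order_trans) (simp add: add_increasing2)
        next
          case False
          \<comment> \<open>The offset makes \<open>i = 0\<close> the first high annulus, with
            number \<open>j0 + 1\<close>.\<close>
          define i where "i = nat (j - j0 - 1)"
          have i: "j = j0 + 1 + int i" using False by (simp add: i_def)
          have "2 powr ((real_of_int j0 + 1) * \<alpha>) * 2 powr (real i * \<alpha>) = (2 powr real_of_int j) powr \<alpha>"
            by (simp add: i powr_powr powr_add[symmetric] algebra_simps)
          also have "\<dots> \<le> norm \<xi> powr \<alpha>" using ann \<alpha> by (intro powr_mono2) (auto simp: annulus_def)
          finally have "t * (2 powr ((real_of_int j0 + 1) * \<alpha>) * 2 powr (real i * \<alpha>)) \<le> t * norm \<xi> powr \<alpha>" using t by simp
          moreover have "1 * 2 powr (real i * \<alpha>) \<le> (t * 2 powr ((real_of_int j0 + 1) * \<alpha>)) * 2 powr (real i * \<alpha>)"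
            using i0 by (intro mult_right_mono) auto
          ultimately have y: "2 powr (real i * \<alpha>) \<le> t * norm \<xi> powr \<alpha>" by (simp only: mult.assoc mult_1)
          also have "\<dots> \<le> exp (t * norm \<xi> powr \<alpha>)" using exp_ge_add_one_self[of "t * norm \<xi> powr \<alpha>"] by linarith
          finally have "exp (- (t * norm \<xi> powr \<alpha>)) \<le> 2 powr (- (real i * \<alpha>))"
            by (simp add: exp_minus powr_minus le_imp_inverse_le)
          then have "ennreal (exp (- t * norm \<xi> powr \<alpha>)) * G \<xi> \<le> ennreal (2 powr (- (real i * \<alpha>))) * G \<xi>"
            by (intro mult_right_mono ennreal_leI) auto
          also have "\<dots> = ennreal (2 powr (- (real i * \<alpha>))) * (indicator (annulus (j0 + 1 + int i)) \<xi> * G \<xi>)"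
            using ann i by simp
          also have "\<dots> \<le> (\<Sum>i. ennreal (2 powr (- (real i * \<alpha>))) * (indicator (annulus (j0 + 1 + int i)) \<xi> * G \<xi>))"
            by (rule ennreal_le_suminf)
          finally show ?thesis by (rule order_trans) (simp add: add_increasing)
        qed
      qed
      have g1: "(\<Sum>i. K1 i) = ennreal (2 powr (real_of_int j0 * (\<alpha> * r)) * C1) * X"
      proof -
        have "K1 i = ennreal (2 powr (real_of_int j0 * (\<alpha> * r)) * (2 powr (- (\<alpha> * r))) ^ i) * X" for i
          by (simp add: K1_def powr_realpow[symmetric] powr_powr powr_add[symmetric] algebra_simps)
        then have "(\<Sum>i. K1 i) = (\<Sum>i. ennreal (2 powr (real_of_int j0 * (\<alpha> * r)) * (2 powr (- (\<alpha> * r))) ^ i)) * X"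
          by simp
        also have "\<dots> = ennreal (2 powr (real_of_int j0 * (\<alpha> * r)) * C1) * X"
          by (subst suminf_ennreal_geometric) (use lt in \<open>auto simp: C1_def\<close>)
        finally show ?thesis .
      qed
      have g2: "(\<Sum>i. K2 i) = ennreal (2 powr (real_of_int j0 * (\<alpha> * r)) * C2) * X"
      proof -
        have "K2 i = ennreal (2 powr ((real_of_int j0 + 1) * (\<alpha> * r)) * (2 powr (- (\<alpha> * (1 - r)))) ^ i) * X" for i
          by (simp add: K2_def mult.assoc[symmetric] ennreal_mult[symmetric] powr_realpow[symmetric] powr_powr powr_add[symmetric])
            (simp add: algebra_simps)
        then have "(\<Sum>i. K2 i) = (\<Sum>i. ennreal (2 powr ((real_of_int j0 + 1) * (\<alpha> * r)) * (2 powr (- (\<alpha> * (1 - r)))) ^ i)) * X"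
          by simp
        also have "\<dots> = ennreal (2 powr (real_of_int j0 * (\<alpha> * r)) * C2) * X"
          by (subst suminf_ennreal_geometric) (use lt in \<open>auto simp: C2_def powr_add distrib_right\<close>)
        finally show ?thesis .
      qed
      have "(\<Sum>i. K1 i) + (\<Sum>i. K2 i) = ennreal (2 powr (real_of_int j0 * (\<alpha> * r)) * (C1 + C2)) * X"
        unfolding g1 g2 using C12 by (simp add: distrib_left distrib_right ennreal_plus)
      also have "\<dots> \<le> ennreal ((C1 + C2) * t powr (- r)) * X"
        using lor C12 by (intro mult_right_mono ennreal_leI) (auto simp: mult.commute intro!: mult_left_mono)
      finally show "(\<Sum>i. K1 i) + (\<Sum>i. K2 i) \<le> ennreal (C1 + C2) * ennreal (t powr (- r)) * X"
        using C12 by (simp add: ennreal_mult)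
    qed
  qed
  then show ?thesis using C12 by (intro exI[of _ "C1 + C2"]) auto
qed

text \<open>Domination of \<open>h\<close> by \<open>g\<close> is what applications provide:
  \<open>g\<close> is the transform of the whole initial velocity and \<open>h\<close> a symmetrised
  version of one component.\<close>

lemma annuli_norm_heat:
  assumes \<alpha>: "0 < \<alpha>" and r: "0 < r" "r < 1" and q: "1 < q"
  shows "\<exists>C>0. \<forall>X (g::real^'n::finite \<Rightarrow> 'b::real_normed_vector) h. (\<lambda>\<xi>. norm (g \<xi>)) \<in> borel_measurable borel \<longrightarrow>
    annuli_norm (- (\<alpha> * r)) q g \<le> ennreal X \<longrightarrow> 0 \<le> X \<longrightarrow> h \<in> borel_measurable borel \<longrightarrow> (AE \<xi> in lborel. norm (h \<xi>) \<le> norm (g \<xi>)) \<longrightarrow>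
    (\<forall>t>0. lorentz (1 - 1 / q) (ennreal (C * X) * ennreal (t powr (- r))) (\<lambda>\<xi>. ennreal (norm (heat_symbol \<alpha> t \<xi> * h \<xi>))))"
proof -
  obtain C where C: "0 < C" "\<And>X (G::real^'n \<Rightarrow> ennreal) t. G \<in> borel_measurable borel \<Longrightarrow>
    (\<And>j. lorentz (1 - 1 / q) (ennreal (2 powr (real_of_int j * (\<alpha> * r))) * X) (\<lambda>\<xi>. indicator (annulus j) \<xi> * G \<xi>)) \<Longrightarrow> 0 < t \<Longrightarrow>
    lorentz (1 - 1 / q) (ennreal C * ennreal (t powr (- r)) * X) (\<lambda>\<xi>. ennreal (exp (- t * norm \<xi> powr \<alpha>)) * G \<xi>)"
    using lorentz_annuli_heat[OF \<alpha> r, where \<kappa> = "1 - 1 / q" and 'n = 'n] by blast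
  obtain D where D: "0 < D" "\<And>K (g::real^'n \<Rightarrow> ennreal). g \<in> borel_measurable borel \<Longrightarrow>
    weak_norm lborel q g \<le> K \<Longrightarrow> lorentz (1 - 1 / q) (ennreal D * K) g"
    using weak_norm_lorentz[OF q, where 'a = "real^'n"] by blast
  have "lorentz (1 - 1 / q) (ennreal (C * D * X) * ennreal (t powr (- r))) (\<lambda>\<xi>. ennreal (norm (heat_symbol \<alpha> t \<xi> * h \<xi>)))"
    if [measurable]: "(\<lambda>\<xi>. norm (g \<xi>)) \<in> borel_measurable borel" and X: "annuli_norm (- (\<alpha> * r)) q g \<le> ennreal X" and "0 \<le> X" and t: "0 < t"
      and [measurable]: "h \<in> borel_measurable borel" and h: "AE \<xi> in lborel. norm (h \<xi>) \<le> norm (g \<xi>)"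
    for X t h and g :: "real^'n \<Rightarrow> 'b"
  proof -
    have ann [measurable]: "annulus j \<in> sets (borel :: (real^'n) measure)" for j
      unfolding annulus_def by measurable
    have "lorentz (1 - 1 / q) (ennreal (2 powr (real_of_int j * (\<alpha> * r))) * (ennreal D * ennreal X)) (\<lambda>\<xi>. indicator (annulus j) \<xi> * ennreal (norm (g \<xi>)))" for j
    proof -
      let ?w = "weak_norm lborel q (\<lambda>\<xi>. indicator (annulus j) \<xi> * ennreal (norm (g \<xi>)))"
      have eq: "ennreal (norm (indicat_real (annulus j) \<xi> *\<^sub>R g \<xi>)) = indicator (annulus j) \<xi> * ennreal (norm (g \<xi>))" for \<xi>
        by (simp add: indicator_def)
      have "ennreal (2 powr (real_of_int j * - (\<alpha> * r))) * ?w \<le> ennreal X"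
        using X[unfolded annuli_norm_def SUP_le_iff, rule_format, of j] by (simp only: eq UNIV_I)
      then have "ennreal (2 powr (real_of_int j * (\<alpha> * r))) * (ennreal (2 powr (real_of_int j * - (\<alpha> * r))) * ?w) \<le> ennreal (2 powr (real_of_int j * (\<alpha> * r))) * ennreal X"
        by (rule mult_left_mono) simp
      moreover have "ennreal (2 powr (real_of_int j * (\<alpha> * r))) * (ennreal (2 powr (real_of_int j * - (\<alpha> * r))) * ?w) = ?w"
        by (simp add: mult.assoc[symmetric] ennreal_mult[symmetric] powr_add[symmetric])
      ultimately have "?w \<le> ennreal (2 powr (real_of_int j * (\<alpha> * r))) * ennreal X" by simp
      from D(2)[OF _ this] show ?thesis by (simp add: mult.left_commute)
    qed
    from C(2)[OF _ this t]
    have "lorentz (1 - 1 / q) (ennreal C * ennreal (t powr (- r)) * (ennreal D * ennreal X)) (\<lambda>\<xi>. ennreal (exp (- t * norm \<xi> powr \<alpha>)) * ennreal (norm (g \<xi>)))"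
      by simp
    then show ?thesis
    proof (rule lorentz_mono)
      have [measurable]: "heat_symbol \<alpha> t \<in> borel_measurable borel" unfolding heat_symbol_def[abs_def] by measurable
      show "(\<lambda>\<xi>. ennreal (norm (heat_symbol \<alpha> t \<xi> * h \<xi>))) \<in> borel_measurable borel" by measurable
      show "AE \<xi> in lborel. ennreal (norm (heat_symbol \<alpha> t \<xi> * h \<xi>)) \<le> ennreal (exp (- t * norm \<xi> powr \<alpha>)) * ennreal (norm (g \<xi>))"
        using h by eventually_elim (simp add: heat_symbol_def norm_mult ennreal_mult[symmetric] mult_left_mono)
      show "ennreal C * ennreal (t powr (- r)) * (ennreal D * ennreal X) \<le> ennreal (C * D * X) * ennreal (t powr (- r))"
        using C(1) D(1) \<open>0 \<le> X\<close> by (simp add: ennreal_mult[symmetric] mult_ac)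
    qed
  qed
  then show ?thesis using C(1) D(1) by (intro exI[of _ "C * D"]) auto
qed

context critical_exponents
begin

text \<open>The force has its own indices and a weight of order \<sigma>, but the same mechanism
  applies: the heat kernel pays for the weight, and the scaling relation \<open>crit\<close> brings
  the frequency index down to \<kappa>q. The second conclusion is the local integrability needed to
  define the Duhamel term.\<close>

lemma force_bounds:
  assumes \<kappa>g: "0 < \<kappa>g" "\<kappa>g < \<kappa>p" and \<kappa>f: "\<kappa>q \<le> \<kappa>f" "\<kappa>f \<le> 1"
    and crit: "\<sigma> + \<alpha> * (1 + \<kappa>g - \<kappa>p) = d * (\<kappa>f - \<kappa>q)"
  shows "\<exists>C>0. \<exists>N. \<forall>X v (H :: real \<Rightarrow> real^'n \<Rightarrow> ennreal). lorentz \<kappa>g (ennreal X) v \<longrightarrow> jointly_measurable H \<longrightarrow>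
    (\<forall>s. lorentz \<kappa>f (v s) (\<lambda>\<xi>. ennreal (norm \<xi> powr \<sigma>) * H s \<xi>)) \<longrightarrow>
    (\<exists>a. lorentz \<kappa>p (ennreal (C * X)) a \<and>
      (\<forall>t. lorentz \<kappa>q (a t) (heat_duhamel_maj \<alpha> H t))) \<and>
    (\<forall>t. (\<integral>\<^sup>+s\<in>{0..t}. (\<integral>\<^sup>+\<xi>. H s \<xi> * ennreal (decay N \<xi>) \<partial>lborel) \<partial>lborel) < \<infinity>)"
proof -
  \<comment> \<open>The exponent is forced by the time indices: the kernel adds 1 - c to \<kappa>g,
    and the result has to be \<kappa>p.\<close>
  define c where "c = 1 + \<kappa>g - \<kappa>p"
  have c: "0 < c" "c < 1" "\<kappa>g < c" "1 - c + \<kappa>g = \<kappa>p" using \<kappa>g \<kappa>p by (auto simp: c_def)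
  have cr: "\<alpha> * c - (- \<sigma>) = d * (\<kappa>f - \<kappa>q)" using crit by (simp add: c_def)
  have D: "real DIM(real^'n) = d" by (simp add: d)
  have dq: "0 < d * \<kappa>q" using d_pos \<kappa>q by simp
  obtain C1 where C1: "0 < C1" "\<And>K (G::real^'n \<Rightarrow> ennreal) t. lorentz \<kappa>f K G \<Longrightarrow> 0 < t \<Longrightarrow>
      lorentz \<kappa>q (ennreal C1 * ennreal (t powr (- c)) * K) (\<lambda>\<xi>. ennreal (exp (- t * norm \<xi> powr \<alpha>)) * (ennreal (norm \<xi> powr (- \<sigma>)) * G \<xi>))"
  proof -
    have "0 \<le> \<alpha> * c - (- \<sigma>)" unfolding cr using \<kappa>f d_pos by simp
    moreover have "\<alpha> * c - (- \<sigma>) < real DIM(real^'n) * \<kappa>f" unfolding cr D using dq by (simp add: right_diff_distrib)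
    moreover have "\<kappa>f - (\<alpha> * c - (- \<sigma>)) / real DIM(real^'n) = \<kappa>q" unfolding cr D using d_pos by simp
    ultimately show thesis using lorentz_heat_weight[OF c(1), of \<alpha> "- \<sigma>" \<kappa>f, where 'a = "real^'n"] that by auto
  qed
  obtain C2 where C2: "0 < C2" "\<And>K g. lorentz \<kappa>g K g \<Longrightarrow>
      lorentz \<kappa>p (ennreal C2 * K) (\<lambda>t::real. \<integral>\<^sup>+s. ennreal (\<bar>t - s\<bar> powr (- c)) * g s \<partial>lborel)"
    using lorentz_fractional_integral[OF c(1,2) \<kappa>g(1) c(3)] unfolding c(4) by blast
  obtain C3 N where C3: "\<And>K (H::real^'n \<Rightarrow> ennreal). H \<in> borel_measurable borel \<Longrightarrow> lorentz \<kappa>f K (\<lambda>\<xi>. ennreal (norm \<xi> powr \<sigma>) * H \<xi>) \<Longrightarrow>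
      (\<integral>\<^sup>+\<xi>. H \<xi> * ennreal (decay N \<xi>) \<partial>lborel) \<le> ennreal C3 * K"
  \<comment> \<open>Removing the weight from the hypothesis costs a factor
    \<open>norm \<xi> powr (- \<sigma>)\<close>. For positive \<sigma> it is singular at the origin
    and absorbed by a smaller index; otherwise it grows at infinity and is absorbed by additional
    decay.\<close>
  proof (cases "0 < \<sigma>")
    case True
    have pos: "0 < d * \<kappa>f - \<sigma>" using cr dq mult_pos_pos[OF \<alpha> c(1)] by (simp add: right_diff_distrib)
    obtain B where B: "0 < B" "\<And>K (G::real^'n \<Rightarrow> ennreal). lorentz \<kappa>f K G \<Longrightarrow>
        lorentz (\<kappa>f - \<sigma> / d) (ennreal B * K) (\<lambda>x. ennreal (norm x powr (- \<sigma>)) * G x)"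
      using lorentz_weight[of \<sigma> \<kappa>f, where 'a = "real^'n"] True pos unfolding D by auto
    have "0 \<le> \<kappa>f - \<sigma> / d" using pos d_pos by (simp add: field_simps)
    moreover have "0 \<le> \<sigma> / d" using True d_pos by simp
    then have "\<kappa>f - \<sigma> / d \<le> 1" using \<kappa>f by linarith
    ultimately obtain B' where B': "\<And>K (G::real^'n \<Rightarrow> ennreal). lorentz (\<kappa>f - \<sigma> / d) K G \<Longrightarrow>
        (\<integral>\<^sup>+x. G x * ennreal (decay (Suc DIM(real^'n)) x) \<partial>lborel) \<le> ennreal B' * K" "0 < B'"
      using lorentz_decay_integral[of "\<kappa>f - \<sigma> / d", where 'a = "real^'n"] by blast
    show thesis
    proof (rule that[of "Suc DIM(real^'n)" "B' * B"])
      fix K and H :: "real^'n \<Rightarrow> ennreal"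
      assume H: "lorentz \<kappa>f K (\<lambda>\<xi>. ennreal (norm \<xi> powr \<sigma>) * H \<xi>)"
      have "(\<integral>\<^sup>+\<xi>. H \<xi> * ennreal (decay (Suc DIM(real^'n)) \<xi>) \<partial>lborel)
          = (\<integral>\<^sup>+\<xi>. (ennreal (norm \<xi> powr (- \<sigma>)) * (ennreal (norm \<xi> powr \<sigma>) * H \<xi>)) * ennreal (decay (Suc DIM(real^'n)) \<xi>) \<partial>lborel)"
      proof (rule nn_integral_cong_AE)
        show "AE \<xi> in lborel. H \<xi> * ennreal (decay (Suc DIM(real^'n)) \<xi>)
          = (ennreal (norm \<xi> powr (- \<sigma>)) * (ennreal (norm \<xi> powr \<sigma>) * H \<xi>)) * ennreal (decay (Suc DIM(real^'n)) \<xi>)"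
          using AE_lborel_singleton[of "0::real^'n"]
          by eventually_elim (simp only: mult.assoc[symmetric] ennreal_mult[symmetric] powr_ge_zero powr_add[symmetric], simp)
      qed
      also have "\<dots> \<le> ennreal B' * (ennreal B * K)" by (rule B'(1)[OF B(2)[OF H]])
      finally show "(\<integral>\<^sup>+\<xi>. H \<xi> * ennreal (decay (Suc DIM(real^'n)) \<xi>) \<partial>lborel) \<le> ennreal (B' * B) * K"
        using B(1) B'(2) by (simp add: ennreal_mult mult.assoc)
    qed
  next
    case False
    define M where "M = nat \<lceil>- \<sigma>\<rceil>"
    have M: "- \<sigma> \<le> real M" using False by (simp add: M_def)
    obtain B where B: "0 < B" "\<And>K (G::real^'n \<Rightarrow> ennreal). lorentz \<kappa>f K G \<Longrightarrow>
        (\<integral>\<^sup>+x. G x * ennreal (decay (Suc DIM(real^'n)) x) \<partial>lborel) \<le> ennreal B * K"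
      using lorentz_decay_integral[of \<kappa>f, where 'a = "real^'n"] \<kappa>f \<kappa>q by auto
    show thesis
    proof (rule that[of "Suc DIM(real^'n) + M" B])
      fix K and H :: "real^'n \<Rightarrow> ennreal"
      assume H: "lorentz \<kappa>f K (\<lambda>\<xi>. ennreal (norm \<xi> powr \<sigma>) * H \<xi>)"
      have "(\<integral>\<^sup>+\<xi>. H \<xi> * ennreal (decay (Suc DIM(real^'n) + M) \<xi>) \<partial>lborel)
          \<le> (\<integral>\<^sup>+\<xi>. (ennreal (norm \<xi> powr \<sigma>) * H \<xi>) * ennreal (decay (Suc DIM(real^'n)) \<xi>) \<partial>lborel)"
      proof (rule nn_integral_mono_AE)
        show "AE \<xi> in lborel. H \<xi> * ennreal (decay (Suc DIM(real^'n) + M) \<xi>)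
          \<le> (ennreal (norm \<xi> powr \<sigma>) * H \<xi>) * ennreal (decay (Suc DIM(real^'n)) \<xi>)"
          using AE_lborel_singleton[of "0::real^'n"]
        proof eventually_elim
          case (elim \<xi>)
          have "norm \<xi> powr (- \<sigma>) \<le> (1 + norm \<xi>) powr (- \<sigma>)" using False by (intro powr_mono2) auto
          also have "\<dots> \<le> (1 + norm \<xi>) powr real M" using M by (intro powr_mono) auto
          finally have "norm \<xi> powr (- \<sigma>) \<le> (1 + norm \<xi>) ^ M"
            by (simp add: powr_realpow add_pos_nonneg)
          then have "norm \<xi> powr (- \<sigma>) * decay M \<xi> \<le> 1"
            using mult_right_mono[of "norm \<xi> powr (- \<sigma>)" "(1 + norm \<xi>) ^ M" "decay M \<xi>"] by simp
          then have "norm \<xi> powr \<sigma> * (norm \<xi> powr (- \<sigma>) * decay M \<xi>) \<le> norm \<xi> powr \<sigma> * 1"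
            by (intro mult_left_mono) auto
          moreover have "norm \<xi> powr \<sigma> * (norm \<xi> powr (- \<sigma>) * decay M \<xi>) = decay M \<xi>"
            using elim by (simp add: mult.assoc[symmetric] powr_add[symmetric])
          ultimately have "decay M \<xi> * decay (Suc DIM(real^'n)) \<xi> \<le> norm \<xi> powr \<sigma> * decay (Suc DIM(real^'n)) \<xi>"
            by (intro mult_right_mono) auto
          then have "ennreal (decay (Suc DIM(real^'n) + M) \<xi>) \<le> ennreal (norm \<xi> powr \<sigma> * decay (Suc DIM(real^'n)) \<xi>)"
            by (intro ennreal_leI) (simp only: decay_add mult.commute)
          from mult_left_mono[OF this, of "H \<xi>"] show ?case
            unfolding ennreal_mult[OF powr_ge_zero decay_nonneg]
            by (simp only: mult.assoc mult.left_commute[of "H \<xi>"] zero_le simp_thms)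
        qed
      qed
      also have "\<dots> \<le> ennreal B * K" by (rule B(2)[OF H])
      finally show "(\<integral>\<^sup>+\<xi>. H \<xi> * ennreal (decay (Suc DIM(real^'n) + M) \<xi>) \<partial>lborel) \<le> ennreal B * K" .
    qed
  qed
  show ?thesis
  proof (intro exI[of _ "C1 * C2"] exI[of _ N] conjI allI impI)
    show "0 < C1 * C2" using C1 C2 by simp
    fix X v and H :: "real \<Rightarrow> real^'n \<Rightarrow> ennreal"
    assume v: "lorentz \<kappa>g (ennreal X) v" and H: "jointly_measurable H"
      and b: "\<forall>s. lorentz \<kappa>f (v s) (\<lambda>\<xi>. ennreal (norm \<xi> powr \<sigma>) * H s \<xi>)"
    note [measurable] = lorentz_measurable[OF v]
    define K where "K t s = ennreal C1 * (ennreal (\<bar>t - s\<bar> powr (- c)) * v s)" for t s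
    have K_measurable [measurable]: "K t \<in> borel_measurable borel" for t unfolding K_def by measurable
    show "\<exists>a. lorentz \<kappa>p (ennreal (C1 * C2 * X)) a \<and>
      (\<forall>t. lorentz \<kappa>q (a t) (heat_duhamel_maj \<alpha> H t))"
    proof (intro exI conjI allI)
      have "(\<integral>\<^sup>+s. K t s \<partial>lborel) = ennreal C1 * (\<integral>\<^sup>+s. ennreal (\<bar>t - s\<bar> powr (- c)) * v s \<partial>lborel)" for t
        unfolding K_def by (rule nn_integral_cmult) measurable
      moreover have "ennreal C1 * (ennreal C2 * ennreal X) = ennreal (C1 * C2 * X)"
        using C1(1) C2(1) by (simp add: ennreal_mult' mult.assoc)
      ultimately show "lorentz \<kappa>p (ennreal (C1 * C2 * X)) (\<lambda>t. \<integral>\<^sup>+s. K t s \<partial>lborel)"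
        using lorentz_cmult[OF C2(2)[OF v], of "ennreal C1"] by simp
      show "lorentz \<kappa>q (\<integral>\<^sup>+s. K t s \<partial>lborel) (heat_duhamel_maj \<alpha> H t)" for t
      proof (rule lorentz_heat_duhamel[OF H K_measurable])
        fix s assume s: "0 \<le> s" "s < t"
        note [measurable] = jointly_measurable_section[OF H]
        have "lorentz \<kappa>q (K t s) (\<lambda>\<xi>. ennreal (exp (- (t - s) * norm \<xi> powr \<alpha>)) * (ennreal (norm \<xi> powr (- \<sigma>)) * (ennreal (norm \<xi> powr \<sigma>) * H s \<xi>)))"
          using C1(2)[OF b[rule_format, of s], of "t - s"] s by (simp add: K_def mult.assoc)
        then show "lorentz \<kappa>q (K t s) (\<lambda>\<xi>. ennreal (exp (- (t - s) * norm \<xi> powr \<alpha>)) * H s \<xi>)"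
        proof (rule lorentz_mono)
          show "(\<lambda>\<xi>. ennreal (exp (- (t - s) * norm \<xi> powr \<alpha>)) * H s \<xi>) \<in> borel_measurable borel" by measurable
          show "AE \<xi> in lborel. ennreal (exp (- (t - s) * norm \<xi> powr \<alpha>)) * H s \<xi>
              \<le> ennreal (exp (- (t - s) * norm \<xi> powr \<alpha>)) * (ennreal (norm \<xi> powr (- \<sigma>)) * (ennreal (norm \<xi> powr \<sigma>) * H s \<xi>))"
            using AE_lborel_singleton[of "0::real^'n"]
          proof eventually_elim
            case (elim \<xi>)
            have "ennreal (norm \<xi> powr (- \<sigma>)) * (ennreal (norm \<xi> powr \<sigma>) * H s \<xi>) = H s \<xi>"
              using elim by (simp add: mult.assoc[symmetric] ennreal_mult[symmetric] powr_add[symmetric])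
            then show ?case by simp
          qed
        qed simp
      qed
    qed
    fix t :: real
    have "(\<integral>\<^sup>+s\<in>{0..t}. (\<integral>\<^sup>+\<xi>. H s \<xi> * ennreal (decay N \<xi>) \<partial>lborel) \<partial>lborel) \<le> (\<integral>\<^sup>+s. ennreal C3 * (v s * indicator {0..t} s) \<partial>lborel)"
    proof (rule nn_integral_mono)
      fix s
      have "(\<integral>\<^sup>+\<xi>. H s \<xi> * ennreal (decay N \<xi>) \<partial>lborel) \<le> ennreal C3 * v s"
        by (rule C3[OF jointly_measurable_section[OF H] b[rule_format]])
      from mult_right_mono[OF this, of "indicator {0..t} s"]
      show "(\<integral>\<^sup>+\<xi>. H s \<xi> * ennreal (decay N \<xi>) \<partial>lborel) * indicator {0..t} s \<le> ennreal C3 * (v s * indicator {0..t} s)"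
        by (simp add: mult.assoc)
    qed
    also have "\<dots> = ennreal C3 * (\<integral>\<^sup>+s. v s * indicator {0..t} s \<partial>lborel)" by (rule nn_integral_cmult) measurable
    also have "\<dots> < \<infinity>" using lorentz_Icc_finite[OF v] by (simp add: ennreal_mult_less_top)
    finally show "(\<integral>\<^sup>+s\<in>{0..t}. (\<integral>\<^sup>+\<xi>. H s \<xi> * ennreal (decay N \<xi>) \<partial>lborel) \<partial>lborel) < \<infinity>" .
  qed
qed

end

section \<open>Fourier transforms of the terms of the system\<close>

text \<open>\<open>h\<close> is an explicit Borel version of the chosen representative
  \<open>fhat T\<close>; all terms of the system are computed on such versions.\<close>

definition spectrum :: "'n::finite tdist \<Rightarrow> (real^'n \<Rightarrow> complex) \<Rightarrow> bool" where
  "spectrum T h \<longleftrightarrow> fourier_regular T \<and> h \<in> borel_measurable borel \<and> (AE \<xi> in lborel. fhat T \<xi> = h \<xi>)"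

lemma spectrum_regular: "spectrum T h \<Longrightarrow> fourier_regular T"
  and spectrum_measurable: "spectrum T h \<Longrightarrow> h \<in> borel_measurable borel"
  and spectrum_fhat: "spectrum T h \<Longrightarrow> AE \<xi> in lborel. fhat T \<xi> = h \<xi>"
  by (auto simp: spectrum_def)

lemma spectrum_fhat_measurable: "spectrum T h \<Longrightarrow> fhat T \<in> borel_measurable borel"
  unfolding spectrum_def fourier_regular_def by (auto dest: tempered_fun_measurable)

lemma spectrum_tempered: "spectrum T h \<Longrightarrow> tempered_fun h"
  using tempered_fun_cong_AE[of "fhat T" h] unfolding spectrum_def fourier_regular_def by (auto simp: eq_commute)

lemma spectrum_dist_inv_fourier: "tempered_fun h \<Longrightarrow> spectrum (dist_inv_fourier h) h"
  by (simp add: spectrum_def fourier_regular_dist_inv_fourier tempered_fun_measurable fhat_dist_inv_fourier)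

lemma spectrum_cong:
  assumes "\<And>\<phi>. schwartz \<phi> \<Longrightarrow> T \<phi> = T' \<phi>"
  shows "spectrum T h \<longleftrightarrow> spectrum T' h"
  unfolding spectrum_def using fhat_cong[of T T', OF assms] fourier_regular_cong[of T T', OF assms] by simp

text \<open>Changing the factors on null sets does not affect the integral at any \<xi>, so the
  convolutions are equal as functions and not only almost everywhere.\<close>

lemma convolution_cong_AE:
  fixes f g :: "real^'n::finite \<Rightarrow> complex"
  assumes [measurable]: "f \<in> borel_measurable borel" "f' \<in> borel_measurable borel" "g \<in> borel_measurable borel" "g' \<in> borel_measurable borel"
    and f: "AE \<xi> in lborel. f \<xi> = f' \<xi>" and g: "AE \<xi> in lborel. g \<xi> = g' \<xi>"
  shows "Defs.convolution f g = Defs.convolution f' g'"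
proof
  fix \<xi>
  have "AE \<eta> in lborel. f (\<xi> - \<eta>) * g \<eta> = f' (\<xi> - \<eta>) * g' \<eta>"
    using AE_lborel_reflect[OF f, of \<xi>] g by eventually_elim simp
  then show "Defs.convolution f g \<xi> = Defs.convolution f' g' \<xi>"
    unfolding Defs.convolution_def by (intro integral_cong_AE) auto
qed

lemma spectrum_prod:
  fixes T S :: "'n::finite tdist"
  assumes T: "spectrum T a" and S: "spectrum S b"
    and int: "AE \<xi> in lborel. integrable lborel (\<lambda>\<eta>. a (\<xi> - \<eta>) * b \<eta>)"
    and conv: "tempered_fun (Defs.convolution a b)"
  shows "dist_prod_defined T S"
    and "dist_prod T S = dist_inv_fourier (\<lambda>\<xi>. Defs.convolution a b \<xi> / of_real ((2 * pi) ^ CARD('n)))"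
proof -
  note [measurable] = spectrum_measurable[OF T] spectrum_measurable[OF S] spectrum_fhat_measurable[OF T] spectrum_fhat_measurable[OF S]
  have eq: "Defs.convolution (fhat T) (fhat S) = Defs.convolution a b"
    by (intro convolution_cong_AE spectrum_fhat T S) measurable
  have "AE \<xi> in lborel. integrable lborel (\<lambda>\<eta>. fhat T (\<xi> - \<eta>) * fhat S \<eta>)"
    using int
  proof eventually_elim
    case (elim \<xi>)
    have "AE \<eta> in lborel. a (\<xi> - \<eta>) * b \<eta> = fhat T (\<xi> - \<eta>) * fhat S \<eta>"
      using AE_lborel_reflect[OF spectrum_fhat[OF T], of \<xi>] spectrum_fhat[OF S] by eventually_elim simp
    then show ?case by (rule integrable_cong_AE_imp[OF elim, rotated]) measurable
  qed
  then show "dist_prod_defined T S"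
    unfolding dist_prod_defined_def eq using spectrum_regular[OF T] spectrum_regular[OF S] conv by simp
  show "dist_prod T S = dist_inv_fourier (\<lambda>\<xi>. Defs.convolution a b \<xi> / of_real ((2 * pi) ^ CARD('n)))"
    unfolding dist_prod_def eq ..
qed

lemma tempered_fun_cmult: "tempered_fun g \<Longrightarrow> tempered_fun (\<lambda>\<xi>. c * g \<xi>)"
proof (rule tempered_fun_bound[of g _ "norm c" 0])
  assume g: "tempered_fun g"
  show "(\<lambda>\<xi>. c * g \<xi>) \<in> borel_measurable borel" using tempered_fun_measurable[OF g] by simp
qed (simp_all add: norm_mult)

lemma spectrum_dist_div:
  fixes c :: "'n::finite \<Rightarrow> real^'n \<Rightarrow> complex"
  assumes "\<And>j. tempered_fun (c j)"
  shows "spectrum (dist_div (\<chi> j. dist_inv_fourier (c j))) (\<lambda>\<xi>. \<Sum>j\<in>UNIV. \<i> * of_real (\<xi> $ j) * c j \<xi>)"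
  by (rule iffD2[OF spectrum_cong[OF dist_div_dist_inv_fourier[OF assms]]], assumption) (intro spectrum_dist_inv_fourier tempered_fun_sum tempered_fun_coord assms finite)

text \<open>An entry of the matrix of the Leray projector. Division by 0 yields 0, so at the origin
  the matrix is the identity.\<close>

definition leray_symbol :: "'n::finite \<Rightarrow> 'n \<Rightarrow> real^'n \<Rightarrow> real" where
  "leray_symbol i l \<xi> = (if i = l then 1 else 0) - \<xi> $ i * \<xi> $ l / (norm \<xi>)\<^sup>2"

lemma leray_symbol_measurable [measurable]: "leray_symbol i l \<in> borel_measurable borel"
  unfolding leray_symbol_def[abs_def] by measurable

lemma leray_symbol_uminus [simp]: "leray_symbol i l (- \<xi>) = leray_symbol i l \<xi>"
  by (simp add: leray_symbol_def)

lemma leray_symbol_le: "\<bar>leray_symbol i l \<xi>\<bar> \<le> 2"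
proof -
  have "\<bar>\<xi> $ i * \<xi> $ l\<bar> \<le> norm \<xi> * norm \<xi>"
    unfolding abs_mult by (intro mult_mono component_le_norm_cart) auto
  then have "\<bar>\<xi> $ i * \<xi> $ l / (norm \<xi>)\<^sup>2\<bar> \<le> 1"
    by (cases "\<xi> = 0") (simp_all add: abs_divide power2_eq_square divide_le_eq_1)
  then show ?thesis unfolding leray_symbol_def by (auto simp only: split: if_splits)
qed

lemma spectrum_leray:
  assumes V: "\<And>l. spectrum (V $ l) (h l)"
  shows "spectrum (leray V $ i) (\<lambda>\<xi>. \<Sum>l\<in>UNIV. of_real (leray_symbol i l \<xi>) * h l \<xi>)"
proof -
  let ?k = "\<lambda>\<xi>. fhat (V $ i) \<xi> - of_real (\<xi> $ i) * (\<Sum>j\<in>UNIV. of_real (\<xi> $ j) * fhat (V $ j) \<xi>) / of_real ((norm \<xi>)\<^sup>2)"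
  let ?h = "\<lambda>\<xi>. \<Sum>l\<in>UNIV. of_real (leray_symbol i l \<xi>) * h l \<xi>"
  note [measurable] = spectrum_measurable[OF V] spectrum_fhat_measurable[OF V]
  have "AE \<xi> in lborel. \<forall>l. fhat (V $ l) \<xi> = h l \<xi>" unfolding AE_all_countable using spectrum_fhat[OF V] by blast
  then have eq: "AE \<xi> in lborel. ?k \<xi> = ?h \<xi>"
  proof eventually_elim
    case (elim \<xi>)
    have "?h \<xi> = (\<Sum>l\<in>UNIV. (if i = l then h l \<xi> else 0) - of_real (\<xi> $ i) * (of_real (\<xi> $ l) * h l \<xi>) / of_real ((norm \<xi>)\<^sup>2))"
      by (intro sum.cong) (auto simp: leray_symbol_def algebra_simps)
    also have "\<dots> = h i \<xi> - (\<Sum>l\<in>UNIV. of_real (\<xi> $ i) * (of_real (\<xi> $ l) * h l \<xi>) / of_real ((norm \<xi>)\<^sup>2))"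
      by (simp add: sum_subtractf)
    finally show ?case using elim by (simp add: sum_distrib_left sum_divide_distrib)
  qed
  have h: "tempered_fun ?h"
  proof (intro tempered_fun_sum finite)
    fix l
    show "tempered_fun (\<lambda>\<xi>. of_real (leray_symbol i l \<xi>) * h l \<xi>)"
      by (rule tempered_fun_bound[OF spectrum_tempered[OF V[of l]], of _ 2 0]) (auto simp: norm_mult intro!: mult_right_mono leray_symbol_le)
  qed
  have "tempered_fun ?k" by (rule tempered_fun_cong_AE[OF h _ eq]) measurable
  from spectrum_dist_inv_fourier[OF this] eq tempered_fun_measurable[OF h]
  show ?thesis unfolding spectrum_def leray_def by (auto elim!: eventually_elim2)
qed

lemma spectrum_along_last:
  assumes "spectrum T h"
  shows "spectrum (along_last T $ l) (\<lambda>\<xi>. if l = Max UNIV then h \<xi> else 0)"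
proof (cases "l = Max UNIV")
  case False
  have "(\<lambda>_. 0) = (dist_inv_fourier (\<lambda>_. 0) :: 'a tdist)" by (simp add: dist_inv_fourier_def fun_eq_iff)
  moreover have "along_last T $ l = (\<lambda>_. 0)" "(\<lambda>\<xi>. if l = Max UNIV then h \<xi> else 0) = (\<lambda>_. 0)"
    unfolding along_last_def using False by auto
  ultimately show ?thesis using spectrum_dist_inv_fourier[OF tempered_fun_zero] by (simp only:)
next
  case True
  have "along_last T $ l = T" "(\<lambda>\<xi>. if l = Max UNIV then h \<xi> else 0) = h" unfolding along_last_def using True by auto
  then show ?thesis using assms by (simp only:)
qed

text \<open>The transform of a real distribution is Hermitian almost everywhere only. Symmetrising the data
  makes all Picard iterates Hermitian at every frequency.\<close>

definition hermitian_part :: "(real^'n::finite \<Rightarrow> complex) \<Rightarrow> real^'n \<Rightarrow> complex" where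
  "hermitian_part g \<xi> = (g \<xi> + cnj (g (- \<xi>))) / 2"

lemma hermitian_part_uminus: "hermitian_part g (- \<xi>) = cnj (hermitian_part g \<xi>)"
  by (simp add: hermitian_part_def add.commute)

lemma hermitian_part_measurable: "g \<in> borel_measurable borel \<Longrightarrow> hermitian_part g \<in> borel_measurable borel"
  unfolding hermitian_part_def[abs_def]
proof -
  assume [measurable]: "g \<in> borel_measurable borel"
  have [measurable]: "cnj \<in> borel_measurable borel"
    by (intro borel_measurable_continuous_onI continuous_intros)
  show "(\<lambda>\<xi>. (g \<xi> + cnj (g (- \<xi>))) / 2) \<in> borel_measurable borel" by measurable
qed

lemma hermitian_part_fhat:
  assumes "fourier_off_origin T g" "real_valued T"
  shows "AE \<xi> in lborel. hermitian_part (fhat T) \<xi> = fhat T \<xi>"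
  using real_valued_fhat_symmetric[OF fhat_off_origin[OF assms(1)] assms(2)]
  by eventually_elim (simp add: hermitian_part_def)

text \<open>The weighted integral of the Duhamel majorant of \<open>norm (H s \<xi>)\<close> is
  finite. This bounds the Duhamel integral and, the weight being positive, makes the time integrand
  integrable at almost every frequency.\<close>

lemma
  fixes H :: "real \<Rightarrow> real^'n::finite \<Rightarrow> complex"
  assumes H: "jointly_measurable H"
    and fin: "(\<integral>\<^sup>+s\<in>{0..t}. (\<integral>\<^sup>+\<xi>. ennreal (norm (H s \<xi>)) * ennreal (decay N \<xi>) \<partial>lborel) \<partial>lborel) < \<infinity>"
  shows heat_duhamel_tempered: "tempered_fun (heat_duhamel \<alpha> H t)"
    and heat_duhamel_integrable: "AE \<xi> in lborel. integrable lborel (\<lambda>s. indicator {0..t} s *\<^sub>R (heat_symbol \<alpha> (t - s) \<xi> * H s \<xi>))"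
proof -
  let ?h = "heat_duhamel_maj \<alpha> (\<lambda>s \<xi>. ennreal (norm (H s \<xi>))) t"
  have n: "jointly_measurable (\<lambda>s \<xi>. ennreal (norm (H s \<xi>)))"
    using H unfolding jointly_measurable_def by measurable
  note [measurable (raw)] = jointly_measurable_app[OF n] jointly_measurable_app[OF jointly_measurable_heat] jointly_measurable_app[OF H]
  have f: "(\<integral>\<^sup>+\<xi>. ?h \<xi> * ennreal (decay N \<xi>) \<partial>lborel) < \<infinity>"
    by (rule order_le_less_trans[OF heat_duhamel_decay_le[OF n] fin])
  show "tempered_fun (heat_duhamel \<alpha> H t)"
  proof (rule tempered_funI[OF jointly_measurable_section[OF heat_duhamel_measurable[OF H]]])
    show "(\<integral>\<^sup>+\<xi>. ennreal (norm (heat_duhamel \<alpha> H t \<xi>)) * ennreal (decay N \<xi>) \<partial>lborel) < \<infinity>"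
      by (rule order_le_less_trans[OF _ f], intro nn_integral_mono mult_right_mono heat_duhamel_dom order_refl) simp
  qed
  have "AE \<xi> in lborel. ?h \<xi> * ennreal (decay N \<xi>) \<noteq> \<infinity>"
    by (rule nn_integral_PInf_AE) (use f jointly_measurable_section[OF heat_duhamel_maj_measurable[OF n]] in \<open>auto intro!: borel_measurable_times_ennreal\<close>)
  then show "AE \<xi> in lborel. integrable lborel (\<lambda>s. indicator {0..t} s *\<^sub>R (heat_symbol \<alpha> (t - s) \<xi> * H s \<xi>))"
  proof eventually_elim
    case (elim \<xi>)
    then have "?h \<xi> < \<infinity>" using decay_pos[of N \<xi>] by (auto simp: ennreal_mult_eq_top_iff less_top)
    moreover have "(\<integral>\<^sup>+s. ennreal (norm (indicat_real {0..t} s *\<^sub>R (heat_symbol \<alpha> (t - s) \<xi> * H s \<xi>))) \<partial>lborel) = ?h \<xi>"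
      unfolding heat_duhamel_maj_def by (intro nn_integral_cong) (auto simp: indicator_def norm_mult ennreal_mult)
    ultimately show ?case by (intro integrableI_bounded) auto
  qed
qed

lemma duhamel_spectrum:
  fixes F :: "real \<Rightarrow> 'n::finite tdist" and H :: "real \<Rightarrow> real^'n \<Rightarrow> complex"
  assumes H: "jointly_measurable H" and F: "AE s in lborel. 0 \<le> s \<longrightarrow> spectrum (F s) (H s)"
    and fin: "(\<integral>\<^sup>+s\<in>{0..t}. (\<integral>\<^sup>+\<xi>. ennreal (norm (H s \<xi>)) * ennreal (decay N \<xi>) \<partial>lborel) \<partial>lborel) < \<infinity>"
    and t: "0 < t"
  shows "duhamel_defined \<alpha> t F" and "schwartz \<phi> \<Longrightarrow> duhamel \<alpha> t F \<phi> = dist_inv_fourier (heat_duhamel \<alpha> H t) \<phi>"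
proof -
  have m: "(\<lambda>(s, \<xi>). H s \<xi>) \<in> borel_measurable (borel \<Otimes>\<^sub>M borel)"
    using H unfolding jointly_measurable_def by (simp add: case_prod_unfold)
  have F': "AE s in lebesgue_on {0..}. fourier_regular (F s) \<and> (AE \<xi> in lborel. fhat (F s) \<xi> = H s \<xi>)"
    unfolding AE_lebesgue_on_iff[OF atLeast_borel] using F by eventually_elim (auto simp: spectrum_def)
  show "duhamel_defined \<alpha> t F" by (rule duhamel_defined_fourier[OF m F' fin t])
  show "duhamel \<alpha> t F \<phi> = dist_inv_fourier (heat_duhamel \<alpha> H t) \<phi>" if "schwartz \<phi>"
    using duhamel_fourier[OF m F' fin t that]
    by (simp add: dist_inv_fourier_def heat_duhamel_def set_lebesgue_integral_def)
qed

text \<open>A finite integral against a strictly positive weight forces finiteness almost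
  everywhere.\<close>

lemma lorentz_finite_AE:
  fixes g :: "'a::euclidean_space \<Rightarrow> ennreal"
  assumes g: "lorentz \<kappa> K g" and \<kappa>: "0 \<le> \<kappa>" "\<kappa> \<le> 1" and K: "K < \<infinity>"
  shows "AE x in lborel. g x < \<infinity>"
proof -
  note [measurable] = lorentz_measurable[OF g]
  obtain C where "\<And>K (G::'a \<Rightarrow> ennreal). lorentz \<kappa> K G \<Longrightarrow> (\<integral>\<^sup>+x. G x * ennreal (decay (Suc DIM('a)) x) \<partial>lborel) \<le> ennreal C * K"
    using lorentz_decay_integral[OF \<kappa>, where 'a = 'a] by blast
  note this[OF g]
  also have "ennreal C * K < \<infinity>" using K by (simp add: ennreal_mult_less_top)
  finally have "(\<integral>\<^sup>+x. g x * ennreal (decay (Suc DIM('a)) x) \<partial>lborel) < \<infinity>" .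
  then have "AE x in lborel. g x * ennreal (decay (Suc DIM('a)) x) \<noteq> \<infinity>"
    by (intro nn_integral_PInf_AE) auto
  then show ?thesis
  proof eventually_elim
    case (elim x)
    then show ?case using decay_pos[of "Suc DIM('a)" x] by (auto simp: ennreal_mult_eq_top_iff less_top)
  qed
qed

lemma lorentz_tempered:
  fixes g :: "real^'n::finite \<Rightarrow> complex"
  assumes g: "lorentz \<kappa> K (\<lambda>\<xi>. ennreal (norm (g \<xi>)))" and "g \<in> borel_measurable borel" "0 \<le> \<kappa>" "\<kappa> \<le> 1" "K < \<infinity>"
  shows "tempered_fun g"
proof -
  obtain C where "\<And>K (G::real^'n \<Rightarrow> ennreal). lorentz \<kappa> K G \<Longrightarrow> (\<integral>\<^sup>+x. G x * ennreal (decay (Suc DIM(real^'n)) x) \<partial>lborel) \<le> ennreal C * K"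
    using lorentz_decay_integral[OF assms(3,4), where 'a = "real^'n"] by blast
  note this[OF g]
  also have "ennreal C * K < \<infinity>" using assms(5) by (simp add: ennreal_mult_less_top)
  finally show ?thesis using assms(2) by (intro tempered_funI)
qed

text \<open>The weak Young inequality for the moduli yields both parts: its convolution dominates
  the given one and is finite almost everywhere.\<close>

lemma
  fixes a b :: "real^'n::finite \<Rightarrow> complex"
  assumes a: "lorentz \<kappa>1 K (\<lambda>\<xi>. ennreal (norm (a \<xi>)))" and b: "lorentz \<kappa>2 L (\<lambda>\<xi>. ennreal (norm (b \<xi>)))"
    and [measurable]: "a \<in> borel_measurable borel" "b \<in> borel_measurable borel"
    and \<kappa>: "0 < \<kappa>1" "0 < \<kappa>2" "\<kappa>1 + \<kappa>2 < 1" and fin: "K < \<infinity>" "L < \<infinity>"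
  shows convolution_tempered: "tempered_fun (Defs.convolution a b)"
    and convolution_integrable: "AE \<xi> in lborel. integrable lborel (\<lambda>\<eta>. a (\<xi> - \<eta>) * b \<eta>)"
proof -
  let ?c = "\<lambda>\<xi>. \<integral>\<^sup>+\<eta>. ennreal (norm (a (\<xi> - \<eta>))) * ennreal (norm (b \<eta>)) \<partial>lborel"
  obtain C where c: "lorentz (\<kappa>1 + \<kappa>2) (ennreal C * K * L) ?c"
    using lorentz_convolution[OF \<kappa>, where 'a = "real^'n"] a b by blast
  have f: "ennreal C * K * L < \<infinity>" using fin by (simp add: ennreal_mult_less_top)
  have le: "ennreal (norm (Defs.convolution a b \<xi>)) \<le> ?c \<xi>" for \<xi>
    using norm_integral_le_nn_integral[of lborel "\<lambda>\<eta>. a (\<xi> - \<eta>) * b \<eta>"]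
    by (simp add: Defs.convolution_def norm_mult ennreal_mult)
  have [measurable]: "Defs.convolution a b \<in> borel_measurable borel"
    unfolding Defs.convolution_def[abs_def] by measurable
  show "tempered_fun (Defs.convolution a b)"
  proof (rule lorentz_tempered[OF lorentz_mono[OF c]])
    show "AE \<xi> in lborel. ennreal (norm (Defs.convolution a b \<xi>)) \<le> ?c \<xi>" using le by simp
  qed (use \<kappa> f in auto)
  have "AE \<xi> in lborel. ?c \<xi> < \<infinity>" by (rule lorentz_finite_AE[OF c]) (use \<kappa> f in auto)
  then show "AE \<xi> in lborel. integrable lborel (\<lambda>\<eta>. a (\<xi> - \<eta>) * b \<eta>)"
    by eventually_elim (intro integrableI_bounded, auto simp: norm_mult ennreal_mult)
qed

lemma dist_inv_fourier_add:
  assumes "tempered_fun f" "tempered_fun g" "schwartz \<phi>"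
  shows "dist_inv_fourier (\<lambda>\<xi>. f \<xi> + g \<xi>) \<phi> = dist_inv_fourier f \<phi> + dist_inv_fourier g \<phi>"
  unfolding dist_inv_fourier_def distrib_right
  by (intro Bochner_Integration.integral_add tempered_fun_pairing schwartz_inv_fourier assms)

lemma heat_duhamel_add:
  assumes "integrable lborel (\<lambda>s. indicator {0..t} s *\<^sub>R (heat_symbol \<alpha> (t - s) \<xi> * H s \<xi>))"
    and "integrable lborel (\<lambda>s. indicator {0..t} s *\<^sub>R (heat_symbol \<alpha> (t - s) \<xi> * H' s \<xi>))"
  shows "heat_duhamel \<alpha> (\<lambda>s \<xi>. H s \<xi> + H' s \<xi>) t \<xi> = heat_duhamel \<alpha> H t \<xi> + heat_duhamel \<alpha> H' t \<xi>"
  unfolding heat_duhamel_def distrib_left scaleR_add_right by (rule Bochner_Integration.integral_add[OF assms])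

lemma heat_duhamel_uminus_fun: "heat_duhamel \<alpha> (\<lambda>s \<xi>. - H s \<xi>) t = (\<lambda>\<xi>. - heat_duhamel \<alpha> H t \<xi>)"
  by (simp add: heat_duhamel_def fun_eq_iff)

lemma dist_inv_fourier_uminus: "dist_inv_fourier (\<lambda>\<xi>. - g \<xi>) \<phi> = - dist_inv_fourier g \<phi>"
  by (simp add: dist_inv_fourier_def)

lemma time_fourier_measurable_spectrum:
  assumes Z: "jointly_measurable Z" and T: "AE t in lborel. 0 \<le> t \<longrightarrow> spectrum (T t) (Z t)"
  shows "time_fourier_measurable T"
  unfolding time_fourier_measurable_def AE_lebesgue_on_iff[OF atLeast_borel]
proof (intro conjI bexI)
  show "AE t in lborel. t \<in> {0..} \<longrightarrow> fourier_regular (T t)"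
    using T by eventually_elim (auto simp: spectrum_def)
  show "AE t in lborel. t \<in> {0..} \<longrightarrow> (AE \<xi> in lborel. fhat (T t) \<xi> = (\<lambda>p. Z (fst p) (snd p)) (t, \<xi>))"
    using T by eventually_elim (auto simp: spectrum_def)
  show "(\<lambda>p. Z (fst p) (snd p)) \<in> borel_measurable borel"
    using Z unfolding jointly_measurable_def borel_prod .
qed

text \<open>The weight \<open>norm \<xi> powr 0\<close> is \<open>0\<close> rather than \<open>1\<close> at \<open>\<xi> = 0\<close>, hence the equalities almost everywhere.\<close>

lemma herz_norm_bound:
  fixes h g :: "real \<Rightarrow> real^'n::finite \<Rightarrow> real"
  assumes p: "1 < p" and q: "1 < q"
    and g: "jointly_measurable g" "\<And>t. lorentz (1 - 1 / q) (v t) (\<lambda>\<xi>. ennreal (g t \<xi>))" and v: "lorentz (1 - 1 / p) K v"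
    and h: "\<And>t. 0 < t \<Longrightarrow> h t \<in> borel_measurable borel \<and> (AE \<xi> in lborel. h t \<xi> = g t \<xi>)"
  shows "weak_norm (lebesgue_on {0..}) p (\<lambda>t. weak_norm lborel q (\<lambda>\<xi>. ennreal (norm \<xi> powr 0 * h t \<xi>))) \<le> K"
proof -
  note [measurable (raw)] = jointly_measurable_app[OF g(1)]
  define W where "W t = weak_norm lborel q (\<lambda>\<xi>. ennreal (g t \<xi>))" for t
  have gm: "(\<lambda>(t, \<xi>). ennreal (g t \<xi>)) \<in> borel_measurable (borel \<Otimes>\<^sub>M borel)" by measurable
  have Wm [measurable]: "W \<in> borel_measurable borel"
    unfolding W_def using weak_norm_measurable[OF gm] q by simp
  have "AE t in lborel. 0 \<le> t \<longrightarrow> weak_norm lborel q (\<lambda>\<xi>. ennreal (norm \<xi> powr 0 * h t \<xi>)) = W t"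
    using AE_lborel_singleton[of "0::real"]
  proof (eventually_elim, intro impI)
    fix t :: real assume "t \<noteq> 0" "0 \<le> t"
    then have t: "h t \<in> borel_measurable borel" "AE \<xi> in lborel. h t \<xi> = g t \<xi>" using h[of t] by auto
    note [measurable] = t(1)
    have "AE \<xi> in lborel. ennreal (norm \<xi> powr 0 * h t \<xi>) = ennreal (g t \<xi>)"
      using t(2) AE_lborel_singleton[of "0::real^'n"] by eventually_elim simp
    then show "weak_norm lborel q (\<lambda>\<xi>. ennreal (norm \<xi> powr 0 * h t \<xi>)) = W t"
      unfolding W_def by (intro weak_norm_cong_AE) measurable
  qed
  then have "weak_norm (lebesgue_on {0..}) p (\<lambda>t. weak_norm lborel q (\<lambda>\<xi>. ennreal (norm \<xi> powr 0 * h t \<xi>)))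
      = weak_norm lborel p (\<lambda>t. indicator {0..} t * W t)"
    by (intro weak_norm_half_line Wm)
  also have "\<dots> \<le> K"
  proof (rule lorentz_weak_norm[OF p lorentz_mono[OF v]])
    show "AE t in lborel. indicator {0..} t * W t \<le> v t"
      using lorentz_weak_norm[OF q g(2)] by (auto simp: indicator_def W_def)
  qed auto
  finally show ?thesis .
qed

section \<open>The mild solution\<close>

text \<open>The unknowns are indexed by an option type: \<open>Some i\<close> is the \<open>i\<close>-th component of the velocity and
  \<open>None\<close> the temperature.\<close>

definition convection :: "'n::finite option \<Rightarrow> 'n option \<Rightarrow> 'n option \<Rightarrow> (real, 'n) vec \<Rightarrow> complex" where
  "convection m j k \<xi> =
    (case k of None \<Rightarrow> 0 | Some k \<Rightarrow> - (\<i> * of_real (\<xi> $ k) / of_real ((2 * pi) ^ CARD('n)))) *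
    (case m of None \<Rightarrow> (case j of None \<Rightarrow> 1 | Some l \<Rightarrow> 0)
     | Some i \<Rightarrow> (case j of None \<Rightarrow> 0 | Some l \<Rightarrow> of_real (leray_symbol i l \<xi>)))"

definition buoyancy :: "'n::{finite,linorder} option \<Rightarrow> 'n option \<Rightarrow> (real, 'n) vec \<Rightarrow> complex" where
  "buoyancy m j \<xi> = (case m of None \<Rightarrow> 0
     | Some i \<Rightarrow> (case j of None \<Rightarrow> of_real (leray_symbol i (Max UNIV) \<xi>) | Some l \<Rightarrow> 0))"

lemma convection_measurable: "convection m j k \<in> borel_measurable borel"
  unfolding convection_def[abs_def] by (cases m; cases j; cases k) simp_all

lemma buoyancy_measurable: "buoyancy m j \<in> borel_measurable borel"
  unfolding buoyancy_def[abs_def] by (cases m; cases j) simp_all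

lemma convection_le: "norm (convection m j k \<xi>) \<le> 2 * norm \<xi>"
  for \<xi> :: "real^'n::finite"
proof -
  have "1 \<le> (2 * pi) ^ CARD('n)" using pi_gt3 by (intro one_le_power) linarith
  then have "\<bar>\<xi> $ k\<bar> / (2 * pi) ^ CARD('n) \<le> \<bar>\<xi> $ k\<bar> / 1" for k by (intro divide_left_mono) auto
  then have "\<bar>\<xi> $ k\<bar> / (2 * pi) ^ CARD('n) \<le> norm \<xi>" for k
    using component_le_norm_cart[of \<xi> k] by (metis div_by_1 order_trans)
  then have 1: "norm ((case k of None \<Rightarrow> 0 | Some k \<Rightarrow> - (\<i> * of_real (\<xi> $ k) / of_real ((2 * pi) ^ CARD('n)))) :: complex) \<le> norm \<xi>"
    by (auto split: option.split simp: norm_mult norm_divide norm_power)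
  have 2: "norm ((case m of None \<Rightarrow> (case j of None \<Rightarrow> 1 | Some l \<Rightarrow> 0)
     | Some i \<Rightarrow> (case j of None \<Rightarrow> 0 | Some l \<Rightarrow> of_real (leray_symbol i l \<xi>))) :: complex) \<le> 2"
    by (auto split: option.split simp: leray_symbol_le)
  show ?thesis unfolding convection_def norm_mult using mult_mono[OF 1 2] by (simp add: mult.commute)
qed

lemma buoyancy_le: "norm (buoyancy m j \<xi>) \<le> 2"
  by (auto simp: buoyancy_def leray_symbol_le split: option.split)

lemma convection_uminus: "convection m j k (- \<xi>) = cnj (convection m j k \<xi>)"
  by (auto simp: convection_def split: option.split)

lemma buoyancy_uminus: "buoyancy m j (- \<xi>) = cnj (buoyancy m j \<xi>)"
  by (auto simp: buoyancy_def split: option.split)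

lemma norm_vec_lambda: "norm (\<chi> i. f i) = sqrt (\<Sum>i\<in>UNIV. (norm (f i))\<^sup>2)"
  by (simp add: norm_vec_def L2_set_def)

lemma norm_fhat_vec_measurable:
  "(\<And>i. fhat (V $ i) \<in> borel_measurable borel) \<Longrightarrow> (\<lambda>\<xi>. norm (fhat_vec V \<xi>)) \<in> borel_measurable borel"
  unfolding fhat_vec_def norm_vec_lambda by measurable

text \<open>Hermitian symmetry is imposed at every frequency, which is the form that
  \<open>picard_symmetric\<close> propagates.\<close>

locale boussinesq_data =
  critical_exponents \<alpha> \<kappa>p \<kappa>q \<kappa>P \<kappa>Q d space
  for \<alpha> \<kappa>p \<kappa>q \<kappa>P \<kappa>Q d and space :: "'n::{finite,linorder} itself" +
  fixes U :: "'n \<Rightarrow> (real, 'n) vec \<Rightarrow> complex" and \<Theta> :: "(real, 'n) vec \<Rightarrow> complex" and G :: "'n \<Rightarrow> real \<Rightarrow> (real, 'n) vec \<Rightarrow> complex"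
  assumes U_measurable [measurable]: "\<And>i. U i \<in> borel_measurable borel"
    and \<Theta>_measurable [measurable]: "\<Theta> \<in> borel_measurable borel"
    and G_measurable: "\<And>i. jointly_measurable (G i)"
    and U_uminus: "\<And>i \<xi>. U i (- \<xi>) = cnj (U i \<xi>)"
    and \<Theta>_uminus: "\<And>\<xi>. \<Theta> (- \<xi>) = cnj (\<Theta> \<xi>)"
    and G_uminus: "\<And>i s \<xi>. G i s (- \<xi>) = cnj (G i s \<xi>)"
begin

definition force :: "'n \<Rightarrow> real \<Rightarrow> (real, 'n) vec \<Rightarrow> complex" where
  "force i s \<xi> = (\<Sum>l\<in>UNIV. of_real (leray_symbol i l \<xi>) * G l s \<xi>)"

definition initial :: "'n option \<Rightarrow> (real, 'n) vec \<Rightarrow> complex" where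
  "initial m = (case m of None \<Rightarrow> \<Theta> | Some i \<Rightarrow> U i)"

definition forcing :: "'n option \<Rightarrow> real \<Rightarrow> (real, 'n) vec \<Rightarrow> complex" where
  "forcing m = (case m of None \<Rightarrow> (\<lambda>_ _. 0) | Some i \<Rightarrow> force i)"

text \<open>For negative \<open>t\<close> the heat symbol would grow exponentially, and at
  \<open>t = 0\<close> the bound by a power of \<open>\<bar>t\<bar>\<close> is 0; the heat flow of
  the initial data is therefore set to 0 for \<open>t \<le> 0\<close>.\<close>

definition data :: "'n option \<Rightarrow> real \<Rightarrow> (real, 'n) vec \<Rightarrow> complex" where
  "data m t \<xi> = (if 0 < t then heat_symbol \<alpha> t \<xi> * initial m \<xi> else 0) + heat_duhamel \<alpha> (forcing m) t \<xi>"

lemma force_measurable: "jointly_measurable (force i)"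
proof -
  note [measurable (raw)] = jointly_measurable_app[OF G_measurable]
  show ?thesis unfolding jointly_measurable_def force_def by measurable
qed

lemma forcing_measurable: "jointly_measurable (forcing m)"
  using force_measurable by (cases m) (auto simp: forcing_def jointly_measurable_def)

lemma initial_measurable [measurable]: "initial m \<in> borel_measurable borel"
  by (cases m) (auto simp: initial_def)

lemma data_measurable: "jointly_measurable (data m)"
proof -
  note [measurable (raw)] = jointly_measurable_app[OF heat_duhamel_measurable[OF forcing_measurable]]
  show ?thesis unfolding jointly_measurable_def data_def heat_symbol_def by measurable
qed

lemma data_uminus: "data m t (- \<xi>) = cnj (data m t \<xi>)"
proof -
  have "forcing m s (- \<xi>) = cnj (forcing m s \<xi>)" for s \<xi>
    by (cases m) (simp_all add: forcing_def force_def G_uminus)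
  moreover have "initial m (- \<xi>) = cnj (initial m \<xi>)"
    by (cases m) (simp_all add: initial_def U_uminus \<Theta>_uminus)
  ultimately show ?thesis
    unfolding data_def by (simp add: heat_duhamel_uminus heat_symbol_def)
qed

sublocale boussinesq_symbols \<alpha> \<kappa>p \<kappa>q \<kappa>P \<kappa>Q d space convection buoyancy data
  by unfold_locales
    (rule convection_measurable buoyancy_measurable data_measurable convection_le buoyancy_le
      | simp add: convection_def buoyancy_def split: option.split)+

text \<open>Switching off one group of unknowns isolates one term of the velocity equation: without
  temperature only convection remains, without velocity only buoyancy. Both are then values of
  \<open>nonlin\<close> and share its estimates.\<close>

definition velocity_part :: "'n option \<Rightarrow> real \<Rightarrow> (real, 'n) vec \<Rightarrow> complex" where
  "velocity_part m s \<xi> = (if m = None then 0 else solution m s \<xi>)"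

definition temperature_part :: "'n option \<Rightarrow> real \<Rightarrow> (real, 'n) vec \<Rightarrow> complex" where
  "temperature_part m s \<xi> = (if m = None then solution m s \<xi> else 0)"

lemma parts_measurable: "jointly_measurable (velocity_part m)" "jointly_measurable (temperature_part m)"
  unfolding velocity_part_def[abs_def] temperature_part_def[abs_def]
  using solution_measurable[of m] by (cases m; simp add: jointly_measurable_def)+

lemma parts_dom: "ennreal (norm (velocity_part m s \<xi>)) \<le> majorant_lim m s \<xi>"
  "ennreal (norm (temperature_part m s \<xi>)) \<le> majorant_lim m s \<xi>"
  using solution_dom by (auto simp: velocity_part_def temperature_part_def)

lemma nonlin_Some:
  "nonlin Z (Some i) s \<xi> = (\<Sum>l\<in>UNIV. \<Sum>k\<in>UNIV. convection (Some i) (Some l) (Some k) \<xi> * Defs.convolution (Z (Some l) s) (Z (Some k) s) \<xi>)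
    + of_real (leray_symbol i (Max UNIV) \<xi>) * Z None s \<xi>"
  by (simp add: nonlin_def sum_UNIV_option \<beta>_zero \<gamma>_zero) (simp add: buoyancy_def)

lemma nonlin_None:
  "nonlin Z None s \<xi> = (\<Sum>k\<in>UNIV. convection None None (Some k) \<xi> * Defs.convolution (Z None s) (Z (Some k) s) \<xi>)"
  by (simp add: nonlin_def sum_UNIV_option \<beta>_zero \<gamma>_zero)

text \<open>This is the symbol of minus the projected divergence of the tensor product; the power of
  2 \<pi> is the one in \<open>dist_prod\<close>.\<close>

lemma nonlin_velocity_part:
  "nonlin velocity_part (Some i) s \<xi> = - (\<Sum>l\<in>UNIV. of_real (leray_symbol i l \<xi>) *
    (\<Sum>k\<in>UNIV. \<i> * of_real (\<xi> $ k) * (Defs.convolution (solution (Some l) s) (solution (Some k) s) \<xi> / of_real ((2 * pi) ^ CARD('n)))))"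
proof -
  have "velocity_part (Some l) s = solution (Some l) s" "velocity_part None s \<xi> = 0" for l
    by (auto simp: velocity_part_def)
  then show ?thesis
    unfolding nonlin_Some
    by (simp add: convection_def sum_negf[symmetric] sum_distrib_left mult_ac)
qed

lemma nonlin_temperature_part:
  "nonlin temperature_part (Some i) s \<xi> = of_real (leray_symbol i (Max UNIV) \<xi>) * solution None s \<xi>"
proof -
  have "temperature_part (Some l) s = (\<lambda>_. 0)" "temperature_part None s \<xi> = solution None s \<xi>" for l
    by (auto simp: temperature_part_def)
  then show ?thesis unfolding nonlin_Some by (simp add: Defs.convolution_def)
qed

lemma nonlin_solution_Some: "nonlin solution (Some i) s \<xi> = nonlin velocity_part (Some i) s \<xi> + nonlin temperature_part (Some i) s \<xi>"
proof -
  have "velocity_part (Some l) s = solution (Some l) s" "velocity_part None s \<xi> = 0" for l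
    by (auto simp: velocity_part_def)
  then show ?thesis unfolding nonlin_temperature_part by (simp add: nonlin_Some)
qed

lemma nonlin_solution_None:
  "nonlin solution None s \<xi> = - (\<Sum>k\<in>UNIV. \<i> * of_real (\<xi> $ k) * (Defs.convolution (solution None s) (solution (Some k) s) \<xi> / of_real ((2 * pi) ^ CARD('n))))"
  unfolding nonlin_None by (simp add: convection_def sum_negf[symmetric] mult_ac)

end

text \<open>Smallness of the data no longer appears: it serves only to produce the bounds
  \<open>v\<close> and \<open>w\<close> for the limiting majorants, and these are taken as
  given.\<close>

locale boussinesq_solution = boussinesq_data \<alpha> \<kappa>p \<kappa>q \<kappa>P \<kappa>Q d space U \<Theta> G
  for \<alpha> \<kappa>p \<kappa>q \<kappa>P \<kappa>Q d and space :: "'n::{finite,linorder} itself" and U \<Theta> G +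
  fixes X Y :: real and v w :: "real \<Rightarrow> ennreal" and N :: nat
  assumes v: "lorentz \<kappa>p (ennreal X) v" "0 \<le> X" and w: "lorentz \<kappa>P (ennreal Y) w" "0 \<le> Y"
    and velocity_majorant: "\<And>i t. lorentz \<kappa>q (v t) (majorant_lim (Some i) t)"
    and temperature_majorant: "\<And>t. lorentz \<kappa>Q (w t) (majorant_lim None t)"
    and heat_initial: "\<And>m t. 0 < t \<Longrightarrow> tempered_fun (\<lambda>\<xi>. heat_symbol \<alpha> t \<xi> * initial m \<xi>)"
    and force_finite: "\<And>i t. (\<integral>\<^sup>+s\<in>{0..t}. (\<integral>\<^sup>+\<xi>. ennreal (norm (force i s \<xi>)) * ennreal (decay N \<xi>) \<partial>lborel) \<partial>lborel) < \<infinity>"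
begin

text \<open>A general dominated family is allowed so that this covers the solution and both of its
  parts.\<close>

lemma dominated_finite:
  assumes Z: "\<And>m t \<xi>. ennreal (norm (Z m t \<xi>)) \<le> majorant_lim m t \<xi>"
  shows "(\<integral>\<^sup>+s\<in>{0..t}. (\<integral>\<^sup>+\<xi>. ennreal (norm (nonlin Z m s \<xi>)) * ennreal (decay (CARD('n) + 2) \<xi>) \<partial>lborel) \<partial>lborel) < \<infinity>"
  by (rule order_le_less_trans[OF _ nonlin_maj_decay_finite[OF majorant_lim_measurable v w velocity_majorant temperature_majorant, of m t]])
    (intro nn_integral_mono mult_right_mono nonlin_dom Z, auto)

text \<open>This discharges the hypothesis of \<open>solution_eq\<close> at almost every frequency.
  It holds at every \<open>t\<close>, also where \<open>v t\<close> or \<open>w t\<close> is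
  infinite, since only integrals over earlier times enter.\<close>

lemma duh_maj_finite: "AE \<xi> in lborel. duh_maj majorant_lim m t \<xi> < \<infinity>"
proof -
  note [measurable] = jointly_measurable_section[OF heat_duhamel_maj_measurable[OF nonlin_maj_measurable[OF majorant_lim_measurable]]]
  have "(\<integral>\<^sup>+\<xi>. duh_maj majorant_lim m t \<xi> * ennreal (decay (CARD('n) + 2) \<xi>) \<partial>lborel) < \<infinity>"
    using order_le_less_trans[OF heat_duhamel_decay_le[OF nonlin_maj_measurable[OF majorant_lim_measurable]]
      nonlin_maj_decay_finite[OF majorant_lim_measurable v w velocity_majorant temperature_majorant]]
    by blast
  then have "AE \<xi> in lborel. duh_maj majorant_lim m t \<xi> * ennreal (decay (CARD('n) + 2) \<xi>) \<noteq> \<infinity>"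
    by (intro nn_integral_PInf_AE) auto
  then show ?thesis
  proof eventually_elim
    case (elim \<xi>)
    then show ?case using decay_pos[of "CARD('n) + 2" \<xi>] by (auto simp: ennreal_mult_eq_top_iff less_top)
  qed
qed

lemma forcing_finite: "(\<integral>\<^sup>+s\<in>{0..t}. (\<integral>\<^sup>+\<xi>. ennreal (norm (forcing m s \<xi>)) * ennreal (decay N \<xi>) \<partial>lborel) \<partial>lborel) < \<infinity>"
  using force_finite by (cases m) (simp_all add: forcing_def)

lemma solution_AE:
  assumes "0 < t"
  shows "AE \<xi> in lborel. solution m t \<xi> = (heat_symbol \<alpha> t \<xi> * initial m \<xi> + heat_duhamel \<alpha> (forcing m) t \<xi>)
    + heat_duhamel \<alpha> (nonlin solution m) t \<xi>"
  using duh_maj_finite[of m t] by eventually_elim (simp add: solution_eq data_def assms)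

lemma solution_tempered: "0 < t \<Longrightarrow> tempered_fun (solution m t)"
  by (rule tempered_fun_cong_AE[OF _ jointly_measurable_section[OF solution_measurable] solution_AE])
    (intro tempered_fun_add heat_initial heat_duhamel_tempered[OF forcing_measurable forcing_finite]
      heat_duhamel_tempered[OF nonlin_measurable[OF solution_measurable] dominated_finite[OF solution_dom]])

lemma majorant_lim_finite:
  assumes "0 < t"
  shows "AE \<xi> in lborel. majorant_lim m t \<xi> < \<infinity>"
  using duh_maj_finite[of m t]
  by eventually_elim (rule order_le_less_trans[OF majorant_lim_le], simp)

text \<open>The majorant has to be finite at \<xi> and at - \<xi>; both exclude null sets
  only.\<close>

lemma solution_hermitian:
  assumes "0 < t"
  shows "AE \<xi> in lborel. solution m t (- \<xi>) = cnj (solution m t \<xi>)"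
  using majorant_lim_finite[OF assms, of m] AE_lborel_reflect[OF majorant_lim_finite[OF assms, of m], of 0]
  by eventually_elim (rule solution_symmetric[OF convection_uminus buoyancy_uminus data_uminus], simp_all)

definition velocity :: "real \<Rightarrow> 'n tdist_vec" where
  "velocity t = (\<chi> i. dist_inv_fourier (solution (Some i) t))"

definition temperature :: "real \<Rightarrow> 'n tdist" where
  "temperature t = dist_inv_fourier (solution None t)"

lemma spectrum_velocity: "0 < t \<Longrightarrow> spectrum (velocity t $ i) (solution (Some i) t)"
  and spectrum_temperature: "0 < t \<Longrightarrow> spectrum (temperature t) (solution None t)"
  by (simp_all add: velocity_def temperature_def spectrum_dist_inv_fourier solution_tempered)

lemma real_valued_velocity: "0 < t \<Longrightarrow> real_valued (velocity t $ i)"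
  and real_valued_temperature: "0 < t \<Longrightarrow> real_valued (temperature t)"
  by (simp_all add: velocity_def temperature_def real_valued_dist_inv_fourier solution_hermitian
      jointly_measurable_section[OF solution_measurable])

lemma solution_lorentz:
  "lorentz \<kappa>q (v t) (\<lambda>\<xi>. ennreal (norm (solution (Some i) t \<xi>)))"
  "lorentz \<kappa>Q (w t) (\<lambda>\<xi>. ennreal (norm (solution None t \<xi>)))"
proof -
  note [measurable] = jointly_measurable_section[OF solution_measurable]
  show "lorentz \<kappa>q (v t) (\<lambda>\<xi>. ennreal (norm (solution (Some i) t \<xi>)))"
    by (rule lorentz_mono[OF velocity_majorant]) (auto intro: solution_dom)
  show "lorentz \<kappa>Q (w t) (\<lambda>\<xi>. ennreal (norm (solution None t \<xi>)))"
    by (rule lorentz_mono[OF temperature_majorant]) (auto intro: solution_dom)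
qed

text \<open>Products of the unknowns are controlled at positive times with finite frequency bounds.
  The remaining times form a null set, invisible to the Duhamel integrals.\<close>

lemma good_times: "AE s in lborel. 0 \<le> s \<longrightarrow> 0 < s \<and> v s < \<infinity> \<and> w s < \<infinity>"
proof -
  have "AE s in lborel. v s < \<infinity>" "AE s in lborel. w s < \<infinity>"
    by (rule lorentz_finite_AE[OF v(1)] lorentz_finite_AE[OF w(1)]; use \<kappa>p \<kappa>P in simp)+
  with AE_lborel_singleton[of "0::real"] show ?thesis by eventually_elim auto
qed

lemma
  assumes "v s < \<infinity>" "w s < \<infinity>"
  shows convolution_uu: "tempered_fun (Defs.convolution (solution (Some i) s) (solution (Some j) s))"
      "AE \<xi> in lborel. integrable lborel (\<lambda>\<eta>. solution (Some i) s (\<xi> - \<eta>) * solution (Some j) s \<eta>)"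
    and convolution_tu: "tempered_fun (Defs.convolution (solution None s) (solution (Some j) s))"
      "AE \<xi> in lborel. integrable lborel (\<lambda>\<eta>. solution None s (\<xi> - \<eta>) * solution (Some j) s \<eta>)"
proof -
  have m: "solution m s \<in> borel_measurable borel" for m by (rule jointly_measurable_section[OF solution_measurable])
  have q: "\<kappa>q + \<kappa>q < 1" "\<kappa>Q + \<kappa>q < 1" using \<kappa>q \<kappa>Q by auto
  note uu = solution_lorentz(1)[of s i] solution_lorentz(1)[of s j] m m \<kappa>q(1) \<kappa>q(1) q(1) assms(1) assms(1)
  note tu = solution_lorentz(2)[of s] solution_lorentz(1)[of s j] m m exponents_pos(1) \<kappa>q(1) q(2) assms(2) assms(1)
  show "tempered_fun (Defs.convolution (solution (Some i) s) (solution (Some j) s))"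
      "AE \<xi> in lborel. integrable lborel (\<lambda>\<eta>. solution (Some i) s (\<xi> - \<eta>) * solution (Some j) s \<eta>)"
    by (rule convolution_tempered[OF uu] convolution_integrable[OF uu])+
  show "tempered_fun (Defs.convolution (solution None s) (solution (Some j) s))"
      "AE \<xi> in lborel. integrable lborel (\<lambda>\<eta>. solution None s (\<xi> - \<eta>) * solution (Some j) s \<eta>)"
    by (rule convolution_tempered[OF tu] convolution_integrable[OF tu])+
qed

lemma
  assumes s: "0 < s" "v s < \<infinity>" "w s < \<infinity>"
  shows velocity_prod_defined: "dist_prod_defined (velocity s $ i) (velocity s $ j)"
    and temperature_prod_defined: "dist_prod_defined (temperature s) (velocity s $ j)"
    and spectrum_div_tensor: "spectrum (leray (div_tensor (velocity s) (velocity s)) $ i) (\<lambda>\<xi>. - nonlin velocity_part (Some i) s \<xi>)"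
    and spectrum_div_scaled: "spectrum (div_scaled (temperature s) (velocity s)) (\<lambda>\<xi>. - nonlin solution None s \<xi>)"
proof -
  note uu = spectrum_prod[OF spectrum_velocity[OF s(1)] spectrum_velocity[OF s(1)] convolution_uu(2,1)[OF s(2,3)]]
  note tu = spectrum_prod[OF spectrum_temperature[OF s(1)] spectrum_velocity[OF s(1)] convolution_tu(2,1)[OF s(2,3)]]
  show "dist_prod_defined (velocity s $ i) (velocity s $ j)" by (rule uu(1))
  show "dist_prod_defined (temperature s) (velocity s $ j)" by (rule tu(1))
  have t: "tempered_fun (\<lambda>\<xi>. g \<xi> / of_real ((2 * pi) ^ CARD('n)))" if "tempered_fun g" for g :: "(real, 'n) vec \<Rightarrow> complex"
    using tempered_fun_cmult[OF that, of "1 / of_real ((2 * pi) ^ CARD('n))"] by simp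
  have "spectrum (div_tensor (velocity s) (velocity s) $ l)
      (\<lambda>\<xi>. \<Sum>k\<in>UNIV. \<i> * of_real (\<xi> $ k) * (Defs.convolution (solution (Some l) s) (solution (Some k) s) \<xi> / of_real ((2 * pi) ^ CARD('n))))" for l
    unfolding div_tensor_def vec_lambda_beta uu(2) by (intro spectrum_dist_div t convolution_uu(1) s)
  from spectrum_leray[OF this] show "spectrum (leray (div_tensor (velocity s) (velocity s)) $ i) (\<lambda>\<xi>. - nonlin velocity_part (Some i) s \<xi>)"
    unfolding nonlin_velocity_part by simp
  show "spectrum (div_scaled (temperature s) (velocity s)) (\<lambda>\<xi>. - nonlin solution None s \<xi>)"
    unfolding div_scaled_def tu(2) nonlin_solution_None minus_minus
    by (intro spectrum_dist_div t convolution_tu(1) s)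
qed

lemma spectrum_buoyancy:
  assumes "0 < s"
  shows "spectrum (leray (along_last (temperature s)) $ i) (nonlin temperature_part (Some i) s)"
proof -
  have "nonlin temperature_part (Some i) s = (\<lambda>\<xi>. \<Sum>l\<in>UNIV. of_real (leray_symbol i l \<xi>) * (if l = Max UNIV then solution None s \<xi> else 0))"
    by (simp add: nonlin_temperature_part fun_eq_iff if_distrib[of "\<lambda>x. _ * x"] cong: if_cong)
  then show ?thesis
    using spectrum_leray[OF spectrum_along_last[OF spectrum_temperature[OF assms]]] by simp
qed

text \<open>The Duhamel integral of the full nonlinearity is split at almost every frequency, where
  both parts are integrable in time. Each of the four resulting functions is tempered, so the
  pairing with the test function splits as well.\<close>

lemma velocity_equation:
  assumes t: "0 < t" and \<phi>: "schwartz \<phi>"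
  shows "(velocity t $ i) \<phi> = dist_inv_fourier (\<lambda>\<xi>. heat_symbol \<alpha> t \<xi> * U i \<xi>) \<phi> + dist_inv_fourier (heat_duhamel \<alpha> (force i) t) \<phi>
    + dist_inv_fourier (heat_duhamel \<alpha> (nonlin velocity_part (Some i)) t) \<phi>
    + dist_inv_fourier (heat_duhamel \<alpha> (nonlin temperature_part (Some i)) t) \<phi>"
proof -
  let ?h = "\<lambda>\<xi>. heat_symbol \<alpha> t \<xi> * U i \<xi>" and ?f = "heat_duhamel \<alpha> (force i) t"
  let ?u = "heat_duhamel \<alpha> (nonlin velocity_part (Some i)) t" and ?t = "heat_duhamel \<alpha> (nonlin temperature_part (Some i)) t"
  note mu = nonlin_measurable[OF parts_measurable(1)] dominated_finite[OF parts_dom(1)]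
  note mt = nonlin_measurable[OF parts_measurable(2)] dominated_finite[OF parts_dom(2)]
  have tmp: "tempered_fun ?h" "tempered_fun ?f" "tempered_fun ?u" "tempered_fun ?t"
    using heat_initial[OF t, of "Some i"] heat_duhamel_tempered[OF force_measurable force_finite]
      heat_duhamel_tempered[OF mu] heat_duhamel_tempered[OF mt] by (simp_all add: initial_def)
  have "AE \<xi> in lborel. solution (Some i) t \<xi> = ((?h \<xi> + ?f \<xi>) + ?u \<xi>) + ?t \<xi>"
    using solution_AE[OF t, of "Some i"] heat_duhamel_integrable[OF mu, of t \<alpha> "Some i"] heat_duhamel_integrable[OF mt, of t \<alpha> "Some i"]
  proof eventually_elim
    case (elim \<xi>)
    have "nonlin solution (Some i) = (\<lambda>s \<xi>. nonlin velocity_part (Some i) s \<xi> + nonlin temperature_part (Some i) s \<xi>)"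
      by (intro ext nonlin_solution_Some)
    then have "heat_duhamel \<alpha> (nonlin solution (Some i)) t \<xi> = ?u \<xi> + ?t \<xi>"
      using heat_duhamel_add[of t \<alpha> \<xi> "nonlin velocity_part (Some i)" "nonlin temperature_part (Some i)", OF elim(2,3)]
      by (simp only:)
    then show ?case using elim(1) by (simp add: initial_def forcing_def add.assoc)
  qed
  then have "(velocity t $ i) \<phi> = dist_inv_fourier (\<lambda>\<xi>. ((?h \<xi> + ?f \<xi>) + ?u \<xi>) + ?t \<xi>) \<phi>"
    unfolding velocity_def vec_lambda_beta
    by (rule dist_inv_fourier_cong_AE[OF jointly_measurable_section[OF solution_measurable] tempered_fun_measurable _ \<phi>, rotated])
      (intro tempered_fun_add tmp)
  then show ?thesis
    by (simp only: dist_inv_fourier_add[OF _ _ \<phi>] tempered_fun_add tmp)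
qed

lemma temperature_equation:
  assumes t: "0 < t" and \<phi>: "schwartz \<phi>"
  shows "temperature t \<phi> = dist_inv_fourier (\<lambda>\<xi>. heat_symbol \<alpha> t \<xi> * \<Theta> \<xi>) \<phi>
    + dist_inv_fourier (heat_duhamel \<alpha> (nonlin solution None) t) \<phi>"
proof -
  let ?h = "\<lambda>\<xi>. heat_symbol \<alpha> t \<xi> * \<Theta> \<xi>" and ?u = "heat_duhamel \<alpha> (nonlin solution None) t"
  have tmp: "tempered_fun ?h" "tempered_fun ?u"
    using heat_initial[OF t, of None] heat_duhamel_tempered[OF nonlin_measurable[OF solution_measurable] dominated_finite[OF solution_dom]]
    by (simp_all add: initial_def)
  have "AE \<xi> in lborel. solution None t \<xi> = ?h \<xi> + ?u \<xi>"
    using solution_AE[OF t, of None] by (simp add: initial_def forcing_def heat_duhamel_def)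
  then have "temperature t \<phi> = dist_inv_fourier (\<lambda>\<xi>. ?h \<xi> + ?u \<xi>) \<phi>"
    unfolding temperature_def
    by (rule dist_inv_fourier_cong_AE[OF jointly_measurable_section[OF solution_measurable] tempered_fun_measurable _ \<phi>, rotated])
      (intro tempered_fun_add tmp)
  then show ?thesis by (simp only: dist_inv_fourier_add[OF _ _ \<phi>] tmp)
qed

lemma heat_eq:
  assumes T: "fourier_off_origin T g" "AE \<xi> in lborel. fhat T \<xi> = initial m \<xi>" and t: "0 < t"
  shows "heat_defined \<alpha> t T" and "schwartz \<phi> \<Longrightarrow> heat \<alpha> t T \<phi> = dist_inv_fourier (\<lambda>\<xi>. heat_symbol \<alpha> t \<xi> * initial m \<xi>) \<phi>"
proof -
  note [measurable] = fhat_measurable[OF T(1)]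
  have [measurable]: "heat_symbol \<alpha> t \<in> borel_measurable borel" unfolding heat_symbol_def[abs_def] by measurable
  have eq: "AE \<xi> in lborel. heat_symbol \<alpha> t \<xi> * fhat T \<xi> = heat_symbol \<alpha> t \<xi> * initial m \<xi>"
    using T(2) by eventually_elim simp
  show "heat_defined \<alpha> t T"
    unfolding heat_defined_def using T(1) tempered_fun_cong_AE[OF heat_initial[OF t] _ eq] by auto
  show "heat \<alpha> t T \<phi> = dist_inv_fourier (\<lambda>\<xi>. heat_symbol \<alpha> t \<xi> * initial m \<xi>) \<phi>" if "schwartz \<phi>"
    unfolding heat_def by (rule dist_inv_fourier_cong_AE[OF _ _ eq that]) measurable
qed

text \<open>Spectra of the terms at almost every \<open>s\<close> determine the Duhamel integrals at
  every \<open>t\<close>. Those of the two divergence terms carry a minus sign, cancelled by the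
  minus in front of their integrals.\<close>

theorem mild_solution:
  assumes u0: "\<And>i. \<exists>g. fourier_off_origin (u0 $ i) g" "\<And>i. AE \<xi> in lborel. fhat (u0 $ i) \<xi> = U i \<xi>"
    and \<theta>0: "\<exists>g. fourier_off_origin \<theta>0 g" "AE \<xi> in lborel. fhat \<theta>0 \<xi> = \<Theta> \<xi>"
    and f: "AE s in lborel. 0 \<le> s \<longrightarrow> (\<forall>l. spectrum (f s $ l) (G l s))"
  shows "global_mild_solution \<alpha> u0 \<theta>0 f velocity temperature"
proof -
  have fs: "AE s in lborel. 0 \<le> s \<longrightarrow> spectrum (leray (f s) $ i) (force i s)" for i
    using f
  proof eventually_elim
    case (elim s)
    then show ?case using spectrum_leray[of "f s" "\<lambda>l. G l s" i] by (simp add: force_def[abs_def])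
  qed
  have us: "AE s in lborel. 0 \<le> s \<longrightarrow> spectrum (leray (div_tensor (velocity s) (velocity s)) $ i) (\<lambda>\<xi>. - nonlin velocity_part (Some i) s \<xi>)" for i
    using good_times by eventually_elim (auto intro: spectrum_div_tensor)
  have ts: "AE s in lborel. 0 \<le> s \<longrightarrow> spectrum (leray (along_last (temperature s)) $ i) (nonlin temperature_part (Some i) s)" for i
    using good_times by eventually_elim (auto intro: spectrum_buoyancy)
  have ds: "AE s in lborel. 0 \<le> s \<longrightarrow> spectrum (div_scaled (temperature s) (velocity s)) (\<lambda>\<xi>. - nonlin solution None s \<xi>)"
    using good_times by eventually_elim (auto intro: spectrum_div_scaled)
  have neg: "jointly_measurable (\<lambda>s \<xi>. - H s \<xi>)" if "jointly_measurable H" for H :: "real \<Rightarrow> (real, 'n) vec \<Rightarrow> complex"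
    using that unfolding jointly_measurable_def by simp
  have fin: "(\<integral>\<^sup>+s\<in>{0..t}. (\<integral>\<^sup>+\<xi>. ennreal (norm (- nonlin Z m s \<xi>)) * ennreal (decay (CARD('n) + 2) \<xi>) \<partial>lborel) \<partial>lborel) < \<infinity>"
    if "\<And>m t \<xi>. ennreal (norm (Z m t \<xi>)) \<le> majorant_lim m t \<xi>" for Z m t
    using dominated_finite[of Z, OF that] by simp
  note du = duhamel_spectrum[OF neg[OF nonlin_measurable[OF parts_measurable(1)]] us fin[OF parts_dom(1)]]
  note dt = duhamel_spectrum[OF nonlin_measurable[OF parts_measurable(2)] ts dominated_finite[OF parts_dom(2)]]
  note df = duhamel_spectrum[OF force_measurable fs force_finite]
  note dd = duhamel_spectrum[OF neg[OF nonlin_measurable[OF solution_measurable]] ds fin[OF solution_dom]]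
  have hu: "heat_defined \<alpha> t (u0 $ i)" "schwartz \<phi> \<Longrightarrow> heat \<alpha> t (u0 $ i) \<phi> = dist_inv_fourier (\<lambda>\<xi>. heat_symbol \<alpha> t \<xi> * U i \<xi>) \<phi>"
    if "0 < t" for t i \<phi>
    using u0(1)[of i] u0(2)[of i] heat_eq[of "u0 $ i" _ "Some i", OF _ _ that] by (auto simp: initial_def)
  have ht: "heat_defined \<alpha> t \<theta>0" "schwartz \<phi> \<Longrightarrow> heat \<alpha> t \<theta>0 \<phi> = dist_inv_fourier (\<lambda>\<xi>. heat_symbol \<alpha> t \<xi> * \<Theta> \<xi>) \<phi>"
    if "0 < t" for t \<phi>
    using \<theta>0 heat_eq[of \<theta>0 _ None, OF _ _ that] by (auto simp: initial_def)
  have tmp: "tempered (velocity t $ i)" "tempered (temperature t)" if "0 < t" for t i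
    using spectrum_velocity[OF that] spectrum_temperature[OF that] by (auto simp: spectrum_def fourier_regular_def)
  have AE: "AE s in lebesgue_on {0..}. (\<forall>i j. dist_prod_defined (velocity s $ i) (velocity s $ j)) \<and>
      (\<forall>j. dist_prod_defined (temperature s) (velocity s $ j)) \<and> (\<forall>i. fourier_regular (f s $ i))"
    unfolding AE_lebesgue_on_iff[OF atLeast_borel] using good_times f
    by eventually_elim (auto intro: velocity_prod_defined temperature_prod_defined spectrum_regular)
  show ?thesis
    unfolding global_mild_solution_def
  proof (intro conjI AE allI impI)
    fix t :: real assume t: "0 < t"
    show "tempered (velocity t $ i)" "heat_defined \<alpha> t (u0 $ i)" for i by (rule tmp[OF t] hu[OF t])+
    show "duhamel_defined \<alpha> t (\<lambda>s. leray (div_tensor (velocity s) (velocity s)) $ i)" for i by (rule du(1)[OF t])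
    show "duhamel_defined \<alpha> t (\<lambda>s. leray (along_last (temperature s)) $ i)" for i by (rule dt(1)[OF t])
    show "duhamel_defined \<alpha> t (\<lambda>s. leray (f s) $ i)" for i by (rule df(1)[OF t])
    show "tempered (temperature t)" "heat_defined \<alpha> t \<theta>0" by (rule tmp[OF t] ht[OF t])+
    show "duhamel_defined \<alpha> t (\<lambda>s. div_scaled (temperature s) (velocity s))" by (rule dd(1)[OF t])
    show "(velocity t $ i) \<phi> = heat \<alpha> t (u0 $ i) \<phi> - duhamel \<alpha> t (\<lambda>s. leray (div_tensor (velocity s) (velocity s)) $ i) \<phi>
        + duhamel \<alpha> t (\<lambda>s. leray (along_last (temperature s)) $ i) \<phi> + duhamel \<alpha> t (\<lambda>s. leray (f s) $ i) \<phi>"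
      if \<phi>: "schwartz \<phi>" for i \<phi>
      unfolding velocity_equation[OF t \<phi>] hu(2)[OF t \<phi>] du(2)[OF t \<phi>] dt(2)[OF t \<phi>] df(2)[OF t \<phi>]
        heat_duhamel_uminus_fun dist_inv_fourier_uminus by simp
    show "temperature t \<phi> = heat \<alpha> t \<theta>0 \<phi> - duhamel \<alpha> t (\<lambda>s. div_scaled (temperature s) (velocity s)) \<phi>"
      if \<phi>: "schwartz \<phi>" for \<phi>
      unfolding temperature_equation[OF t \<phi>] ht(2)[OF t \<phi>] dd(2)[OF t \<phi>]
        heat_duhamel_uminus_fun dist_inv_fourier_uminus by simp
  qed
qed

lemma spectrum_AE:
  "AE t in lborel. 0 \<le> t \<longrightarrow> spectrum (velocity t $ i) (solution (Some i) t)"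
  "AE t in lborel. 0 \<le> t \<longrightarrow> spectrum (temperature t) (solution None t)"
  using good_times by (eventually_elim, auto intro: spectrum_velocity spectrum_temperature)+

text \<open>The Euclidean norm is at most the sum of the moduli of the components, which costs a
  factor \<open>CARD('n)\<close>.\<close>

lemma velocity_herz:
  assumes p: "1 < p" "\<kappa>p = 1 - 1 / p" and q: "1 < q" "\<kappa>q = 1 - 1 / q"
  shows "velocity \<in> herz_vec p 0 q"
proof -
  define g where "g t \<xi> = norm (\<chi> i. solution (Some i) t \<xi>)" for t \<xi>
  note [measurable (raw)] = jointly_measurable_app[OF solution_measurable]
  have gm: "jointly_measurable g"
    unfolding g_def norm_vec_lambda jointly_measurable_def by measurable
  have g: "lorentz (1 - 1 / q) (of_nat CARD('n) * v t) (\<lambda>\<xi>. ennreal (g t \<xi>))" for t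
  proof -
    have "lorentz \<kappa>q (\<Sum>i\<in>(UNIV::'n set). v t) (\<lambda>\<xi>. \<Sum>i\<in>UNIV. ennreal (norm (solution (Some i) t \<xi>)))"
      by (intro lorentz_sum finite solution_lorentz)
    then show ?thesis
      unfolding q(2)
    proof (rule lorentz_mono)
      show "AE \<xi> in lborel. ennreal (g t \<xi>) \<le> (\<Sum>i\<in>UNIV. ennreal (norm (solution (Some i) t \<xi>)))"
        unfolding g_def norm_vec_def vec_lambda_beta by (intro AE_I2) (simp add: sum_ennreal L2_set_le_sum ennreal_leI)
      show "(\<lambda>\<xi>. ennreal (g t \<xi>)) \<in> borel_measurable borel" using jointly_measurable_section[OF gm] by simp
    qed simp
  qed
  have h: "(\<lambda>\<xi>. norm (fhat_vec (velocity t) \<xi>)) \<in> borel_measurable borel \<and> (AE \<xi> in lborel. norm (fhat_vec (velocity t) \<xi>) = g t \<xi>)"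
    if t: "0 < t" for t
  proof
    show "(\<lambda>\<xi>. norm (fhat_vec (velocity t) \<xi>)) \<in> borel_measurable borel"
      by (intro norm_fhat_vec_measurable spectrum_fhat_measurable[OF spectrum_velocity[OF t]])
    have "AE \<xi> in lborel. \<forall>i. fhat (velocity t $ i) \<xi> = solution (Some i) t \<xi>"
      unfolding AE_all_countable using spectrum_fhat[OF spectrum_velocity[OF t]] by blast
    then show "AE \<xi> in lborel. norm (fhat_vec (velocity t) \<xi>) = g t \<xi>"
      by eventually_elim (simp add: fhat_vec_def g_def)
  qed
  have "herz_norm_vec p 0 q velocity \<le> of_nat CARD('n) * ennreal X"
    unfolding herz_norm_vec_def
    by (rule herz_norm_bound[OF p(1) q(1) gm g lorentz_cmult[OF v(1)[unfolded p(2)]] h])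
  also have "\<dots> < top" by (simp add: ennreal_mult_less_top of_nat_less_top)
  finally show ?thesis
    unfolding herz_vec_def using time_fourier_measurable_spectrum[OF solution_measurable spectrum_AE(1)] by auto
qed

lemma temperature_herz:
  assumes p: "1 < p" "\<kappa>P = 1 - 1 / p" and q: "1 < q" "\<kappa>Q = 1 - 1 / q"
  shows "temperature \<in> herz p 0 q"
proof -
  have gm: "jointly_measurable (\<lambda>t \<xi>. norm (solution None t \<xi>))"
    using solution_measurable unfolding jointly_measurable_def by measurable
  have h: "(\<lambda>\<xi>. norm (fhat (temperature t) \<xi>)) \<in> borel_measurable borel \<and>
      (AE \<xi> in lborel. norm (fhat (temperature t) \<xi>) = norm (solution None t \<xi>))" if t: "0 < t" for t
    using spectrum_fhat[OF spectrum_temperature[OF t]] spectrum_fhat_measurable[OF spectrum_temperature[OF t]]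
    by (auto elim: eventually_mono)
  have "herz_norm p 0 q temperature \<le> ennreal Y"
    unfolding herz_norm_def
    by (rule herz_norm_bound[OF p(1) q(1) gm solution_lorentz(2)[unfolded q(2)] w(1)[unfolded p(2)] h])
  also have "\<dots> < top" by simp
  finally show ?thesis
    unfolding herz_def using time_fourier_measurable_spectrum[OF solution_measurable spectrum_AE(2)] by auto
qed

end

section \<open>Borel versions of the data and the choice of constants\<close>

lemma hermitian_part_cong_AE:
  assumes "AE \<xi> in lborel. f \<xi> = g \<xi>"
  shows "AE \<xi> in lborel. hermitian_part f \<xi> = hermitian_part g \<xi>"
  using assms AE_lborel_reflect[OF assms, of 0] by eventually_elim (simp add: hermitian_part_def)

text \<open>Replaces the force by a version of its transform that is Borel in time and frequency,
  Hermitian at every frequency and of the same norm.\<close>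

lemma herz_vec_spectrum:
  fixes f :: "real \<Rightarrow> 'n::finite tdist_vec"
  assumes f: "f \<in> herz_vec p \<sigma> q" and real: "AE t in lebesgue_on {0..}. \<forall>i. real_valued (f t $ i)" and q: "0 < q"
  obtains G :: "'n \<Rightarrow> real \<Rightarrow> real^'n \<Rightarrow> complex"
  where "\<And>i. jointly_measurable (G i)" "\<And>i t \<xi>. G i t (- \<xi>) = cnj (G i t \<xi>)" "\<And>i t \<xi>. t < 0 \<Longrightarrow> G i t \<xi> = 0"
    "AE t in lborel. 0 \<le> t \<longrightarrow> (\<forall>l. spectrum (f t $ l) (G l t))"
    "(\<lambda>t. weak_norm lborel q (\<lambda>\<xi>. ennreal (norm \<xi> powr \<sigma> * norm (\<chi> i. G i t \<xi>)))) \<in> borel_measurable borel"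
    "weak_norm lborel p (\<lambda>t. indicator {0..} t * weak_norm lborel q (\<lambda>\<xi>. ennreal (norm \<xi> powr \<sigma> * norm (\<chi> i. G i t \<xi>))))
      = herz_norm_vec p \<sigma> q f"
proof -
  have ex: "\<exists>F \<in> borel_measurable (borel :: (real \<times> (real^'n)) measure).
      AE t in lebesgue_on {0..}. AE \<xi> in lborel. fhat (f t $ i) \<xi> = F (t, \<xi>)"
    and reg: "AE t in lebesgue_on {0..}. fourier_regular (f t $ i)" for i
    using f by (auto simp: herz_vec_def time_fourier_measurable_def)
  have "\<forall>i. \<exists>F. F \<in> borel_measurable (borel :: (real \<times> (real^'n)) measure) \<and>
      (AE t in lebesgue_on {0..}. AE \<xi> in lborel. fhat (f t $ i) \<xi> = F (t, \<xi>))"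
    using ex by blast
  from choice[OF this] obtain F where Fm: "\<And>i. F i \<in> borel_measurable (borel :: (real \<times> (real^'n)) measure)"
    and F: "\<And>i. AE t in lebesgue_on {0..}. AE \<xi> in lborel. fhat (f t $ i) \<xi> = F i (t, \<xi>)"
    by blast
  \<comment> \<open>Symmetrisation changes nothing up to null sets, because \<open>f\<close> is real
    at almost every nonnegative time. Negative times, which the hypotheses on \<open>f\<close> do
    not reach, get the value 0.\<close>
  define G where "G i t \<xi> = (if 0 \<le> t then hermitian_part (\<lambda>\<xi>. F i (t, \<xi>)) \<xi> else 0)" for i t \<xi>
  have Gm: "jointly_measurable (G i)" for i
  proof -
    have [measurable]: "F i \<in> borel_measurable (borel \<Otimes>\<^sub>M borel)" using Fm by (simp add: borel_prod)
    have [measurable]: "cnj \<in> borel_measurable borel"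
      by (intro borel_measurable_continuous_onI continuous_intros)
    show ?thesis unfolding jointly_measurable_def G_def hermitian_part_def by measurable
  qed
  have spec: "AE t in lborel. 0 \<le> t \<longrightarrow> (\<forall>l. spectrum (f t $ l) (G l t))"
  proof -
    have "AE t in lborel. t \<in> {0..} \<longrightarrow> spectrum (f t $ l) (G l t)" for l
      using reg[of l, unfolded AE_lebesgue_on_iff[OF atLeast_borel]] F[of l, unfolded AE_lebesgue_on_iff[OF atLeast_borel]]
        real[unfolded AE_lebesgue_on_iff[OF atLeast_borel]]
    proof (eventually_elim, intro impI)
      fix t :: real
      assume *: "t \<in> {0..} \<longrightarrow> fourier_regular (f t $ l)" "t \<in> {0..} \<longrightarrow> (AE \<xi> in lborel. fhat (f t $ l) \<xi> = F l (t, \<xi>))"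
        "t \<in> {0..} \<longrightarrow> (\<forall>i. real_valued (f t $ i))" and t: "t \<in> {0..}"
      then obtain g where g: "fourier_off_origin (f t $ l) g" by (auto simp: fourier_regular_def)
      have "AE \<xi> in lborel. fhat (f t $ l) \<xi> = F l (t, \<xi>)" using * t by blast
      from hermitian_part_cong_AE[OF this] hermitian_part_fhat[OF g, OF *(3)[rule_format, OF t]]
      have "AE \<xi> in lborel. fhat (f t $ l) \<xi> = G l t \<xi>"
        by eventually_elim (use t in \<open>simp add: G_def\<close>)
      then show "spectrum (f t $ l) (G l t)"
        unfolding spectrum_def using *(1) t jointly_measurable_section[OF Gm] by auto
    qed
    then have "AE t in lborel. \<forall>l. t \<in> {0..} \<longrightarrow> spectrum (f t $ l) (G l t)"
      unfolding AE_all_countable by blast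
    then show ?thesis by eventually_elim auto
  qed
  note [measurable (raw)] = jointly_measurable_app[OF Gm]
  define W where "W t = weak_norm lborel q (\<lambda>\<xi>. ennreal (norm \<xi> powr \<sigma> * norm (\<chi> i. G i t \<xi>)))" for t
  have "(\<lambda>(t, \<xi>::real^'n). ennreal (norm \<xi> powr \<sigma> * norm (\<chi> i. G i t \<xi>))) \<in> borel_measurable (borel \<Otimes>\<^sub>M borel)"
    unfolding norm_vec_lambda by measurable
  from weak_norm_measurable[OF this q] have Wm: "W \<in> borel_measurable borel" by (simp add: W_def[abs_def])
  have "AE t in lborel. 0 \<le> t \<longrightarrow> weak_norm lborel q (\<lambda>\<xi>. ennreal (norm \<xi> powr \<sigma> * norm (fhat_vec (f t) \<xi>))) = W t"
    using spec
  proof (eventually_elim, intro impI)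
    fix t :: real assume "0 \<le> t \<longrightarrow> (\<forall>l. spectrum (f t $ l) (G l t))" "0 \<le> t"
    then have t: "\<And>l. spectrum (f t $ l) (G l t)" by blast
    have [measurable]: "(\<lambda>\<xi>. norm (fhat_vec (f t) \<xi>)) \<in> borel_measurable borel"
      by (intro norm_fhat_vec_measurable spectrum_fhat_measurable[OF t])
    have [measurable]: "(\<lambda>\<xi>. norm (\<chi> i. G i t \<xi>)) \<in> borel_measurable borel" unfolding norm_vec_lambda by measurable
    have "AE \<xi> in lborel. \<forall>i. fhat (f t $ i) \<xi> = G i t \<xi>"
      unfolding AE_all_countable using spectrum_fhat[OF t] by blast
    then have "AE \<xi> in lborel. ennreal (norm \<xi> powr \<sigma> * norm (fhat_vec (f t) \<xi>)) = ennreal (norm \<xi> powr \<sigma> * norm (\<chi> i. G i t \<xi>))"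
      by eventually_elim (simp add: fhat_vec_def)
    then show "weak_norm lborel q (\<lambda>\<xi>. ennreal (norm \<xi> powr \<sigma> * norm (fhat_vec (f t) \<xi>))) = W t"
      unfolding W_def by (intro weak_norm_cong_AE) measurable
  qed
  then have "weak_norm lborel p (\<lambda>t. indicator {0..} t * W t) = herz_norm_vec p \<sigma> q f"
    unfolding herz_norm_vec_def by (intro weak_norm_half_line[OF Wm, symmetric])
  then show thesis
    using that[of G] Gm spec Wm by (simp add: W_def[abs_def] G_def hermitian_part_uminus)
qed

text \<open>The second scaling relation of the locale is the temperature relation minus the velocity
  relation, rewritten with d / r' = d (1 - 1 / r).\<close>

lemma critical_exponents_of_indices:
  fixes \<alpha> p q \<pp> \<qq> :: real
  assumes "1 < \<alpha>" "1 < q" "1 < \<qq>"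
    and "\<alpha> / p + real CARD('n::finite) / conj_exp q = \<alpha> - 1" "2 < p" "q < 2"
    and "\<alpha> / \<pp> + real CARD('n) / conj_exp \<qq> = 2 * \<alpha> - 1"
      "conj_exp p < \<pp>" "1 < \<pp>" "\<pp> < p" "q \<le> \<qq>" "\<qq> < conj_exp q"
  shows "critical_exponents TYPE('n) \<alpha> (1 - 1 / p) (1 - 1 / q) (1 - 1 / \<pp>) (1 - 1 / \<qq>) (real CARD('n))"
proof
  have conj: "real CARD('n) / conj_exp r = real CARD('n) * (1 - 1 / r)" if "1 < r" for r
    using that by (simp add: conj_exp_def field_simps)
  show u: "real CARD('n) * (1 - 1 / q) = \<alpha> * (1 - 1 / p) - 1"
    using assms(4) conj[OF assms(2)] by (simp add: right_diff_distrib)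
  have "\<alpha> / \<pp> + real CARD('n) * (1 - 1 / \<qq>) = 2 * \<alpha> - 1"
    using assms(7) conj[OF assms(3)] by simp
  then show "\<alpha> * (1 + (1 - 1 / \<pp>) - (1 - 1 / p)) = real CARD('n) * ((1 - 1 / \<qq>) - (1 - 1 / q))"
    using u by (simp add: algebra_simps)
  show "0 < 1 - 1 / p" "1 - 1 / p < 1" "1 < 2 * (1 - 1 / p)" using assms by (auto simp: field_simps)
  show "0 < 1 - 1 / q" "2 * (1 - 1 / q) < 1" using assms by (auto simp: field_simps)
  show "0 < 1 - 1 / \<pp>" "1 - 1 / \<pp> < 1 - 1 / p" using assms by (auto simp: field_simps)
  have "p < \<pp> * (p - 1)" using assms(5,8) by (simp add: conj_exp_def pos_divide_less_eq)
  then show "1 < (1 - 1 / \<pp>) + (1 - 1 / p)" using assms(5,9) by (simp add: field_simps)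
  show "1 - 1 / q \<le> 1 - 1 / \<qq>" using assms(2,11) by (auto simp: field_simps)
  have "\<qq> * (q - 1) < q" using assms(2,12) by (simp add: conj_exp_def pos_less_divide_eq)
  then show "(1 - 1 / q) + (1 - 1 / \<qq>) < 1" using assms(2,3) by (simp add: field_simps)
qed (use assms in auto)

theorem theorem1:
  fixes \<alpha> p q \<pp> \<qq> p\<^sub>f q\<^sub>f \<ss> :: real
  assumes "1 < \<alpha>" "\<alpha> < 2"
    and "2 \<le> CARD('n::{finite,linorder})"
    and "1 < p" "1 < q" "1 < \<pp>" "1 < \<qq>" "1 < p\<^sub>f" "1 < q\<^sub>f"
    and "\<alpha> / p + real CARD('n) / conj_exp q = \<alpha> - 1" "2 < p" "q < 2"
    and "\<alpha> / \<pp> + real CARD('n) / conj_exp \<qq> = 2 * \<alpha> - 1"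
      "1 < conj_exp p" "conj_exp p < \<pp>" "\<pp> < p" "q \<le> \<qq>" "\<qq> < conj_exp q"
    and "\<alpha> / p\<^sub>f + real CARD('n) / conj_exp q\<^sub>f - \<ss> = 2 * \<alpha> - 1" "p\<^sub>f < p" "q \<le> q\<^sub>f"
  shows "\<exists>\<epsilon>>0. \<forall>(u\<^sub>0 :: 'n tdist_vec) (\<theta>\<^sub>0 :: 'n tdist) (f :: real \<Rightarrow> 'n tdist_vec).
    u\<^sub>0 \<in> besov_vec (- \<alpha> / p) q \<longrightarrow> (\<forall>i. real_valued (u\<^sub>0 $ i)) \<longrightarrow> divergence_free u\<^sub>0 \<longrightarrow>
    \<theta>\<^sub>0 \<in> besov (- \<alpha> / \<pp>) \<qq> \<longrightarrow> real_valued \<theta>\<^sub>0 \<longrightarrow>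
    f \<in> herz_vec p\<^sub>f \<ss> q\<^sub>f \<longrightarrow> (AE t in lebesgue_on {0..}. \<forall>i. real_valued (f t $ i)) \<longrightarrow>
    besov_norm_vec (- \<alpha> / p) q u\<^sub>0 + besov_norm (- \<alpha> / \<pp>) \<qq> \<theta>\<^sub>0 + herz_norm_vec p\<^sub>f \<ss> q\<^sub>f f
      < ennreal \<epsilon> \<longrightarrow>
    (\<exists>u \<theta>. u \<in> herz_vec p 0 q \<and> \<theta> \<in> herz \<pp> 0 \<qq> \<and>
       (\<forall>t>0. (\<forall>i. real_valued (u t $ i)) \<and> real_valued (\<theta> t)) \<and>
       global_mild_solution \<alpha> u\<^sub>0 \<theta>\<^sub>0 f u \<theta>)"
proof -
  define d where "d = real CARD('n)"
  define \<kappa>p where "\<kappa>p = 1 - 1 / p"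
  define \<kappa>q where "\<kappa>q = 1 - 1 / q"
  define \<kappa>P where "\<kappa>P = 1 - 1 / \<pp>"
  define \<kappa>Q where "\<kappa>Q = 1 - 1 / \<qq>"
  define \<kappa>g where "\<kappa>g = 1 - 1 / p\<^sub>f"
  define \<kappa>f where "\<kappa>f = 1 - 1 / q\<^sub>f"
  note \<kappa>_defs = \<kappa>p_def \<kappa>q_def \<kappa>P_def \<kappa>Q_def \<kappa>g_def \<kappa>f_def
  interpret E: critical_exponents \<alpha> \<kappa>p \<kappa>q \<kappa>P \<kappa>Q d "TYPE('n)"
    unfolding \<kappa>_defs d_def by (rule critical_exponents_of_indices) (fact assms)+
  have \<kappa>g: "0 < \<kappa>g" "\<kappa>g < \<kappa>p" using assms by (auto simp: \<kappa>_defs field_simps)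
  have \<kappa>f: "\<kappa>q \<le> \<kappa>f" "\<kappa>f \<le> 1" using assms by (auto simp: \<kappa>_defs field_simps)
  have crit: "\<ss> + \<alpha> * (1 + \<kappa>g - \<kappa>p) = d * (\<kappa>f - \<kappa>q)"
  proof -
    have "real CARD('n) / conj_exp q\<^sub>f = d * \<kappa>f"
      using assms(9) by (simp add: conj_exp_def \<kappa>f_def d_def field_simps)
    then have "\<alpha> / p\<^sub>f + d * \<kappa>f - \<ss> = 2 * \<alpha> - 1" using assms by simp
    then show ?thesis using E.critical_u by (simp add: \<kappa>g_def algebra_simps)
  qed
  have \<alpha>0: "0 < \<alpha>" using assms by simp

  \<comment> \<open>Constants depending on the indices only\<close>
  obtain c1 c2 c3 where sc: "E.space_constants c1 c2 c3" using E.space_constants_exist by blast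
  then have c: "0 \<le> c1" "0 \<le> c2" "0 \<le> c3" by (auto simp: E.space_constants_def)
  obtain \<epsilon>0 X Y where \<epsilon>0: "0 < \<epsilon>0" and XY: "\<And>a0 b0. lorentz \<kappa>p (ennreal \<epsilon>0) a0 \<Longrightarrow> lorentz \<kappa>P (ennreal \<epsilon>0) b0 \<Longrightarrow>
      (\<forall>n. lorentz \<kappa>p (ennreal X) (fst (E.time_maj c1 c2 c3 a0 b0 n)) \<and> lorentz \<kappa>P (ennreal Y) (snd (E.time_maj c1 c2 c3 a0 b0 n)))
      \<and> 0 \<le> X \<and> 0 \<le> Y"
    using E.time_maj_bound[OF c] by blast
  obtain Cu where Cu: "0 < Cu" "\<And>K (g::(real, 'n) vec \<Rightarrow> (complex, 'n) vec) h t. (\<lambda>\<xi>. norm (g \<xi>)) \<in> borel_measurable borel \<Longrightarrow>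
      annuli_norm (- \<alpha> / p) q g \<le> ennreal K \<Longrightarrow> 0 \<le> K \<Longrightarrow> h \<in> borel_measurable borel \<Longrightarrow>
      (AE \<xi> in lborel. norm (h \<xi>) \<le> norm (g \<xi>)) \<Longrightarrow> 0 < t \<Longrightarrow>
      lorentz \<kappa>q (ennreal (Cu * K) * ennreal (t powr (- (1 - \<kappa>p)))) (\<lambda>\<xi>. ennreal (norm (heat_symbol \<alpha> t \<xi> * h \<xi>)))"
    using annuli_norm_heat[OF \<alpha>0, of "1 / p" q, where 'n = 'n and 'b = "(complex, 'n) vec"] assms
    by (auto simp: \<kappa>_defs)
  obtain Ct where Ct: "0 < Ct" "\<And>K (g::(real, 'n) vec \<Rightarrow> complex) h t. (\<lambda>\<xi>. norm (g \<xi>)) \<in> borel_measurable borel \<Longrightarrow>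
      annuli_norm (- \<alpha> / \<pp>) \<qq> g \<le> ennreal K \<Longrightarrow> 0 \<le> K \<Longrightarrow> h \<in> borel_measurable borel \<Longrightarrow>
      (AE \<xi> in lborel. norm (h \<xi>) \<le> norm (g \<xi>)) \<Longrightarrow> 0 < t \<Longrightarrow>
      lorentz \<kappa>Q (ennreal (Ct * K) * ennreal (t powr (- (1 - \<kappa>P)))) (\<lambda>\<xi>. ennreal (norm (heat_symbol \<alpha> t \<xi> * h \<xi>)))"
    using annuli_norm_heat[OF \<alpha>0, of "1 / \<pp>" \<qq>, where 'n = 'n and 'b = complex] assms
    by (auto simp: \<kappa>_defs)
  have \<kappa>P1: "\<kappa>P < 1" using E.\<kappa>P E.\<kappa>p by linarith
  obtain Lp where Lp: "0 < Lp" "lorentz \<kappa>p (ennreal Lp) (\<lambda>t::real. ennreal (\<bar>t\<bar> powr (- (1 - \<kappa>p))))"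
    using lorentz_abs_powr[OF E.\<kappa>p(1,2)] by blast
  obtain LP where LP: "0 < LP" "lorentz \<kappa>P (ennreal LP) (\<lambda>t::real. ennreal (\<bar>t\<bar> powr (- (1 - \<kappa>P))))"
    using lorentz_abs_powr[OF E.\<kappa>P(1) \<kappa>P1] by blast
  obtain Cf N where Cf: "0 < Cf" "\<And>K v (H :: real \<Rightarrow> (real, 'n) vec \<Rightarrow> ennreal). lorentz \<kappa>g (ennreal K) v \<Longrightarrow> jointly_measurable H \<Longrightarrow>
      (\<And>s. lorentz \<kappa>f (v s) (\<lambda>\<xi>. ennreal (norm \<xi> powr \<ss>) * H s \<xi>)) \<Longrightarrow>
      (\<exists>a. lorentz \<kappa>p (ennreal (Cf * K)) a \<and>
        (\<forall>t. lorentz \<kappa>q (a t) (heat_duhamel_maj \<alpha> H t))) \<and>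
      (\<forall>t. (\<integral>\<^sup>+s\<in>{0..t}. (\<integral>\<^sup>+\<xi>. H s \<xi> * ennreal (decay N \<xi>) \<partial>lborel) \<partial>lborel) < \<infinity>)"
    using E.force_bounds[OF \<kappa>g \<kappa>f crit] by blast
  obtain Wf where Wf: "0 < Wf" "\<And>K (g::(real, 'n) vec \<Rightarrow> ennreal). g \<in> borel_measurable borel \<Longrightarrow>
      weak_norm lborel q\<^sub>f g \<le> K \<Longrightarrow> lorentz \<kappa>f (ennreal Wf * K) g"
    using weak_norm_lorentz[OF assms(9), where 'a = "(real, 'n) vec"] unfolding \<kappa>f_def by blast
  obtain Wt where Wt: "0 < Wt" "\<And>K (g::real \<Rightarrow> ennreal). g \<in> borel_measurable borel \<Longrightarrow>
      weak_norm lborel p\<^sub>f g \<le> K \<Longrightarrow> lorentz \<kappa>g (ennreal Wt * K) g"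
    using weak_norm_lorentz[OF assms(8), where 'a = real] unfolding \<kappa>g_def by blast
  \<comment> \<open>\<open>2 * d\<close> bounds the Leray symbol summed over the components;
    \<open>Wf\<close> and \<open>Wt\<close> convert the weak norms in frequency and in time.\<close>
  define D where "D = 2 * d * (Wf * Wt)"
  have D: "0 < D" using E.d_pos Wf Wt by (simp add: D_def)
  \<comment> \<open>The denominator adds up the constants with which the three kinds of data reach
    the majorants, so that each stays within the budget \<open>\<epsilon>0\<close>.\<close>
  define \<epsilon> where "\<epsilon> = \<epsilon>0 / (Cu * Lp + Ct * LP + Cf * D)"
  have den: "0 < Cu * Lp" "0 < Ct * LP" "0 < Cf * D" using Cu Ct Cf Lp LP D by auto
  have \<epsilon>: "0 < \<epsilon>" using \<epsilon>0 den by (simp add: \<epsilon>_def)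
  have "\<epsilon> * (Cu * Lp) + \<epsilon> * (Ct * LP) + \<epsilon> * (Cf * D) = \<epsilon>0"
    unfolding distrib_left[symmetric] using den by (simp add: \<epsilon>_def)
  then have small_u: "\<epsilon> * (Cu * Lp) + \<epsilon> * (Cf * D) \<le> \<epsilon>0" and small_t: "\<epsilon> * (Ct * LP) \<le> \<epsilon>0"
    using \<epsilon> den by (smt (verit) mult_pos_pos)+
  show ?thesis
  proof (intro exI[of _ \<epsilon>] conjI allI impI \<epsilon>)

    \<comment> \<open>Majorants for given data\<close>
    fix u0 :: "'n tdist_vec" and \<theta>0 :: "'n tdist" and f :: "real \<Rightarrow> 'n tdist_vec"
    assume u0: "u0 \<in> besov_vec (- \<alpha> / p) q" "\<forall>i. real_valued (u0 $ i)"
      and \<theta>0: "\<theta>0 \<in> besov (- \<alpha> / \<pp>) \<qq>" "real_valued \<theta>0"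
      and f: "f \<in> herz_vec p\<^sub>f \<ss> q\<^sub>f" "AE t in lebesgue_on {0..}. \<forall>i. real_valued (f t $ i)"
      and small: "besov_norm_vec (- \<alpha> / p) q u0 + besov_norm (- \<alpha> / \<pp>) \<qq> \<theta>0 + herz_norm_vec p\<^sub>f \<ss> q\<^sub>f f < ennreal \<epsilon>"
    have nu: "annuli_norm (- \<alpha> / p) q (fhat_vec u0) \<le> ennreal \<epsilon>"
      and nt: "annuli_norm (- \<alpha> / \<pp>) \<qq> (fhat \<theta>0) \<le> ennreal \<epsilon>"
      and nf: "herz_norm_vec p\<^sub>f \<ss> q\<^sub>f f \<le> ennreal \<epsilon>"
      using small unfolding besov_norm_vec_def besov_norm_def
      by (auto intro: order_trans[OF _ less_imp_le[OF small[unfolded besov_norm_vec_def besov_norm_def]]] add_increasing add_increasing2)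
    have offu: "\<exists>g. fourier_off_origin (u0 $ i) g" for i using u0 by (auto simp: besov_vec_def)
    have offt: "\<exists>g. fourier_off_origin \<theta>0 g" using \<theta>0 by (auto simp: besov_def)
    have [measurable]: "fhat (u0 $ i) \<in> borel_measurable borel" "fhat \<theta>0 \<in> borel_measurable borel" for i
      using offu[of i] offt by (auto intro: fhat_measurable)
    have [measurable]: "(\<lambda>\<xi>. norm (fhat_vec u0 \<xi>)) \<in> borel_measurable borel"
      by (rule norm_fhat_vec_measurable) measurable
    define U where "U i = hermitian_part (fhat (u0 $ i))" for i
    define \<Theta> where "\<Theta> = hermitian_part (fhat \<theta>0)"
    have U: "AE \<xi> in lborel. fhat (u0 $ i) \<xi> = U i \<xi>" for i
      using offu[of i] u0(2) by (auto simp: U_def eq_commute[of "fhat _ _"] intro: hermitian_part_fhat)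
    have \<Theta>: "AE \<xi> in lborel. fhat \<theta>0 \<xi> = \<Theta> \<xi>"
      using offt \<theta>0(2) by (auto simp: \<Theta>_def eq_commute[of "fhat _ _"] intro: hermitian_part_fhat)
    obtain G where Gm: "\<And>i. jointly_measurable (G i)" and Gsym: "\<And>i t \<xi>. G i t (- \<xi>) = cnj (G i t \<xi>)"
      and G0: "\<And>i t \<xi>. t < 0 \<Longrightarrow> G i t \<xi> = 0" and G: "AE t in lborel. 0 \<le> t \<longrightarrow> (\<forall>l. spectrum (f t $ l) (G l t))"
      and Wm: "(\<lambda>t. weak_norm lborel q\<^sub>f (\<lambda>\<xi>. ennreal (norm \<xi> powr \<ss> * norm (\<chi> i. G i t \<xi>)))) \<in> borel_measurable borel"
      and W: "weak_norm lborel p\<^sub>f (\<lambda>t. indicator {0..} t * weak_norm lborel q\<^sub>f (\<lambda>\<xi>. ennreal (norm \<xi> powr \<ss> * norm (\<chi> i. G i t \<xi>))))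
        = herz_norm_vec p\<^sub>f \<ss> q\<^sub>f f"
      by (rule herz_vec_spectrum[OF f]) (use assms in auto)
    interpret B: boussinesq_data \<alpha> \<kappa>p \<kappa>q \<kappa>P \<kappa>Q d "TYPE('n)" U \<Theta> G
      by unfold_locales (auto simp: U_def \<Theta>_def hermitian_part_uminus Gm Gsym intro!: hermitian_part_measurable)
    note [measurable (raw)] = jointly_measurable_app[OF Gm]
    \<comment> \<open>A common majorant for all components of the projected force, so that the force
      bound is applied once and yields one function \<open>a\<close>.\<close>
    define H where "H s \<xi> = ennreal (2 * d * norm (\<chi> i. G i s \<xi>))" for s \<xi>
    have Hm: "jointly_measurable H" unfolding jointly_measurable_def H_def norm_vec_lambda by measurable
    have force_le: "ennreal (norm (B.force i s \<xi>)) \<le> H s \<xi>" for i s \<xi>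
    proof -
      have "norm (B.force i s \<xi>) \<le> (\<Sum>l\<in>(UNIV::'n set). 2 * norm (\<chi> i. G i s \<xi>))"
        unfolding B.force_def
      proof (rule sum_norm_le)
        fix l
        show "norm (of_real (leray_symbol i l \<xi>) * G l s \<xi>) \<le> 2 * norm (\<chi> i. G i s \<xi>)"
          unfolding norm_mult using Finite_Cartesian_Product.norm_nth_le[of "\<chi> i. G i s \<xi>" l] by (intro mult_mono) (auto simp: leray_symbol_le)
      qed
      also have "\<dots> = 2 * d * norm (\<chi> i. G i s \<xi>)" by (simp add: d_def)
      finally show ?thesis unfolding H_def by (rule ennreal_leI)
    qed
    define vf where "vf t = ennreal (2 * d * Wf) * (indicator {0..} t * weak_norm lborel q\<^sub>f (\<lambda>\<xi>. ennreal (norm \<xi> powr \<ss> * norm (\<chi> i. G i t \<xi>))))" for t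
    have vf: "lorentz \<kappa>g (ennreal (D * \<epsilon>)) vf"
    proof -
      have "lorentz \<kappa>g (ennreal (2 * d * Wf) * (ennreal Wt * ennreal \<epsilon>)) vf"
        unfolding vf_def by (intro lorentz_cmult Wt(2)) (use Wm nf W in auto)
      then show ?thesis using E.d_pos Wf(1) Wt(1) \<epsilon> by (simp add: D_def ennreal_mult[symmetric] mult.assoc)
    qed
    have Hf: "lorentz \<kappa>f (vf s) (\<lambda>\<xi>. ennreal (norm \<xi> powr \<ss>) * H s \<xi>)" for s
    proof (cases "0 \<le> s")
      case True
      have [measurable]: "(\<lambda>\<xi>. norm (\<chi> i. G i s \<xi>)) \<in> borel_measurable borel" unfolding norm_vec_lambda by measurable
      have "lorentz \<kappa>f (ennreal Wf * weak_norm lborel q\<^sub>f (\<lambda>\<xi>. ennreal (norm \<xi> powr \<ss> * norm (\<chi> i. G i s \<xi>))))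
          (\<lambda>\<xi>. ennreal (norm \<xi> powr \<ss> * norm (\<chi> i. G i s \<xi>)))"
        by (rule Wf(2)[OF _ order_refl]) measurable
      from lorentz_cmult[OF this, of "ennreal (2 * d)"]
      show ?thesis using True E.d_pos Wf(1) by (simp add: vf_def H_def ennreal_mult mult_ac)
    next
      case False
      have "norm (\<chi> i. G i s \<xi>) = 0" for \<xi> using G0 False by (simp add: norm_vec_lambda)
      then show ?thesis by (simp add: H_def lorentz_zero)
    qed
    obtain a where a: "lorentz \<kappa>p (ennreal (Cf * (D * \<epsilon>))) a"
      "\<And>t. lorentz \<kappa>q (a t) (heat_duhamel_maj \<alpha> H t)"
      and Hfin: "\<And>t. (\<integral>\<^sup>+s\<in>{0..t}. (\<integral>\<^sup>+\<xi>. H s \<xi> * ennreal (decay N \<xi>) \<partial>lborel) \<partial>lborel) < \<infinity>"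
      using Cf(2)[OF vf Hm Hf] by blast
    \<comment> \<open>The heat flow of the initial velocity decays like this power of time, which
      has index \<kappa>p in the weak scale; the temperature has its counterpart in
      \<open>b0\<close>.\<close>
    define a1 where "a1 t = ennreal (Cu * \<epsilon>) * ennreal (\<bar>t\<bar> powr (- (1 - \<kappa>p)))" for t
    define b0 where "b0 t = ennreal (Ct * \<epsilon>) * ennreal (\<bar>t\<bar> powr (- (1 - \<kappa>P)))" for t
    define a0 where "a0 t = a1 t + a t" for t
    have heat_u: "lorentz \<kappa>q (a1 t) (\<lambda>\<xi>. ennreal (norm (heat_symbol \<alpha> t \<xi> * U i \<xi>)))" if t: "0 < t" for i t
    proof -
      have "AE \<xi> in lborel. norm (U i \<xi>) \<le> norm (fhat_vec u0 \<xi>)"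
        using U[of i]
      proof eventually_elim
        case (elim \<xi>)
        then show ?case using Finite_Cartesian_Product.norm_nth_le[of "fhat_vec u0 \<xi>" i] by (simp add: fhat_vec_def)
      qed
      then show ?thesis unfolding a1_def using Cu(2)[OF _ nu less_imp_le[OF \<epsilon>] B.U_measurable _ t] t by simp
    qed
    have heat_t: "lorentz \<kappa>Q (b0 t) (\<lambda>\<xi>. ennreal (norm (heat_symbol \<alpha> t \<xi> * \<Theta> \<xi>)))" if t: "0 < t" for t
    proof -
      have "AE \<xi> in lborel. norm (\<Theta> \<xi>) \<le> norm (fhat \<theta>0 \<xi>)" using \<Theta> by eventually_elim simp
      then show ?thesis unfolding b0_def using Ct(2)[OF _ nt less_imp_le[OF \<epsilon>] B.\<Theta>_measurable _ t] t by simp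
    qed
    have Au: "lorentz \<kappa>q (a0 t) (\<lambda>\<xi>. ennreal (norm (B.data (Some i) t \<xi>)))" for i t
    proof -
      let ?h = "\<lambda>\<xi>. if 0 < t then heat_symbol \<alpha> t \<xi> * U i \<xi> else 0"
      have "lorentz \<kappa>q (a1 t) (\<lambda>\<xi>. ennreal (norm (?h \<xi>)))"
        using heat_u[of t i] by (cases "0 < t") (simp_all add: lorentz_zero)
      from lorentz_add[OF this a(2)[of t]] show ?thesis
        unfolding a0_def
      proof (rule lorentz_mono)
        note [measurable] = jointly_measurable_section[OF B.data_measurable]
        show "(\<lambda>\<xi>. ennreal (norm (B.data (Some i) t \<xi>))) \<in> borel_measurable borel" by measurable
        show "AE \<xi> in lborel. ennreal (norm (B.data (Some i) t \<xi>)) \<le> ennreal (norm (?h \<xi>))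
            + heat_duhamel_maj \<alpha> H t \<xi>"
        proof (rule AE_I2)
          fix \<xi> :: "(real, 'n) vec"
          have "B.data (Some i) t \<xi> = ?h \<xi> + heat_duhamel \<alpha> (B.force i) t \<xi>"
            by (simp add: B.data_def B.initial_def B.forcing_def)
          moreover have "ennreal (norm (heat_duhamel \<alpha> (B.force i) t \<xi>))
              \<le> heat_duhamel_maj \<alpha> H t \<xi>"
            by (intro heat_duhamel_dom force_le)
          ultimately show "ennreal (norm (B.data (Some i) t \<xi>)) \<le> ennreal (norm (?h \<xi>))
            + heat_duhamel_maj \<alpha> H t \<xi>"
            using order_trans[OF ennreal_norm_triangle add_left_mono] by (simp only:)
        qed
      qed simp
    qed
    have At: "lorentz \<kappa>Q (b0 t) (\<lambda>\<xi>. ennreal (norm (B.data None t \<xi>)))" for t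
      using heat_t[of t] by (cases "0 < t") (simp_all add: B.data_def B.initial_def B.forcing_def heat_duhamel_def lorentz_zero)
    have la1: "lorentz \<kappa>p (ennreal (\<epsilon> * (Cu * Lp))) a1"
      using lorentz_cmult[OF Lp(2), of "ennreal (Cu * \<epsilon>)"] Cu(1) Lp(1) \<epsilon>
      by (simp add: a1_def[abs_def] ennreal_mult[symmetric] mult_ac)
    have la0: "lorentz \<kappa>p (ennreal \<epsilon>0) a0"
    proof -
      note l = lorentz_add[OF la1 a(1)]
      have "ennreal (\<epsilon> * (Cu * Lp)) + ennreal (Cf * (D * \<epsilon>)) = ennreal (\<epsilon> * (Cu * Lp) + \<epsilon> * (Cf * D))"
      proof -
        have "0 \<le> \<epsilon> * (Cu * Lp)" "0 \<le> \<epsilon> * (Cf * D)" using \<epsilon> den by simp_all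
        moreover have "Cf * (D * \<epsilon>) = \<epsilon> * (Cf * D)" by simp
        ultimately show ?thesis by (simp only: ennreal_plus)
      qed
      also have "\<dots> \<le> ennreal \<epsilon>0" by (rule ennreal_leI[OF small_u])
      finally show ?thesis
        using lorentz_mono[OF l lorentz_measurable[OF l]] by (simp add: a0_def[abs_def])
    qed
    have lb0: "lorentz \<kappa>P (ennreal \<epsilon>0) b0"
    proof -
      have l: "lorentz \<kappa>P (ennreal (\<epsilon> * (Ct * LP))) b0"
        using lorentz_cmult[OF LP(2), of "ennreal (Ct * \<epsilon>)"] Ct(1) LP(1) \<epsilon>
        by (simp add: b0_def[abs_def] ennreal_mult[symmetric] mult_ac)
      show ?thesis by (rule lorentz_mono[OF l lorentz_measurable[OF l] _ ennreal_leI[OF small_t]]) simp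
    qed

    \<comment> \<open>The solution and its properties\<close>
    note XY' = XY[OF la0 lb0]
    obtain v w where v: "lorentz \<kappa>p (ennreal X) v" and w: "lorentz \<kappa>P (ennreal Y) w"
      and vm: "\<And>i t. lorentz \<kappa>q (v t) (B.majorant_lim (Some i) t)" and wm: "\<And>t. lorentz \<kappa>Q (w t) (B.majorant_lim None t)"
      using B.majorant_lim_lorentz[OF sc lorentz_measurable[OF la0] lorentz_measurable[OF lb0] Au At] XY' by blast
    interpret S: boussinesq_solution \<alpha> \<kappa>p \<kappa>q \<kappa>P \<kappa>Q d "TYPE('n)" U \<Theta> G X Y v w N
    proof unfold_locales
      fix m and t :: real assume t: "0 < t"
      have hm: "(\<lambda>\<xi>. heat_symbol \<alpha> t \<xi> * B.initial m \<xi>) \<in> borel_measurable borel"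
        unfolding heat_symbol_def by measurable
      show "tempered_fun (\<lambda>\<xi>. heat_symbol \<alpha> t \<xi> * B.initial m \<xi>)"
      proof (cases m)
        case None
        then show ?thesis using lorentz_tempered[OF heat_t[OF t]] hm E.exponents_pos
          by (simp add: B.initial_def b0_def ennreal_mult_less_top)
      next
        case (Some i)
        then show ?thesis using lorentz_tempered[OF heat_u[OF t]] hm E.exponents_pos E.\<kappa>q
          by (simp add: B.initial_def a1_def ennreal_mult_less_top)
      qed
    next
      fix i t
      show "(\<integral>\<^sup>+s\<in>{0..t}. (\<integral>\<^sup>+\<xi>. ennreal (norm (B.force i s \<xi>)) * ennreal (decay N \<xi>) \<partial>lborel) \<partial>lborel) < \<infinity>"
        by (rule order_le_less_trans[OF _ Hfin[of t]]) (intro nn_integral_mono mult_right_mono force_le, auto)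
    qed (use v w vm wm XY' in auto)
    have "global_mild_solution \<alpha> u0 \<theta>0 f S.velocity S.temperature"
      by (rule S.mild_solution[OF offu U offt \<Theta> G])
    moreover have "S.velocity \<in> herz_vec p 0 q" "S.temperature \<in> herz \<pp> 0 \<qq>"
      using assms by (auto intro!: S.velocity_herz S.temperature_herz simp: \<kappa>_defs)
    moreover have "\<forall>t>0. (\<forall>i. real_valued (S.velocity t $ i)) \<and> real_valued (S.temperature t)"
      by (auto intro: S.real_valued_velocity S.real_valued_temperature)
    ultimately show "\<exists>u \<theta>. u \<in> herz_vec p 0 q \<and> \<theta> \<in> herz \<pp> 0 \<qq> \<and>
       (\<forall>t>0. (\<forall>i. real_valued (u t $ i)) \<and> real_valued (\<theta> t)) \<and> global_mild_solution \<alpha> u0 \<theta>0 f u \<theta>"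
      by blast
  qed
qed

end
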